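(* Let $(X,\tau,\mathsf d,\mathfrak m)$ be an asymptotically Hilbertian extended metric measure space with $(X,\mathsf d)$ complete, and let $\mathrm{Ch}$ be the associated Cheeger energy. Defining $\mathcal E:=\mathrm{Ch}$ (i.e. $\mathcal E$ is the symmetric bilinear form with $\mathcal E(f,f)=\mathrm{Ch}(f)$), one has that $(X,\mathscr B(\tau),\mathcal E,\mathfrak m)$ is an energy measure space. In addition, with $\mathbb V=D(\mathrm{Ch})$ and $\Gamma$ the carré du champ of $\mathcal E$: (a) $\Gamma(f)=|\mathrm Df|_w^2$ for any $f\in\mathbb V\cap L^\infty(X,\mathfrak m)$, and the formula $$\Gamma(f,g):=\lim_{\epsilon\downarrow0}\frac{|\mathrm D(f+\epsilon g)|_w^2-|\mathrm Df|_w^2}{2\epsilon}\qquad\text{in }L^1(X,\mathfrak m)$$ extends the $\Gamma$ operator from $\mathbb V\cap L^\infty(X,\mathfrak m)$ to the whole of $\mathbb V$. (b) The extended distance $$\mathsf d_{\mathcal E}(x,y):=\sup\{|f(x)-f(y)|:\ f\in\mathbb V\cap C_b(X),\ \Gamma(f)\le1\}$$ satisfies $\mathsf d_{\mathcal E}\ge\mathsf d$ and, denoting by $\mathrm{Ch}_{\mathsf d_{\mathcal E}}$ the Cheeger energy associated to the new structure $(X,\tau,\mathsf d_{\mathcal E},\mathfrak m)$, one has $\mathrm{Ch}_{\mathsf d_{\mathcal E}}=\mathcal E$. (c) $\mathsf d_{\mathcal E}=\mathsf d$ if and only if every $f\in\mathbb V\cap C_b(X)$ with $|\mathrm Df|_w\le1$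 $\mathfrak m$-a.e. in $X$ belongs to $\mathrm{Lip}_b(X,\tau,\mathsf d)$ with $\mathrm{Lip}(f,\mathsf d)\le1$.
   Context: An extended metric space $(X,\mathsf d)$ is a set with a symmetric $\mathsf d:X\times X\to[0,\infty]$ satisfying the triangle inequality and $\mathsf d(x,y)=0$ iff $x=y$; for a semidistance the last condition is weakened to $\mathsf d(x,x)=0$. For a Hausdorff topology $\tau$ on $X$, $\mathrm{Lip}_b(X,\tau,\mathsf d)$ is the set of bounded, $\mathsf d$-Lipschitz, $\tau$-continuous functions $f:X\to\mathbb R$; $\mathrm{Lip}(f,\mathsf d)$ is the Lipschitz constant; $C_b(X)$ is the set of bounded $\tau$-continuous functions; $\mathscr B(\tau)$ is the Borel $\sigma$-algebra. $(X,\tau,\mathsf d)$ is an extended metric-topological space if (a) there are $(\tau\times\tau)$-continuous bounded semidistances $\mathsf d_i:X\times X\to[0,\infty)$, $i\in I$, with $\mathsf d=\sup_i\mathsf d_i$; (b) $\tau$ is generated by $\mathrm{Lip}_b(X,\tau,\mathsf d)$. It is an extended metric measure space $(X,\tau,\mathsf d,\mathfrak m)$ when endowed with a Radon probability measure $\mathfrak m$ on $\mathscr B(\tau)$. Cheeger energy: for $f\in\mathrm{Lip}_b(X,\tau,\mathsf d)$, $\mathrm{Lip}_a(f,x)=\lim_{r\downarrow0}\sup\{|f(y)-f(z)|/\mathsf d(y,z):\ \mathsf d(y,x)\vee\mathsf d(z,x)<r,\ \mathsf d(y,z)>0\}$ ($=0$ at $\mathsf d$-isolated points), and $\mathrm{Lip}_a^*(f,\cdot)$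 is the $\mathfrak m$-essentially smallest $\mathfrak m$-measurable function which is $\ge\mathrm{Lip}_a(f,\cdot)$ $\mathfrak m$-a.e. For $f\in L^2(X,\mathfrak m)$, $\mathrm{Ch}(f)=\inf\liminf_n\int(\mathrm{Lip}_a^*(f_n,\cdot))^2\,d\mathfrak m$ over sequences $f_n\in\mathrm{Lip}_b(X,\tau,\mathsf d)$ with $f_n\to f$ in $L^2(X,\mathfrak m)$; $D(\mathrm{Ch})=\{\mathrm{Ch}<\infty\}$. A relaxed slope of $f$ is any $G\ge g$ with $g$ a weak $L^2(X,\mathfrak m)$ limit point of $\mathrm{Lip}_a^*(f_n,\cdot)$ for some $f_n\in\mathrm{Lip}_b(X,\tau,\mathsf d)$, $f_n\to f$ in $L^2(X,\mathfrak m)$; $|\mathrm Df|_w$ is the relaxed slope of smallest $L^2$ norm, and $\mathrm{Ch}(f)=\int|\mathrm Df|_w^2\,d\mathfrak m$ on $D(\mathrm{Ch})$. The space is asymptotically Hilbertian if $\mathrm{Ch}(f+g)+\mathrm{Ch}(f-g)=2\mathrm{Ch}(f)+2\mathrm{Ch}(g)$ for all $f,g\in L^2(X,\mathfrak m)$. Energy measure space $(X,\mathcal B,\mathcal E,\mathfrak m)$: $\mathfrak m$ is a probability measure on the $\sigma$-algebra $\mathcal B$; $\mathcal E$ is a strongly local Markovian (symmetric) Dirichlet form in $L^2(X,\mathfrak m)$ with dense domain $\mathbb V=\{f:\mathcal E(f,f)<\infty\}$; and $\mathcal E$ admits a carré du champ $\Gamma:(\mathbb V\cap L^\infty)^2\to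 L^1(X,\mathfrak m)$, the bilinear form characterized by $\int\Gamma(f,f)\varphi\,d\mathfrak m=-\frac12\mathcal E(f^2,\varphi)+\mathcal E(f,f\varphi)$ for $f,\varphi\in\mathbb V\cap L^\infty(X,\mathfrak m)$; $\Gamma(f)=\Gamma(f,f)$. *)

theory Defs
  imports "HOL-Probability.Probability"
begin

text \<open>
  The underlying set \<open>X\<close> is a type of class \<open>t2_space\<close>, whose topology plays the role of \<open>\<tau>\<close>;
  extended distances have type \<open>'a \<Rightarrow> 'a \<Rightarrow> ennreal\<close>. Elements of \<open>L\<^sup>2\<close>, \<open>L\<^sup>1\<close> and \<open>L\<^sup>\<infinity>\<close> are
  represented by measurable functions, equality of classes being equality almost everywhere.
\<close>

section \<open>Lebesgue spaces\<close>

definition L2 :: "'a measure \<Rightarrow> ('a \<Rightarrow> real) set" where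
  "L2 M = {f \<in> borel_measurable M. integrable M (\<lambda>x. (f x)\<^sup>2)}"

definition Linfty :: "'a measure \<Rightarrow> ('a \<Rightarrow> real) set" where
  "Linfty M = {f \<in> borel_measurable M. \<exists>C. AE x in M. \<bar>f x\<bar> \<le> C}"

definition L2_tendsto :: "'a measure \<Rightarrow> (nat \<Rightarrow> 'a \<Rightarrow> real) \<Rightarrow> ('a \<Rightarrow> real) \<Rightarrow> bool" where
  "L2_tendsto M F f \<longleftrightarrow>
     (\<forall>n. F n \<in> L2 M) \<and> f \<in> L2 M \<and> (\<lambda>n. \<integral>x. (F n x - f x)\<^sup>2 \<partial>M) \<longlonglongrightarrow> 0"

definition weak_L2_limit_point ::
    "'a measure \<Rightarrow> (nat \<Rightarrow> 'a \<Rightarrow> real) \<Rightarrow> ('a \<Rightarrow> real) \<Rightarrow> bool" where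
  "weak_L2_limit_point M F g \<longleftrightarrow>
     (\<forall>n. F n \<in> L2 M) \<and> g \<in> L2 M \<and>
     (\<exists>r :: nat \<Rightarrow> nat. strict_mono r \<and>
        (\<forall>h\<in>L2 M. (\<lambda>n. \<integral>x. F (r n) x * h x \<partial>M) \<longlonglongrightarrow> (\<integral>x. g x * h x \<partial>M)))"

definition L1_tendsto ::
    "'a measure \<Rightarrow> ('b \<Rightarrow> 'a \<Rightarrow> real) \<Rightarrow> ('a \<Rightarrow> real) \<Rightarrow> 'b filter \<Rightarrow> bool" where
  "L1_tendsto M Q h F \<longleftrightarrow>
     integrable M h \<and> (\<forall>\<^sub>F e in F. integrable M (Q e)) \<and>
     ((\<lambda>e. \<integral>x. \<bar>Q e x - h x\<bar> \<partial>M) \<longlongrightarrow> 0) F"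

section \<open>Extended metric measure spaces\<close>

definition extended_distance :: "('a \<Rightarrow> 'a \<Rightarrow> ennreal) \<Rightarrow> bool" where
  "extended_distance d \<longleftrightarrow>
     (\<forall>x y. d x y = d y x) \<and> (\<forall>x y z. d x z \<le> d x y + d y z) \<and>
     (\<forall>x y. d x y = 0 \<longleftrightarrow> x = y)"

definition semidistance :: "('a \<Rightarrow> 'a \<Rightarrow> real) \<Rightarrow> bool" where
  "semidistance \<delta> \<longleftrightarrow>
     (\<forall>x y. 0 \<le> \<delta> x y) \<and> (\<forall>x y. \<delta> x y = \<delta> y x) \<and>
     (\<forall>x y z. \<delta> x z \<le> \<delta> x y + \<delta> y z) \<and> (\<forall>x. \<delta> x x = 0)"

definition ext_complete :: "('a \<Rightarrow> 'a \<Rightarrow> ennreal) \<Rightarrow> bool" where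
  "ext_complete d \<longleftrightarrow>
     (\<forall>s :: nat \<Rightarrow> 'a.
        (\<forall>e>0. \<exists>N. \<forall>i\<ge>N. \<forall>j\<ge>N. d (s i) (s j) < e) \<longrightarrow>
        (\<exists>x. (\<lambda>n. d (s n) x) \<longlonglongrightarrow> 0))"

definition ext_lipschitz :: "('a \<Rightarrow> 'a \<Rightarrow> ennreal) \<Rightarrow> ('a \<Rightarrow> real) \<Rightarrow> real \<Rightarrow> bool" where
  "ext_lipschitz d f L \<longleftrightarrow>
     0 \<le> L \<and> (\<forall>x y. ennreal \<bar>f x - f y\<bar> \<le> ennreal L * d x y)"

text \<open>
  In \<^typ>\<open>ennreal\<close> one has \<open>0 * \<infinity> = 0\<close>, which affects \<^const>\<open>ext_lipschitz\<close> only for \<open>L = 0\<close>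
  and hence not the infimum below.
\<close>

definition Lip_const :: "('a \<Rightarrow> 'a \<Rightarrow> ennreal) \<Rightarrow> ('a \<Rightarrow> real) \<Rightarrow> ennreal" where
  "Lip_const d f = (INF L\<in>{L. ext_lipschitz d f L}. ennreal L)"

definition Cb :: "('a::topological_space \<Rightarrow> real) set" where
  "Cb = {f. continuous_on UNIV f \<and> bounded (range f)}"

definition Lip_b :: "('a::topological_space \<Rightarrow> 'a \<Rightarrow> ennreal) \<Rightarrow> ('a \<Rightarrow> real) set" where
  "Lip_b d = {f \<in> Cb. \<exists>L. ext_lipschitz d f L}"

definition extended_metric_topological_space ::
    "('a::t2_space \<Rightarrow> 'a \<Rightarrow> ennreal) \<Rightarrow> bool" where
  "extended_metric_topological_space d \<longleftrightarrow>
     extended_distance d \<and>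
     (\<exists>D :: ('a \<Rightarrow> 'a \<Rightarrow> real) set.
        (\<forall>\<delta>\<in>D. semidistance \<delta> \<and> (\<exists>C. \<forall>x y. \<delta> x y \<le> C) \<and>
               continuous_on UNIV (\<lambda>(x, y). \<delta> x y)) \<and>
        (\<forall>x y. d x y = (SUP \<delta>\<in>D. ennreal (\<delta> x y)))) \<and>
     (\<forall>U :: 'a set. open U \<longleftrightarrow>
        generate_topology {f -` S | f S. f \<in> Lip_b d \<and> open S} U)"

definition Radon_measure :: "'a::topological_space measure \<Rightarrow> bool" where
  "Radon_measure m \<longleftrightarrow>
     sets m = sets borel \<and>
     (\<forall>B\<in>sets borel. \<forall>e>0. \<exists>K. K \<subseteq> B \<and> compact K \<and> emeasure m (B - K) \<le> e)"

definition extended_metric_measure_space ::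
    "('a::t2_space \<Rightarrow> 'a \<Rightarrow> ennreal) \<Rightarrow> 'a measure \<Rightarrow> bool" where
  "extended_metric_measure_space d m \<longleftrightarrow>
     extended_metric_topological_space d \<and> prob_space m \<and> Radon_measure m"

section \<open>The Cheeger energy\<close>

definition Lip_a :: "('a \<Rightarrow> 'a \<Rightarrow> ennreal) \<Rightarrow> ('a \<Rightarrow> real) \<Rightarrow> 'a \<Rightarrow> ennreal" where
  "Lip_a d f x =
     Lim (at_right (0::real))
       (\<lambda>r. SUP (y, z)\<in>{(y, z). max (d y x) (d z x) < ennreal r \<and> 0 < d y z}.
              ennreal \<bar>f y - f z\<bar> / d y z)"

text \<open>
  For Lipschitz \<open>f\<close> the function \<open>Lip_a d f\<close> is finite, so \<^const>\<open>enn2real\<close> loses nothing.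
  It need not be Borel measurable. Minimality ranges over all \<open>m\<close>-measurable
  functions, i.e. those measurable for the completion of \<open>m\<close>; every such function agrees almost
  everywhere with a Borel one, and we select a Borel representative.
\<close>

definition Lip_a_star ::
    "'a measure \<Rightarrow> ('a \<Rightarrow> 'a \<Rightarrow> ennreal) \<Rightarrow> ('a \<Rightarrow> real) \<Rightarrow> 'a \<Rightarrow> real" where
  "Lip_a_star m d f =
     (SOME g. g \<in> borel_measurable m \<and> (AE x in m. enn2real (Lip_a d f x) \<le> g x) \<and>
        (\<forall>h \<in> borel_measurable (completion m).
           (AE x in m. enn2real (Lip_a d f x) \<le> h x) \<longrightarrow> (AE x in m. g x \<le> h x)))"

definition Ch ::
    "'a::topological_space measure \<Rightarrow> ('a \<Rightarrow> 'a \<Rightarrow> ennreal) \<Rightarrow> ('a \<Rightarrow> real) \<Rightarrow> ennreal" where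
  "Ch m d f =
     (INF F\<in>{F. (\<forall>n. F n \<in> Lip_b d) \<and> L2_tendsto m F f}.
        liminf (\<lambda>n. \<integral>\<^sup>+x. ennreal ((Lip_a_star m d (F n) x)\<^sup>2) \<partial>m))"

definition Ch_domain ::
    "'a::topological_space measure \<Rightarrow> ('a \<Rightarrow> 'a \<Rightarrow> ennreal) \<Rightarrow> ('a \<Rightarrow> real) set" where
  "Ch_domain m d = {f \<in> L2 m. Ch m d f < \<infinity>}"

definition relaxed_slope ::
    "'a::topological_space measure \<Rightarrow> ('a \<Rightarrow> 'a \<Rightarrow> ennreal) \<Rightarrow> ('a \<Rightarrow> real) \<Rightarrow> ('a \<Rightarrow> real) \<Rightarrow> bool"
  where
  "relaxed_slope m d f G \<longleftrightarrow>
     G \<in> L2 m \<and>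
     (\<exists>F g. (\<forall>n. F n \<in> Lip_b d) \<and> L2_tendsto m F f \<and>
        weak_L2_limit_point m (\<lambda>n. Lip_a_star m d (F n)) g \<and> (AE x in m. g x \<le> G x))"

definition minimal_relaxed_slope ::
    "'a::topological_space measure \<Rightarrow> ('a \<Rightarrow> 'a \<Rightarrow> ennreal) \<Rightarrow> ('a \<Rightarrow> real) \<Rightarrow> 'a \<Rightarrow> real" where
  "minimal_relaxed_slope m d f =
     (SOME G. relaxed_slope m d f G \<and>
        (\<forall>H. relaxed_slope m d f H \<longrightarrow> (\<integral>x. (G x)\<^sup>2 \<partial>m) \<le> (\<integral>x. (H x)\<^sup>2 \<partial>m)))"

definition asymptotically_Hilbertian ::
    "'a::topological_space measure \<Rightarrow> ('a \<Rightarrow> 'a \<Rightarrow> ennreal) \<Rightarrow> bool" where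
  "asymptotically_Hilbertian m d \<longleftrightarrow>
     (\<forall>f\<in>L2 m. \<forall>g\<in>L2 m.
        Ch m d (\<lambda>x. f x + g x) + Ch m d (\<lambda>x. f x - g x) = 2 * Ch m d f + 2 * Ch m d g)"

text \<open>Polarization; no other symmetric bilinear form on the domain can have the diagonal \<open>Ch\<close>.\<close>

definition Ch_form ::
    "'a::topological_space measure \<Rightarrow> ('a \<Rightarrow> 'a \<Rightarrow> ennreal) \<Rightarrow> ('a \<Rightarrow> real) \<Rightarrow> ('a \<Rightarrow> real) \<Rightarrow> real"
  where
  "Ch_form m d f g =
     (enn2real (Ch m d (\<lambda>x. f x + g x)) - enn2real (Ch m d (\<lambda>x. f x - g x))) / 4"

section \<open>Energy measure spaces\<close>

definition symmetric_form ::
    "'a measure \<Rightarrow> ('a \<Rightarrow> real) set \<Rightarrow> (('a \<Rightarrow> real) \<Rightarrow> ('a \<Rightarrow> real) \<Rightarrow> real) \<Rightarrow> bool" where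
  "symmetric_form M V E \<longleftrightarrow>
     V \<subseteq> L2 M \<and> (\<lambda>x. 0) \<in> V \<and>
     (\<forall>f\<in>V. \<forall>g\<in>V. \<forall>a b. (\<lambda>x. a * f x + b * g x) \<in> V) \<and>
     (\<forall>f\<in>V. \<forall>g\<in>borel_measurable M. (AE x in M. f x = g x) \<longrightarrow>
        g \<in> V \<and> (\<forall>h\<in>V. E g h = E f h)) \<and>
     (\<forall>f\<in>V. \<forall>g\<in>V. E f g = E g f) \<and>
     (\<forall>f\<in>V. \<forall>g\<in>V. \<forall>h\<in>V. \<forall>a b. E (\<lambda>x. a * f x + b * g x) h = a * E f h + b * E g h) \<and>
     (\<forall>f\<in>V. 0 \<le> E f f)"

definition densely_defined :: "'a measure \<Rightarrow> ('a \<Rightarrow> real) set \<Rightarrow> bool" where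
  "densely_defined M V \<longleftrightarrow>
     (\<forall>f\<in>L2 M. \<forall>e>0. \<exists>g\<in>V. (\<integral>x. (f x - g x)\<^sup>2 \<partial>M) < e)"

text \<open>Closedness: \<open>V\<close> is complete for the squared norm \<open>\<parallel>f\<parallel>\<^sup>2 + E f f\<close>.\<close>

definition closed_form ::
    "'a measure \<Rightarrow> ('a \<Rightarrow> real) set \<Rightarrow> (('a \<Rightarrow> real) \<Rightarrow> ('a \<Rightarrow> real) \<Rightarrow> real) \<Rightarrow> bool" where
  "closed_form M V E \<longleftrightarrow>
     (let N = (\<lambda>f g. (\<integral>x. (f x - g x)\<^sup>2 \<partial>M) + E (\<lambda>x. f x - g x) (\<lambda>x. f x - g x))
      in \<forall>F :: nat \<Rightarrow> 'a \<Rightarrow> real.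
           (\<forall>n. F n \<in> V) \<and> (\<forall>e>0. \<exists>k. \<forall>i\<ge>k. \<forall>j\<ge>k. N (F i) (F j) < e) \<longrightarrow>
           (\<exists>f\<in>V. (\<lambda>n. N (F n) f) \<longlonglongrightarrow> 0))"

definition Markovian_form ::
    "('a \<Rightarrow> real) set \<Rightarrow> (('a \<Rightarrow> real) \<Rightarrow> ('a \<Rightarrow> real) \<Rightarrow> real) \<Rightarrow> bool" where
  "Markovian_form V E \<longleftrightarrow>
     (\<forall>\<eta> :: real \<Rightarrow> real. \<eta> 0 = 0 \<and> (\<forall>s t. \<bar>\<eta> s - \<eta> t\<bar> \<le> \<bar>s - t\<bar>) \<longrightarrow>
        (\<forall>f\<in>V. \<eta> \<circ> f \<in> V \<and> E (\<eta> \<circ> f) (\<eta> \<circ> f) \<le> E f f))"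

definition strongly_local_form ::
    "'a measure \<Rightarrow> ('a \<Rightarrow> real) set \<Rightarrow> (('a \<Rightarrow> real) \<Rightarrow> ('a \<Rightarrow> real) \<Rightarrow> real) \<Rightarrow> bool" where
  "strongly_local_form M V E \<longleftrightarrow>
     (\<forall>f\<in>V. \<forall>g\<in>V. (\<exists>a. AE x in M. (f x + a) * g x = 0) \<longrightarrow> E f g = 0)"

definition Dirichlet_form ::
    "'a measure \<Rightarrow> ('a \<Rightarrow> real) set \<Rightarrow> (('a \<Rightarrow> real) \<Rightarrow> ('a \<Rightarrow> real) \<Rightarrow> real) \<Rightarrow> bool" where
  "Dirichlet_form M V E \<longleftrightarrow>
     symmetric_form M V E \<and> densely_defined M V \<and> closed_form M V E \<and> Markovian_form V E"

definition L1_bilinear ::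
    "'a measure \<Rightarrow> ('a \<Rightarrow> real) set \<Rightarrow> (('a \<Rightarrow> real) \<Rightarrow> ('a \<Rightarrow> real) \<Rightarrow> 'a \<Rightarrow> real) \<Rightarrow> bool" where
  "L1_bilinear M W \<Gamma> \<longleftrightarrow>
     (\<forall>f\<in>W. \<forall>g\<in>W. integrable M (\<Gamma> f g)) \<and>
     (\<forall>f\<in>W. \<forall>g\<in>W. AE x in M. \<Gamma> f g x = \<Gamma> g f x) \<and>
     (\<forall>f\<in>W. \<forall>g\<in>W. \<forall>h\<in>W. \<forall>a b.
        AE x in M. \<Gamma> (\<lambda>x. a * f x + b * g x) h x = a * \<Gamma> f h x + b * \<Gamma> g h x)"

definition carre_du_champ ::
    "'a measure \<Rightarrow> ('a \<Rightarrow> real) set \<Rightarrow> (('a \<Rightarrow> real) \<Rightarrow> ('a \<Rightarrow> real) \<Rightarrow> real) \<Rightarrow>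
      (('a \<Rightarrow> real) \<Rightarrow> ('a \<Rightarrow> real) \<Rightarrow> 'a \<Rightarrow> real) \<Rightarrow> bool" where
  "carre_du_champ M V E \<Gamma> \<longleftrightarrow>
     L1_bilinear M (V \<inter> Linfty M) \<Gamma> \<and>
     (\<forall>f\<in>V \<inter> Linfty M. \<forall>\<phi>\<in>V \<inter> Linfty M.
        (\<integral>x. \<Gamma> f f x * \<phi> x \<partial>M) = - (1/2) * E (\<lambda>x. (f x)\<^sup>2) \<phi> + E f (\<lambda>x. f x * \<phi> x))"

definition energy_measure_space ::
    "'a measure \<Rightarrow> ('a \<Rightarrow> real) set \<Rightarrow> (('a \<Rightarrow> real) \<Rightarrow> ('a \<Rightarrow> real) \<Rightarrow> real) \<Rightarrow> bool" where
  "energy_measure_space M V E \<longleftrightarrow>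
     prob_space M \<and> Dirichlet_form M V E \<and> strongly_local_form M V E \<and>
     (\<exists>\<Gamma>. carre_du_champ M V E \<Gamma>)"

definition energy_distance ::
    "'a::topological_space measure \<Rightarrow> ('a \<Rightarrow> real) set \<Rightarrow>
      (('a \<Rightarrow> real) \<Rightarrow> ('a \<Rightarrow> real) \<Rightarrow> 'a \<Rightarrow> real) \<Rightarrow> 'a \<Rightarrow> 'a \<Rightarrow> ennreal" where
  "energy_distance M V \<Gamma> x y =
     (SUP f\<in>{f \<in> V \<inter> Cb. AE z in M. \<Gamma> f f z \<le> 1}. ennreal \<bar>f x - f y\<bar>)"

end

theory Submission
  imports Defs
begin

text \<open>
  All properties of the Cheeger energy come from the set of pairs \<open>(f, G)\<close> that are \<open>L\<^sup>2\<close> limits of pairs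
  \<open>(u, v)\<close> with \<open>u\<close> bounded Lipschitz and \<open>v\<close> above the asymptotic Lipschitz constant of \<open>u\<close>. It is closed and
  convex, and Lipschitz cut-offs show that, for fixed \<open>f\<close>, it is stable under gluing along Borel sets, so that the
  relaxed slope of least norm is also the pointwise least one. Chain rule, locality and Leibniz inequality pass
  to the limit.

  If the energy is quadratic, the one-sided derivatives of the convex functions
  \<open>t \<mapsto> |D (f + t g)|\<^sup>2(x)\<close> at \<open>0\<close> have equal integrals and hence coincide almost everywhere. Expanding
  products around rational approximations of their factors gives
  \<open>\<integral> |D f|\<^sup>2 \<phi> = E(f, f \<phi>) - E(f\<^sup>2, \<phi>) / 2\<close>, the right-hand side of which is quadratic in \<open>f\<close>. Therefore \<open>|D f|\<^sup>2\<close>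
  is a pointwise quadratic form, and its polarization is the carre du champ.

  The bound \<open>|D f| \<le> Lip_a f\<close> for functions that are Lipschitz with respect to the energy distance follows
  by approximating \<open>f\<close>, on compact sets, by finite infimal convolutions \<open>min\<^sub>y (f y + c (\<delta> x y))\<close> with continuous
  \<open>\<delta>\<close> built from functions of slope at most \<open>1\<close>.
\<close>

section \<open>The space \<open>L\<^sup>2\<close> of a probability measure\<close>

text \<open>The calculus of \<open>Lip_a\<close> yields only inequalities: chain and Leibniz rules
  bound slopes from above, convexity bounds the squared slope along a line from below by tangents,
  and linearity has to be extracted from a parallelogram identity known only after integration.
  Equalities arise by squeezing: once the two one-sided derivatives agree, a lower bound that is
  affine up to a quadratic error determines the derivative. In the representation of
  \<open>|D f|^2 \<phi>\<close> the derivative of \<open>f\<close> along \<open>\<phi>\<close>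
  occurs both in \<open>E(f, f \<phi>)\<close> and in \<open>E(f^2, \<phi>) / 2\<close> and cancels.
  The distance is only a supremum of continuous semidistances, so distance functions need not be
  continuous and cannot serve as cut-offs. Continuous test functions are built from single
  semidistances, and compactness with inner regularity upgrades pointwise choices to statements off
  sets of measure \<open>2^-n\<close>, summable for Borel-Cantelli. The same scheme serves for the
  energy distance, whose semidistances are \<open>|g x - g y|\<close> with \<open>g\<close> of slope
  at most one.\<close>

definition sqnorm :: "'a measure \<Rightarrow> ('a \<Rightarrow> real) \<Rightarrow> real" where
  "sqnorm M f = (\<integral>x. (f x)\<^sup>2 \<partial>M)"

lemma L2_measurable [measurable_dest]: "f \<in> L2 M \<Longrightarrow> f \<in> borel_measurable M"
  by (simp add: L2_def)

lemma L2_integrable_sq: "f \<in> L2 M \<Longrightarrow> integrable M (\<lambda>x. (f x)\<^sup>2)"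
  by (simp add: L2_def)

lemma L2_dominated:
  assumes "f \<in> borel_measurable M" "g \<in> L2 M" "AE x in M. \<bar>f x\<bar> \<le> \<bar>g x\<bar>"
  shows "f \<in> L2 M"
proof -
  have "integrable M (\<lambda>x. (f x)\<^sup>2)"
    by (rule Bochner_Integration.integrable_bound[OF L2_integrable_sq[OF assms(2)]])
      (use assms in \<open>auto elim!: eventually_mono simp: abs_le_square_iff\<close>)
  with assms show ?thesis by (simp add: L2_def)
qed

lemma L2_scale: "f \<in> L2 M \<Longrightarrow> (\<lambda>x. a * f x) \<in> L2 M"
  by (auto simp: L2_def power_mult_distrib)

lemma L2_abs: "f \<in> L2 M \<Longrightarrow> (\<lambda>x. \<bar>f x\<bar>) \<in> L2 M"
  by (auto simp: L2_def)

lemma L2_zero [simp]: "(\<lambda>x. 0) \<in> L2 M"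
  by (simp add: L2_def)

lemma L2_cong_AE:
  assumes "f \<in> L2 M" "g \<in> borel_measurable M" "AE x in M. f x = g x"
  shows "g \<in> L2 M"
  by (rule L2_dominated[OF assms(2,1)]) (use assms(3) in auto)

lemma L2_integrable_mult:
  assumes "f \<in> L2 M" "g \<in> L2 M"
  shows "integrable M (\<lambda>x. f x * g x)"
proof (rule Bochner_Integration.integrable_bound)
  show "integrable M (\<lambda>x. (f x)\<^sup>2 + (g x)\<^sup>2)"
    using assms by (auto intro!: L2_integrable_sq)
  have "\<bar>a * b\<bar> \<le> a\<^sup>2 + b\<^sup>2" for a b :: real
    using sum_squares_bound[of "\<bar>a\<bar>" "\<bar>b\<bar>"] mult_nonneg_nonneg[of "\<bar>a\<bar>" "\<bar>b\<bar>"]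
    unfolding abs_mult by (simp add: mult.assoc del: mult_nonneg_nonneg)
  then show "AE x in M. norm (f x * g x) \<le> norm ((f x)\<^sup>2 + (g x)\<^sup>2)" by simp
qed (use assms in measurable)

lemma L2_add:
  assumes "f \<in> L2 M" "g \<in> L2 M"
  shows "(\<lambda>x. f x + g x) \<in> L2 M"
proof -
  have "integrable M (\<lambda>x. (f x)\<^sup>2 + 2 * (f x * g x) + (g x)\<^sup>2)"
    by (intro Bochner_Integration.integrable_add integrable_mult_right L2_integrable_sq L2_integrable_mult assms)
  then show ?thesis using assms by (auto simp: L2_def power2_sum algebra_simps)
qed

lemma L2_lincomb: "f \<in> L2 M \<Longrightarrow> g \<in> L2 M \<Longrightarrow> (\<lambda>x. a * f x + b * g x) \<in> L2 M"
  by (intro L2_add L2_scale)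

lemma L2_diff: "f \<in> L2 M \<Longrightarrow> g \<in> L2 M \<Longrightarrow> (\<lambda>x. f x - g x) \<in> L2 M"
  using L2_lincomb[of f M g 1 "-1"] by simp

lemma sqnorm_nonneg [simp]: "0 \<le> sqnorm M f"
  by (simp add: sqnorm_def)

lemma sqnorm_cong_AE:
  assumes "f \<in> borel_measurable M" "g \<in> borel_measurable M" "AE x in M. f x = g x"
  shows "sqnorm M f = sqnorm M g"
  unfolding sqnorm_def by (rule integral_cong_AE) (use assms in auto)

lemma sqnorm_scale: "sqnorm M (\<lambda>x. a * f x) = a\<^sup>2 * sqnorm M f"
  by (simp add: sqnorm_def power_mult_distrib)

lemma sqnorm_minus_commute: "sqnorm M (\<lambda>x. f x - g x) = sqnorm M (\<lambda>x. g x - f x)"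
  by (simp add: sqnorm_def power2_commute)

lemma sqnorm_zero [simp]: "sqnorm M (\<lambda>x. 0) = 0"
  by (simp add: sqnorm_def)

lemma sqnorm_lincomb:
  assumes "f \<in> L2 M" "g \<in> L2 M"
  shows "sqnorm M (\<lambda>x. a * f x + b * g x) =
    a\<^sup>2 * sqnorm M f + 2 * a * b * (\<integral>x. f x * g x \<partial>M) + b\<^sup>2 * sqnorm M g"
proof -
  have "sqnorm M (\<lambda>x. a * f x + b * g x) =
      (\<integral>x. a\<^sup>2 * (f x)\<^sup>2 + (2 * a * b) * (f x * g x) + b\<^sup>2 * (g x)\<^sup>2 \<partial>M)"
    unfolding sqnorm_def by (rule Bochner_Integration.integral_cong) (auto simp: power2_eq_square algebra_simps)
  also have "\<dots> = a\<^sup>2 * sqnorm M f + 2 * a * b * (\<integral>x. f x * g x \<partial>M) + b\<^sup>2 * sqnorm M g"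
    using assms by (simp add: sqnorm_def L2_integrable_sq L2_integrable_mult)
  finally show ?thesis .
qed

text \<open>The squared norm of \<open>f - g\<close> is nonnegative. Working with squares costs the
  factor 2, which is why tolerances are split into quarters later on.\<close>

lemma sqnorm_add_le:
  assumes "f \<in> L2 M" "g \<in> L2 M"
  shows "sqnorm M (\<lambda>x. f x + g x) \<le> 2 * sqnorm M f + 2 * sqnorm M g"
  using sqnorm_lincomb[OF assms, of 1 1] sqnorm_lincomb[OF assms, of 1 "-1"]
    sqnorm_nonneg[of M "\<lambda>x. 1 * f x + -1 * g x"] by simp

lemma sqnorm_parallelogram:
  assumes "f \<in> L2 M" "g \<in> L2 M"
  shows "sqnorm M (\<lambda>x. f x - g x) =
    2 * sqnorm M f + 2 * sqnorm M g - 4 * sqnorm M (\<lambda>x. 1/2 * f x + 1/2 * g x)"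
  using sqnorm_lincomb[OF assms, of 1 "-1"] sqnorm_lincomb[OF assms, of "1/2" "1/2"]
  by (simp add: power2_eq_square)

lemma sqnorm_diff_triangle:
  assumes "f \<in> L2 M" "g \<in> L2 M" "h \<in> L2 M"
  shows "sqnorm M (\<lambda>x. f x - h x) \<le> 2 * sqnorm M (\<lambda>x. f x - g x) + 2 * sqnorm M (\<lambda>x. g x - h x)"
  using sqnorm_add_le[OF L2_diff[OF assms(1,2)] L2_diff[OF assms(2,3)]] by simp

lemma sqnorm_mono:
  assumes "f \<in> borel_measurable M" "g \<in> L2 M" "AE x in M. \<bar>f x\<bar> \<le> \<bar>g x\<bar>"
  shows "sqnorm M f \<le> sqnorm M g"
  unfolding sqnorm_def
  by (rule integral_mono_AE)
    (use assms L2_dominated[OF assms] in \<open>auto elim!: eventually_mono simp: L2_integrable_sq abs_le_square_iff\<close>)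

lemma sqnorm_eq_0_iff: "f \<in> L2 M \<Longrightarrow> sqnorm M f = 0 \<longleftrightarrow> (AE x in M. f x = 0)"
  unfolding sqnorm_def by (subst integral_nonneg_eq_0_iff_AE) (auto simp: L2_integrable_sq)

lemma ennreal_sqnorm: "f \<in> L2 M \<Longrightarrow> ennreal (sqnorm M f) = (\<integral>\<^sup>+x. ennreal ((f x)\<^sup>2) \<partial>M)"
  unfolding sqnorm_def by (rule nn_integral_eq_integral[symmetric]) (auto simp: L2_integrable_sq)

lemma L2_I_nn_integral:
  assumes "f \<in> borel_measurable M" "(\<integral>\<^sup>+x. ennreal ((f x)\<^sup>2) \<partial>M) < \<infinity>"
  shows "f \<in> L2 M"
  using assms by (auto simp: L2_def intro!: integrableI_bounded)

lemma L2_tendsto_iff: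
  "L2_tendsto M F f \<longleftrightarrow> (\<forall>n. F n \<in> L2 M) \<and> f \<in> L2 M \<and> (\<lambda>n. sqnorm M (\<lambda>x. F n x - f x)) \<longlonglongrightarrow> 0"
  by (simp add: L2_tendsto_def sqnorm_def)

lemma L2_tendsto_subseq: "L2_tendsto M F f \<Longrightarrow> strict_mono r \<Longrightarrow> L2_tendsto M (\<lambda>n. F (r n)) f"
  unfolding L2_tendsto_iff using LIMSEQ_subseq_LIMSEQ[of _ 0 r] by (auto simp: o_def)

lemma L2_tendsto_AE_subseq:
  assumes "L2_tendsto M F f"
  obtains r where "strict_mono r" "AE x in M. (\<lambda>n. F (r n) x) \<longlonglongrightarrow> f x"
proof -
  have F: "\<And>n. F n \<in> L2 M" and f: "f \<in> L2 M"
    and lim: "(\<lambda>n. sqnorm M (\<lambda>x. F n x - f x)) \<longlonglongrightarrow> 0"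
    using assms by (auto simp: L2_tendsto_iff)
  obtain r where r: "strict_mono r" and ae: "AE x in M. (\<lambda>n. (F (r n) x - f x)\<^sup>2) \<longlonglongrightarrow> 0"
  proof -
    have "\<exists>r::nat\<Rightarrow>nat. strict_mono r \<and> (AE x in M. (\<lambda>n. (F (r n) x - f x)\<^sup>2) \<longlonglongrightarrow> 0)"
    proof (rule tendsto_L1_AE_subseq)
      show "integrable M (\<lambda>x. (F n x - f x)\<^sup>2)" for n
        by (intro L2_integrable_sq L2_diff F f)
      show "(\<lambda>n. \<integral>x. norm ((F n x - f x)\<^sup>2) \<partial>M) \<longlonglongrightarrow> 0"
        using lim by (simp add: sqnorm_def)
    qed
    then show ?thesis using that by blast
  qed
  have "AE x in M. (\<lambda>n. F (r n) x) \<longlonglongrightarrow> f x"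
    using ae
  proof (eventually_elim)
    case (elim x)
    then have "(\<lambda>n. sqrt ((F (r n) x - f x)\<^sup>2)) \<longlonglongrightarrow> sqrt 0" by (intro tendsto_intros)
    then show ?case by (simp add: LIM_zero_iff tendsto_rabs_zero_iff)
  qed
  with r show ?thesis by (rule that)
qed

lemma sqnorm_tendsto:
  assumes "L2_tendsto M F f"
  shows "(\<lambda>n. sqnorm M (F n)) \<longlonglongrightarrow> sqnorm M f"
proof -
  have F: "\<And>n. F n \<in> L2 M" and f: "f \<in> L2 M"
    and lim: "(\<lambda>n. sqnorm M (\<lambda>x. F n x - f x)) \<longlonglongrightarrow> 0"
    using assms by (auto simp: L2_tendsto_iff)
  have bd: "\<bar>sqnorm M (F n) - sqnorm M f\<bar> \<le>
      (1 + 1/e) * sqnorm M (\<lambda>x. F n x - f x) + e * sqnorm M f" if "e > 0" for n e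
  proof -
    define g where "g = (\<lambda>x. F n x - f x)"
    have g: "g \<in> L2 M" unfolding g_def by (intro L2_diff F f)
    \<comment> \<open>Young's inequality with weight \<open>e\<close>: the squared norms of
      \<open>sqrt (1/e) * g\<close> plus and minus \<open>sqrt e * f\<close> are
      nonnegative.\<close>
    have *: "\<bar>2 * (\<integral>x. g x * f x \<partial>M)\<bar> \<le> 1/e * sqnorm M g + e * sqnorm M f"
      using sqnorm_lincomb[OF g f, of "sqrt (1/e)" "sqrt e"] sqnorm_lincomb[OF g f, of "sqrt (1/e)" "- sqrt e"]
        sqnorm_nonneg[of M "\<lambda>x. sqrt (1/e) * g x + sqrt e * f x"]
        sqnorm_nonneg[of M "\<lambda>x. sqrt (1/e) * g x + - sqrt e * f x"] \<open>e > 0\<close>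
      by (simp add: real_sqrt_divide power_divide abs_le_iff)
    have "F n = (\<lambda>x. 1 * g x + 1 * f x)" by (simp add: g_def)
    then have "sqnorm M (F n) = sqnorm M g + 2 * (\<integral>x. g x * f x \<partial>M) + sqnorm M f"
      using sqnorm_lincomb[OF g f, of 1 1] by simp
    then have "sqnorm M (F n) - sqnorm M f = sqnorm M g + 2 * (\<integral>x. g x * f x \<partial>M)" by simp
    moreover have "\<bar>sqnorm M g + 2 * (\<integral>x. g x * f x \<partial>M)\<bar> \<le> sqnorm M g + (1/e * sqnorm M g + e * sqnorm M f)"
      using * sqnorm_nonneg[of M g] by (simp only: abs_le_iff) linarith
    ultimately show ?thesis by (simp add: g_def[symmetric] distrib_right)
  qed
  show ?thesis
  proof (rule LIMSEQ_I)
    fix r :: real assume "r > 0"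
    \<comment> \<open>This weight keeps \<open>e * sqnorm M f\<close> below \<open>r/2\<close>; the
      summand 1 excludes a zero denominator.\<close>
    define e where "e = r / (2 * (sqnorm M f + 1))"
    have "sqnorm M f + 1 > 0" using sqnorm_nonneg[of M f] by linarith
    then have e: "e > 0" "e * sqnorm M f < r/2 + r/4"
      using \<open>r > 0\<close> by (auto simp: e_def field_simps intro: add_pos_nonneg)
    have "(\<lambda>n. (1 + 1/e) * sqnorm M (\<lambda>x. F n x - f x)) \<longlonglongrightarrow> (1 + 1/e) * 0"
      by (intro tendsto_intros lim)
    then have "\<forall>\<^sub>F n in sequentially. (1 + 1/e) * sqnorm M (\<lambda>x. F n x - f x) < r/4"
      by (rule order_tendstoD) (use \<open>r > 0\<close> in auto)
    then obtain N where N: "\<And>n. n \<ge> N \<Longrightarrow> (1 + 1/e) * sqnorm M (\<lambda>x. F n x - f x) < r/4"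
      by (auto simp: eventually_sequentially)
    have "norm (sqnorm M (F n) - sqnorm M f) < r" if "n \<ge> N" for n
      using bd[OF e(1), of n] e(2) N[OF that] unfolding real_norm_def by linarith
    then show "\<exists>N. \<forall>n\<ge>N. norm (sqnorm M (F n) - sqnorm M f) < r" by blast
  qed
qed

lemma sqnorm_Fatou:
  assumes "\<And>n. F n \<in> L2 M" "f \<in> borel_measurable M" "AE x in M. (\<lambda>n. F n x) \<longlonglongrightarrow> f x"
    and "\<And>n. sqnorm M (F n) \<le> C"
  shows "f \<in> L2 M" "sqnorm M f \<le> C"
proof -
  have "(\<integral>\<^sup>+x. ennreal ((f x)\<^sup>2) \<partial>M) = (\<integral>\<^sup>+x. liminf (\<lambda>n. ennreal ((F n x)\<^sup>2)) \<partial>M)"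
  proof (rule nn_integral_cong_AE)
    show "AE x in M. ennreal ((f x)\<^sup>2) = liminf (\<lambda>n. ennreal ((F n x)\<^sup>2))"
      using assms(3)
    proof eventually_elim
      case (elim x)
      then have "(\<lambda>n. ennreal ((F n x)\<^sup>2)) \<longlonglongrightarrow> ennreal ((f x)\<^sup>2)"
        by (intro tendsto_ennrealI tendsto_intros)
      then show ?case by (intro lim_imp_Liminf[symmetric]) auto
    qed
  qed
  also have "\<dots> \<le> liminf (\<lambda>n. \<integral>\<^sup>+x. ennreal ((F n x)\<^sup>2) \<partial>M)"
    by (rule nn_integral_liminf) (use assms(1) in measurable)
  also have "\<dots> = liminf (\<lambda>n. ennreal (sqnorm M (F n)))"
    using assms(1) by (simp add: ennreal_sqnorm)
  also have "\<dots> \<le> liminf (\<lambda>n. ennreal C)"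
    by (intro Liminf_mono always_eventually allI ennreal_leI assms(4))
  finally have le: "(\<integral>\<^sup>+x. ennreal ((f x)\<^sup>2) \<partial>M) \<le> ennreal C" by (simp add: Liminf_const)
  show f: "f \<in> L2 M"
    by (rule L2_I_nn_integral[OF assms(2)]) (use le in \<open>auto intro: le_less_trans[OF _ ennreal_less_top]\<close>)
  have "0 \<le> C" using assms(4)[of 0] sqnorm_nonneg[of M "F 0"] by linarith
  then show "sqnorm M f \<le> C" using le f by (simp add: ennreal_sqnorm[symmetric])
qed

section \<open>Completeness, uniform convexity and Mazur's lemma\<close>

lemma Cauchy_fast_subseq:
  fixes D :: "nat \<Rightarrow> nat \<Rightarrow> real" and b :: "nat \<Rightarrow> real"
  assumes "\<And>e. e > 0 \<Longrightarrow> \<exists>k. \<forall>i\<ge>k. \<forall>j\<ge>k. D i j < e" and "\<And>k. b k > 0"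
  obtains r :: "nat \<Rightarrow> nat" where "strict_mono r" "\<And>k j. j \<ge> r k \<Longrightarrow> D (r k) j < b k"
proof -
  have "\<exists>r. \<forall>k. (\<forall>i\<ge>r k. \<forall>j\<ge>r k. D i j < b k) \<and> r k < r (Suc k)"
  proof (rule dependent_nat_choice[where P="\<lambda>k x. \<forall>i\<ge>x. \<forall>j\<ge>x. D i j < b k" and Q="\<lambda>k x y. x < y"])
    show "\<exists>x. \<forall>i\<ge>x. \<forall>j\<ge>x. D i j < b 0" using assms by blast
    fix x k
    obtain y where y: "\<forall>i\<ge>y. \<forall>j\<ge>y. D i j < b (Suc k)" using assms by blast
    show "\<exists>y. (\<forall>i\<ge>y. \<forall>j\<ge>y. D i j < b (Suc k)) \<and> x < y"
      by (rule exI[of _ "max y (Suc x)"]) (use y in auto)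
  qed
  then obtain r where "\<forall>k. \<forall>i\<ge>r k. \<forall>j\<ge>r k. D i j < b k" "\<forall>k. r k < r (Suc k)" by blast
  then show ?thesis using that[of r] by (auto simp: strict_mono_Suc_iff)
qed

text \<open>Riesz-Fischer. Along a subsequence the squared increments \<open>g k\<close> have
  integral at most \<open>8^-k\<close>, so the series of \<open>4^k (g k)^2\<close> is integrable;
  where it is finite, \<open>|g k|\<close> is of order \<open>2^-k\<close> and the subsequence
  converges. Fatou's lemma transfers the Cauchy estimate of the whole sequence to this pointwise
  limit.\<close>

theorem L2_complete:
  assumes F: "\<And>n. F n \<in> L2 M"
    and Cauchy: "\<And>e. e > 0 \<Longrightarrow> \<exists>k. \<forall>i\<ge>k. \<forall>j\<ge>k. sqnorm M (\<lambda>x. F i x - F j x) < e"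
  obtains f where "L2_tendsto M F f"
proof -
  obtain r where r: "strict_mono r" "\<And>k j. j \<ge> r k \<Longrightarrow> sqnorm M (\<lambda>x. F (r k) x - F j x) < (1/8)^k"
    using Cauchy_fast_subseq[where D="\<lambda>i j. sqnorm M (\<lambda>x. F i x - F j x)" and b="\<lambda>k. (1/8)^k", OF Cauchy]
    by auto
  define g where "g k x = F (r k) x - F (r (Suc k)) x" for k x
  have g: "g k \<in> L2 M" for k unfolding g_def by (intro L2_diff F)
  have gn: "sqnorm M (g k) \<le> (1/8)^k" for k
    using r(2)[of k "r (Suc k)"] r(1)
    by (auto simp: g_def[abs_def] strict_mono_less_eq intro: less_imp_le)
  have "(\<integral>\<^sup>+x. (\<Sum>k. ennreal (4^k * (g k x)\<^sup>2)) \<partial>M) = (\<Sum>k. \<integral>\<^sup>+x. ennreal (4^k * (g k x)\<^sup>2) \<partial>M)"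
    by (rule nn_integral_suminf) (use g in measurable)
  also have "\<dots> \<le> (\<Sum>k. ennreal ((1/2)^k))"
  proof (intro suminf_le summableI)
    fix k
    have "(\<integral>\<^sup>+x. ennreal (4^k * (g k x)\<^sup>2) \<partial>M) = ennreal (4^k * sqnorm M (g k))"
      unfolding sqnorm_def using g[of k]
      by (subst nn_integral_eq_integral) (auto simp: L2_integrable_sq)
    also have "\<dots> \<le> ennreal (4^k * (1/8)^k)" by (intro ennreal_leI mult_left_mono gn) auto
    also have "4^k * (1/8)^k = (1/2::real)^k" by (simp flip: power_mult_distrib)
    finally show "(\<integral>\<^sup>+x. ennreal (4^k * (g k x)\<^sup>2) \<partial>M) \<le> ennreal ((1/2)^k)" .
  qed
  also have "\<dots> = ennreal (\<Sum>k. (1/2)^k)" by (rule suminf_ennreal2) (auto intro: summable_geometric)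
  finally have "(\<integral>\<^sup>+x. (\<Sum>k. ennreal (4^k * (g k x)\<^sup>2)) \<partial>M) \<noteq> \<infinity>"
    by (metis ennreal_less_top infinity_ennreal_def leD)
  then have "AE x in M. (\<Sum>k. ennreal (4^k * (g k x)\<^sup>2)) \<noteq> \<infinity>"
    by (intro nn_integral_PInf_AE) (use g in measurable)
  then have ae: "AE x in M. convergent (\<lambda>k. F (r k) x)"
  proof eventually_elim
    case (elim x)
    have "\<exists>C\<ge>0. z = ennreal C" if "z \<noteq> \<infinity>" for z :: ennreal
      using that by (cases z) auto
    then obtain C where C: "(\<Sum>k. ennreal (4^k * (g k x)\<^sup>2)) = ennreal C" "0 \<le> C"
      using elim by blast
    have "\<bar>g k x\<bar> \<le> sqrt C * (1/2)^k" for k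
    proof -
      have "ennreal (4^k * (g k x)\<^sup>2) \<le> ennreal C"
        using sum_le_suminf[of "\<lambda>k. ennreal (4^k * (g k x)\<^sup>2)" "{k}"] C(1) by simp
      then have "4^k * (g k x)\<^sup>2 \<le> C" using C(2) by (simp add: ennreal_le_iff)
      then have "sqrt (4^k * (g k x)\<^sup>2) \<le> sqrt C" by simp
      moreover have "sqrt (4^k * (g k x)\<^sup>2) = 2^k * \<bar>g k x\<bar>"
      proof -
        have "(4::real)^k = (2^k)\<^sup>2" by (simp add: power2_eq_square flip: power_mult_distrib)
        then show ?thesis by (simp add: real_sqrt_mult)
      qed
      ultimately have "2^k * \<bar>g k x\<bar> \<le> sqrt C" by simp
      then show ?thesis by (simp add: power_divide pos_le_divide_eq mult.commute)
    qed
    then have "summable (\<lambda>k. g k x)"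
      using summable_comparison_test'[OF summable_mult[OF summable_geometric[of "1/2::real"]], of 0 "\<lambda>k. g k x" "sqrt C"]
      by simp
    then have "convergent (\<lambda>n. F (r 0) x - (\<Sum>k<n. g k x))"
      unfolding summable_iff_convergent by (intro convergent_diff convergent_const)
    moreover have "F (r 0) x - (\<Sum>k<n. g k x) = F (r n) x" for n
      by (induction n) (auto simp: g_def)
    ultimately show ?case by simp
  qed
  define f where "f x = lim (\<lambda>k. F (r k) x)" for x
  have fm: "f \<in> borel_measurable M"
    unfolding f_def using F by (intro borel_measurable_lim_metric) auto
  have lim: "AE x in M. (\<lambda>k. F (r k) x) \<longlonglongrightarrow> f x"
    using ae by eventually_elim (simp add: f_def convergent_LIMSEQ_iff)
  have main: "(\<lambda>x. F i x - f x) \<in> L2 M \<and> sqnorm M (\<lambda>x. F i x - f x) \<le> e"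
    if k: "\<And>i j. i \<ge> k \<Longrightarrow> j \<ge> k \<Longrightarrow> sqnorm M (\<lambda>x. F i x - F j x) < e" and "i \<ge> k" for i k e
  proof -
    have rk: "r (k + n) \<ge> k" for n using seq_suble[OF r(1), of "k+n"] by simp
    have *: "(\<lambda>x. F i x - F (r (k + n)) x) \<in> L2 M" "sqnorm M (\<lambda>x. F i x - F (r (k + n)) x) \<le> e" for n
      using k[OF \<open>i \<ge> k\<close> rk[of n]] by (auto intro!: L2_diff F)
    have "AE x in M. (\<lambda>n. F i x - F (r (k + n)) x) \<longlonglongrightarrow> F i x - f x"
      using lim
    proof eventually_elim
      case (elim x)
      have "(\<lambda>n. F (r (n + k)) x) \<longlonglongrightarrow> f x" by (rule LIMSEQ_ignore_initial_segment[OF elim])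
      then show ?case by (intro tendsto_diff tendsto_const) (simp add: add.commute)
    qed
    then show ?thesis
      using sqnorm_Fatou[of "\<lambda>n x. F i x - F (r (k + n)) x" M "\<lambda>x. F i x - f x" e] * F fm by auto
  qed
  obtain k where "\<forall>i\<ge>k. \<forall>j\<ge>k. sqnorm M (\<lambda>x. F i x - F j x) < 1" using Cauchy[of 1] by auto
  then have "(\<lambda>x. F k x - f x) \<in> L2 M" using main[of k 1 k] by simp
  from L2_diff[OF F[of k] this] have f: "f \<in> L2 M" by simp
  have "(\<lambda>n. sqnorm M (\<lambda>x. F n x - f x)) \<longlonglongrightarrow> 0"
  proof (rule LIMSEQ_I)
    fix e :: real assume "e > 0"
    then obtain k where "\<forall>i\<ge>k. \<forall>j\<ge>k. sqnorm M (\<lambda>x. F i x - F j x) < e/2" using Cauchy[of "e/2"] by auto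
    then have "\<forall>i\<ge>k. sqnorm M (\<lambda>x. F i x - f x) \<le> e/2" using main[of k "e/2"] by blast
    then show "\<exists>no. \<forall>n\<ge>no. norm (sqnorm M (\<lambda>x. F n x - f x) - 0) < e"
      using \<open>e > 0\<close> by (intro exI[of _ k]) force
  qed
  then have "L2_tendsto M F f" using f F by (simp add: L2_tendsto_iff)
  then show ?thesis by (rule that)
qed

text \<open>Uniform convexity through the parallelogram law: if squared norms tend to
  \<open>c\<close> and midpoints are asymptotically not shorter, differences tend to 0. With both
  tolerances \<open>e/16\<close> the law leaves at most \<open>e/2\<close>. This yields projections
  onto convex sets as well as strongly convergent slopes.\<close>

lemma L2_minimizing_converges:
  assumes v: "\<And>n. v n \<in> L2 M" and lim: "(\<lambda>n. sqnorm M (v n)) \<longlonglongrightarrow> c"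
    and mid: "\<And>e. e > 0 \<Longrightarrow> \<exists>k. \<forall>i\<ge>k. \<forall>j\<ge>k. c - e \<le> sqnorm M (\<lambda>x. 1/2 * v i x + 1/2 * v j x)"
  obtains w where "L2_tendsto M v w" "sqnorm M w = c"
proof -
  have "\<exists>k. \<forall>i\<ge>k. \<forall>j\<ge>k. sqnorm M (\<lambda>x. v i x - v j x) < e" if "e > 0" for e
  proof -
    obtain k1 where k1: "\<And>i j. i\<ge>k1 \<Longrightarrow> j\<ge>k1 \<Longrightarrow> c - e/16 \<le> sqnorm M (\<lambda>x. 1/2 * v i x + 1/2 * v j x)"
      using mid[of "e/16"] \<open>e > 0\<close> by auto
    obtain k2 where k2: "\<And>i. i\<ge>k2 \<Longrightarrow> sqnorm M (v i) < c + e/16"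
      using order_tendstoD(2)[OF lim, of "c + e/16"] \<open>e > 0\<close> by (auto simp: eventually_sequentially)
    have "sqnorm M (\<lambda>x. v i x - v j x) < e" if "i \<ge> max k1 k2" "j \<ge> max k1 k2" for i j
      using sqnorm_parallelogram[OF v v, of i j] k1[of i j] k2[of i] k2[of j] that \<open>e > 0\<close>
      by simp
    then show ?thesis by blast
  qed
  then obtain w where w: "L2_tendsto M v w" by (rule L2_complete[of v M, OF v]) blast+
  moreover have "sqnorm M w = c" using LIMSEQ_unique[OF sqnorm_tendsto[OF w] lim] .
  ultimately show ?thesis by (rule that)
qed

lemma nonneg_if_small_quadratic:
  fixes a b :: real
  assumes "\<And>t. 0 < t \<Longrightarrow> t < 1 \<Longrightarrow> 0 \<le> 2 * t * a + t\<^sup>2 * b"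
  shows "0 \<le> a"
proof (rule ccontr)
  assume "\<not> 0 \<le> a"
  \<comment> \<open>For a step this small the quadratic term cannot outweigh the negative linear
    one.\<close>
  define t where "t = min (1/2) (-a / (\<bar>b\<bar> + 1))"
  have t: "0 < t" "t < 1" "t * (\<bar>b\<bar> + 1) \<le> -a"
    using \<open>\<not> 0 \<le> a\<close> pos_le_divide_eq[of "\<bar>b\<bar> + 1" t "-a"]
    by (auto simp: t_def divide_neg_pos add_nonneg_pos)
  have "0 \<le> t * (2 * a + t * b)" using assms[OF t(1,2)] by (simp add: algebra_simps power2_eq_square)
  then have "0 \<le> 2 * a + t * b" using t(1) by (simp add: zero_le_mult_iff)
  moreover have "t * b \<le> t * (\<bar>b\<bar> + 1)" using t(1) by (intro mult_left_mono) auto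
  ultimately show False using t(3) \<open>\<not> 0 \<le> a\<close> by linarith
qed

text \<open>The weak limit is projected onto the closure of the convex set.\<close>

lemma L2_Mazur:
  assumes C: "C \<subseteq> L2 M"
    and conv: "\<And>u v t. u \<in> C \<Longrightarrow> v \<in> C \<Longrightarrow> 0 \<le> t \<Longrightarrow> t \<le> 1 \<Longrightarrow> (\<lambda>x. (1 - t) * u x + t * v x) \<in> C"
    and v: "\<And>n. v n \<in> C" and g: "g \<in> L2 M"
    and weak: "\<And>h. h \<in> L2 M \<Longrightarrow> (\<lambda>n. \<integral>x. v n x * h x \<partial>M) \<longlonglongrightarrow> (\<integral>x. g x * h x \<partial>M)"
    and "e > 0"
  shows "\<exists>u\<in>C. sqnorm M (\<lambda>x. u x - g x) < e"
proof -
  define a where "a = (INF u\<in>C. sqnorm M (\<lambda>x. u x - g x))"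
  have bdd: "bdd_below ((\<lambda>u. sqnorm M (\<lambda>x. u x - g x)) ` C)" by (rule bdd_belowI2[of _ 0]) simp
  have a_le: "a \<le> sqnorm M (\<lambda>x. u x - g x)" if "u \<in> C" for u
    unfolding a_def by (rule cINF_lower[OF bdd that])
  have "\<exists>u\<in>C. sqnorm M (\<lambda>x. u x - g x) < a + 1 / Suc n" for n
    using cINF_less_iff[OF _ bdd, of "a + 1 / Suc n"] v by (auto simp: a_def)
  then obtain u where u: "\<And>n. u n \<in> C" "\<And>n. sqnorm M (\<lambda>x. u n x - g x) < a + 1 / Suc n" by metis
  have uL: "(\<lambda>x. u n x - g x) \<in> L2 M" for n using u(1) C g by (auto intro: L2_diff)
  have "(\<lambda>n. sqnorm M (\<lambda>x. u n x - g x)) \<longlonglongrightarrow> a"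
  proof (rule tendsto_sandwich)
    show "(\<lambda>n. a) \<longlonglongrightarrow> a" by simp
    have "(\<lambda>n. a + 1 / Suc n) \<longlonglongrightarrow> a + 0" by (intro tendsto_intros LIMSEQ_Suc lim_1_over_n)
    then show "(\<lambda>n. a + 1 / Suc n) \<longlonglongrightarrow> a" by simp
  qed (use u a_le in \<open>auto intro!: always_eventually less_imp_le\<close>)
  moreover have "\<exists>k. \<forall>i\<ge>k. \<forall>j\<ge>k. a - e \<le> sqnorm M (\<lambda>x. 1/2 * (u i x - g x) + 1/2 * (u j x - g x))"
    if "e > 0" for e
  proof -
    have "a \<le> sqnorm M (\<lambda>x. 1/2 * (u i x - g x) + 1/2 * (u j x - g x))" for i j
      using a_le[OF conv[OF u(1) u(1), of "1/2" i j]] by (simp add: algebra_simps)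
    then show ?thesis using that by (meson diff_le_eq dual_order.trans le_add_same_cancel1 less_imp_le)
  qed
  ultimately obtain w where w: "L2_tendsto M (\<lambda>n x. u n x - g x) w" and wa: "sqnorm M w = a"
    by (rule L2_minimizing_converges[of "\<lambda>n x. u n x - g x" M a, OF uL]) blast+
  have wL: "w \<in> L2 M" using w by (simp add: L2_tendsto_iff)
  \<comment> \<open>First-order optimality of the projection: no point of the segment from the limit
    of \<open>u n - g\<close> towards \<open>v k - g\<close> is shorter than
    \<open>w\<close>.\<close>
  have ineq: "0 \<le> (\<integral>x. w x * (v k x - g x - w x) \<partial>M)" for k
  proof (rule nonneg_if_small_quadratic)
    fix t :: real assume t: "0 < t" "t < 1"
    define p where "p x = v k x - g x" for x
    have p: "p \<in> L2 M" unfolding p_def using v C g by (auto intro: L2_diff)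
    have "a \<le> sqnorm M (\<lambda>x. (1 - t) * (u n x - g x) + t * p x)" for n
      using a_le[OF conv[OF u(1) v, of t n k]] t by (simp add: algebra_simps p_def)
    moreover have "L2_tendsto M (\<lambda>n x. (1 - t) * (u n x - g x) + t * p x) (\<lambda>x. (1 - t) * w x + t * p x)"
    proof -
      have "(\<lambda>n. (1-t)\<^sup>2 * sqnorm M (\<lambda>x. (u n x - g x) - w x)) \<longlonglongrightarrow> (1-t)\<^sup>2 * 0"
        using w by (intro tendsto_intros) (simp add: L2_tendsto_iff)
      moreover have "sqnorm M (\<lambda>x. ((1 - t) * (u n x - g x) + t * p x) - ((1 - t) * w x + t * p x)) =
         (1-t)\<^sup>2 * sqnorm M (\<lambda>x. (u n x - g x) - w x)" for n
        unfolding sqnorm_scale[symmetric] by (simp add: algebra_simps)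
      ultimately show ?thesis using uL p wL by (simp add: L2_tendsto_iff L2_lincomb)
    qed
    ultimately have "a \<le> sqnorm M (\<lambda>x. (1 - t) * w x + t * p x)"
      by (intro LIMSEQ_le_const[OF sqnorm_tendsto]) auto
    also have "(\<lambda>x. (1 - t) * w x + t * p x) = (\<lambda>x. 1 * w x + t * (p x - w x))"
      by (simp add: algebra_simps)
    also have "sqnorm M \<dots> = a + 2 * t * (\<integral>x. w x * (p x - w x) \<partial>M) + t\<^sup>2 * sqnorm M (\<lambda>x. p x - w x)"
      using sqnorm_lincomb[OF wL L2_diff[OF p wL], of 1 t] wa by simp
    finally show "0 \<le> 2 * t * (\<integral>x. w x * (v k x - g x - w x) \<partial>M) + t\<^sup>2 * sqnorm M (\<lambda>x. p x - w x)"
      by (simp add: p_def)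
  qed
  have vL: "v k \<in> L2 M" for k using v C by auto
  have "(\<integral>x. w x * (v k x - g x - w x) \<partial>M) = (\<integral>x. v k x * w x \<partial>M) - (\<integral>x. g x * w x \<partial>M) - sqnorm M w" for k
  proof -
    have "(\<integral>x. w x * (v k x - g x - w x) \<partial>M) = (\<integral>x. v k x * w x - g x * w x - (w x)\<^sup>2 \<partial>M)"
      by (rule Bochner_Integration.integral_cong) (auto simp: algebra_simps power2_eq_square)
    then show ?thesis
      using L2_integrable_mult[OF vL wL, of k] L2_integrable_mult[OF g wL] L2_integrable_sq[OF wL]
      by (simp add: sqnorm_def)
  qed
  then have "0 \<le> (\<integral>x. v k x * w x \<partial>M) - (\<integral>x. g x * w x \<partial>M) - a" for k using ineq[of k] wa by simp
  \<comment> \<open>Weak convergence tested with \<open>w\<close> itself leaves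
    \<open>0 \<le> - a\<close> in the limit.\<close>
  moreover have "(\<lambda>k. (\<integral>x. v k x * w x \<partial>M) - (\<integral>x. g x * w x \<partial>M) - a) \<longlonglongrightarrow>
      (\<integral>x. g x * w x \<partial>M) - (\<integral>x. g x * w x \<partial>M) - a"
    by (intro tendsto_intros weak wL)
  ultimately have "a \<le> 0" using LIMSEQ_le_const[of _ _ 0] by fastforce
  then show ?thesis using cINF_less_iff[OF _ bdd, of e] v \<open>e > 0\<close> unfolding a_def by fastforce
qed

section \<open>Operations compatible with strong convergence\<close>

lemma tendsto_0_if_le:
  fixes s t :: "nat \<Rightarrow> real"
  assumes "\<And>n. s n \<le> t n" "t \<longlonglongrightarrow> c" "c = 0" "\<And>n. 0 \<le> s n"
  shows "s \<longlonglongrightarrow> 0"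
  by (rule tendsto_sandwich[OF _ _ tendsto_const[of 0]]) (use assms in \<open>auto intro: always_eventually\<close>)

text \<open>\<open>h n * v n - h0 * G = h n * (v n - G) + (h n - h0) * G\<close>: boundedness
  controls the first summand, dominated convergence the second. In this way coefficients that
  converge only almost everywhere pass to the limit.\<close>

lemma L2_tendsto_multiplier:
  assumes v: "L2_tendsto M v G" and h: "\<And>n. h n \<in> borel_measurable M" "h0 \<in> borel_measurable M"
    and bd: "\<And>n. AE x in M. \<bar>h n x\<bar> \<le> C" and lim: "AE x in M. (\<lambda>n. h n x) \<longlonglongrightarrow> h0 x"
  shows "L2_tendsto M (\<lambda>n x. h n x * v n x) (\<lambda>x. h0 x * G x)"
proof -
  have vL: "\<And>n. v n \<in> L2 M" and G: "G \<in> L2 M"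
    and v0: "(\<lambda>n. sqnorm M (\<lambda>x. v n x - G x)) \<longlonglongrightarrow> 0"
    using v by (auto simp: L2_tendsto_iff)
  have bd': "AE x in M. \<forall>n. \<bar>h n x\<bar> \<le> C" using bd by (simp add: AE_all_countable)
  have bd0: "AE x in M. \<bar>h0 x\<bar> \<le> C"
    using bd' lim
  proof eventually_elim
    case (elim x)
    then show ?case using LIMSEQ_le_const2[OF tendsto_rabs[OF elim(2)]] by blast
  qed
  have L: "(\<lambda>x. b x * w x) \<in> L2 M"
    if "b \<in> borel_measurable M" "AE x in M. \<bar>b x\<bar> \<le> c" "w \<in> L2 M" for b w and c :: real
    by (rule L2_dominated[OF _ L2_scale[OF that(3), of c]])
      (use that in \<open>auto elim!: eventually_mono simp: abs_mult intro!: mult_mono\<close>)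
  have "(\<lambda>n. \<integral>x. ((h n x - h0 x) * G x)\<^sup>2 \<partial>M) \<longlonglongrightarrow> (\<integral>x. 0 \<partial>M)"
  proof (rule integral_dominated_convergence)
    show "integrable M (\<lambda>x. 4 * C\<^sup>2 * (G x)\<^sup>2)" using G by (simp add: L2_integrable_sq)
    show "AE x in M. norm (((h n x - h0 x) * G x)\<^sup>2) \<le> 4 * C\<^sup>2 * (G x)\<^sup>2" for n
      using bd[of n] bd0
    proof eventually_elim
      case (elim x)
      then have "\<bar>h n x - h0 x\<bar> \<le> \<bar>2 * C\<bar>" by linarith
      then have "(h n x - h0 x)\<^sup>2 \<le> (2 * C)\<^sup>2" by (simp add: abs_le_square_iff)
      then show ?case by (simp add: power_mult_distrib mult_right_mono)
    qed
    show "AE x in M. (\<lambda>n. ((h n x - h0 x) * G x)\<^sup>2) \<longlonglongrightarrow> 0"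
      using lim
    proof eventually_elim
      case (elim x)
      then have "(\<lambda>n. ((h n x - h0 x) * G x)\<^sup>2) \<longlonglongrightarrow> ((h0 x - h0 x) * G x)\<^sup>2"
        by (intro tendsto_intros)
      then show ?case by simp
    qed
  qed (use h G in auto)
  then have A: "(\<lambda>n. sqnorm M (\<lambda>x. (h n x - h0 x) * G x)) \<longlonglongrightarrow> 0" by (simp add: sqnorm_def)
  have "sqnorm M (\<lambda>x. h n x * v n x - h0 x * G x) \<le>
      2 * (C\<^sup>2 * sqnorm M (\<lambda>x. v n x - G x)) + 2 * sqnorm M (\<lambda>x. (h n x - h0 x) * G x)" for n
  proof -
    have d: "(\<lambda>x. v n x - G x) \<in> L2 M" by (intro L2_diff vL G)
    have "sqnorm M (\<lambda>x. h n x * v n x - h0 x * G x) =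
        sqnorm M (\<lambda>x. h n x * (v n x - G x) + (h n x - h0 x) * G x)" by (simp add: algebra_simps)
    also have "\<dots> \<le> 2 * sqnorm M (\<lambda>x. h n x * (v n x - G x)) + 2 * sqnorm M (\<lambda>x. (h n x - h0 x) * G x)"
    proof (rule sqnorm_add_le)
      have "AE x in M. \<bar>h n x - h0 x\<bar> \<le> 2 * C" using bd[of n] bd0 by eventually_elim linarith
      then show "(\<lambda>x. (h n x - h0 x) * G x) \<in> L2 M" by (intro L[OF _ _ G]) (use h in auto)
    qed (rule L[OF h(1) bd d])
    also have "sqnorm M (\<lambda>x. h n x * (v n x - G x)) \<le> sqnorm M (\<lambda>x. C * (v n x - G x))"
      by (rule sqnorm_mono)
        (use bd[of n] h vL G d in \<open>auto elim!: eventually_mono simp: abs_mult intro!: mult_mono L2_scale\<close>)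
    finally show ?thesis by (simp add: sqnorm_scale)
  qed
  moreover have "(\<lambda>n. 2 * (C\<^sup>2 * sqnorm M (\<lambda>x. v n x - G x)) + 2 * sqnorm M (\<lambda>x. (h n x - h0 x) * G x))
      \<longlonglongrightarrow> 2 * (C\<^sup>2 * 0) + 2 * 0"
    by (intro tendsto_intros v0 A)
  ultimately have "(\<lambda>n. sqnorm M (\<lambda>x. h n x * v n x - h0 x * G x)) \<longlonglongrightarrow> 0"
    by (rule tendsto_0_if_le) simp_all
  moreover have "(\<lambda>x. h n x * v n x) \<in> L2 M" for n by (rule L[OF h(1) bd vL])
  moreover have "(\<lambda>x. h0 x * G x) \<in> L2 M" by (rule L[OF h(2) bd0 G])
  ultimately show ?thesis by (simp add: L2_tendsto_iff)
qed

lemma L2_tendsto_add: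
  assumes "L2_tendsto M F f" "L2_tendsto M H h"
  shows "L2_tendsto M (\<lambda>n x. F n x + H n x) (\<lambda>x. f x + h x)"
proof -
  have L: "\<And>n. F n \<in> L2 M" "\<And>n. H n \<in> L2 M" "f \<in> L2 M" "h \<in> L2 M"
    and 0: "(\<lambda>n. sqnorm M (\<lambda>x. F n x - f x)) \<longlonglongrightarrow> 0" "(\<lambda>n. sqnorm M (\<lambda>x. H n x - h x)) \<longlonglongrightarrow> 0"
    using assms by (auto simp: L2_tendsto_iff)
  have "sqnorm M (\<lambda>x. F n x + H n x - (f x + h x)) \<le>
      2 * sqnorm M (\<lambda>x. F n x - f x) + 2 * sqnorm M (\<lambda>x. H n x - h x)" for n
    using sqnorm_add_le[OF L2_diff[OF L(1,3)] L2_diff[OF L(2,4)], of n n] by (simp add: add_diff_add)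
  moreover have "(\<lambda>n. 2 * sqnorm M (\<lambda>x. F n x - f x) + 2 * sqnorm M (\<lambda>x. H n x - h x)) \<longlonglongrightarrow> 2 * 0 + 2 * 0"
    by (intro tendsto_intros 0)
  ultimately have "(\<lambda>n. sqnorm M (\<lambda>x. F n x + H n x - (f x + h x))) \<longlonglongrightarrow> 0"
    by (rule tendsto_0_if_le) simp_all
  then show ?thesis using L by (simp add: L2_tendsto_iff L2_add)
qed

lemma L2_tendsto_const: "f \<in> L2 M \<Longrightarrow> L2_tendsto M (\<lambda>n. f) f"
  by (simp add: L2_tendsto_iff)

lemma L2_tendsto_scale: "L2_tendsto M F f \<Longrightarrow> L2_tendsto M (\<lambda>n x. a * F n x) (\<lambda>x. a * f x)"
  using tendsto_mult_right_zero[of "\<lambda>n. sqnorm M (\<lambda>x. F n x - f x)" sequentially "a\<^sup>2"]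
  by (auto simp: L2_tendsto_iff L2_scale sqnorm_scale simp flip: right_diff_distrib)

lemma L2_tendsto_dominated:
  assumes "L2_tendsto M F f" "\<And>n. H n \<in> L2 M" "h \<in> L2 M"
    and "\<And>n. AE x in M. \<bar>H n x - h x\<bar> \<le> C * \<bar>F n x - f x\<bar>"
  shows "L2_tendsto M H h"
proof -
  have L: "\<And>n. F n \<in> L2 M" "f \<in> L2 M"
    and 0: "(\<lambda>n. sqnorm M (\<lambda>x. F n x - f x)) \<longlonglongrightarrow> 0"
    using assms by (auto simp: L2_tendsto_iff)
  have "sqnorm M (\<lambda>x. H n x - h x) \<le> C\<^sup>2 * sqnorm M (\<lambda>x. F n x - f x)" for n
    unfolding sqnorm_scale[symmetric]
  proof (rule sqnorm_mono)
    show "AE x in M. \<bar>H n x - h x\<bar> \<le> \<bar>C * (F n x - f x)\<bar>"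
      using assms(4)[of n]
    proof eventually_elim
      case (elim x)
      also have "C * \<bar>F n x - f x\<bar> \<le> \<bar>C * (F n x - f x)\<bar>"
        by (simp add: abs_mult mult_right_mono)
      finally show ?case .
    qed
  qed (use assms L in \<open>auto intro!: L2_scale L2_diff\<close>)
  moreover have "(\<lambda>n. C\<^sup>2 * sqnorm M (\<lambda>x. F n x - f x)) \<longlonglongrightarrow> C\<^sup>2 * 0" by (intro tendsto_intros 0)
  ultimately have "(\<lambda>n. sqnorm M (\<lambda>x. H n x - h x)) \<longlonglongrightarrow> 0"
    by (rule tendsto_0_if_le) simp_all
  then show ?thesis using assms by (simp add: L2_tendsto_iff)
qed

lemma L2_Cauchy_Schwarz:
  assumes "f \<in> L2 M" "g \<in> L2 M"
  shows "(\<integral>x. f x * g x \<partial>M)\<^sup>2 \<le> sqnorm M f * sqnorm M g"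
proof (cases "sqnorm M g = 0")
  case True
  then have "AE x in M. g x = 0" using assms by (simp add: sqnorm_eq_0_iff)
  then have "(\<integral>x. f x * g x \<partial>M) = (\<integral>x. 0 \<partial>M)"
    using assms by (intro integral_cong_AE) (auto elim: eventually_mono)
  then show ?thesis by simp
next
  case False
  define b where "b = (\<integral>x. f x * g x \<partial>M)"
  have c: "0 < sqnorm M g" using False sqnorm_nonneg[of M g] by linarith
  \<comment> \<open>This coefficient of \<open>g\<close> minimizes the squared norm.\<close>
  have "0 \<le> sqnorm M (\<lambda>x. 1 * f x + (- b / sqnorm M g) * g x)" by simp
  also have "\<dots> = sqnorm M f - b\<^sup>2 / sqnorm M g"
    unfolding sqnorm_lincomb[OF assms] b_def[symmetric] using False by (simp add: power2_eq_square)
  finally show ?thesis using c by (simp add: b_def[symmetric] pos_divide_le_eq)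
qed

lemma L2_tendsto_inner:
  assumes "L2_tendsto M F f" "h \<in> L2 M"
  shows "(\<lambda>n. \<integral>x. F n x * h x \<partial>M) \<longlonglongrightarrow> (\<integral>x. f x * h x \<partial>M)"
proof -
  have L: "\<And>n. F n \<in> L2 M" "f \<in> L2 M"
    and 0: "(\<lambda>n. sqnorm M (\<lambda>x. F n x - f x)) \<longlonglongrightarrow> 0"
    using assms by (auto simp: L2_tendsto_iff)
  have eq: "(\<integral>x. F n x * h x \<partial>M) - (\<integral>x. f x * h x \<partial>M) = (\<integral>x. (F n x - f x) * h x \<partial>M)" for n
    by (subst Bochner_Integration.integral_diff[symmetric])
      (use L assms in \<open>auto intro!: L2_integrable_mult simp: left_diff_distrib\<close>)
  have "(\<lambda>n. \<bar>\<integral>x. (F n x - f x) * h x \<partial>M\<bar>) \<longlonglongrightarrow> 0"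
  proof (rule tendsto_0_if_le)
    show "\<bar>\<integral>x. (F n x - f x) * h x \<partial>M\<bar> \<le> sqrt (sqnorm M (\<lambda>x. F n x - f x) * sqnorm M h)" for n
      using L2_Cauchy_Schwarz[OF L2_diff[OF L] assms(2)] real_le_rsqrt by (metis power2_abs)
    show "(\<lambda>n. sqrt (sqnorm M (\<lambda>x. F n x - f x) * sqnorm M h)) \<longlonglongrightarrow> sqrt (0 * sqnorm M h)"
      by (intro tendsto_intros 0)
  qed simp_all
  then show ?thesis
    unfolding LIM_zero_iff[symmetric, of _ "\<integral>x. f x * h x \<partial>M"] eq by (simp add: tendsto_rabs_zero_iff)
qed

lemma L2_tendsto_measurable:
  assumes "L2_tendsto M F f"
  shows "F n \<in> borel_measurable M" "f \<in> borel_measurable M"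
  using assms L2_measurable by (auto simp: L2_tendsto_iff)

lemma (in prob_space) L2_bounded:
  assumes "f \<in> borel_measurable M" "AE x in M. \<bar>f x\<bar> \<le> C"
  shows "f \<in> L2 M"
  by (rule L2_dominated[OF assms(1), of "\<lambda>x. C"]) (use assms(2) in \<open>auto simp: L2_def elim!: eventually_mono\<close>)

lemma (in prob_space) L2_const: "(\<lambda>x. c) \<in> L2 M"
  by (simp add: L2_def)

section \<open>The asymptotic Lipschitz constant\<close>

text \<open>Both points vary over a small ball, as in \<open>Lip_a\<close>. Points of a ball of
  finite radius have finite distance (\<open>dist_near\<close>), so \<open>enn2real\<close> loses
  nothing there.\<close>

definition local_lipschitz_at :: "('a \<Rightarrow> 'a \<Rightarrow> ennreal) \<Rightarrow> ('a \<Rightarrow> real) \<Rightarrow> 'a \<Rightarrow> real \<Rightarrow> bool" where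
  "local_lipschitz_at d u x c \<longleftrightarrow>
    (\<exists>r>0. \<forall>y z. d y x < ennreal r \<longrightarrow> d z x < ennreal r \<longrightarrow> \<bar>u y - u z\<bar> \<le> c * enn2real (d y z))"

definition LIP :: "('a \<Rightarrow> 'a \<Rightarrow> ennreal) \<Rightarrow> ('a \<Rightarrow> real) \<Rightarrow> 'a \<Rightarrow> real" where
  "LIP d u x = enn2real (Lip_a d u x)"

text \<open>The supremum grows with the radius, so its limit at 0 from the right is an
  infimum.\<close>

lemma Lip_a_eq_INF:
  "Lip_a d f x = (INF r\<in>{0<..}. SUP (y, z)\<in>{(y, z). max (d y x) (d z x) < ennreal r \<and> 0 < d y z}.
      ennreal \<bar>f y - f z\<bar> / d y z)"
proof -
  define A where "A r = (SUP (y, z)\<in>{(y, z). max (d y x) (d z x) < ennreal r \<and> 0 < d y z}.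
      ennreal \<bar>f y - f z\<bar> / d y z)" for r :: real
  have mono: "A r \<le> A s" if "r \<le> s" for r s
    unfolding A_def using that by (intro SUP_subset_mono) (auto intro: less_le_trans ennreal_leI)
  have "(A \<longlongrightarrow> (INF r\<in>{0<..}. A r)) (at_right 0)"
  proof (rule order_tendstoI)
    fix a assume "a < (INF r\<in>{0<..}. A r)"
    then have "a < A r" if "r > 0" for r using that by (auto intro: less_le_trans INF_lower)
    then show "\<forall>\<^sub>F r in at_right 0. a < A r"
      using eventually_at_right_less[of "0::real"] by (auto elim: eventually_mono)
  next
    fix a assume "(INF r\<in>{0<..}. A r) < a"
    then obtain s where "s > 0" "A s < a" by (auto simp: INF_less_iff)
    then show "\<forall>\<^sub>F r in at_right 0. A r < a"
      by (intro eventually_at_rightI[of 0 s]) (auto intro: le_less_trans[OF mono[of _ s]])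
  qed
  then show ?thesis unfolding Lip_a_def A_def by (rule tendsto_Lim[OF trivial_limit_at_right_real])
qed

locale ext_dist =
  fixes d :: "'a \<Rightarrow> 'a \<Rightarrow> ennreal"
  assumes ext_dist: "extended_distance d"
begin

lemma dist_commute: "d x y = d y x"
  and dist_triangle: "d x z \<le> d x y + d y z"
  and dist_eq_0: "d x y = 0 \<longleftrightarrow> x = y"
  using ext_dist by (auto simp: extended_distance_def)

lemma dist_same [simp]: "d x x = 0"
  by (simp add: dist_eq_0)

lemma dist_near:
  assumes "d y x < ennreal r" "d z x < ennreal r"
  shows "d y z = ennreal (enn2real (d y z))"
proof -
  have "d y z \<le> d y x + d z x" using dist_triangle[of y z x] dist_commute[of z x] by simp
  also have "\<dots> < \<top>" using assms by (auto intro: less_trans)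
  finally show ?thesis by simp
qed

lemma Lip_a_less_imp:
  assumes "Lip_a d u x < ennreal c"
  shows "local_lipschitz_at d u x c"
proof -
  have "c > 0" using assms by (metis ennreal_neg not_le not_less_zero)
  obtain r where r: "r > 0" and less:
    "(SUP (y, z)\<in>{(y, z). max (d y x) (d z x) < ennreal r \<and> 0 < d y z}. ennreal \<bar>u y - u z\<bar> / d y z) < ennreal c"
    using assms unfolding Lip_a_eq_INF INF_less_iff by auto
  show ?thesis
    unfolding local_lipschitz_at_def
  proof (intro exI[of _ r] conjI allI impI r)
    fix y z assume yz: "d y x < ennreal r" "d z x < ennreal r"
    show "\<bar>u y - u z\<bar> \<le> c * enn2real (d y z)"
    proof (cases "y = z")
      case False
      define D where "D = enn2real (d y z)"
      have D: "d y z = ennreal D" using dist_near[OF yz] by (simp add: D_def)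
      then have "D > 0" using False dist_eq_0[of y z] by (auto simp: D_def enn2real_positive_iff less_le)
      have "ennreal \<bar>u y - u z\<bar> / d y z \<le>
          (SUP (y, z)\<in>{(y, z). max (d y x) (d z x) < ennreal r \<and> 0 < d y z}. ennreal \<bar>u y - u z\<bar> / d y z)"
        by (rule SUP_upper2[of "(y, z)"]) (use yz \<open>D > 0\<close> D in auto)
      also note less
      finally have "ennreal (\<bar>u y - u z\<bar> / D) < ennreal c" using \<open>D > 0\<close> by (simp add: D divide_ennreal)
      then have "\<bar>u y - u z\<bar> / D \<le> c" using \<open>c > 0\<close> by (metis ennreal_le_iff less_imp_le)
      then show ?thesis using \<open>D > 0\<close> by (simp add: D_def[symmetric] pos_divide_le_eq)
    qed simp
  qed
qed

lemma Lip_a_le: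
  assumes "local_lipschitz_at d u x c" "0 \<le> c"
  shows "Lip_a d u x \<le> ennreal c"
proof -
  obtain r where r: "r > 0"
    "\<And>y z. d y x < ennreal r \<Longrightarrow> d z x < ennreal r \<Longrightarrow> \<bar>u y - u z\<bar> \<le> c * enn2real (d y z)"
    using assms(1) by (auto simp: local_lipschitz_at_def)
  show ?thesis
    unfolding Lip_a_eq_INF
  proof (rule INF_lower2[of r])
    show "(SUP (y, z)\<in>{(y, z). max (d y x) (d z x) < ennreal r \<and> 0 < d y z}. ennreal \<bar>u y - u z\<bar> / d y z)
        \<le> ennreal c"
    proof (rule SUP_least, clarsimp)
      fix y z assume yz: "d y x < ennreal r" "d z x < ennreal r" "0 < d y z"
      define D where "D = enn2real (d y z)"
      have D: "d y z = ennreal D" using dist_near[OF yz(1,2)] by (simp add: D_def)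
      then have "D > 0" using yz(3) by simp
      then show "ennreal \<bar>u y - u z\<bar> / d y z \<le> ennreal c"
        using r(2)[OF yz(1,2)] assms(2)
        by (simp add: D divide_ennreal D_def[symmetric] pos_divide_le_eq ennreal_leI)
    qed
  qed (use r in auto)
qed

lemma LIP_nonneg [simp]: "0 \<le> LIP d u x"
  by (simp add: LIP_def)

lemma ext_lipschitz_enn2real:
  assumes "ext_lipschitz d u L" "d y x < ennreal r" "d z x < ennreal r"
  shows "\<bar>u y - u z\<bar> \<le> L * enn2real (d y z)"
proof -
  have L: "0 \<le> L" using assms(1) by (simp add: ext_lipschitz_def)
  have "ennreal \<bar>u y - u z\<bar> \<le> ennreal L * d y z" using assms(1) by (simp add: ext_lipschitz_def)
  also have "\<dots> = ennreal (L * enn2real (d y z))"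
    by (subst dist_near[OF assms(2,3)]) (simp add: ennreal_mult L)
  finally show ?thesis using L by simp
qed

lemma ext_lipschitz_local: "ext_lipschitz d u L \<Longrightarrow> local_lipschitz_at d u x L"
  unfolding local_lipschitz_at_def by (auto intro!: exI[of _ 1] ext_lipschitz_enn2real)

lemma LIP_le_lipschitz: "ext_lipschitz d u L \<Longrightarrow> LIP d u x \<le> L"
  unfolding LIP_def using Lip_a_le[OF ext_lipschitz_local]
  by (auto simp: ext_lipschitz_def intro!: enn2real_leI)

lemma Lip_a_eq_LIP: "ext_lipschitz d u L \<Longrightarrow> Lip_a d u x = ennreal (LIP d u x)"
  using Lip_a_le[OF ext_lipschitz_local, of u L x]
  by (auto simp: LIP_def ext_lipschitz_def ennreal_enn2real_if top_unique)

lemma local_lipschitz_LIP: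
  assumes "ext_lipschitz d u L" "LIP d u x < c"
  shows "local_lipschitz_at d u x c"
  using assms by (intro Lip_a_less_imp) (simp add: Lip_a_eq_LIP ennreal_less_iff)

lemma LIP_leI:
  assumes "\<And>e. e > 0 \<Longrightarrow> local_lipschitz_at d u x (c + e)" "0 \<le> c"
  shows "LIP d u x \<le> c"
proof (rule field_le_epsilon)
  fix e :: real assume "e > 0"
  then have "Lip_a d u x \<le> ennreal (c + e)" using assms by (intro Lip_a_le) auto
  then show "LIP d u x \<le> c + e" unfolding LIP_def using \<open>e > 0\<close> assms(2) by (intro enn2real_leI) auto
qed

lemma ext_lipschitz_near:
  assumes "ext_lipschitz d u L" "e > 0"
  obtains r where "r > 0" "\<And>y. d y x < ennreal r \<Longrightarrow> \<bar>u y - u x\<bar> < e"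
proof
  have L: "0 \<le> L" using assms(1) by (simp add: ext_lipschitz_def)
  show "e / (L + 1) > 0" using L assms by simp
  fix y assume y: "d y x < ennreal (e / (L + 1))"
  then have "\<bar>u y - u x\<bar> \<le> L * enn2real (d y x)"
    using L assms by (intro ext_lipschitz_enn2real[OF assms(1) y]) auto
  also have "\<dots> \<le> L * (e / (L + 1))"
    using y L assms(2) by (intro mult_left_mono enn2real_leI) auto
  also have "\<dots> < e" using L assms by (simp add: field_simps)
  finally show "\<bar>u y - u x\<bar> < e" .
qed

text \<open>All chain and Leibniz rules below are instances of this one.\<close>

lemma LIP_chain:
  assumes u: "ext_lipschitz d u K1" and v: "ext_lipschitz d v K2" and w: "ext_lipschitz d w K3"
    and nn: "0 \<le> A" "0 \<le> B" "0 \<le> C"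
    and h: "\<And>e. e > 0 \<Longrightarrow> \<exists>\<delta>>0. \<forall>y z.
      \<bar>u y - u x\<bar> < \<delta> \<longrightarrow> \<bar>v y - v x\<bar> < \<delta> \<longrightarrow> \<bar>w y - w x\<bar> < \<delta> \<longrightarrow>
      \<bar>u z - u x\<bar> < \<delta> \<longrightarrow> \<bar>v z - v x\<bar> < \<delta> \<longrightarrow> \<bar>w z - w x\<bar> < \<delta> \<longrightarrow>
      \<bar>h y - h z\<bar> \<le> (A + e) * \<bar>u y - u z\<bar> + (B + e) * \<bar>v y - v z\<bar> + (C + e) * \<bar>w y - w z\<bar>"
  shows "LIP d h x \<le> A * LIP d u x + B * LIP d v x + C * LIP d w x"
proof (rule LIP_leI)
  fix \<eta> :: real assume "\<eta> > 0"
  \<comment> \<open>As \<open>e \<le> 1\<close>, the error terms of the expanded products add up to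
    at most \<open>e * T\<close>; the summand 3 absorbs the three squares of
    \<open>e\<close>.\<close>
  define T where "T = A + B + C + LIP d u x + LIP d v x + LIP d w x + 3"
  have "T > 0" using nn LIP_nonneg[of u x] LIP_nonneg[of v x] LIP_nonneg[of w x] unfolding T_def by linarith
  define e where "e = min 1 (\<eta> / T)"
  have e: "0 < e" "e \<le> 1" "e * T \<le> \<eta>"
    using \<open>\<eta> > 0\<close> \<open>T > 0\<close> by (auto simp: e_def min_def field_simps)
  have loc: "local_lipschitz_at d u x (LIP d u x + e)" "local_lipschitz_at d v x (LIP d v x + e)"
     "local_lipschitz_at d w x (LIP d w x + e)"
    using e by (auto intro: local_lipschitz_LIP[OF u] local_lipschitz_LIP[OF v] local_lipschitz_LIP[OF w])
  obtain r1 r2 r3 where r: "r1 > 0" "r2 > 0" "r3 > 0"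
    and lip: "\<And>y z. d y x < ennreal r1 \<Longrightarrow> d z x < ennreal r1 \<Longrightarrow> \<bar>u y - u z\<bar> \<le> (LIP d u x + e) * enn2real (d y z)"
      "\<And>y z. d y x < ennreal r2 \<Longrightarrow> d z x < ennreal r2 \<Longrightarrow> \<bar>v y - v z\<bar> \<le> (LIP d v x + e) * enn2real (d y z)"
      "\<And>y z. d y x < ennreal r3 \<Longrightarrow> d z x < ennreal r3 \<Longrightarrow> \<bar>w y - w z\<bar> \<le> (LIP d w x + e) * enn2real (d y z)"
    using loc unfolding local_lipschitz_at_def by metis
  obtain \<delta> where \<delta>: "\<delta> > 0" and hle: "\<And>y z. \<bar>u y - u x\<bar> < \<delta> \<Longrightarrow> \<bar>v y - v x\<bar> < \<delta> \<Longrightarrow> \<bar>w y - w x\<bar> < \<delta> \<Longrightarrow>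
      \<bar>u z - u x\<bar> < \<delta> \<Longrightarrow> \<bar>v z - v x\<bar> < \<delta> \<Longrightarrow> \<bar>w z - w x\<bar> < \<delta> \<Longrightarrow>
      \<bar>h y - h z\<bar> \<le> (A + e) * \<bar>u y - u z\<bar> + (B + e) * \<bar>v y - v z\<bar> + (C + e) * \<bar>w y - w z\<bar>"
    using h[OF e(1)] by blast
  obtain s1 where s1: "s1 > 0" "\<And>y. d y x < ennreal s1 \<Longrightarrow> \<bar>u y - u x\<bar> < \<delta>"
    using ext_lipschitz_near[OF u \<delta>] by blast
  obtain s2 where s2: "s2 > 0" "\<And>y. d y x < ennreal s2 \<Longrightarrow> \<bar>v y - v x\<bar> < \<delta>"
    using ext_lipschitz_near[OF v \<delta>] by blast
  obtain s3 where s3: "s3 > 0" "\<And>y. d y x < ennreal s3 \<Longrightarrow> \<bar>w y - w x\<bar> < \<delta>"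
    using ext_lipschitz_near[OF w \<delta>] by blast
  define \<rho> where "\<rho> = Min {r1, r2, r3, s1, s2, s3}"
  have \<rho>: "\<rho> > 0" "\<rho> \<le> r1" "\<rho> \<le> r2" "\<rho> \<le> r3" "\<rho> \<le> s1" "\<rho> \<le> s2" "\<rho> \<le> s3"
    using r s1(1) s2(1) s3(1) unfolding \<rho>_def by (auto intro: Min_le)
  have near: "d y x < ennreal t" if "d y x < ennreal \<rho>" "\<rho> \<le> t" for y t
    using that by (auto intro: less_le_trans ennreal_leI)
  show "local_lipschitz_at d h x (A * LIP d u x + B * LIP d v x + C * LIP d w x + \<eta>)"
    unfolding local_lipschitz_at_def
  proof (intro exI[of _ \<rho>] conjI allI impI \<rho>)
    fix y z assume yz: "d y x < ennreal \<rho>" "d z x < ennreal \<rho>"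
    define D where "D = enn2real (d y z)"
    have D: "D \<ge> 0" by (simp add: D_def)
    have "\<bar>h y - h z\<bar> \<le> (A + e) * \<bar>u y - u z\<bar> + (B + e) * \<bar>v y - v z\<bar> + (C + e) * \<bar>w y - w z\<bar>"
      using near[OF yz(1)] near[OF yz(2)] \<rho> by (intro hle s1 s2 s3) auto
    also have "\<dots> \<le> (A + e) * ((LIP d u x + e) * D) + (B + e) * ((LIP d v x + e) * D) + (C + e) * ((LIP d w x + e) * D)"
      unfolding D_def using near[OF yz(1)] near[OF yz(2)] \<rho> e nn
      by (intro add_mono mult_left_mono lip) auto
    also have "\<dots> = (A * LIP d u x + B * LIP d v x + C * LIP d w x +
        e * (A + B + C + LIP d u x + LIP d v x + LIP d w x + 3 * e)) * D"
      by (simp add: algebra_simps)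
    also have "\<dots> \<le> (A * LIP d u x + B * LIP d v x + C * LIP d w x + e * T) * D"
      using e D by (intro mult_right_mono add_left_mono mult_left_mono) (auto simp: T_def)
    also have "\<dots> \<le> (A * LIP d u x + B * LIP d v x + C * LIP d w x + \<eta>) * D"
      using e D by (intro mult_right_mono add_left_mono) auto
    finally show "\<bar>h y - h z\<bar> \<le> (A * LIP d u x + B * LIP d v x + C * LIP d w x + \<eta>) * enn2real (d y z)"
      by (simp add: D_def)
  qed
qed (use nn in simp)

lemma LIP_contraction:
  assumes "ext_lipschitz d u L" "0 \<le> c" "\<And>y z. \<bar>h y - h z\<bar> \<le> c * \<bar>u y - u z\<bar>"
  shows "LIP d h x \<le> c * LIP d u x"
proof -
  \<comment> \<open>A single function is involved, so the other two slots of
    \<open>LIP_chain\<close> repeat it with coefficient 0.\<close>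
  have "LIP d h x \<le> c * LIP d u x + 0 * LIP d u x + 0 * LIP d u x"
  proof (rule LIP_chain[OF assms(1,1,1) assms(2)])
    fix e :: real assume "e > 0"
    then have "\<bar>h y - h z\<bar> \<le> (c + e) * \<bar>u y - u z\<bar> + (0 + e) * \<bar>u y - u z\<bar> + (0 + e) * \<bar>u y - u z\<bar>" for y z
      using assms(3)[of y z] mult_nonneg_nonneg[of e "\<bar>u y - u z\<bar>"] unfolding distrib_right by linarith
    then show "\<exists>\<delta>>0. \<forall>y z.
      \<bar>u y - u x\<bar> < \<delta> \<longrightarrow> \<bar>u y - u x\<bar> < \<delta> \<longrightarrow> \<bar>u y - u x\<bar> < \<delta> \<longrightarrow>
      \<bar>u z - u x\<bar> < \<delta> \<longrightarrow> \<bar>u z - u x\<bar> < \<delta> \<longrightarrow> \<bar>u z - u x\<bar> < \<delta> \<longrightarrow>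
      \<bar>h y - h z\<bar> \<le> (c + e) * \<bar>u y - u z\<bar> + (0 + e) * \<bar>u y - u z\<bar> + (0 + e) * \<bar>u y - u z\<bar>"
      by (intro exI[of _ 1]) auto
  qed auto
  then show ?thesis by simp
qed

lemma LIP_lincomb:
  assumes "ext_lipschitz d u K1" "ext_lipschitz d v K2"
  shows "LIP d (\<lambda>x. a * u x + b * v x) x \<le> \<bar>a\<bar> * LIP d u x + \<bar>b\<bar> * LIP d v x"
proof -
  let ?h = "\<lambda>x. a * u x + b * v x"
  have "LIP d ?h x \<le> \<bar>a\<bar> * LIP d u x + \<bar>b\<bar> * LIP d v x + 0 * LIP d v x"
  proof (rule LIP_chain[OF assms(1,2,2)])
    fix e :: real assume "e > 0"
    have "\<bar>?h y - ?h z\<bar> \<le> (\<bar>a\<bar> + e) * \<bar>u y - u z\<bar> + (\<bar>b\<bar> + e) * \<bar>v y - v z\<bar> + (0 + e) * \<bar>v y - v z\<bar>" for y z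
    proof -
      have "\<bar>?h y - ?h z\<bar> = \<bar>a * (u y - u z) + b * (v y - v z)\<bar>" by (simp add: algebra_simps)
      also have "\<dots> \<le> \<bar>a\<bar> * \<bar>u y - u z\<bar> + \<bar>b\<bar> * \<bar>v y - v z\<bar>"
        by (metis abs_mult abs_triangle_ineq)
      finally show ?thesis
        using \<open>e > 0\<close> mult_nonneg_nonneg[of e "\<bar>u y - u z\<bar>"] mult_nonneg_nonneg[of e "\<bar>v y - v z\<bar>"]
        unfolding distrib_right by linarith
    qed
    then show "\<exists>\<delta>>0. \<forall>y z.
      \<bar>u y - u x\<bar> < \<delta> \<longrightarrow> \<bar>v y - v x\<bar> < \<delta> \<longrightarrow> \<bar>v y - v x\<bar> < \<delta> \<longrightarrow>
      \<bar>u z - u x\<bar> < \<delta> \<longrightarrow> \<bar>v z - v x\<bar> < \<delta> \<longrightarrow> \<bar>v z - v x\<bar> < \<delta> \<longrightarrow>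
      \<bar>?h y - ?h z\<bar> \<le> (\<bar>a\<bar> + e) * \<bar>u y - u z\<bar> + (\<bar>b\<bar> + e) * \<bar>v y - v z\<bar> + (0 + e) * \<bar>v y - v z\<bar>"
      by (intro exI[of _ 1]) auto
  qed auto
  then show ?thesis by simp
qed

lemma LIP_mult:
  assumes "ext_lipschitz d u K1" "ext_lipschitz d v K2"
  shows "LIP d (\<lambda>x. u x * v x) x \<le> \<bar>v x\<bar> * LIP d u x + \<bar>u x\<bar> * LIP d v x"
proof -
  let ?h = "\<lambda>x. u x * v x"
  have "LIP d ?h x \<le> \<bar>v x\<bar> * LIP d u x + \<bar>u x\<bar> * LIP d v x + 0 * LIP d v x"
  proof (rule LIP_chain[OF assms(1,2,2)])
    fix e :: real assume "e > 0"
    have "\<bar>?h y - ?h z\<bar> \<le> (\<bar>v x\<bar> + e) * \<bar>u y - u z\<bar> + (\<bar>u x\<bar> + e) * \<bar>v y - v z\<bar> + (0 + e) * \<bar>v y - v z\<bar>"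
      if "\<bar>v y - v x\<bar> < e" "\<bar>u z - u x\<bar> < e" for y z
    proof -
      have "\<bar>?h y - ?h z\<bar> = \<bar>v y * (u y - u z) + u z * (v y - v z)\<bar>" by (simp add: algebra_simps)
      also have "\<dots> \<le> \<bar>v y\<bar> * \<bar>u y - u z\<bar> + \<bar>u z\<bar> * \<bar>v y - v z\<bar>"
        by (metis abs_mult abs_triangle_ineq)
      also have "\<dots> \<le> (\<bar>v x\<bar> + e) * \<bar>u y - u z\<bar> + (\<bar>u x\<bar> + e) * \<bar>v y - v z\<bar>"
        using that by (intro add_mono mult_right_mono) auto
      finally show ?thesis
        using \<open>e > 0\<close> mult_nonneg_nonneg[of e "\<bar>v y - v z\<bar>"] unfolding add_0 by linarith
    qed
    then show "\<exists>\<delta>>0. \<forall>y z.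
      \<bar>u y - u x\<bar> < \<delta> \<longrightarrow> \<bar>v y - v x\<bar> < \<delta> \<longrightarrow> \<bar>v y - v x\<bar> < \<delta> \<longrightarrow>
      \<bar>u z - u x\<bar> < \<delta> \<longrightarrow> \<bar>v z - v x\<bar> < \<delta> \<longrightarrow> \<bar>v z - v x\<bar> < \<delta> \<longrightarrow>
      \<bar>?h y - ?h z\<bar> \<le> (\<bar>v x\<bar> + e) * \<bar>u y - u z\<bar> + (\<bar>u x\<bar> + e) * \<bar>v y - v z\<bar> + (0 + e) * \<bar>v y - v z\<bar>"
      using \<open>e > 0\<close> by (intro exI[of _ e]) auto
  qed auto
  then show ?thesis by simp
qed

text \<open>Because the weights add up to one, the cut-off \<open>c\<close> is differentiated only
  against \<open>u - v\<close>. When \<open>u\<close> and \<open>v\<close> approximate the same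
  function this term disappears, which is what makes gluing possible.\<close>

lemma LIP_interpolate:
  assumes "ext_lipschitz d u K1" "ext_lipschitz d v K2" "ext_lipschitz d c K3" "0 \<le> c x" "c x \<le> 1"
  shows "LIP d (\<lambda>x. c x * u x + (1 - c x) * v x) x \<le>
    c x * LIP d u x + (1 - c x) * LIP d v x + \<bar>u x - v x\<bar> * LIP d c x"
proof (rule LIP_chain[OF assms(1,2,3)])
  let ?h = "\<lambda>x. c x * u x + (1 - c x) * v x"
  fix e :: real assume "e > 0"
  have "\<bar>?h y - ?h z\<bar> \<le> (c x + e) * \<bar>u y - u z\<bar> + (1 - c x + e) * \<bar>v y - v z\<bar> + (\<bar>u x - v x\<bar> + e) * \<bar>c y - c z\<bar>"
    if "\<bar>c y - c x\<bar> < e/2" "\<bar>u z - u x\<bar> < e/2" "\<bar>v z - v x\<bar> < e/2" for y z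
  proof -
    have "\<bar>?h y - ?h z\<bar> = \<bar>c y * (u y - u z) + (1 - c y) * (v y - v z) + (u z - v z) * (c y - c z)\<bar>"
      by (simp add: algebra_simps)
    also have "\<dots> \<le> \<bar>c y\<bar> * \<bar>u y - u z\<bar> + \<bar>1 - c y\<bar> * \<bar>v y - v z\<bar> + \<bar>u z - v z\<bar> * \<bar>c y - c z\<bar>"
      using abs_triangle_ineq[of "c y * (u y - u z) + (1 - c y) * (v y - v z)" "(u z - v z) * (c y - c z)"]
        abs_triangle_ineq[of "c y * (u y - u z)" "(1 - c y) * (v y - v z)"]
      unfolding abs_mult by linarith
    also have "\<dots> \<le> (c x + e) * \<bar>u y - u z\<bar> + (1 - c x + e) * \<bar>v y - v z\<bar> + (\<bar>u x - v x\<bar> + e) * \<bar>c y - c z\<bar>"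
    proof (intro add_mono mult_right_mono)
      show "\<bar>c y\<bar> \<le> c x + e" "\<bar>1 - c y\<bar> \<le> 1 - c x + e" "\<bar>u z - v z\<bar> \<le> \<bar>u x - v x\<bar> + e"
        using that assms(4,5) by linarith+
    qed auto
    finally show ?thesis .
  qed
  then show "\<exists>\<delta>>0. \<forall>y z.
    \<bar>u y - u x\<bar> < \<delta> \<longrightarrow> \<bar>v y - v x\<bar> < \<delta> \<longrightarrow> \<bar>c y - c x\<bar> < \<delta> \<longrightarrow>
    \<bar>u z - u x\<bar> < \<delta> \<longrightarrow> \<bar>v z - v x\<bar> < \<delta> \<longrightarrow> \<bar>c z - c x\<bar> < \<delta> \<longrightarrow>
    \<bar>?h y - ?h z\<bar> \<le> (c x + e) * \<bar>u y - u z\<bar> + (1 - c x + e) * \<bar>v y - v z\<bar> + (\<bar>u x - v x\<bar> + e) * \<bar>c y - c z\<bar>"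
    using \<open>e > 0\<close> by (intro exI[of _ "e/2"]) auto
qed (use assms in auto)

text \<open>The mean value theorem and continuity of \<open>\<eta>'\<close> give the derivative at
  the point itself as factor; a global Lipschitz constant of \<open>\<eta>\<close> would not detect
  that the slope vanishes where \<open>\<eta>'\<close> does.\<close>

lemma LIP_compose_C1:
  assumes u: "ext_lipschitz d u L"
    and der: "\<And>t. (\<eta> has_real_derivative \<eta>' t) (at t)" and cont: "isCont \<eta>' (u x)"
  shows "LIP d (\<lambda>x. \<eta> (u x)) x \<le> \<bar>\<eta>' (u x)\<bar> * LIP d u x"
proof -
  let ?h = "\<lambda>x. \<eta> (u x)"
  have "LIP d ?h x \<le> \<bar>\<eta>' (u x)\<bar> * LIP d u x + 0 * LIP d u x + 0 * LIP d u x"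
  proof (rule LIP_chain[OF u u u])
    fix e :: real assume "e > 0"
    obtain \<delta> where \<delta>: "\<delta> > 0" "\<And>t. \<bar>t - u x\<bar> < \<delta> \<Longrightarrow> \<bar>\<eta>' t - \<eta>' (u x)\<bar> < e"
      using cont \<open>e > 0\<close> unfolding continuous_at_eps_delta dist_real_def by blast
    have "\<bar>\<eta> s - \<eta> t\<bar> \<le> (\<bar>\<eta>' (u x)\<bar> + e) * \<bar>s - t\<bar>" if "\<bar>s - u x\<bar> < \<delta>" "\<bar>t - u x\<bar> < \<delta>" "s < t" for s t
    proof -
      obtain z where z: "s < z" "z < t" "\<eta> t - \<eta> s = (t - s) * \<eta>' z"
        using MVT2[OF \<open>s < t\<close>, of \<eta> \<eta>'] der by blast
      have "\<bar>z - u x\<bar> < \<delta>" using z that by linarith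
      then have "\<bar>\<eta>' z\<bar> \<le> \<bar>\<eta>' (u x)\<bar> + e" using \<delta>(2)[of z] by linarith
      then show ?thesis using z mult_left_mono[of "\<bar>\<eta>' z\<bar>" "\<bar>\<eta>' (u x)\<bar> + e" "\<bar>s - t\<bar>"]
        by (simp add: abs_minus_commute[of "\<eta> s"] abs_mult mult.commute abs_minus_commute[of s t])
    qed
    note * = this
    have *: "\<bar>\<eta> s - \<eta> t\<bar> \<le> (\<bar>\<eta>' (u x)\<bar> + e) * \<bar>s - t\<bar>" if "\<bar>s - u x\<bar> < \<delta>" "\<bar>t - u x\<bar> < \<delta>" for s t
      using that
    proof (cases s t rule: linorder_cases)
      case greater
      then show ?thesis
        using * that by (metis abs_minus_commute)
    qed (use * in auto)
    have "\<bar>?h y - ?h z\<bar> \<le> (\<bar>\<eta>' (u x)\<bar> + e) * \<bar>u y - u z\<bar> + (0 + e) * \<bar>u y - u z\<bar> + (0 + e) * \<bar>u y - u z\<bar>"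
      if "\<bar>u y - u x\<bar> < \<delta>" "\<bar>u z - u x\<bar> < \<delta>" for y z
      using *[OF that] \<open>e > 0\<close> mult_nonneg_nonneg[of e "\<bar>u y - u z\<bar>"] unfolding add_0 by linarith
    then show "\<exists>\<delta>>0. \<forall>y z.
      \<bar>u y - u x\<bar> < \<delta> \<longrightarrow> \<bar>u y - u x\<bar> < \<delta> \<longrightarrow> \<bar>u y - u x\<bar> < \<delta> \<longrightarrow>
      \<bar>u z - u x\<bar> < \<delta> \<longrightarrow> \<bar>u z - u x\<bar> < \<delta> \<longrightarrow> \<bar>u z - u x\<bar> < \<delta> \<longrightarrow>
      \<bar>?h y - ?h z\<bar> \<le> (\<bar>\<eta>' (u x)\<bar> + e) * \<bar>u y - u z\<bar> + (0 + e) * \<bar>u y - u z\<bar> + (0 + e) * \<bar>u y - u z\<bar>"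
      using \<delta>(1) by (intro exI[of _ \<delta>]) auto
  qed auto
  then show ?thesis by simp
qed

text \<open>A larger distance has smaller balls and larger denominators.\<close>

lemma LIP_antimono:
  assumes "extended_distance d'" "\<And>x y. d x y \<le> d' x y" "ext_lipschitz d u L"
  shows "LIP d' u x \<le> LIP d u x" "ext_lipschitz d' u L"
proof -
  interpret D': ext_dist d' by unfold_locales fact
  show L: "ext_lipschitz d' u L"
    using assms(2,3) unfolding ext_lipschitz_def by (meson mult_left_mono order_trans zero_le)
  show "LIP d' u x \<le> LIP d u x"
  proof (rule D'.LIP_leI)
    fix e :: real assume "e > 0"
    then have "local_lipschitz_at d u x (LIP d u x + e)" by (intro local_lipschitz_LIP[OF assms(3)]) auto
    then obtain r where r: "r > 0" "\<And>y z. d y x < ennreal r \<Longrightarrow> d z x < ennreal r \<Longrightarrow>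
        \<bar>u y - u z\<bar> \<le> (LIP d u x + e) * enn2real (d y z)"
      by (auto simp: local_lipschitz_at_def)
    show "local_lipschitz_at d' u x (LIP d u x + e)"
      unfolding local_lipschitz_at_def
    proof (intro exI[of _ r] conjI allI impI r(1))
      fix y z assume yz: "d' y x < ennreal r" "d' z x < ennreal r"
      then have "\<bar>u y - u z\<bar> \<le> (LIP d u x + e) * enn2real (d y z)"
        using assms(2) by (intro r(2)) (auto intro: le_less_trans)
      also have "\<dots> \<le> (LIP d u x + e) * enn2real (d' y z)"
        using D'.dist_near[OF yz] \<open>e > 0\<close> assms(2)[of y z]
        by (intro mult_left_mono enn2real_mono) (auto, metis ennreal_less_top)
      finally show "\<bar>u y - u z\<bar> \<le> (LIP d u x + e) * enn2real (d' y z)" .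
    qed
  qed simp
qed

end

section \<open>Stability of bounded continuous and bounded Lipschitz functions\<close>

lemma Lip_bI:
  assumes "continuous_on UNIV h" "bounded (range h)" "u \<in> Lip_b d" "v \<in> Lip_b d" "0 \<le> A" "0 \<le> B"
    and "\<And>y z. \<bar>h y - h z\<bar> \<le> A * \<bar>u y - u z\<bar> + B * \<bar>v y - v z\<bar>"
  shows "h \<in> Lip_b d"
proof -
  obtain K L where K: "ext_lipschitz d u K" and L: "ext_lipschitz d v L"
    using assms(3,4) by (auto simp: Lip_b_def)
  have "ext_lipschitz d h (A * K + B * L)"
    unfolding ext_lipschitz_def
  proof (intro conjI allI)
    have KL: "0 \<le> K" "0 \<le> L" using K L by (auto simp: ext_lipschitz_def)
    then show "0 \<le> A * K + B * L" using assms(5,6) by simp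
    fix x y
    have "ennreal \<bar>h x - h y\<bar> \<le> ennreal (A * \<bar>u x - u y\<bar> + B * \<bar>v x - v y\<bar>)"
      by (intro ennreal_leI assms)
    also have "\<dots> = ennreal A * ennreal \<bar>u x - u y\<bar> + ennreal B * ennreal \<bar>v x - v y\<bar>"
      using assms(5,6) by (simp add: ennreal_plus ennreal_mult)
    also have "\<dots> \<le> ennreal A * (ennreal K * d x y) + ennreal B * (ennreal L * d x y)"
      using K L by (intro add_mono mult_left_mono) (auto simp: ext_lipschitz_def)
    also have "\<dots> = ennreal (A * K + B * L) * d x y"
      using assms(5,6) KL by (simp add: ennreal_plus ennreal_mult distrib_right mult.assoc)
    finally show "ennreal \<bar>h x - h y\<bar> \<le> ennreal (A * K + B * L) * d x y" .
  qed
  then show ?thesis using assms(1,2) by (auto simp: Lip_b_def Cb_def)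
qed

lemma Cb_bound:
  assumes "f \<in> Cb"
  obtains C where "0 \<le> C" "\<And>x. \<bar>f x\<bar> \<le> C"
proof -
  from assms obtain C where "\<And>x. \<bar>f x\<bar> \<le> C" by (auto simp: Cb_def bounded_iff)
  moreover have "0 \<le> C" using order_trans[OF abs_ge_zero calculation] .
  ultimately show ?thesis by (rule that[rotated])
qed

lemma CbI: "continuous_on UNIV f \<Longrightarrow> (\<And>x. \<bar>f x\<bar> \<le> C) \<Longrightarrow> f \<in> Cb"
  by (auto simp: Cb_def bounded_iff)

lemma Lip_b_Cb: "f \<in> Lip_b d \<Longrightarrow> f \<in> Cb"
  by (simp add: Lip_b_def)

lemma Cb_continuous: "f \<in> Cb \<Longrightarrow> continuous_on UNIV f"
  by (simp add: Cb_def)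

lemma Lip_b_const: "(\<lambda>x. c) \<in> Lip_b d"
  by (auto simp: Lip_b_def Cb_def ext_lipschitz_def intro!: exI[of _ 0])

lemma Cb_lincomb: "u \<in> Cb \<Longrightarrow> v \<in> Cb \<Longrightarrow> (\<lambda>x. a * u x + b * v x) \<in> Cb"
  unfolding Cb_def
  by (auto intro!: continuous_intros bounded_plus_comp simp: bounded_scaleR_comp[where 'b=real, unfolded real_scaleR_def])

lemma Cb_mult:
  assumes "u \<in> Cb" "v \<in> Cb"
  shows "(\<lambda>x. u x * v x) \<in> Cb"
proof -
  obtain U where U: "0 \<le> U" "\<And>x. \<bar>u x\<bar> \<le> U" using Cb_bound[OF assms(1)] by metis
  obtain V where V: "0 \<le> V" "\<And>x. \<bar>v x\<bar> \<le> V" using Cb_bound[OF assms(2)] by metis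
  show ?thesis
    by (rule CbI[of _ "U * V"])
      (use U V assms in \<open>auto simp: abs_mult Cb_def intro!: mult_mono continuous_intros\<close>)
qed

lemma Cb_compose:
  assumes "u \<in> Cb" "continuous_on UNIV \<eta>"
  shows "(\<lambda>x. \<eta> (u x)) \<in> Cb"
proof -
  obtain C where C: "\<And>x. \<bar>u x\<bar> \<le> C" using assms(1) Cb_bound by metis
  have "compact (\<eta> ` {-C..C})"
    by (intro compact_continuous_image continuous_on_subset[OF assms(2)]) auto
  then have "bounded (range (\<lambda>x. \<eta> (u x)))"
    by (rule bounded_subset[OF compact_imp_bounded]) (use C in \<open>auto simp: abs_le_iff intro!: imageI, smt\<close>)
  then show ?thesis
    using assms by (auto simp: Cb_def intro!: continuous_on_compose2[OF assms(2)])
qed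

lemma Lip_b_lincomb:
  assumes "u \<in> Lip_b d" "v \<in> Lip_b d"
  shows "(\<lambda>x. a * u x + b * v x) \<in> Lip_b d"
proof (rule Lip_bI[OF _ _ assms])
  show "\<bar>a * u y + b * v y - (a * u z + b * v z)\<bar> \<le> \<bar>a\<bar> * \<bar>u y - u z\<bar> + \<bar>b\<bar> * \<bar>v y - v z\<bar>" for y z
    using abs_triangle_ineq[of "a * (u y - u z)" "b * (v y - v z)"] unfolding abs_mult by (simp add: algebra_simps)
qed (use Cb_lincomb[OF Lip_b_Cb[OF assms(1)] Lip_b_Cb[OF assms(2)], of a b] in \<open>auto simp: Cb_def\<close>)

lemma Lip_b_mult:
  assumes "u \<in> Lip_b d" "v \<in> Lip_b d"
  shows "(\<lambda>x. u x * v x) \<in> Lip_b d"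
proof -
  obtain U where U: "0 \<le> U" "\<And>x. \<bar>u x\<bar> \<le> U" using Cb_bound[OF Lip_b_Cb[OF assms(1)]] by metis
  obtain V where V: "0 \<le> V" "\<And>x. \<bar>v x\<bar> \<le> V" using Cb_bound[OF Lip_b_Cb[OF assms(2)]] by metis
  show ?thesis
  proof (rule Lip_bI[OF _ _ assms])
    fix y z
    have "\<bar>u y * v y - u z * v z\<bar> = \<bar>v y * (u y - u z) + u z * (v y - v z)\<bar>" by (simp add: algebra_simps)
    also have "\<dots> \<le> \<bar>v y\<bar> * \<bar>u y - u z\<bar> + \<bar>u z\<bar> * \<bar>v y - v z\<bar>"
      by (metis abs_mult abs_triangle_ineq)
    also have "\<dots> \<le> V * \<bar>u y - u z\<bar> + U * \<bar>v y - v z\<bar>"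
      using U V by (intro add_mono mult_right_mono) auto
    finally show "\<bar>u y * v y - u z * v z\<bar> \<le> V * \<bar>u y - u z\<bar> + U * \<bar>v y - v z\<bar>" .
  qed (use U V Cb_mult[OF Lip_b_Cb[OF assms(1)] Lip_b_Cb[OF assms(2)]] in \<open>auto simp: Cb_def\<close>)
qed

lemma Lip_b_compose:
  assumes "u \<in> Lip_b d" "continuous_on UNIV \<eta>" "0 \<le> L" "\<And>s t. \<bar>\<eta> s - \<eta> t\<bar> \<le> L * \<bar>s - t\<bar>"
  shows "(\<lambda>x. \<eta> (u x)) \<in> Lip_b d"
  by (rule Lip_bI[OF _ _ assms(1,1), of _ L 0])
    (use assms Cb_compose[OF Lip_b_Cb[OF assms(1)] assms(2)] in \<open>auto simp: Cb_def\<close>)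

lemma Cb_max: "u \<in> Cb \<Longrightarrow> v \<in> Cb \<Longrightarrow> (\<lambda>x. max (u x) (v x)) \<in> Cb"
  and Cb_min: "u \<in> Cb \<Longrightarrow> v \<in> Cb \<Longrightarrow> (\<lambda>x. min (u x) (v x)) \<in> Cb"
proof -
  assume uv: "u \<in> Cb" "v \<in> Cb"
  obtain U where U: "0 \<le> U" "\<And>x. \<bar>u x\<bar> \<le> U" using Cb_bound[OF uv(1)] by metis
  obtain V where V: "0 \<le> V" "\<And>x. \<bar>v x\<bar> \<le> V" using Cb_bound[OF uv(2)] by metis
  have "\<bar>max (u x) (v x)\<bar> \<le> U + V" "\<bar>min (u x) (v x)\<bar> \<le> U + V" for x
    using U(2)[of x] V(2)[of x] U(1) V(1) by (auto simp: max_def min_def)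
  then show "(\<lambda>x. max (u x) (v x)) \<in> Cb" "(\<lambda>x. min (u x) (v x)) \<in> Cb"
    using uv by (auto simp: Cb_def intro!: CbI[unfolded Cb_def, simplified] continuous_intros)
qed

lemma Lip_b_max: "u \<in> Lip_b d \<Longrightarrow> v \<in> Lip_b d \<Longrightarrow> (\<lambda>x. max (u x) (v x)) \<in> Lip_b d"
  by (rule Lip_bI[of _ u d v 1 1])
    (use Cb_max[of u v] Lip_b_Cb[of u d] Lip_b_Cb[of v d] in \<open>auto simp: Cb_def max_def\<close>)

lemma Lip_b_min: "u \<in> Lip_b d \<Longrightarrow> v \<in> Lip_b d \<Longrightarrow> (\<lambda>x. min (u x) (v x)) \<in> Lip_b d"
  by (rule Lip_bI[of _ u d v 1 1])
    (use Cb_min[of u v] Lip_b_Cb[of u d] Lip_b_Cb[of v d] in \<open>auto simp: Cb_def min_def\<close>)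

text \<open>\<open>\<phi>\<close> need not be measurable, so the least majorant is found by
  minimizing the integral over measurable majorants below \<open>C\<close>. The infimum
  \<open>g\<close> of a minimizing sequence is such a majorant, and so is its minimum with any other
  one, whose integral cannot be smaller. This shows that the choice in \<open>Lip_a_star\<close> is
  met.\<close>

lemma (in prob_space) essential_majorant_exists:
  fixes \<phi> :: "'a \<Rightarrow> real"
  assumes "\<And>x. 0 \<le> \<phi> x" "\<And>x. \<phi> x \<le> C"
  shows "\<exists>g. g \<in> borel_measurable M \<and> (AE x in M. \<phi> x \<le> g x) \<and>
    (\<forall>h\<in>borel_measurable (completion M). (AE x in M. \<phi> x \<le> h x) \<longrightarrow> (AE x in M. g x \<le> h x))"
proof -
  define H where "H = {h \<in> borel_measurable M. (AE x in M. \<phi> x \<le> h x) \<and> (AE x in M. h x \<le> C)}"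
  have bd: "AE x in M. 0 \<le> h x \<and> h x \<le> C" if "h \<in> H" for h
    using that assms(1) unfolding H_def by (auto elim!: eventually_elim2 intro: order_trans)
  have int: "integrable M h" if "h \<in> H" for h
    by (rule integrable_const_bound[of _ C]) (use bd[OF that] that in \<open>auto simp: H_def\<close>)
  define a where "a = (INF h\<in>H. \<integral>x. h x \<partial>M)"
  have bdd: "bdd_below ((\<lambda>h. \<integral>x. h x \<partial>M) ` H)"
    by (rule bdd_belowI2[of _ 0]) (use bd in \<open>auto intro!: integral_nonneg_AE\<close>)
  have "(\<lambda>x. C) \<in> H" using assms by (auto simp: H_def)
  then have "H \<noteq> {}" by blast
  have "\<exists>h\<in>H. (\<integral>x. h x \<partial>M) < a + 1 / Suc n" for n
    using cINF_less_iff[OF \<open>H \<noteq> {}\<close> bdd, of "a + 1 / Suc n"] by (auto simp: a_def)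
  then obtain h where h: "\<And>n. h n \<in> H" "\<And>n. (\<integral>x. h n x \<partial>M) < a + 1 / Suc n" by metis
  \<comment> \<open>Members of \<open>H\<close> are nonnegative only almost everywhere;
    \<open>max 0\<close> bounds the sequence below at every point, so that the infimum behaves well
    everywhere.\<close>
  define g where "g x = (INF n. max 0 (h n x))" for x
  have bdd_g: "bdd_below (range (\<lambda>n. max 0 (h n x)))" for x by (rule bdd_belowI2[of _ 0]) auto
  have gm: "g \<in> borel_measurable M"
    unfolding g_def using h(1) by (intro borel_measurable_cINF bdd_g borel_measurable_max) (auto simp: H_def)
  have g_le: "AE x in M. \<forall>n. g x \<le> h n x"
    unfolding AE_all_countable
  proof
    fix n
    show "AE x in M. g x \<le> h n x"
      using bd[OF h(1)[of n]]
    proof eventually_elim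
      case (elim x)
      have "g x \<le> max 0 (h n x)" unfolding g_def by (rule cINF_lower[OF bdd_g]) simp
      then show ?case using elim by simp
    qed
  qed
  have g_ge: "AE x in M. \<phi> x \<le> g x"
  proof -
    have "AE x in M. \<forall>n. \<phi> x \<le> h n x" using h(1) by (simp add: AE_all_countable H_def)
    then show ?thesis by eventually_elim (auto simp: g_def intro!: cINF_greatest le_max_iff_disj[THEN iffD2])
  qed
  have gH: "g \<in> H"
    unfolding H_def using gm g_ge g_le bd[OF h(1)[of 0]] by (auto elim!: eventually_elim2 intro: order_trans)
  have "(\<integral>x. g x \<partial>M) \<le> a + 1 / Suc n" for n
  proof -
    have "(\<integral>x. g x \<partial>M) \<le> (\<integral>x. h n x \<partial>M)"
      by (rule integral_mono_AE[OF int[OF gH] int[OF h(1)]]) (use g_le in auto)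
    then show ?thesis using h(2)[of n] by linarith
  qed
  moreover have "(\<lambda>n. a + 1 / Suc n) \<longlonglongrightarrow> a + 0" by (intro tendsto_intros LIMSEQ_Suc lim_1_over_n)
  ultimately have ga: "(\<integral>x. g x \<partial>M) \<le> a" using LIMSEQ_le_const by fastforce
  have "AE x in M. g x \<le> h x"
    if "h \<in> borel_measurable (completion M)" "AE x in M. \<phi> x \<le> h x" for h
  proof -
    \<comment> \<open>Competitors measurable for the completion are replaced by Borel
      representatives.\<close>
    obtain h' where h': "h' \<in> borel_measurable M" "AE x in M. h x = h' x"
      using completion_ex_borel_measurable_real[OF \<open>h \<in> borel_measurable (completion M)\<close>] by auto
    define k where "k x = min (g x) (h' x)" for x
    have "AE x in M. \<phi> x \<le> k x" using that(2) h'(2) g_ge by eventually_elim (auto simp: k_def)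
    moreover have "AE x in M. k x \<le> C" using bd[OF gH] by eventually_elim (auto simp: k_def)
    moreover have "k \<in> borel_measurable M" unfolding k_def using gm h'(1) by measurable
    ultimately have kH: "k \<in> H" by (simp add: H_def)
    then have "a \<le> (\<integral>x. k x \<partial>M)" unfolding a_def by (intro cINF_lower bdd)
    then have "(\<integral>x. g x - k x \<partial>M) \<le> 0" using ga int[OF gH] int[OF kH] by simp
    moreover have nn: "AE x in M. 0 \<le> g x - k x" by (simp add: k_def)
    ultimately have "(\<integral>x. g x - k x \<partial>M) = 0" using integral_nonneg_AE[OF nn] by linarith
    then have "AE x in M. g x - k x = 0"
      using integral_nonneg_eq_0_iff_AE[OF Bochner_Integration.integrable_diff[OF int[OF gH] int[OF kH]] nn] by simp
    then show ?thesis using h'(2) by eventually_elim (auto simp: k_def)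
  qed
  then show ?thesis using gm g_ge by blast
qed

text \<open>Extraction of a finite subcover as an induction principle: \<open>P\<close> holds near
  each point and survives finite unions and passage to subsets.\<close>

lemma compact_local_induct:
  assumes "compact K" and "P {}" and "\<And>A B. P A \<Longrightarrow> P B \<Longrightarrow> P (A \<union> B)" and "\<And>A B. P B \<Longrightarrow> A \<subseteq> B \<Longrightarrow> P A"
    and "\<And>x. x \<in> K \<Longrightarrow> \<exists>U. open U \<and> x \<in> U \<and> P U"
  shows "P K"
proof -
  obtain U where U: "\<And>x. x \<in> K \<Longrightarrow> open (U x) \<and> x \<in> U x \<and> P (U x)" using assms(5) by metis
  obtain C where C: "C \<subseteq> K" "finite C" "K \<subseteq> (\<Union>x\<in>C. U x)"
    using compactE_image[OF assms(1), of K U] U by blast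
  have "P (\<Union>x\<in>C. U x)" using C(2,1) by (induction C) (auto intro: assms(2,3) simp: U)
  then show ?thesis using C(3) assms(4) by blast
qed

section \<open>Extended metric measure spaces\<close>

locale ext_metric_measure =
  fixes d :: "'a::t2_space \<Rightarrow> 'a \<Rightarrow> ennreal" and m :: "'a measure"
  assumes emms: "extended_metric_measure_space d m"

sublocale ext_metric_measure \<subseteq> ext_dist d
  using emms by unfold_locales (simp add: extended_metric_measure_space_def extended_metric_topological_space_def)

sublocale ext_metric_measure \<subseteq> prob_space m
  using emms by (simp add: extended_metric_measure_space_def)

context ext_metric_measure
begin

lemma sets_m [measurable_cong]: "sets m = sets borel"
  using emms by (simp add: extended_metric_measure_space_def Radon_measure_def)

lemma space_m [simp]: "space m = UNIV"
  using sets_eq_imp_space_eq[OF sets_m] by simp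

lemma inner_compact:
  assumes "B \<in> sets m" "e > 0"
  obtains K where "K \<subseteq> B" "compact K" "measure m (B - K) \<le> e"
proof -
  obtain K where "K \<subseteq> B" "compact K" "emeasure m (B - K) \<le> ennreal e"
    using emms assms sets_m ennreal_less_zero_iff
    unfolding extended_metric_measure_space_def Radon_measure_def
    by (metis ennreal_less_zero_iff)
  moreover have "measure m (B - K) \<le> e"
    using calculation(3) assms(2) by (simp add: emeasure_eq_measure)
  ultimately show ?thesis by (intro that)
qed

lemma compact_sets_m: "compact K \<Longrightarrow> K \<in> sets m"
  by (simp add: sets_m compact_imp_closed)

lemma open_sets_m: "open U \<Longrightarrow> U \<in> sets m"
  by (simp add: sets_m)

lemma Cb_measurable: "f \<in> Cb \<Longrightarrow> f \<in> borel_measurable m"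
  by (simp add: Cb_def borel_measurable_continuous_onI cong: measurable_cong_sets[OF sets_m refl])

lemma Cb_L2: "f \<in> Cb \<Longrightarrow> f \<in> L2 m"
  by (metis AE_I2 Cb_bound Cb_measurable L2_bounded)

lemma Lip_b_L2: "f \<in> Lip_b d \<Longrightarrow> f \<in> L2 m"
  by (rule Cb_L2[OF Lip_b_Cb])

text \<open>\<open>u\<close> is the distance to \<open>x\<close> for one of the continuous
  semidistances generating \<open>d\<close>. It is therefore continuous, which \<open>d\<close> in
  one variable need not be, and 1-Lipschitz because the semidistance lies below
  \<open>d\<close>.\<close>

lemma Lip_b_witness:
  assumes "c < d x y"
  obtains u where "u \<in> Lip_b d" "ext_lipschitz d u 1" "\<And>z. 0 \<le> u z" "u x = 0" "c < ennreal (u y)"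
proof -
  have "\<exists>D :: ('a \<Rightarrow> 'a \<Rightarrow> real) set. (\<forall>\<delta>\<in>D. semidistance \<delta> \<and> (\<exists>C. \<forall>x y. \<delta> x y \<le> C) \<and>
       continuous_on UNIV (\<lambda>(x, y). \<delta> x y)) \<and> (\<forall>x y. d x y = (SUP \<delta>\<in>D. ennreal (\<delta> x y)))"
    using emms unfolding extended_metric_measure_space_def extended_metric_topological_space_def
    by (elim conjE)
  then obtain D where D: "\<And>\<delta>. \<delta> \<in> D \<Longrightarrow> semidistance \<delta> \<and> (\<exists>C. \<forall>x y. \<delta> x y \<le> C) \<and>
       continuous_on UNIV (\<lambda>(x, y). \<delta> x y)" and dD: "\<And>x y. d x y = (SUP \<delta>\<in>D. ennreal (\<delta> x y))"
    by (elim exE conjE) (rule that, simp_all)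
  obtain \<delta> where \<delta>: "\<delta> \<in> D" "c < ennreal (\<delta> x y)" using assms unfolding dD less_SUP_iff by auto
  note sd = D[OF \<delta>(1)]
  define u where "u z = \<delta> z x" for z
  have "continuous_on UNIV (\<lambda>z. (z, x))" by (intro continuous_intros)
  then have cont: "continuous_on UNIV u"
    unfolding u_def
    using continuous_on_compose2[of UNIV "\<lambda>(x, y). \<delta> x y" UNIV "\<lambda>z. (z, x)"] sd by auto
  obtain C where C: "\<And>x y. \<delta> x y \<le> C" using sd by blast
  have "u \<in> Cb" by (rule CbI[OF cont, of C]) (use C sd in \<open>auto simp: u_def semidistance_def\<close>)
  moreover have lip: "ext_lipschitz d u 1"
    unfolding ext_lipschitz_def
  proof (intro conjI allI)
    fix y z
    have "\<delta> y x \<le> \<delta> y z + \<delta> z x" "\<delta> z x \<le> \<delta> z y + \<delta> y x" "\<delta> z y = \<delta> y z"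
      using sd unfolding semidistance_def by blast+
    then have "\<bar>u y - u z\<bar> \<le> \<delta> y z" by (auto simp: u_def)
    then have "ennreal \<bar>u y - u z\<bar> \<le> ennreal (\<delta> y z)" by (rule ennreal_leI)
    also have "\<dots> \<le> d y z" unfolding dD by (rule SUP_upper[OF \<delta>(1)])
    finally show "ennreal \<bar>u y - u z\<bar> \<le> ennreal 1 * d y z" by simp
  qed simp
  ultimately have "u \<in> Lip_b d" by (auto simp: Lip_b_def)
  moreover have "0 \<le> u z" "u x = 0" "u y = \<delta> x y" for z
    using sd by (auto simp: u_def semidistance_def)
  ultimately show ?thesis using \<delta>(2) lip by (intro that[of u]) auto
qed

lemma separating_Lip_b:
  assumes "x \<noteq> y"
  obtains g U V where "g \<in> Lip_b d" "\<And>z. 0 \<le> g z" "\<And>z. g z \<le> 1"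
    "open U" "x \<in> U" "\<And>z. z \<in> U \<Longrightarrow> g z = 1" "open V" "y \<in> V" "\<And>z. z \<in> V \<Longrightarrow> g z = 0"
proof -
  have "0 < d x y" using assms dist_eq_0[of x y] by (simp add: zero_less_iff_neq_zero)
  then obtain u where uL: "u \<in> Lip_b d" and u: "\<And>z. 0 \<le> u z" "u x = 0" "0 < ennreal (u y)"
    by (elim Lip_b_witness) (rule that)
  have cont: "continuous_on UNIV u" using uL by (simp add: Lip_b_def Cb_def)
  define a where "a = u y"
  have a: "a > 0" using u by (simp add: a_def)
  \<comment> \<open>Piecewise linear, equal to 1 up to \<open>a/3\<close> and to 0 from
    \<open>2*a/3\<close> on, so that both values are taken on open neighbourhoods of the two
    points.\<close>
  define \<eta> where "\<eta> t = max 0 (min 1 (2 - 3 / a * t))" for t :: real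
  have "(\<lambda>x. \<eta> (u x)) \<in> Lip_b d"
  proof (rule Lip_b_compose[OF uL])
    show "continuous_on UNIV \<eta>" unfolding \<eta>_def by (intro continuous_intros)
    show "\<bar>\<eta> s - \<eta> t\<bar> \<le> 3 / a * \<bar>s - t\<bar>" for s t
    proof -
      have "\<bar>\<eta> s - \<eta> t\<bar> \<le> \<bar>3 / a * s - 3 / a * t\<bar>" unfolding \<eta>_def by linarith
      also have "\<dots> = \<bar>3 / a\<bar> * \<bar>s - t\<bar>" by (simp only: right_diff_distrib[symmetric] abs_mult)
      finally show ?thesis using a by simp
    qed
  qed (use a in simp)
  moreover have "open {z. u z < a/3}" "open {z. 2*a/3 < u z}"
    by (auto intro!: open_Collect_less cont continuous_intros)
  moreover have "u x < a/3" "2*a/3 < u y" using a u by (auto simp: a_def)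
  moreover have "\<eta> (u z) = 1" if "u z < a/3" for z using that a by (auto simp: \<eta>_def field_simps)
  moreover have "\<eta> (u z) = 0" if "2*a/3 < u z" for z using that a by (auto simp: \<eta>_def field_simps)
  ultimately show ?thesis
    by (intro that[of "\<lambda>x. \<eta> (u x)" "{z. u z < a/3}" "{z. 2*a/3 < u z}"]) (auto simp: \<eta>_def)
qed

text \<open>Separation of points is upgraded twice by compactness: finite minima separate a point
  from \<open>K'\<close>, finite maxima then separate \<open>K\<close> from \<open>K'\<close>.
  Finitely many pieces do because the separating functions are constant on neighbourhoods.\<close>

lemma Lip_b_Urysohn:
  assumes "compact K" "compact K'" "K \<inter> K' = {}"
  obtains g where "g \<in> Lip_b d" "\<And>z. 0 \<le> g z" "\<And>z. g z \<le> 1"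
    "\<And>z. z \<in> K \<Longrightarrow> g z = 1" "\<And>z. z \<in> K' \<Longrightarrow> g z = 0"
proof -
  have pt: "\<exists>U. open U \<and> x \<in> U \<and> (\<exists>g\<in>Lip_b d. (\<forall>z. 0 \<le> g z \<and> g z \<le> 1) \<and> (\<forall>z\<in>U. g z = 1) \<and> (\<forall>z\<in>K'. g z = 0))"
    if "x \<in> K" for x
  proof -
    define P where "P W \<longleftrightarrow> (\<exists>U. open U \<and> x \<in> U \<and>
      (\<exists>g\<in>Lip_b d. (\<forall>z. 0 \<le> g z \<and> g z \<le> 1) \<and> (\<forall>z\<in>U. g z = 1) \<and> (\<forall>z\<in>W. g z = 0)))" for W
    have "P K'"
    proof (rule compact_local_induct[OF assms(2)])
      show "P {}" unfolding P_def by (intro exI[of _ UNIV] conjI bexI[of _ "\<lambda>x. 1"]) (auto intro: Lip_b_const)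
      show "P (A \<union> B)" if "P A" "P B" for A B
      proof -
        obtain U g where 1: "open U" "x \<in> U" "g \<in> Lip_b d" "\<forall>z. 0 \<le> g z \<and> g z \<le> 1" "\<forall>z\<in>U. g z = 1" "\<forall>z\<in>A. g z = 0"
          using \<open>P A\<close> unfolding P_def by blast
        obtain V h where 2: "open V" "x \<in> V" "h \<in> Lip_b d" "\<forall>z. 0 \<le> h z \<and> h z \<le> 1" "\<forall>z\<in>V. h z = 1" "\<forall>z\<in>B. h z = 0"
          using \<open>P B\<close> unfolding P_def by blast
        show ?thesis unfolding P_def
          by (intro exI[of _ "U \<inter> V"] conjI bexI[of _ "\<lambda>z. min (g z) (h z)"] open_Int Lip_b_min)
            (use 1 2 in \<open>auto simp: min_def intro: antisym\<close>)
      qed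
      show "P A" if "P B" "A \<subseteq> B" for A B using that unfolding P_def by (meson subsetD)
      show "\<exists>U. open U \<and> y \<in> U \<and> P U" if "y \<in> K'" for y
      proof -
        have "x \<noteq> y" using \<open>x \<in> K\<close> that assms(3) by blast
        then show ?thesis unfolding P_def by (rule separating_Lip_b) (metis (no_types, lifting))
      qed
    qed
    then show ?thesis unfolding P_def .
  qed
  define Q where "Q W \<longleftrightarrow> (\<exists>g\<in>Lip_b d. (\<forall>z. 0 \<le> g z \<and> g z \<le> 1) \<and> (\<forall>z\<in>W. g z = 1) \<and> (\<forall>z\<in>K'. g z = 0))" for W
  have "Q K"
  proof (rule compact_local_induct[OF assms(1)])
    show "Q {}" unfolding Q_def by (intro bexI[of _ "\<lambda>x. 0"]) (auto intro: Lip_b_const)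
    show "Q (A \<union> B)" if "Q A" "Q B" for A B
    proof -
      obtain g where 1: "g \<in> Lip_b d" "\<forall>z. 0 \<le> g z \<and> g z \<le> 1" "\<forall>z\<in>A. g z = 1" "\<forall>z\<in>K'. g z = 0"
        using \<open>Q A\<close> unfolding Q_def by blast
      obtain h where 2: "h \<in> Lip_b d" "\<forall>z. 0 \<le> h z \<and> h z \<le> 1" "\<forall>z\<in>B. h z = 1" "\<forall>z\<in>K'. h z = 0"
        using \<open>Q B\<close> unfolding Q_def by blast
      show ?thesis unfolding Q_def
        by (intro conjI bexI[of _ "\<lambda>z. max (g z) (h z)"] Lip_b_max) (use 1 2 in \<open>auto simp: max_def intro: antisym\<close>)
    qed
    show "Q A" if "Q B" "A \<subseteq> B" for A B using that unfolding Q_def by (meson subsetD)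
    show "\<exists>U. open U \<and> x \<in> U \<and> Q U" if "x \<in> K" for x using pt[OF that] unfolding Q_def .
  qed
  then show ?thesis unfolding Q_def using that by blast
qed

lemma AE_eventually_in:
  assumes "\<And>n. B n \<in> sets m" "\<And>n. measure m (- B n) \<le> (1/2)^n"
  shows "AE x in m. \<forall>\<^sub>F n in sequentially. x \<in> B n"
proof -
  have "AE x in m. \<forall>\<^sub>F n in sequentially. x \<in> space m - (- B n)"
  proof (rule borel_cantelli_AE1)
    show "- B n \<in> sets m" for n using sets.compl_sets[OF assms(1)[of n]] by (simp add: Compl_eq_Diff_UNIV)
    show "emeasure m (- B n) < \<infinity>" for n by (simp add: less_top[symmetric])
    show "summable (\<lambda>n. measure m (- B n))"
      by (rule summable_comparison_test'[OF summable_geometric[of "1/2::real"], of 0]) (use assms(2) in auto)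
  qed
  then show ?thesis by simp
qed

text \<open>A Urysohn function agrees with the indicator on compact sets
  \<open>K \<subseteq> B\<close> and \<open>K' \<subseteq> - B\<close>. Inner regularity of
  \<open>B\<close> and of its complement makes the rest have measure at most \<open>2^-n\<close>,
  and Borel-Cantelli gives convergence almost everywhere.\<close>

lemma Lip_b_approx_indicator:
  assumes "B \<in> sets m"
  obtains g where "\<And>n. g n \<in> Lip_b d" "\<And>n x. 0 \<le> g n x" "\<And>n x. g n x \<le> 1"
    "AE x in m. (\<lambda>n. g n x) \<longlonglongrightarrow> indicator B x"
proof -
  have B': "- B \<in> sets m" using sets.compl_sets[OF assms] by (simp add: Compl_eq_Diff_UNIV)
  have "\<forall>n::nat. \<exists>g K K'. g \<in> Lip_b d \<and> (\<forall>x. 0 \<le> g x \<and> g x \<le> 1) \<and> compact K \<and> compact K' \<and> K \<subseteq> B \<and> K' \<subseteq> - B \<and>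
      measure m (- (K \<union> K')) \<le> (1/2)^n \<and> (\<forall>z\<in>K. g z = 1) \<and> (\<forall>z\<in>K'. g z = 0)"
  proof
    fix n :: nat
    obtain K where K: "K \<subseteq> B" "compact K" "measure m (B - K) \<le> (1/2)^n / 2"
      by (rule inner_compact[OF assms, of "(1/2)^n / 2"]) auto
    obtain K' where K': "K' \<subseteq> - B" "compact K'" "measure m (- B - K') \<le> (1/2)^n / 2"
      by (rule inner_compact[OF B', of "(1/2)^n / 2"]) auto
    obtain g where g: "g \<in> Lip_b d" "\<And>z. 0 \<le> g z" "\<And>z. g z \<le> 1"
      "\<And>z. z \<in> K \<Longrightarrow> g z = 1" "\<And>z. z \<in> K' \<Longrightarrow> g z = 0"
      by (rule Lip_b_Urysohn[OF K(2) K'(2)]) (use K K' in blast)+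
    have "- (K \<union> K') = (B - K) \<union> (- B - K')" using K(1) K'(1) by blast
    then have "measure m (- (K \<union> K')) \<le> measure m (B - K) + measure m (- B - K')"
      using measure_Un_le[of "B - K" m "- B - K'"] assms B' compact_sets_m[OF K(2)] compact_sets_m[OF K'(2)] by auto
    also have "\<dots> \<le> (1/2)^n" using K(3) K'(3) by simp
    finally show "\<exists>g K K'. g \<in> Lip_b d \<and> (\<forall>x. 0 \<le> g x \<and> g x \<le> 1) \<and> compact K \<and> compact K' \<and> K \<subseteq> B \<and> K' \<subseteq> - B \<and>
      measure m (- (K \<union> K')) \<le> (1/2)^n \<and> (\<forall>z\<in>K. g z = 1) \<and> (\<forall>z\<in>K'. g z = 0)"
      using K K' g by (intro exI[of _ g] exI[of _ K] exI[of _ K']) simp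
  qed
  then obtain g K K' where all: "\<forall>n. g n \<in> Lip_b d \<and> (\<forall>x. 0 \<le> g n x \<and> g n x \<le> 1) \<and> compact (K n) \<and> compact (K' n) \<and>
      K n \<subseteq> B \<and> K' n \<subseteq> - B \<and> measure m (- (K n \<union> K' n)) \<le> (1/2)^n \<and> (\<forall>z\<in>K n. g n z = 1) \<and> (\<forall>z\<in>K' n. g n z = 0)"
    unfolding choice_iff by (elim exE) (rule that)
  then have g: "\<And>n. g n \<in> Lip_b d" "\<And>n x. 0 \<le> g n x \<and> g n x \<le> 1"
    and K: "\<And>n. compact (K n) \<and> compact (K' n)" "\<And>n. K n \<subseteq> B" "\<And>n. K' n \<subseteq> - B"
    "\<And>n. measure m (- (K n \<union> K' n)) \<le> (1/2)^n"
    and gK: "\<And>n z. z \<in> K n \<Longrightarrow> g n z = 1" "\<And>n z. z \<in> K' n \<Longrightarrow> g n z = 0"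
    by simp_all
  have "AE x in m. \<forall>\<^sub>F n in sequentially. x \<in> K n \<union> K' n"
    by (rule AE_eventually_in) (use K compact_sets_m in auto)
  then have "AE x in m. (\<lambda>n. g n x) \<longlonglongrightarrow> indicator B x"
  proof eventually_elim
    case (elim x)
    then have "\<forall>\<^sub>F n in sequentially. g n x = indicator B x"
    proof eventually_elim
      case (elim n)
      then show ?case using gK[of x n] K(2,3)[of n] by (auto simp: indicator_def)
    qed
    then show ?case by (rule tendsto_eventually)
  qed
  then show ?thesis using g by (intro that[of g]) auto
qed

lemma Lip_a_star:
  assumes "u \<in> Lip_b d"
  shows Lip_a_star_measurable: "Lip_a_star m d u \<in> borel_measurable m"
    and LIP_le_star: "AE x in m. LIP d u x \<le> Lip_a_star m d u x"
    and Lip_a_star_least: "h \<in> borel_measurable m \<Longrightarrow> AE x in m. LIP d u x \<le> h x \<Longrightarrow> AE x in m. Lip_a_star m d u x \<le> h x"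
proof -
  obtain L where L: "ext_lipschitz d u L" using assms by (auto simp: Lip_b_def)
  have "\<exists>g. g \<in> borel_measurable m \<and> (AE x in m. LIP d u x \<le> g x) \<and>
    (\<forall>h\<in>borel_measurable (completion m). (AE x in m. LIP d u x \<le> h x) \<longrightarrow> (AE x in m. g x \<le> h x))"
    by (rule essential_majorant_exists[of _ L]) (use LIP_le_lipschitz[OF L] in auto)
  from someI_ex[OF this]
  have *: "Lip_a_star m d u \<in> borel_measurable m \<and> (AE x in m. LIP d u x \<le> Lip_a_star m d u x) \<and>
    (\<forall>h\<in>borel_measurable (completion m). (AE x in m. LIP d u x \<le> h x) \<longrightarrow> (AE x in m. Lip_a_star m d u x \<le> h x))"
    unfolding Lip_a_star_def LIP_def .
  then show "Lip_a_star m d u \<in> borel_measurable m" "AE x in m. LIP d u x \<le> Lip_a_star m d u x" by auto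
  show "AE x in m. Lip_a_star m d u x \<le> h x" if "h \<in> borel_measurable m" "AE x in m. LIP d u x \<le> h x"
    using * that measurable_completion by blast
qed

lemma Lip_a_star_nonneg: "u \<in> Lip_b d \<Longrightarrow> AE x in m. 0 \<le> Lip_a_star m d u x"
  using LIP_le_star[of u] by (auto elim!: eventually_mono intro: order_trans[OF LIP_nonneg[of u]])

lemma Lip_a_star_le: "u \<in> Lip_b d \<Longrightarrow> ext_lipschitz d u L \<Longrightarrow> AE x in m. Lip_a_star m d u x \<le> L"
  by (rule Lip_a_star_least) (auto simp: LIP_le_lipschitz)

lemma Lip_a_star_L2:
  assumes "u \<in> Lip_b d"
  shows "Lip_a_star m d u \<in> L2 m"
proof -
  obtain L where L: "ext_lipschitz d u L" using assms by (auto simp: Lip_b_def)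
  have "AE x in m. \<bar>Lip_a_star m d u x\<bar> \<le> L"
    using Lip_a_star_le[OF assms L] Lip_a_star_nonneg[OF assms] by eventually_elim auto
  then show ?thesis by (rule L2_bounded[OF Lip_a_star_measurable[OF assms]])
qed

end

section \<open>Relaxed slopes\<close>

lemma C1_bounded_lipschitz:
  fixes \<eta> :: "real \<Rightarrow> real"
  assumes der: "\<And>t. (\<eta> has_real_derivative \<eta>' t) (at t)" and bd: "\<And>t. \<bar>\<eta>' t\<bar> \<le> C"
  shows "\<bar>\<eta> s - \<eta> t\<bar> \<le> C * \<bar>s - t\<bar>"
proof -
  have *: "\<bar>\<eta> s - \<eta> t\<bar> \<le> C * \<bar>s - t\<bar>" if st: "s < t" for s t
  proof -
    obtain z where z: "\<eta> t - \<eta> s = (t - s) * \<eta>' z" using MVT2[OF st, of \<eta> \<eta>'] der by blast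
    then have "\<bar>\<eta> t - \<eta> s\<bar> = \<bar>\<eta>' z\<bar> * \<bar>t - s\<bar>" by (simp add: abs_mult mult.commute)
    also have "\<dots> \<le> C * \<bar>t - s\<bar>" by (intro mult_right_mono bd) simp
    finally show ?thesis by (simp add: abs_minus_commute)
  qed
  show ?thesis
  proof (cases s t rule: linorder_cases)
    case greater
    then show ?thesis using *[of t s] by (simp add: abs_minus_commute)
  qed (use * in auto)
qed

context ext_metric_measure
begin

abbreviation star :: "('a \<Rightarrow> real) \<Rightarrow> 'a \<Rightarrow> real" where
  "star \<equiv> Lip_a_star m d"

abbreviation slope :: "('a \<Rightarrow> real) \<Rightarrow> 'a \<Rightarrow> real" where
  "slope \<equiv> minimal_relaxed_slope m d"

text \<open>
  Allowing a majorant \<open>v\<close> of \<open>star u\<close> and strong instead of weak convergence makes the set of pairs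
  \<open>(f, G)\<close> convex and closed under \<open>L\<^sup>2\<close> convergence of both components; by Mazur's lemma
  nothing is lost.
\<close>

definition relaxed_pair :: "('a \<Rightarrow> real) \<Rightarrow> ('a \<Rightarrow> real) \<Rightarrow> bool" where
  "relaxed_pair f G \<longleftrightarrow> f \<in> L2 m \<and> G \<in> L2 m \<and>
    (\<forall>e>0. \<exists>u\<in>Lip_b d. \<exists>v\<in>L2 m. sqnorm m (\<lambda>x. u x - f x) < e \<and> sqnorm m (\<lambda>x. v x - G x) < e \<and>
      (AE x in m. star u x \<le> v x))"

lemma relaxed_pair_L2: "relaxed_pair f G \<Longrightarrow> f \<in> L2 m" "relaxed_pair f G \<Longrightarrow> G \<in> L2 m"
  by (auto simp: relaxed_pair_def)

text \<open>With the definition phrased by tolerances instead of sequences, closedness is a triangle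
  inequality rather than a diagonal argument.\<close>

lemma relaxed_pair_closed:
  assumes "\<And>n. relaxed_pair (F n) (H n)" "L2_tendsto m F f" "L2_tendsto m H G"
  shows "relaxed_pair f G"
  unfolding relaxed_pair_def
proof (intro conjI allI impI)
  show L: "f \<in> L2 m" "G \<in> L2 m" using assms by (auto simp: L2_tendsto_iff)
  fix e :: real assume "e > 0"
  then have "\<forall>\<^sub>F n in sequentially. sqnorm m (\<lambda>x. F n x - f x) < e/4"
    "\<forall>\<^sub>F n in sequentially. sqnorm m (\<lambda>x. H n x - G x) < e/4"
    using assms(2,3) by (auto simp: L2_tendsto_iff intro!: order_tendstoD(2))
  then have "\<forall>\<^sub>F n in sequentially. sqnorm m (\<lambda>x. F n x - f x) < e/4 \<and> sqnorm m (\<lambda>x. H n x - G x) < e/4"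
    by eventually_elim simp
  then obtain n where n: "sqnorm m (\<lambda>x. F n x - f x) < e/4" "sqnorm m (\<lambda>x. H n x - G x) < e/4"
    by (auto simp: eventually_sequentially)
  obtain u v where uv: "u \<in> Lip_b d" "v \<in> L2 m" "sqnorm m (\<lambda>x. u x - F n x) < e/4"
     "sqnorm m (\<lambda>x. v x - H n x) < e/4" "AE x in m. star u x \<le> v x"
    using assms(1)[of n] \<open>e > 0\<close> unfolding relaxed_pair_def
    by (elim conjE allE[of _ "e/4"]) (auto intro: that)
  have FH: "F n \<in> L2 m" "H n \<in> L2 m" using relaxed_pair_L2[OF assms(1)] by auto
  have "sqnorm m (\<lambda>x. u x - f x) < e" "sqnorm m (\<lambda>x. v x - G x) < e"
    using sqnorm_diff_triangle[OF Lip_b_L2[OF uv(1)] FH(1) L(1)] sqnorm_diff_triangle[OF uv(2) FH(2) L(2)] n uv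
    by linarith+
  then show "\<exists>u\<in>Lip_b d. \<exists>v\<in>L2 m. sqnorm m (\<lambda>x. u x - f x) < e \<and> sqnorm m (\<lambda>x. v x - G x) < e \<and>
      (AE x in m. star u x \<le> v x)" using uv by blast
qed

lemma relaxed_pair_Lip_b:
  assumes "u \<in> Lip_b d" "v \<in> L2 m" "AE x in m. star u x \<le> v x"
  shows "relaxed_pair u v"
  unfolding relaxed_pair_def
proof (intro conjI allI impI Lip_b_L2[OF assms(1)] assms(2))
  fix e :: real assume "e > 0"
  then show "\<exists>u'\<in>Lip_b d. \<exists>v'\<in>L2 m. sqnorm m (\<lambda>x. u' x - u x) < e \<and> sqnorm m (\<lambda>x. v' x - v x) < e \<and>
      (AE x in m. star u' x \<le> v' x)"
    using assms by - (rule bexI[of _ u], rule bexI[of _ v], auto)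
qed

lemma relaxed_pair_star: "u \<in> Lip_b d \<Longrightarrow> relaxed_pair u (star u)"
  by (rule relaxed_pair_Lip_b) (auto intro: Lip_a_star_L2)

lemma relaxed_pairI_seq:
  assumes "\<And>n. u n \<in> Lip_b d" "\<And>n. AE x in m. star (u n) x \<le> v n x" "L2_tendsto m u f" "L2_tendsto m v G"
  shows "relaxed_pair f G"
  by (rule relaxed_pair_closed[OF _ assms(3,4)], rule relaxed_pair_Lip_b)
    (use assms in \<open>auto simp: L2_tendsto_iff\<close>)

text \<open>Back from tolerances to sequences. Passing to a subsequence adds convergence of
  \<open>u\<close> almost everywhere, on which the chain and product rules rely.\<close>

lemma relaxed_pair_seq:
  assumes "relaxed_pair f G"
  obtains u v where "\<And>n. u n \<in> Lip_b d" "\<And>n. AE x in m. star (u n) x \<le> v n x" "L2_tendsto m u f" "L2_tendsto m v G"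
    "AE x in m. (\<lambda>n. u n x) \<longlonglongrightarrow> f x"
proof -
  have "\<forall>n. \<exists>u v. u \<in> Lip_b d \<and> v \<in> L2 m \<and> sqnorm m (\<lambda>x. u x - f x) < 1 / real (Suc n) \<and>
      sqnorm m (\<lambda>x. v x - G x) < 1 / real (Suc n) \<and> (AE x in m. star u x \<le> v x)"
  proof
    fix n
    have "0 < 1 / real (Suc n)" by simp
    with assms show "\<exists>u v. u \<in> Lip_b d \<and> v \<in> L2 m \<and> sqnorm m (\<lambda>x. u x - f x) < 1 / real (Suc n) \<and>
      sqnorm m (\<lambda>x. v x - G x) < 1 / real (Suc n) \<and> (AE x in m. star u x \<le> v x)"
      unfolding relaxed_pair_def by blast
  qed
  then obtain u v where all: "\<forall>n. u n \<in> Lip_b d \<and> v n \<in> L2 m \<and> sqnorm m (\<lambda>x. u n x - f x) < 1 / real (Suc n) \<and>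
      sqnorm m (\<lambda>x. v n x - G x) < 1 / real (Suc n) \<and> (AE x in m. star (u n) x \<le> v n x)"
    unfolding choice_iff by (elim exE) (rule that)
  have lim: "(\<lambda>n. 1 / real (Suc n)) \<longlonglongrightarrow> 0" by (intro LIMSEQ_Suc lim_1_over_n)
  have L: "f \<in> L2 m" "G \<in> L2 m" using relaxed_pair_L2[OF assms] by auto
  have "(\<lambda>n. sqnorm m (\<lambda>x. u n x - f x)) \<longlonglongrightarrow> 0" "(\<lambda>n. sqnorm m (\<lambda>x. v n x - G x)) \<longlonglongrightarrow> 0"
    by (rule tendsto_0_if_le[OF _ lim]; use all in \<open>simp add: less_imp_le\<close>)+
  then have u: "L2_tendsto m u f" and v: "L2_tendsto m v G"
    using all L by (auto simp: L2_tendsto_iff Lip_b_L2)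
  obtain r where r: "strict_mono r" "AE x in m. (\<lambda>n. u (r n) x) \<longlonglongrightarrow> f x"
    by (rule L2_tendsto_AE_subseq[OF u])
  show ?thesis
    by (rule that[of "\<lambda>n. u (r n)" "\<lambda>n. v (r n)"])
      (use all r L2_tendsto_subseq[OF u r(1)] L2_tendsto_subseq[OF v r(1)] in auto)
qed

lemma relaxed_pair_nonneg:
  assumes "relaxed_pair f G"
  shows "AE x in m. 0 \<le> G x"
proof -
  obtain u v where uv: "\<And>n. u n \<in> Lip_b d" "\<And>n. AE x in m. star (u n) x \<le> v n x" "L2_tendsto m v G"
    by (rule relaxed_pair_seq[OF assms]) (rule that)
  obtain r where r: "AE x in m. (\<lambda>n. v (r n) x) \<longlonglongrightarrow> G x" by (rule L2_tendsto_AE_subseq[OF uv(3)])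
  have "AE x in m. \<forall>n. 0 \<le> v n x"
    unfolding AE_all_countable
  proof
    fix n
    show "AE x in m. 0 \<le> v n x"
      using uv(2)[of n] Lip_a_star_nonneg[OF uv(1)[of n]] by eventually_elim simp
  qed
  with r show ?thesis by eventually_elim (auto intro: LIMSEQ_le_const)
qed

text \<open>The difference \<open>H - G\<close>, nonnegative almost everywhere, is added to every
  approximating majorant \<open>v n\<close>.\<close>

lemma relaxed_pair_mono:
  assumes "relaxed_pair f G" "H \<in> L2 m" "AE x in m. G x \<le> H x"
  shows "relaxed_pair f H"
proof -
  obtain u v where uv: "\<And>n. u n \<in> Lip_b d" "\<And>n. AE x in m. star (u n) x \<le> v n x" "L2_tendsto m u f" "L2_tendsto m v G"
    by (rule relaxed_pair_seq[OF assms(1)]) (rule that)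
  have "L2_tendsto m (\<lambda>n x. v n x + (H x - G x)) (\<lambda>x. G x + (H x - G x))"
    by (intro L2_tendsto_add uv L2_tendsto_const L2_diff assms relaxed_pair_L2[OF assms(1)])
  then have lim: "L2_tendsto m (\<lambda>n x. v n x + (H x - G x)) H" by simp
  show ?thesis
  proof (rule relaxed_pairI_seq[OF uv(1) _ uv(3) lim])
    show "AE x in m. star (u n) x \<le> v n x + (H x - G x)" for n
      using uv(2)[of n] assms(3) by eventually_elim simp
  qed
qed

lemma relaxed_pair_cong:
  assumes "relaxed_pair f G" "g \<in> borel_measurable m" "AE x in m. f x = g x"
  shows "relaxed_pair g G"
proof -
  have gL: "g \<in> L2 m" by (rule L2_cong_AE[OF relaxed_pair_L2(1)[OF assms(1)] assms(2,3)])
  have eq: "sqnorm m (\<lambda>x. u x - f x) = sqnorm m (\<lambda>x. u x - g x)" if "u \<in> Lip_b d" for u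
    by (rule sqnorm_cong_AE)
      (use assms(2,3) L2_measurable[OF Lip_b_L2[OF that]] L2_measurable[OF relaxed_pair_L2(1)[OF assms(1)]] in auto)
  show ?thesis using assms(1) gL unfolding relaxed_pair_def by (simp add: eq cong: bex_cong)
qed

section \<open>Calculus of relaxed pairs\<close>

lemma relaxed_pair_lincomb:
  assumes "relaxed_pair f G" "relaxed_pair g H"
  shows "relaxed_pair (\<lambda>x. a * f x + b * g x) (\<lambda>x. \<bar>a\<bar> * G x + \<bar>b\<bar> * H x)"
proof -
  obtain u v where 1: "\<And>n. u n \<in> Lip_b d" "\<And>n. AE x in m. star (u n) x \<le> v n x" "L2_tendsto m u f" "L2_tendsto m v G"
    by (rule relaxed_pair_seq[OF assms(1)]) (rule that)
  obtain w z where 2: "\<And>n. w n \<in> Lip_b d" "\<And>n. AE x in m. star (w n) x \<le> z n x" "L2_tendsto m w g" "L2_tendsto m z H"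
    by (rule relaxed_pair_seq[OF assms(2)]) (rule that)
  show ?thesis
  proof (rule relaxed_pairI_seq)
    show mem: "(\<lambda>x. a * u n x + b * w n x) \<in> Lip_b d" for n by (intro Lip_b_lincomb 1 2)
    show "L2_tendsto m (\<lambda>n x. a * u n x + b * w n x) (\<lambda>x. a * f x + b * g x)"
      "L2_tendsto m (\<lambda>n x. \<bar>a\<bar> * v n x + \<bar>b\<bar> * z n x) (\<lambda>x. \<bar>a\<bar> * G x + \<bar>b\<bar> * H x)"
      by (intro L2_tendsto_add L2_tendsto_scale 1 2)+
    show "AE x in m. star (\<lambda>x. a * u n x + b * w n x) x \<le> \<bar>a\<bar> * v n x + \<bar>b\<bar> * z n x" for n
    proof (rule Lip_a_star_least[OF mem])
      show "(\<lambda>x. \<bar>a\<bar> * v n x + \<bar>b\<bar> * z n x) \<in> borel_measurable m"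
        by (intro borel_measurable_add borel_measurable_times borel_measurable_const
            L2_tendsto_measurable(1)[OF 1(4)] L2_tendsto_measurable(1)[OF 2(4)])
      obtain K L where K: "ext_lipschitz d (u n) K" and L: "ext_lipschitz d (w n) L"
        using 1(1)[of n] 2(1)[of n] by (auto simp: Lip_b_def)
      show "AE x in m. LIP d (\<lambda>x. a * u n x + b * w n x) x \<le> \<bar>a\<bar> * v n x + \<bar>b\<bar> * z n x"
        using 1(2)[of n] 2(2)[of n] LIP_le_star[OF 1(1)[of n]] LIP_le_star[OF 2(1)[of n]]
      proof eventually_elim
        case (elim x)
        have "LIP d (\<lambda>x. a * u n x + b * w n x) x \<le> \<bar>a\<bar> * LIP d (u n) x + \<bar>b\<bar> * LIP d (w n) x"
          by (rule LIP_lincomb[OF K L])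
        also have "\<dots> \<le> \<bar>a\<bar> * v n x + \<bar>b\<bar> * z n x"
          using elim by (intro add_mono mult_left_mono) auto
        finally show ?case .
      qed
    qed
  qed
qed

lemma relaxed_pair_const: "relaxed_pair (\<lambda>x. c) (\<lambda>x. 0)"
proof (rule relaxed_pair_Lip_b[OF Lip_b_const L2_zero])
  have "ext_lipschitz d (\<lambda>x. c) 0" by (simp add: ext_lipschitz_def)
  then show "AE x in m. star (\<lambda>x. c) x \<le> 0" by (rule Lip_a_star_le[OF Lip_b_const])
qed

lemma lipschitz_continuous:
  fixes \<eta> :: "real \<Rightarrow> real"
  assumes "\<And>s t. \<bar>\<eta> s - \<eta> t\<bar> \<le> c * \<bar>s - t\<bar>" "0 \<le> c"
  shows "continuous_on UNIV \<eta>"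
  using assms by (intro lipschitz_on_continuous_on[of c] lipschitz_onI) (auto simp: dist_real_def)

lemma L2_compose_lipschitz:
  fixes \<eta> :: "real \<Rightarrow> real"
  assumes "f \<in> L2 m" "\<And>s t. \<bar>\<eta> s - \<eta> t\<bar> \<le> c * \<bar>s - t\<bar>" "0 \<le> c"
  shows "(\<lambda>x. \<eta> (f x)) \<in> L2 m"
proof -
  have "\<eta> \<in> borel_measurable borel"
    by (intro borel_measurable_continuous_onI lipschitz_continuous[OF assms(2,3)])
  then have meas: "(\<lambda>x. \<eta> (f x)) \<in> borel_measurable m" using assms(1) by measurable
  have "(\<lambda>x. \<eta> (f x) - \<eta> 0) \<in> L2 m"
    by (rule L2_dominated[OF _ L2_scale[OF assms(1), of c]])
      (use meas assms(2)[of _ 0] assms(3) in \<open>auto simp: abs_mult\<close>)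
  from L2_add[OF this L2_const[of "\<eta> 0"]] show ?thesis by simp
qed

lemma L2_tendsto_compose:
  fixes \<eta> :: "real \<Rightarrow> real"
  assumes "L2_tendsto m F f" "\<And>s t. \<bar>\<eta> s - \<eta> t\<bar> \<le> c * \<bar>s - t\<bar>" "0 \<le> c"
  shows "L2_tendsto m (\<lambda>n x. \<eta> (F n x)) (\<lambda>x. \<eta> (f x))"
proof (rule L2_tendsto_dominated[OF assms(1)])
  show "(\<lambda>x. \<eta> (F n x)) \<in> L2 m" "(\<lambda>x. \<eta> (f x)) \<in> L2 m" for n
    using assms(1) by (auto simp: L2_tendsto_iff intro: L2_compose_lipschitz[OF _ assms(2,3)])
  show "AE x in m. \<bar>\<eta> (F n x) - \<eta> (f x)\<bar> \<le> c * \<bar>F n x - f x\<bar>" for n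
    using assms(2) by simp
qed

lemma relaxed_pair_contraction:
  assumes "relaxed_pair f G" "\<And>s t. \<bar>\<eta> s - \<eta> t\<bar> \<le> c * \<bar>s - t\<bar>" "0 \<le> c"
  shows "relaxed_pair (\<lambda>x. \<eta> (f x)) (\<lambda>x. c * G x)"
proof -
  obtain u v where uv: "\<And>n. u n \<in> Lip_b d" "\<And>n. AE x in m. star (u n) x \<le> v n x" "L2_tendsto m u f" "L2_tendsto m v G"
    by (rule relaxed_pair_seq[OF assms(1)]) (rule that)
  show ?thesis
  proof (rule relaxed_pairI_seq)
    show mem: "(\<lambda>x. \<eta> (u n x)) \<in> Lip_b d" for n
      by (intro Lip_b_compose[OF uv(1) lipschitz_continuous[OF assms(2,3)] assms(3)] assms(2))
    show "L2_tendsto m (\<lambda>n x. \<eta> (u n x)) (\<lambda>x. \<eta> (f x))" by (rule L2_tendsto_compose[OF uv(3) assms(2,3)])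
    show "L2_tendsto m (\<lambda>n x. c * v n x) (\<lambda>x. c * G x)" by (intro L2_tendsto_scale uv)
    show "AE x in m. star (\<lambda>x. \<eta> (u n x)) x \<le> c * v n x" for n
    proof (rule Lip_a_star_least[OF mem])
      show "(\<lambda>x. c * v n x) \<in> borel_measurable m"
        by (intro borel_measurable_times borel_measurable_const L2_tendsto_measurable(1)[OF uv(4)])
      obtain K where K: "ext_lipschitz d (u n) K" using uv(1)[of n] by (auto simp: Lip_b_def)
      show "AE x in m. LIP d (\<lambda>x. \<eta> (u n x)) x \<le> c * v n x"
        using uv(2)[of n] LIP_le_star[OF uv(1)[of n]]
      proof eventually_elim
        case (elim x)
        have "LIP d (\<lambda>x. \<eta> (u n x)) x \<le> c * LIP d (u n) x" by (rule LIP_contraction[OF K assms(3,2)])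
        also have "\<dots> \<le> c * v n x" using elim assms(3) by (intro mult_left_mono) auto
        finally show ?case .
      qed
    qed
  qed
qed

text \<open>The factors \<open>\<bar>\<eta>' (u n x)\<bar>\<close> in front of the majorants are
  bounded and converge almost everywhere, so \<open>L2_tendsto_multiplier\<close> passes to the
  limit.\<close>

lemma relaxed_pair_C1:
  assumes "relaxed_pair f G" and der: "\<And>t. (\<eta> has_real_derivative \<eta>' t) (at t)"
    and cont: "continuous_on UNIV \<eta>'" and bd: "\<And>t. \<bar>\<eta>' t\<bar> \<le> C"
  shows "relaxed_pair (\<lambda>x. \<eta> (f x)) (\<lambda>x. \<bar>\<eta>' (f x)\<bar> * G x)"
proof -
  have C: "0 \<le> C" using order_trans[OF abs_ge_zero bd] .
  note lip = C1_bounded_lipschitz[OF der bd]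
  obtain u v where uv: "\<And>n. u n \<in> Lip_b d" "\<And>n. AE x in m. star (u n) x \<le> v n x" "L2_tendsto m u f" "L2_tendsto m v G"
    "AE x in m. (\<lambda>n. u n x) \<longlonglongrightarrow> f x"
    by (rule relaxed_pair_seq[OF assms(1)]) (rule that)
  note um = L2_tendsto_measurable(1)[OF uv(3)] and fm = L2_tendsto_measurable(2)[OF uv(3)]
    and vm = L2_tendsto_measurable(1)[OF uv(4)]
  have \<eta>m [measurable]: "\<eta>' \<in> borel_measurable borel" by (rule borel_measurable_continuous_onI[OF cont])
  show ?thesis
  proof (rule relaxed_pairI_seq)
    show mem: "(\<lambda>x. \<eta> (u n x)) \<in> Lip_b d" for n
      by (intro Lip_b_compose[OF uv(1) lipschitz_continuous[OF lip C] C] lip)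
    show "L2_tendsto m (\<lambda>n x. \<eta> (u n x)) (\<lambda>x. \<eta> (f x))" by (rule L2_tendsto_compose[OF uv(3) lip C])
    show "L2_tendsto m (\<lambda>n x. \<bar>\<eta>' (u n x)\<bar> * v n x) (\<lambda>x. \<bar>\<eta>' (f x)\<bar> * G x)"
    proof (rule L2_tendsto_multiplier[OF uv(4)])
      show "AE x in m. (\<lambda>n. \<bar>\<eta>' (u n x)\<bar>) \<longlonglongrightarrow> \<bar>\<eta>' (f x)\<bar>"
        using uv(5) by eventually_elim (intro tendsto_rabs continuous_on_tendsto_compose[OF cont], auto)
    qed (use um fm bd in auto)
    show "AE x in m. star (\<lambda>x. \<eta> (u n x)) x \<le> \<bar>\<eta>' (u n x)\<bar> * v n x" for n
    proof (rule Lip_a_star_least[OF mem])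
      show "(\<lambda>x. \<bar>\<eta>' (u n x)\<bar> * v n x) \<in> borel_measurable m" using um[of n] vm[of n] by measurable
      obtain K where K: "ext_lipschitz d (u n) K" using uv(1)[of n] by (auto simp: Lip_b_def)
      show "AE x in m. LIP d (\<lambda>x. \<eta> (u n x)) x \<le> \<bar>\<eta>' (u n x)\<bar> * v n x"
        using uv(2)[of n] LIP_le_star[OF uv(1)[of n]]
      proof eventually_elim
        case (elim x)
        have "LIP d (\<lambda>x. \<eta> (u n x)) x \<le> \<bar>\<eta>' (u n x)\<bar> * LIP d (u n) x"
          by (rule LIP_compose_C1[OF K der]) (use cont in \<open>simp add: continuous_on_eq_continuous_at\<close>)
        also have "\<dots> \<le> \<bar>\<eta>' (u n x)\<bar> * v n x" using elim by (intro mult_left_mono) auto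
        finally show ?case .
      qed
    qed
  qed
qed

lemma clamp_contraction: "\<bar>max (- A) (min A s) - max (- A) (min A t)\<bar> \<le> 1 * \<bar>s - t\<bar>" for s t A :: real
  by (auto simp: max_def min_def)

text \<open>Truncation at level \<open>A\<close> does not increase slopes and only moves
  \<open>u n\<close> closer to \<open>f\<close>. Products of approximations call for such a uniform
  bound.\<close>

lemma relaxed_pair_seq_bounded:
  assumes "relaxed_pair f G" "AE x in m. \<bar>f x\<bar> \<le> A" "0 \<le> A"
  obtains u v where "\<And>n. u n \<in> Lip_b d" "\<And>n. AE x in m. star (u n) x \<le> v n x" "L2_tendsto m u f" "L2_tendsto m v G"
    "AE x in m. (\<lambda>n. u n x) \<longlonglongrightarrow> f x" "\<And>n x. \<bar>u n x\<bar> \<le> A"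
proof -
  obtain u v where uv: "\<And>n. u n \<in> Lip_b d" "\<And>n. AE x in m. star (u n) x \<le> v n x" "L2_tendsto m u f" "L2_tendsto m v G"
    "AE x in m. (\<lambda>n. u n x) \<longlonglongrightarrow> f x"
    by (rule relaxed_pair_seq[OF assms(1)]) (rule that)
  define \<eta> where "\<eta> t = max (- A) (min A t)" for t
  have \<eta>: "\<bar>\<eta> s - \<eta> t\<bar> \<le> 1 * \<bar>s - t\<bar>" for s t unfolding \<eta>_def by (rule clamp_contraction)
  have fL: "f \<in> L2 m" using relaxed_pair_L2[OF assms(1)] by simp
  have \<eta>f: "AE x in m. \<eta> (f x) = f x" using assms(2) by eventually_elim (auto simp: \<eta>_def)
  have mem: "(\<lambda>x. \<eta> (u n x)) \<in> Lip_b d" for n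
    by (rule Lip_b_compose[OF uv(1) lipschitz_continuous[OF \<eta>] _ \<eta>]) auto
  show ?thesis
  proof (rule that[of "\<lambda>n x. \<eta> (u n x)" v])
    show "(\<lambda>x. \<eta> (u n x)) \<in> Lip_b d" for n by (rule mem)
    show "AE x in m. star (\<lambda>x. \<eta> (u n x)) x \<le> v n x" for n
    proof -
      obtain K where K: "ext_lipschitz d (u n) K" using uv(1)[of n] by (auto simp: Lip_b_def)
      have "AE x in m. star (\<lambda>x. \<eta> (u n x)) x \<le> star (u n) x"
      proof (rule Lip_a_star_least[OF mem Lip_a_star_measurable[OF uv(1)]])
        show "AE x in m. LIP d (\<lambda>x. \<eta> (u n x)) x \<le> star (u n) x"
          using LIP_le_star[OF uv(1)[of n]] LIP_contraction[OF K _ \<eta>]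
          by (auto elim!: eventually_mono intro: order_trans)
      qed
      with uv(2)[of n] show ?thesis by eventually_elim simp
    qed
    show "L2_tendsto m (\<lambda>n x. \<eta> (u n x)) f"
    proof (rule L2_tendsto_dominated[OF uv(3) _ fL, of _ 1])
      show "(\<lambda>x. \<eta> (u n x)) \<in> L2 m" for n by (rule Lip_b_L2[OF mem])
      show "AE x in m. \<bar>\<eta> (u n x) - f x\<bar> \<le> 1 * \<bar>u n x - f x\<bar>" for n
        using \<eta>f
      proof eventually_elim
        case (elim x)
        then show ?case using \<eta>[of "u n x" "f x"] by simp
      qed
    qed
    show "AE x in m. (\<lambda>n. \<eta> (u n x)) \<longlonglongrightarrow> f x"
      using uv(5) \<eta>f
    proof eventually_elim
      case (elim x)
      have "(\<lambda>n. \<eta> (u n x)) \<longlonglongrightarrow> \<eta> (f x)" unfolding \<eta>_def by (intro tendsto_intros elim(1))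
      then show ?case using elim(2) by simp
    qed
    show "\<bar>\<eta> (u n x)\<bar> \<le> A" for n x using assms(3) by (auto simp: \<eta>_def)
  qed (rule uv)
qed

lemma relaxed_pair_mult:
  assumes "relaxed_pair f G" "relaxed_pair g H" "AE x in m. \<bar>f x\<bar> \<le> A" "AE x in m. \<bar>g x\<bar> \<le> B" "0 \<le> A" "0 \<le> B"
  shows "relaxed_pair (\<lambda>x. f x * g x) (\<lambda>x. \<bar>g x\<bar> * G x + \<bar>f x\<bar> * H x)"
proof -
  obtain u v where 1: "\<And>n. u n \<in> Lip_b d" "\<And>n. AE x in m. star (u n) x \<le> v n x" "L2_tendsto m u f" "L2_tendsto m v G"
    "AE x in m. (\<lambda>n. u n x) \<longlonglongrightarrow> f x" "\<And>n x. \<bar>u n x\<bar> \<le> A"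
    by (rule relaxed_pair_seq_bounded[OF assms(1,3,5)]) (rule that)
  obtain w z where 2: "\<And>n. w n \<in> Lip_b d" "\<And>n. AE x in m. star (w n) x \<le> z n x" "L2_tendsto m w g" "L2_tendsto m z H"
    "AE x in m. (\<lambda>n. w n x) \<longlonglongrightarrow> g x" "\<And>n x. \<bar>w n x\<bar> \<le> B"
    by (rule relaxed_pair_seq_bounded[OF assms(2,4,6)]) (rule that)
  note um = L2_tendsto_measurable(1)[OF 1(3)] L2_tendsto_measurable(1)[OF 1(4)]
    L2_tendsto_measurable(1)[OF 2(3)] L2_tendsto_measurable(1)[OF 2(4)]
  note fm = L2_tendsto_measurable(2)[OF 1(3)] L2_tendsto_measurable(2)[OF 2(3)]
  have abs1: "AE x in m. (\<lambda>n. \<bar>u n x\<bar>) \<longlonglongrightarrow> \<bar>f x\<bar>" "AE x in m. (\<lambda>n. \<bar>w n x\<bar>) \<longlonglongrightarrow> \<bar>g x\<bar>"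
    by (use 1(5) in eventually_elim, rule tendsto_rabs, assumption)
      (use 2(5) in eventually_elim, rule tendsto_rabs, assumption)
  show ?thesis
  proof (rule relaxed_pairI_seq)
    show mem: "(\<lambda>x. u n x * w n x) \<in> Lip_b d" for n by (intro Lip_b_mult 1 2)
    show "L2_tendsto m (\<lambda>n x. u n x * w n x) (\<lambda>x. f x * g x)"
      by (rule L2_tendsto_multiplier[OF 2(3) _ _ _ 1(5), of A]) (use um fm 1(6) in auto)
    show "L2_tendsto m (\<lambda>n x. \<bar>w n x\<bar> * v n x + \<bar>u n x\<bar> * z n x) (\<lambda>x. \<bar>g x\<bar> * G x + \<bar>f x\<bar> * H x)"
    proof (rule L2_tendsto_add)
      show "L2_tendsto m (\<lambda>n x. \<bar>w n x\<bar> * v n x) (\<lambda>x. \<bar>g x\<bar> * G x)"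
        by (rule L2_tendsto_multiplier[OF 1(4) _ _ _ abs1(2), of B]) (use um fm 2(6) in auto)
      show "L2_tendsto m (\<lambda>n x. \<bar>u n x\<bar> * z n x) (\<lambda>x. \<bar>f x\<bar> * H x)"
        by (rule L2_tendsto_multiplier[OF 2(4) _ _ _ abs1(1), of A]) (use um fm 1(6) in auto)
    qed
    show "AE x in m. star (\<lambda>x. u n x * w n x) x \<le> \<bar>w n x\<bar> * v n x + \<bar>u n x\<bar> * z n x" for n
    proof (rule Lip_a_star_least[OF mem])
      show "(\<lambda>x. \<bar>w n x\<bar> * v n x + \<bar>u n x\<bar> * z n x) \<in> borel_measurable m"
        using um[of n] by measurable
      obtain K L where K: "ext_lipschitz d (u n) K" and L: "ext_lipschitz d (w n) L"
        using 1(1)[of n] 2(1)[of n] by (auto simp: Lip_b_def)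
      show "AE x in m. LIP d (\<lambda>x. u n x * w n x) x \<le> \<bar>w n x\<bar> * v n x + \<bar>u n x\<bar> * z n x"
        using 1(2)[of n] 2(2)[of n] LIP_le_star[OF 1(1)[of n]] LIP_le_star[OF 2(1)[of n]]
      proof eventually_elim
        case (elim x)
        have "LIP d (\<lambda>x. u n x * w n x) x \<le> \<bar>w n x\<bar> * LIP d (u n) x + \<bar>u n x\<bar> * LIP d (w n) x"
          by (rule LIP_mult[OF K L])
        also have "\<dots> \<le> \<bar>w n x\<bar> * v n x + \<bar>u n x\<bar> * z n x"
          using elim by (intro add_mono mult_left_mono) auto
        finally show ?case .
      qed
    qed
  qed
qed

text \<open>Both approximating sequences converge to \<open>f\<close>, so the error
  \<open>\<Lambda> * \<bar>u n x - w n x\<bar>\<close> created by differentiating the cut-off tends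
  to 0 in \<open>L2\<close>.\<close>

lemma relaxed_pair_interpolate:
  assumes "relaxed_pair f G" "relaxed_pair f H" "c \<in> Lip_b d" "\<And>x. 0 \<le> c x" "\<And>x. c x \<le> 1"
  shows "relaxed_pair f (\<lambda>x. c x * G x + (1 - c x) * H x)"
proof -
  obtain u v where 1: "\<And>n. u n \<in> Lip_b d" "\<And>n. AE x in m. star (u n) x \<le> v n x" "L2_tendsto m u f" "L2_tendsto m v G"
    by (rule relaxed_pair_seq[OF assms(1)]) (rule that)
  obtain w z where 2: "\<And>n. w n \<in> Lip_b d" "\<And>n. AE x in m. star (w n) x \<le> z n x" "L2_tendsto m w f" "L2_tendsto m z H"
    by (rule relaxed_pair_seq[OF assms(2)]) (rule that)
  note um = L2_tendsto_measurable(1)[OF 1(3)] L2_tendsto_measurable(1)[OF 1(4)]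
    L2_tendsto_measurable(1)[OF 2(3)] L2_tendsto_measurable(1)[OF 2(4)]
  have cm: "c \<in> borel_measurable m" by (rule L2_measurable[OF Lip_b_L2[OF assms(3)]])
  have fL: "f \<in> L2 m" using relaxed_pair_L2[OF assms(1)] by simp
  obtain \<Lambda> where \<Lambda>: "ext_lipschitz d c \<Lambda>" using assms(3) by (auto simp: Lip_b_def)
  then have \<Lambda>0: "0 \<le> \<Lambda>" by (simp add: ext_lipschitz_def)
  have mult: "L2_tendsto m (\<lambda>n x. c x * F n x + (1 - c x) * F' n x) (\<lambda>x. c x * h x + (1 - c x) * h' x)"
    if "L2_tendsto m F h" "L2_tendsto m F' h'" for F F' h h'
    by (intro L2_tendsto_add L2_tendsto_multiplier[OF that(1), of "\<lambda>n. c" _ 1] L2_tendsto_multiplier[OF that(2), of "\<lambda>n x. 1 - c x" _ 1])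
      (use cm assms in \<open>auto\<close>)
  have diff: "L2_tendsto m (\<lambda>n x. \<Lambda> * \<bar>u n x - w n x\<bar>) (\<lambda>x. 0)"
  proof (rule L2_tendsto_dominated)
    show "L2_tendsto m (\<lambda>n x. u n x + -1 * w n x) (\<lambda>x. f x + -1 * f x)"
      by (intro L2_tendsto_add L2_tendsto_scale 1 2)
    show "(\<lambda>x. \<Lambda> * \<bar>u n x - w n x\<bar>) \<in> L2 m" for n
      using 1(3) 2(3) by (intro L2_scale L2_abs L2_diff) (auto simp: L2_tendsto_iff)
    show "AE x in m. \<bar>\<Lambda> * \<bar>u n x - w n x\<bar> - 0\<bar> \<le> \<Lambda> * \<bar>u n x + -1 * w n x - (f x + -1 * f x)\<bar>" for n
      using \<Lambda>0 by (simp add: abs_mult)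
  qed simp
  show ?thesis
  proof (rule relaxed_pairI_seq)
    show mem: "(\<lambda>x. c x * u n x + (1 - c x) * w n x) \<in> Lip_b d" for n
    proof -
      have "(\<lambda>x. 1 * 1 + (-1) * c x) \<in> Lip_b d" by (rule Lip_b_lincomb[OF Lip_b_const assms(3)])
      then have "(\<lambda>x. 1 * (c x * u n x) + 1 * ((1 - c x) * w n x)) \<in> Lip_b d"
        by (intro Lip_b_lincomb Lip_b_mult 1 2 assms) simp
      then show ?thesis by simp
    qed
    show "L2_tendsto m (\<lambda>n x. c x * u n x + (1 - c x) * w n x) f"
      using mult[OF 1(3) 2(3)] by (simp flip: distrib_right)
    show "L2_tendsto m (\<lambda>n x. (c x * v n x + (1 - c x) * z n x) + \<Lambda> * \<bar>u n x - w n x\<bar>) (\<lambda>x. c x * G x + (1 - c x) * H x)"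
      using L2_tendsto_add[OF mult[OF 1(4) 2(4)] diff] by simp
    show "AE x in m. star (\<lambda>x. c x * u n x + (1 - c x) * w n x) x \<le> (c x * v n x + (1 - c x) * z n x) + \<Lambda> * \<bar>u n x - w n x\<bar>" for n
    proof (rule Lip_a_star_least[OF mem])
      show "(\<lambda>x. (c x * v n x + (1 - c x) * z n x) + \<Lambda> * \<bar>u n x - w n x\<bar>) \<in> borel_measurable m"
        using um[of n] cm by measurable
      obtain K L where K: "ext_lipschitz d (u n) K" and L: "ext_lipschitz d (w n) L"
        using 1(1)[of n] 2(1)[of n] by (auto simp: Lip_b_def)
      show "AE x in m. LIP d (\<lambda>x. c x * u n x + (1 - c x) * w n x) x \<le> (c x * v n x + (1 - c x) * z n x) + \<Lambda> * \<bar>u n x - w n x\<bar>"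
        using 1(2)[of n] 2(2)[of n] LIP_le_star[OF 1(1)[of n]] LIP_le_star[OF 2(1)[of n]]
      proof eventually_elim
        case (elim x)
        have "LIP d (\<lambda>x. c x * u n x + (1 - c x) * w n x) x \<le>
            c x * LIP d (u n) x + (1 - c x) * LIP d (w n) x + \<bar>u n x - w n x\<bar> * LIP d c x"
          by (rule LIP_interpolate[OF K L \<Lambda> assms(4,5)])
        also have "\<dots> \<le> c x * v n x + (1 - c x) * z n x + \<bar>u n x - w n x\<bar> * \<Lambda>"
          using elim assms(4,5)[of x] LIP_le_lipschitz[OF \<Lambda>] by (intro add_mono mult_left_mono) auto
        finally show ?case by (simp add: mult.commute)
      qed
    qed
  qed
qed

lemma relaxed_pair_glue:
  assumes "relaxed_pair f G" "relaxed_pair f H" "B \<in> sets m"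
  shows "relaxed_pair f (\<lambda>x. if x \<in> B then G x else H x)"
proof -
  obtain c where c: "\<And>n. c n \<in> Lip_b d" "\<And>n x. 0 \<le> c n x" "\<And>n x. c n x \<le> 1"
    "AE x in m. (\<lambda>n. c n x) \<longlonglongrightarrow> indicator B x"
    by (rule Lip_b_approx_indicator[OF assms(3)]) (rule that)
  have GH: "G \<in> L2 m" "H \<in> L2 m" "f \<in> L2 m" using assms relaxed_pair_L2 by auto
  have cm: "c n \<in> borel_measurable m" for n by (rule L2_measurable[OF Lip_b_L2[OF c(1)]])
  have im: "(\<lambda>x. indicator B x :: real) \<in> borel_measurable m" using assms(3) by measurable
  have "L2_tendsto m (\<lambda>n x. c n x * G x + (1 - c n x) * H x) (\<lambda>x. indicator B x * G x + (1 - indicator B x) * H x)"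
  proof (rule L2_tendsto_add)
    show "L2_tendsto m (\<lambda>n x. c n x * G x) (\<lambda>x. indicator B x * G x)"
      by (rule L2_tendsto_multiplier[OF L2_tendsto_const[OF GH(1)] cm im _ c(4), of 1]) (use c in auto)
    show "L2_tendsto m (\<lambda>n x. (1 - c n x) * H x) (\<lambda>x. (1 - indicator B x) * H x)"
    proof (rule L2_tendsto_multiplier[OF L2_tendsto_const[OF GH(2)], of _ _ 1])
      show "AE x in m. (\<lambda>n. 1 - c n x) \<longlonglongrightarrow> 1 - indicator B x"
        using c(4) by eventually_elim (intro tendsto_intros)
    qed (use c cm im in auto)
  qed
  then have "relaxed_pair f (\<lambda>x. indicator B x * G x + (1 - indicator B x) * H x)"
    by (rule relaxed_pair_closed[OF relaxed_pair_interpolate[OF assms(1,2) c(1-3)] L2_tendsto_const[OF GH(3)]])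
  moreover have "(\<lambda>x. indicator B x * G x + (1 - indicator B x) * H x) = (\<lambda>x. if x \<in> B then G x else H x)"
    by (auto simp: indicator_def)
  ultimately show ?thesis by simp
qed

lemma relaxed_pair_min:
  assumes "relaxed_pair f G" "relaxed_pair f H"
  shows "relaxed_pair f (\<lambda>x. min (G x) (H x))"
proof -
  have GH: "G \<in> borel_measurable m" "H \<in> borel_measurable m" using assms by (auto dest!: relaxed_pair_L2)
  have "{x \<in> space m. G x \<le> H x} \<in> sets m" by (rule borel_measurable_le[OF GH])
  then have "relaxed_pair f (\<lambda>x. if x \<in> {x \<in> space m. G x \<le> H x} then G x else H x)"
    by (rule relaxed_pair_glue[OF assms])
  moreover have "(\<lambda>x. if x \<in> {x \<in> space m. G x \<le> H x} then G x else H x) = (\<lambda>x. min (G x) (H x))"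
    by auto
  ultimately show ?thesis by simp
qed

subsection \<open>The minimal relaxed slope\<close>

lemma nn_integral_star: "u \<in> Lip_b d \<Longrightarrow> (\<integral>\<^sup>+x. ennreal ((star u x)\<^sup>2) \<partial>m) = ennreal (sqnorm m (star u))"
  by (rule ennreal_sqnorm[symmetric, OF Lip_a_star_L2])

lemma Ch_le_relaxed_pair:
  assumes "relaxed_pair f G"
  shows "Ch m d f \<le> ennreal (sqnorm m G)"
proof -
  obtain u v where uv: "\<And>n. u n \<in> Lip_b d" "\<And>n. AE x in m. star (u n) x \<le> v n x" "L2_tendsto m u f" "L2_tendsto m v G"
    by (rule relaxed_pair_seq[OF assms]) (rule that)
  have "Ch m d f \<le> liminf (\<lambda>n. \<integral>\<^sup>+x. ennreal ((star (u n) x)\<^sup>2) \<partial>m)"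
    unfolding Ch_def by (rule INF_lower) (use uv in auto)
  also have "\<dots> \<le> liminf (\<lambda>n. ennreal (sqnorm m (v n)))"
  proof (intro Liminf_mono always_eventually allI)
    fix n
    have "sqnorm m (star (u n)) \<le> sqnorm m (v n)"
    proof (rule sqnorm_mono)
      show "AE x in m. \<bar>star (u n) x\<bar> \<le> \<bar>v n x\<bar>"
        using uv(2)[of n] Lip_a_star_nonneg[OF uv(1)[of n]] by eventually_elim auto
    qed (use uv(4) Lip_a_star_measurable[OF uv(1)] in \<open>auto simp: L2_tendsto_iff\<close>)
    then show "(\<integral>\<^sup>+x. ennreal ((star (u n) x)\<^sup>2) \<partial>m) \<le> ennreal (sqnorm m (v n))"
      using uv(1) by (simp add: nn_integral_star ennreal_leI)
  qed
  also have "\<dots> = ennreal (sqnorm m G)"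
    by (intro lim_imp_Liminf tendsto_ennrealI sqnorm_tendsto uv) simp
  finally show ?thesis .
qed

lemma Ch_approx:
  assumes "Ch m d f < ennreal b" "e > 0"
  shows "\<exists>u\<in>Lip_b d. sqnorm m (\<lambda>x. u x - f x) < e \<and> sqnorm m (star u) < b"
proof -
  obtain F where F: "\<And>n. F n \<in> Lip_b d" "L2_tendsto m F f"
    and less: "liminf (\<lambda>n. \<integral>\<^sup>+x. ennreal ((star (F n) x)\<^sup>2) \<partial>m) < ennreal b"
    using assms(1) unfolding Ch_def INF_less_iff by blast
  \<comment> \<open>A lower limit below \<open>b\<close> provides only infinitely many good indices;
    these still meet the indices for which \<open>F n\<close> is eventually close to
    \<open>f\<close>.\<close>
  have "\<not> (\<forall>\<^sub>F n in sequentially. ennreal b \<le> (\<integral>\<^sup>+x. ennreal ((star (F n) x)\<^sup>2) \<partial>m))"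
    using less Liminf_bounded[of "ennreal b" _ sequentially] by (auto simp: not_le[symmetric])
  then have "\<exists>\<^sub>F n in sequentially. sqnorm m (star (F n)) < b"
    unfolding not_eventually nn_integral_star[OF F(1)]
    by (rule frequently_elim1) (auto simp: not_le ennreal_less_iff)
  moreover have "\<forall>\<^sub>F n in sequentially. sqnorm m (\<lambda>x. F n x - f x) < e"
    using F(2) assms(2) by (auto simp: L2_tendsto_iff intro!: order_tendstoD(2))
  ultimately have "\<exists>\<^sub>F n in sequentially. sqnorm m (star (F n)) < b \<and> sqnorm m (\<lambda>x. F n x - f x) < e"
    by (rule frequently_rev_mp[OF _ eventually_mono]) auto
  then show ?thesis using F(1) by (auto dest!: frequently_ex)
qed

text \<open>Otherwise functions approaching \<open>f\<close> with energy below \<open>b\<close>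
  would form a competitor in the infimum defining \<open>Ch\<close>. Together with
  \<open>Ch_approx\<close> this describes \<open>Ch\<close> as a lower limit over
  \<open>Lip_b d\<close>, free of sequences.\<close>

lemma Ch_lower_bound:
  assumes "f \<in> L2 m" "ennreal b < Ch m d f"
  shows "\<exists>\<delta>>0. \<forall>u\<in>Lip_b d. sqnorm m (\<lambda>x. u x - f x) < \<delta> \<longrightarrow> b \<le> sqnorm m (star u)"
proof (rule ccontr)
  assume "\<not> ?thesis"
  then have *: "\<exists>u\<in>Lip_b d. sqnorm m (\<lambda>x. u x - f x) < \<delta> \<and> sqnorm m (star u) < b" if "\<delta> > 0" for \<delta>
    using that by (meson not_le)
  have "\<forall>n. \<exists>u. u \<in> Lip_b d \<and> sqnorm m (\<lambda>x. u x - f x) < 1 / real (Suc n) \<and> sqnorm m (star u) < b"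
  proof
    fix n
    show "\<exists>u. u \<in> Lip_b d \<and> sqnorm m (\<lambda>x. u x - f x) < 1 / real (Suc n) \<and> sqnorm m (star u) < b"
      using *[of "1 / real (Suc n)"] by auto
  qed
  then obtain u where u: "\<And>n. u n \<in> Lip_b d" "\<And>n. sqnorm m (\<lambda>x. u n x - f x) < 1 / real (Suc n)" "\<And>n. sqnorm m (star (u n)) < b"
    by metis
  have lim: "(\<lambda>n. 1 / real (Suc n)) \<longlonglongrightarrow> 0" by (intro LIMSEQ_Suc lim_1_over_n)
  have "(\<lambda>n. sqnorm m (\<lambda>x. u n x - f x)) \<longlonglongrightarrow> 0"
    by (rule tendsto_0_if_le[OF _ lim]) (use u in \<open>simp_all add: less_imp_le\<close>)
  then have uf: "L2_tendsto m u f" using u assms by (auto simp: L2_tendsto_iff Lip_b_L2)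
  have "Ch m d f \<le> liminf (\<lambda>n. \<integral>\<^sup>+x. ennreal ((star (u n) x)\<^sup>2) \<partial>m)"
    unfolding Ch_def by (rule INF_lower) (use u uf in auto)
  also have "\<dots> \<le> liminf (\<lambda>n. ennreal b)"
    by (intro Liminf_mono always_eventually allI)
      (use u in \<open>auto simp: nn_integral_star intro!: ennreal_leI intro: less_imp_le\<close>)
  also have "\<dots> = ennreal b" by (simp add: Liminf_const)
  finally show False using assms(2) by simp
qed

text \<open>Midpoints of nearly optimal approximations are again close to \<open>f\<close>, so by
  \<open>Ch_lower_bound\<close> their \<open>star\<close> is not much shorter; it lies below the
  midpoint of the two \<open>star\<close> functions. Uniform convexity then gives strong convergence
  of \<open>star (u n)\<close>.\<close>

lemma Ch_attained:
  assumes "f \<in> L2 m" "Ch m d f < \<infinity>"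
  obtains G where "relaxed_pair f G" "relaxed_slope m d f G" "ennreal (sqnorm m G) = Ch m d f"
proof -
  obtain c where c: "Ch m d f = ennreal c" "0 \<le> c" using assms(2) by (cases "Ch m d f") auto
  have lb: "\<exists>\<delta>>0. \<forall>u\<in>Lip_b d. sqnorm m (\<lambda>x. u x - f x) < \<delta> \<longrightarrow> c - e \<le> sqnorm m (star u)" if "e > 0" for e
  proof (cases "c - e < 0")
    \<comment> \<open>Here \<open>ennreal (c - e)\<close> collapses to 0 and need not lie below
      \<open>Ch\<close>, but squared norms are nonnegative anyway.\<close>
    case True
    then show ?thesis using sqnorm_nonneg[of m] by (intro exI[of _ 1]) (auto intro: order_trans[of _ 0])
  next
    case False
    then show ?thesis using c that by (intro Ch_lower_bound[OF assms(1)]) (simp add: ennreal_less_iff)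
  qed
  have "\<forall>n. \<exists>u. u \<in> Lip_b d \<and> sqnorm m (\<lambda>x. u x - f x) < 1 / real (Suc n) \<and> sqnorm m (star u) < c + 1 / real (Suc n)"
  proof
    fix n
    have "\<exists>u\<in>Lip_b d. sqnorm m (\<lambda>x. u x - f x) < 1 / real (Suc n) \<and> sqnorm m (star u) < c + 1 / real (Suc n)"
      by (rule Ch_approx) (use c in \<open>auto simp: ennreal_less_iff\<close>)
    then show "\<exists>u. u \<in> Lip_b d \<and> sqnorm m (\<lambda>x. u x - f x) < 1 / real (Suc n) \<and> sqnorm m (star u) < c + 1 / real (Suc n)"
      by blast
  qed
  then obtain u where u: "\<And>n. u n \<in> Lip_b d" "\<And>n. sqnorm m (\<lambda>x. u n x - f x) < 1 / real (Suc n)"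
    "\<And>n. sqnorm m (star (u n)) < c + 1 / real (Suc n)"
    by metis
  have lim: "(\<lambda>n. 1 / real (Suc n)) \<longlonglongrightarrow> 0" by (intro LIMSEQ_Suc lim_1_over_n)
  have un: "(\<lambda>n. sqnorm m (\<lambda>x. u n x - f x)) \<longlonglongrightarrow> 0"
    by (rule tendsto_0_if_le[OF _ lim]) (use u in \<open>simp_all add: less_imp_le\<close>)
  then have uf: "L2_tendsto m u f" using u assms by (auto simp: L2_tendsto_iff Lip_b_L2)
  have starL: "star (u n) \<in> L2 m" for n by (rule Lip_a_star_L2[OF u(1)])
  have "(\<lambda>n. sqnorm m (star (u n))) \<longlonglongrightarrow> c"
  proof (rule order_tendstoI)
    fix a assume "a < c"
    then obtain \<delta> where \<delta>: "\<delta> > 0" "\<And>u. u \<in> Lip_b d \<Longrightarrow> sqnorm m (\<lambda>x. u x - f x) < \<delta> \<Longrightarrow> c - (c - a)/2 \<le> sqnorm m (star u)"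
      using lb[of "(c - a)/2"] by auto
    have "\<forall>\<^sub>F n in sequentially. sqnorm m (\<lambda>x. u n x - f x) < \<delta>"
      using un \<delta>(1) by (rule order_tendstoD)
    then show "\<forall>\<^sub>F n in sequentially. a < sqnorm m (star (u n))"
    proof eventually_elim
      case (elim n)
      have "c - (c - a)/2 \<le> sqnorm m (star (u n))" by (rule \<delta>(2)[OF u(1) elim])
      then show ?case using \<open>a < c\<close> by (simp add: field_simps)
    qed
  next
    fix a assume "c < a"
    have "(\<lambda>n. c + 1 / real (Suc n)) \<longlonglongrightarrow> c + 0" by (intro tendsto_intros lim)
    then have "\<forall>\<^sub>F n in sequentially. c + 1 / real (Suc n) < a" by (rule order_tendstoD) (use \<open>c < a\<close> in simp)
    then show "\<forall>\<^sub>F n in sequentially. sqnorm m (star (u n)) < a"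
      by eventually_elim (use u(3) in \<open>auto intro: less_trans\<close>)
  qed
  moreover have "\<exists>k. \<forall>i\<ge>k. \<forall>j\<ge>k. c - e \<le> sqnorm m (\<lambda>x. 1/2 * star (u i) x + 1/2 * star (u j) x)" if "e > 0" for e
  proof -
    obtain \<delta> where \<delta>: "\<delta> > 0" "\<And>u. u \<in> Lip_b d \<Longrightarrow> sqnorm m (\<lambda>x. u x - f x) < \<delta> \<Longrightarrow> c - e \<le> sqnorm m (star u)"
      using lb[OF \<open>e > 0\<close>] by blast
    have "\<forall>\<^sub>F n in sequentially. sqnorm m (\<lambda>x. u n x - f x) < \<delta>"
      using un \<delta>(1) by (rule order_tendstoD)
    then obtain k where k: "\<And>n. n \<ge> k \<Longrightarrow> sqnorm m (\<lambda>x. u n x - f x) < \<delta>"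
      by (auto simp: eventually_sequentially)
    have "c - e \<le> sqnorm m (\<lambda>x. 1/2 * star (u i) x + 1/2 * star (u j) x)" if ij: "i \<ge> k" "j \<ge> k" for i j
    proof -
      let ?w = "\<lambda>x. 1/2 * u i x + 1/2 * u j x"
      have w: "?w \<in> Lip_b d" by (intro Lip_b_lincomb u)
      have "(\<lambda>x. u n x - f x) \<in> L2 m" for n by (intro L2_diff Lip_b_L2 u assms)
      from sqnorm_add_le[OF L2_scale[OF this[of i], of "1/2"] L2_scale[OF this[of j], of "1/2"]]
      have "sqnorm m (\<lambda>x. 1/2 * (u i x - f x) + 1/2 * (u j x - f x)) < \<delta>"
        using k[OF ij(1)] k[OF ij(2)] unfolding sqnorm_scale by (simp add: power2_eq_square)
      moreover have "(\<lambda>x. 1/2 * (u i x - f x) + 1/2 * (u j x - f x)) = (\<lambda>x. ?w x - f x)"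
        by (auto simp: field_simps)
      ultimately have "sqnorm m (\<lambda>x. ?w x - f x) < \<delta>" by simp
      then have "c - e \<le> sqnorm m (star ?w)" by (rule \<delta>(2)[OF w])
      also have "\<dots> \<le> sqnorm m (\<lambda>x. 1/2 * star (u i) x + 1/2 * star (u j) x)"
      proof (rule sqnorm_mono)
        show "star ?w \<in> borel_measurable m" by (rule Lip_a_star_measurable[OF w])
        show S: "(\<lambda>x. 1/2 * star (u i) x + 1/2 * star (u j) x) \<in> L2 m" by (intro L2_lincomb starL)
        obtain K L where K: "ext_lipschitz d (u i) K" and L: "ext_lipschitz d (u j) L"
          using u(1)[of i] u(1)[of j] by (auto simp: Lip_b_def)
        have "AE x in m. star ?w x \<le> 1/2 * star (u i) x + 1/2 * star (u j) x"
        proof (rule Lip_a_star_least[OF w L2_measurable[OF S]])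
          show "AE x in m. LIP d ?w x \<le> 1/2 * star (u i) x + 1/2 * star (u j) x"
            using LIP_le_star[OF u(1)[of i]] LIP_le_star[OF u(1)[of j]]
          proof eventually_elim
            case (elim x)
            have "LIP d ?w x \<le> \<bar>1/2\<bar> * LIP d (u i) x + \<bar>1/2\<bar> * LIP d (u j) x"
              by (rule LIP_lincomb[OF K L])
            then show ?case using elim by simp
          qed
        qed
        then show "AE x in m. \<bar>star ?w x\<bar> \<le> \<bar>1/2 * star (u i) x + 1/2 * star (u j) x\<bar>"
          using Lip_a_star_nonneg[OF w] by eventually_elim auto
      qed
      finally show ?thesis .
    qed
    then show ?thesis by blast
  qed
  ultimately obtain G where G: "L2_tendsto m (\<lambda>n. star (u n)) G" "sqnorm m G = c"
    by (rule L2_minimizing_converges[of "\<lambda>n. star (u n)" m c, OF starL]) blast+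
  have GL: "G \<in> L2 m" using G by (simp add: L2_tendsto_iff)
  show ?thesis
  proof (rule that)
    show "relaxed_pair f G" by (rule relaxed_pairI_seq[OF u(1) _ uf G(1)]) simp
    have "weak_L2_limit_point m (\<lambda>n. star (u n)) G"
      unfolding weak_L2_limit_point_def using starL GL L2_tendsto_inner[OF G(1)]
      by (auto intro!: exI[of _ "\<lambda>n. n"] strict_monoI)
    then show "relaxed_slope m d f G"
      unfolding relaxed_slope_def using GL u(1) uf by (auto intro!: exI[of _ u] exI[of _ G])
    show "ennreal (sqnorm m G) = Ch m d f" using G(2) c by simp
  qed
qed

text \<open>For each tolerance, Mazur's lemma is applied to the set of majorants belonging to
  functions near \<open>f\<close>. Convexity of the asymptotic Lipschitz constant and of the ball
  around \<open>f\<close> makes this set convex, so improving the convergence of the majorants does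
  not spoil the approximation of \<open>f\<close>.\<close>

lemma relaxed_slope_imp_pair:
  assumes "relaxed_slope m d f H"
  shows "relaxed_pair f H"
proof -
  obtain F g where H: "H \<in> L2 m" and F: "\<And>n. F n \<in> Lip_b d" "L2_tendsto m F f"
    and w: "weak_L2_limit_point m (\<lambda>n. star (F n)) g" and gH: "AE x in m. g x \<le> H x"
    using assms unfolding relaxed_slope_def by blast
  obtain r where gL: "g \<in> L2 m" and r: "strict_mono r"
    and lim: "\<And>h. h \<in> L2 m \<Longrightarrow> (\<lambda>n. \<integral>x. star (F (r n)) x * h x \<partial>m) \<longlonglongrightarrow> (\<integral>x. g x * h x \<partial>m)"
    using w unfolding weak_L2_limit_point_def by blast
  have fL: "f \<in> L2 m" using F by (simp add: L2_tendsto_iff)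
  have "relaxed_pair f g"
    unfolding relaxed_pair_def
  proof (intro conjI allI impI fL gL)
    fix e :: real assume "e > 0"
    define C where "C = {v \<in> L2 m. \<exists>u\<in>Lip_b d. sqnorm m (\<lambda>x. u x - f x) < e \<and> (AE x in m. star u x \<le> v x)}"
    have "\<forall>\<^sub>F n in sequentially. sqnorm m (\<lambda>x. F (r n) x - f x) < e"
      using L2_tendsto_subseq[OF F(2) r] \<open>e > 0\<close> by (auto simp: L2_tendsto_iff intro!: order_tendstoD(2))
    then obtain k where k: "\<And>n. n \<ge> k \<Longrightarrow> sqnorm m (\<lambda>x. F (r n) x - f x) < e" by (auto simp: eventually_sequentially)
    have "\<exists>v\<in>C. sqnorm m (\<lambda>x. v x - g x) < e"
    proof (rule L2_Mazur[OF _ _ _ gL _ \<open>e > 0\<close>])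
      show "C \<subseteq> L2 m" by (auto simp: C_def)
      show "star (F (r (n + k))) \<in> C" for n
        using k[of "n + k"] F(1) by (auto simp: C_def intro!: bexI[of _ "F (r (n + k))"] Lip_a_star_L2)
      show "(\<lambda>n. \<integral>x. star (F (r (n + k))) x * h x \<partial>m) \<longlonglongrightarrow> (\<integral>x. g x * h x \<partial>m)" if "h \<in> L2 m" for h
        by (rule LIMSEQ_ignore_initial_segment[OF lim[OF that]])
      fix v w and t :: real assume vw: "v \<in> C" "w \<in> C" and t: "0 \<le> t" "t \<le> 1"
      obtain p where p: "p \<in> Lip_b d" "sqnorm m (\<lambda>x. p x - f x) < e" "AE x in m. star p x \<le> v x"
        using vw by (auto simp: C_def)
      obtain q where q: "q \<in> Lip_b d" "sqnorm m (\<lambda>x. q x - f x) < e" "AE x in m. star q x \<le> w x"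
        using vw by (auto simp: C_def)
      have vwL: "v \<in> L2 m" "w \<in> L2 m" using vw by (auto simp: C_def)
      let ?s = "\<lambda>x. (1 - t) * p x + t * q x"
      have s: "?s \<in> Lip_b d" by (intro Lip_b_lincomb p q)
      have P: "(\<lambda>x. p x - f x) \<in> L2 m" and Q: "(\<lambda>x. q x - f x) \<in> L2 m"
        by (intro L2_diff Lip_b_L2 p q fL)+
      have "sqnorm m (\<lambda>x. ?s x - f x) = sqnorm m (\<lambda>x. (1 - t) * (p x - f x) + t * (q x - f x))"
        by (simp add: algebra_simps)
      also have "\<dots> \<le> (1 - t) * sqnorm m (\<lambda>x. p x - f x) + t * sqnorm m (\<lambda>x. q x - f x)"
      proof -
        have "sqnorm m (\<lambda>x. (1 - t) * (p x - f x) + t * (q x - f x)) + (t * (1 - t)) * sqnorm m (\<lambda>x. 1 * (p x - f x) + (-1) * (q x - f x)) =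
          (1 - t) * sqnorm m (\<lambda>x. p x - f x) + t * sqnorm m (\<lambda>x. q x - f x)"
          unfolding sqnorm_lincomb[OF P Q] by (simp add: power2_eq_square algebra_simps)
        moreover have "0 \<le> (t * (1 - t)) * sqnorm m (\<lambda>x. 1 * (p x - f x) + (-1) * (q x - f x))"
          using t by simp
        ultimately show ?thesis by linarith
      qed
      also have "\<dots> < e" using p(2) q(2) t by (intro convex_bound_lt) auto
      finally have near: "sqnorm m (\<lambda>x. ?s x - f x) < e" .
      have wm: "(\<lambda>x. (1 - t) * v x + t * w x) \<in> L2 m" by (intro L2_lincomb vwL)
      obtain K L where K: "ext_lipschitz d p K" and L: "ext_lipschitz d q L"
        using p(1) q(1) by (auto simp: Lip_b_def)
      have "AE x in m. star ?s x \<le> (1 - t) * v x + t * w x"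
      proof (rule Lip_a_star_least[OF s L2_measurable[OF wm]])
        show "AE x in m. LIP d ?s x \<le> (1 - t) * v x + t * w x"
          using LIP_le_star[OF p(1)] LIP_le_star[OF q(1)] p(3) q(3)
        proof eventually_elim
          case (elim x)
          have "LIP d ?s x \<le> (1 - t) * LIP d p x + t * LIP d q x"
            using LIP_lincomb[OF K L, of "1 - t" t x] t by simp
          also have "\<dots> \<le> (1 - t) * v x + t * w x" using elim t by (intro add_mono mult_left_mono) auto
          finally show ?case .
        qed
      qed
      then show "(\<lambda>x. (1 - t) * v x + t * w x) \<in> C" using near s wm by (auto simp: C_def)
    qed
    then show "\<exists>u\<in>Lip_b d. \<exists>v\<in>L2 m. sqnorm m (\<lambda>x. u x - f x) < e \<and> sqnorm m (\<lambda>x. v x - g x) < e \<and>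
      (AE x in m. star u x \<le> v x)" by (auto simp: C_def)
  qed
  then show ?thesis by (rule relaxed_pair_mono[OF _ H gH])
qed

lemma Ch_domain_iff: "f \<in> Ch_domain m d \<longleftrightarrow> (\<exists>G. relaxed_pair f G)"
proof
  assume "f \<in> Ch_domain m d"
  then show "\<exists>G. relaxed_pair f G" by (auto simp: Ch_domain_def elim: Ch_attained)
next
  assume "\<exists>G. relaxed_pair f G"
  then obtain G where "relaxed_pair f G" by blast
  then show "f \<in> Ch_domain m d"
    using Ch_le_relaxed_pair[of f G] relaxed_pair_L2[of f G] by (auto simp: Ch_domain_def intro: le_less_trans)
qed

text \<open>Every relaxed slope belongs to a pair and thus has squared norm at least
  \<open>Ch\<close>, a value reached by the relaxed slope of \<open>Ch_attained\<close>. Hence the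
  choice in \<open>minimal_relaxed_slope\<close> is met.\<close>

lemma slope:
  assumes "f \<in> Ch_domain m d"
  shows relaxed_pair_slope: "relaxed_pair f (slope f)"
    and sqnorm_slope: "ennreal (sqnorm m (slope f)) = Ch m d f"
proof -
  obtain G where G: "relaxed_pair f G" "relaxed_slope m d f G" "ennreal (sqnorm m G) = Ch m d f"
    using assms by (auto simp: Ch_domain_def elim: Ch_attained)
  have "\<exists>G. relaxed_slope m d f G \<and>
      (\<forall>H. relaxed_slope m d f H \<longrightarrow> (\<integral>x. (G x)\<^sup>2 \<partial>m) \<le> (\<integral>x. (H x)\<^sup>2 \<partial>m))"
  proof (intro exI[of _ G] conjI allI impI G)
    fix H assume "relaxed_slope m d f H"
    then have "ennreal (sqnorm m G) \<le> ennreal (sqnorm m H)"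
      unfolding G(3) by (intro Ch_le_relaxed_pair relaxed_slope_imp_pair)
    then show "(\<integral>x. (G x)\<^sup>2 \<partial>m) \<le> (\<integral>x. (H x)\<^sup>2 \<partial>m)" by (simp add: sqnorm_def)
  qed
  from someI_ex[OF this] have s: "relaxed_slope m d f (slope f)"
    and min: "\<And>H. relaxed_slope m d f H \<Longrightarrow> sqnorm m (slope f) \<le> sqnorm m H"
    unfolding minimal_relaxed_slope_def sqnorm_def by auto
  show *: "relaxed_pair f (slope f)" by (rule relaxed_slope_imp_pair[OF s])
  show "ennreal (sqnorm m (slope f)) = Ch m d f"
    using Ch_le_relaxed_pair[OF *] min[OF G(2)] G(3)[symmetric] by (auto intro: antisym ennreal_leI)
qed

lemma slope_L2: "f \<in> Ch_domain m d \<Longrightarrow> slope f \<in> L2 m"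
  using relaxed_pair_slope relaxed_pair_L2 by blast

lemma slope_nonneg: "f \<in> Ch_domain m d \<Longrightarrow> AE x in m. 0 \<le> slope f x"
  using relaxed_pair_slope relaxed_pair_nonneg by blast

lemma relaxed_pair_domain: "relaxed_pair f G \<Longrightarrow> f \<in> Ch_domain m d"
  using Ch_domain_iff by blast

text \<open>\<open>min (slope f) G\<close> again belongs to a pair, so its norm cannot drop below
  that of \<open>slope f\<close>; being pointwise no larger, it equals \<open>slope f\<close> almost
  everywhere.\<close>

lemma slope_le:
  assumes "relaxed_pair f G"
  shows "AE x in m. slope f x \<le> G x"
proof -
  have f: "f \<in> Ch_domain m d" by (rule relaxed_pair_domain[OF assms])
  define k where "k x = min (slope f x) (G x)" for x
  have k: "relaxed_pair f k" unfolding k_def by (rule relaxed_pair_min[OF relaxed_pair_slope[OF f] assms])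
  have kL: "k \<in> L2 m" and sL: "slope f \<in> L2 m" using relaxed_pair_L2[OF k] slope_L2[OF f] by auto
  have "ennreal (sqnorm m (slope f)) \<le> ennreal (sqnorm m k)"
    unfolding sqnorm_slope[OF f] by (rule Ch_le_relaxed_pair[OF k])
  then have le: "sqnorm m (slope f) \<le> sqnorm m k" by simp
  have nn: "AE x in m. 0 \<le> (slope f x)\<^sup>2 - (k x)\<^sup>2"
    using relaxed_pair_nonneg[OF k] by eventually_elim (auto simp: k_def intro: power_mono)
  have int: "integrable m (\<lambda>x. (slope f x)\<^sup>2 - (k x)\<^sup>2)" using kL sL by (simp add: L2_integrable_sq)
  have "(\<integral>x. (slope f x)\<^sup>2 - (k x)\<^sup>2 \<partial>m) \<le> 0"
    using le kL sL by (simp add: sqnorm_def L2_integrable_sq)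
  then have "(\<integral>x. (slope f x)\<^sup>2 - (k x)\<^sup>2 \<partial>m) = 0" using integral_nonneg_AE[OF nn] by linarith
  then have "AE x in m. (slope f x)\<^sup>2 - (k x)\<^sup>2 = 0"
    using integral_nonneg_eq_0_iff_AE[OF int nn] by simp
  then show ?thesis
    using slope_nonneg[OF f] relaxed_pair_nonneg[OF k]
  proof eventually_elim
    case (elim x)
    then have "slope f x = k x" by (auto simp: power2_eq_iff_nonneg)
    then show ?case by (auto simp: k_def min_def split: if_splits)
  qed
qed

subsection \<open>Calculus of minimal relaxed slopes\<close>

abbreviation V :: "('a \<Rightarrow> real) set" where
  "V \<equiv> Ch_domain m d"

lemma V_L2: "f \<in> V \<Longrightarrow> f \<in> L2 m"
  by (simp add: Ch_domain_def)

lemma V_measurable: "f \<in> V \<Longrightarrow> f \<in> borel_measurable m"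
  by (simp add: V_L2 L2_measurable)

lemma slope_measurable: "f \<in> V \<Longrightarrow> slope f \<in> borel_measurable m"
  by (simp add: slope_L2 L2_measurable)

lemma V_lincomb: "f \<in> V \<Longrightarrow> g \<in> V \<Longrightarrow> (\<lambda>x. a * f x + b * g x) \<in> V"
  by (rule relaxed_pair_domain[OF relaxed_pair_lincomb[OF relaxed_pair_slope relaxed_pair_slope]])

lemma V_const: "(\<lambda>x. c) \<in> V"
  by (rule relaxed_pair_domain[OF relaxed_pair_const])

lemma V_add: "f \<in> V \<Longrightarrow> g \<in> V \<Longrightarrow> (\<lambda>x. f x + g x) \<in> V"
  using V_lincomb[of f g 1 1] by simp

lemma V_diff: "f \<in> V \<Longrightarrow> g \<in> V \<Longrightarrow> (\<lambda>x. f x - g x) \<in> V"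
  using V_lincomb[of f g 1 "-1"] by simp

lemma V_scale: "f \<in> V \<Longrightarrow> (\<lambda>x. a * f x) \<in> V"
  using V_lincomb[of f f a 0] by simp

lemma Lip_b_subset_V: "u \<in> Lip_b d \<Longrightarrow> u \<in> V"
  by (rule relaxed_pair_domain[OF relaxed_pair_star])

lemma slope_le_star: "u \<in> Lip_b d \<Longrightarrow> AE x in m. slope u x \<le> star u x"
  by (rule slope_le[OF relaxed_pair_star])

lemma V_cong: "f \<in> V \<Longrightarrow> g \<in> borel_measurable m \<Longrightarrow> AE x in m. f x = g x \<Longrightarrow> g \<in> V"
  by (rule relaxed_pair_domain[OF relaxed_pair_cong[OF relaxed_pair_slope]])

lemma slope_cong:
  assumes "f \<in> V" "g \<in> borel_measurable m" "AE x in m. f x = g x"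
  shows "AE x in m. slope f x = slope g x"
proof -
  have g: "g \<in> V" by (rule V_cong[OF assms])
  have "AE x in m. slope g x \<le> slope f x"
    by (rule slope_le[OF relaxed_pair_cong[OF relaxed_pair_slope[OF assms(1)] assms(2,3)]])
  moreover have "AE x in m. slope f x \<le> slope g x"
    by (rule slope_le[OF relaxed_pair_cong[OF relaxed_pair_slope[OF g] V_measurable[OF assms(1)]]])
      (use assms(3) in \<open>auto elim: eventually_mono\<close>)
  ultimately show ?thesis by eventually_elim simp
qed

lemma slope_lincomb_le:
  "f \<in> V \<Longrightarrow> g \<in> V \<Longrightarrow> AE x in m. slope (\<lambda>x. a * f x + b * g x) x \<le> \<bar>a\<bar> * slope f x + \<bar>b\<bar> * slope g x"
  by (rule slope_le[OF relaxed_pair_lincomb[OF relaxed_pair_slope relaxed_pair_slope]])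

lemma slope_contraction:
  "f \<in> V \<Longrightarrow> (\<And>s t. \<bar>\<eta> s - \<eta> t\<bar> \<le> c * \<bar>s - t\<bar>) \<Longrightarrow> 0 \<le> c \<Longrightarrow> AE x in m. slope (\<lambda>x. \<eta> (f x)) x \<le> c * slope f x"
  by (rule slope_le[OF relaxed_pair_contraction[OF relaxed_pair_slope]])

lemma V_contraction:
  "f \<in> V \<Longrightarrow> (\<And>s t. \<bar>\<eta> s - \<eta> t\<bar> \<le> c * \<bar>s - t\<bar>) \<Longrightarrow> 0 \<le> c \<Longrightarrow> (\<lambda>x. \<eta> (f x)) \<in> V"
  by (rule relaxed_pair_domain[OF relaxed_pair_contraction[OF relaxed_pair_slope]])

lemma slope_const: "AE x in m. slope (\<lambda>x. c) x = 0"
  using slope_le[OF relaxed_pair_const[of c]] slope_nonneg[OF V_const[of c]] by eventually_elim simp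

lemma slope_scale:
  assumes "f \<in> V"
  shows "AE x in m. slope (\<lambda>x. a * f x) x = \<bar>a\<bar> * slope f x"
proof (cases "a = 0")
  case True
  then show ?thesis using slope_const[of 0] by simp
next
  case False
  have le: "AE x in m. slope (\<lambda>x. b * g x) x \<le> \<bar>b\<bar> * slope g x" if "g \<in> V" for g b
    using slope_lincomb_le[OF that that, of b 0] by simp
  have "AE x in m. slope (\<lambda>x. (1/a) * (a * f x)) x \<le> \<bar>1/a\<bar> * slope (\<lambda>x. a * f x) x"
    by (rule le[OF V_scale[OF assms]])
  then have "AE x in m. \<bar>a\<bar> * slope f x \<le> slope (\<lambda>x. a * f x) x"
    by eventually_elim (use False in \<open>simp add: field_simps\<close>)
  with le[OF assms, of a] show ?thesis by eventually_elim simp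
qed

lemma slope_add_le:
  "f \<in> V \<Longrightarrow> g \<in> V \<Longrightarrow> AE x in m. slope (\<lambda>x. f x + g x) x \<le> slope f x + slope g x"
  using slope_lincomb_le[of f g 1 1] by simp

lemma slope_diff_commute:
  assumes "f \<in> V" "g \<in> V"
  shows "AE x in m. slope (\<lambda>x. f x - g x) x = slope (\<lambda>x. g x - f x) x"
  using slope_scale[OF V_diff[OF assms], of "-1"] by (auto elim: eventually_mono)

lemma slope_diff_le:
  assumes "f \<in> V" "g \<in> V"
  shows "AE x in m. \<bar>slope f x - slope g x\<bar> \<le> slope (\<lambda>x. f x - g x) x"
  using slope_add_le[OF assms(2) V_diff[OF assms]] slope_add_le[OF assms(1) V_diff[OF assms(2,1)]]
    slope_diff_commute[OF assms]
  by eventually_elim simp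

text \<open>The functions \<open>t - e * arctan (t / e)\<close> have vanishing derivative at \<open>0\<close> and converge
  uniformly to the identity.\<close>

lemma slope_zero_on_zeros:
  assumes f: "f \<in> V"
  shows "AE x in m. f x = 0 \<longrightarrow> slope f x = 0"
proof -
  define e where "e n = 1 / real (Suc n)" for n
  have e: "e n > 0" for n by (simp add: e_def)
  have e0: "e \<longlonglongrightarrow> 0" unfolding e_def by (intro LIMSEQ_Suc lim_1_over_n)
  define \<eta> where "\<eta> n t = t - e n * arctan (t / e n)" for n t
  define \<eta>' where "\<eta>' n t = 1 - 1 / (1 + (t / e n)\<^sup>2)" for n t
  have der: "(\<eta> n has_real_derivative \<eta>' n t) (at t)" for n t
    unfolding \<eta>_def \<eta>'_def using e[of n]
    by (auto intro!: derivative_eq_intros simp: divide_inverse)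
  have pos: "1 + (t / e n)\<^sup>2 > 0" for n t by (rule add_pos_nonneg) auto
  have bd: "\<bar>\<eta>' n t\<bar> \<le> 1" for n t
    using pos[of t n] by (simp add: \<eta>'_def abs_le_iff divide_le_eq)
  have cont: "continuous_on UNIV (\<eta>' n)" for n
    unfolding \<eta>'_def using pos[of _ n] e[of n] by (intro continuous_intros) (auto simp: less_le)
  have \<eta>m [measurable]: "\<eta>' n \<in> borel_measurable borel" for n by (rule borel_measurable_continuous_onI[OF cont])
  have fm [measurable]: "f \<in> borel_measurable m" by (rule V_measurable[OF f])
  have lim: "(\<lambda>n. \<bar>\<eta>' n t\<bar>) \<longlonglongrightarrow> indicator (- {0}) t" for t
  proof (cases "t = 0")
    case True
    then show ?thesis by (simp add: \<eta>'_def)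
  next
    case False
    have "(\<lambda>n. \<bar>1 - (e n)\<^sup>2 / ((e n)\<^sup>2 + t\<^sup>2)\<bar>) \<longlonglongrightarrow> \<bar>1 - 0\<^sup>2 / (0\<^sup>2 + t\<^sup>2)\<bar>"
      using False by (intro tendsto_intros e0) auto
    moreover have "\<eta>' n t = 1 - (e n)\<^sup>2 / ((e n)\<^sup>2 + t\<^sup>2)" for n
      using e[of n] by (simp add: \<eta>'_def power_divide divide_simps add_nonneg_eq_0_iff)
    ultimately show ?thesis using False by simp
  qed
  have sL: "slope f \<in> L2 m" by (rule slope_L2[OF f])
  \<comment> \<open>In the limit the factor \<open>\<eta>'\<close> becomes the indicator of the set
    where \<open>f\<close> is nonzero, while the functions \<open>\<eta> n (f x)\<close> return to
    \<open>f\<close>.\<close>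
  have "relaxed_pair f (\<lambda>x. indicator (- {0}) (f x) * slope f x)"
  proof (rule relaxed_pair_closed)
    show "relaxed_pair (\<lambda>x. \<eta> n (f x)) (\<lambda>x. \<bar>\<eta>' n (f x)\<bar> * slope f x)" for n
      by (rule relaxed_pair_C1[OF relaxed_pair_slope[OF f] der cont bd])
    show "L2_tendsto m (\<lambda>n x. \<bar>\<eta>' n (f x)\<bar> * slope f x) (\<lambda>x. indicator (- {0}) (f x) * slope f x)"
      by (rule L2_tendsto_multiplier[OF L2_tendsto_const[OF sL], of _ _ 1]) (use lim bd in auto)
    have "L2_tendsto m (\<lambda>n x. e n * arctan (f x / e n)) (\<lambda>x. 0)"
    proof (rule L2_tendsto_dominated[of m "\<lambda>n x. e n * 1" "\<lambda>x. 0 * 1" _ _ 2])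
      show "L2_tendsto m (\<lambda>n x. e n * 1) (\<lambda>x. 0 * 1)"
      proof (rule L2_tendsto_multiplier[OF L2_tendsto_const[OF L2_const], of _ _ 1])
        show "AE x in m. \<bar>e n\<bar> \<le> 1" for n by (simp add: e_def)
      qed (use e0 in auto)
      have ab: "\<bar>e n * arctan (f x / e n)\<bar> \<le> 2 * e n" for n x
      proof -
        have "\<bar>arctan (f x / e n)\<bar> \<le> 2"
          using arctan_bounded[of "f x / e n"] pi_half_less_two by (simp add: abs_le_iff)
        then show ?thesis using e[of n] by (simp add: abs_mult)
      qed
      show "(\<lambda>x. e n * arctan (f x / e n)) \<in> L2 m" for n
        by (rule L2_bounded[of _ "2 * e n"]) (use ab in auto)
      show "AE x in m. \<bar>e n * arctan (f x / e n) - 0\<bar> \<le> 2 * \<bar>e n * 1 - 0 * 1\<bar>" for n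
        using ab[of n] e[of n] by simp
    qed simp_all
    from L2_tendsto_add[OF L2_tendsto_const[OF V_L2[OF f]] L2_tendsto_scale[OF this, of "-1"]]
    show "L2_tendsto m (\<lambda>n x. \<eta> n (f x)) f" by (simp add: \<eta>_def)
  qed
  from slope_le[OF this] slope_nonneg[OF f] show ?thesis
    by eventually_elim (auto simp: indicator_def)
qed

text \<open>\<open>f - g - c\<close> vanishes on the set in question and therefore so does its
  slope; adding a constant does not change slopes.\<close>

lemma slope_local:
  assumes "f \<in> V" "g \<in> V"
  shows "AE x in m. f x = g x + c \<longrightarrow> slope f x = slope g x"
proof -
  have h: "(\<lambda>x. f x - g x - c) \<in> V" by (intro V_diff assms V_const)
  have k: "(\<lambda>x. g x + c) \<in> V" by (intro V_add assms V_const)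
  have 1: "AE x in m. f x - g x - c = 0 \<longrightarrow> slope (\<lambda>x. f x - g x - c) x = 0"
    by (rule slope_zero_on_zeros[OF h])
  have 2: "AE x in m. \<bar>slope f x - slope (\<lambda>x. g x + c) x\<bar> \<le> slope (\<lambda>x. f x - g x - c) x"
    using slope_diff_le[OF assms(1) k] by (simp add: algebra_simps)
  have 3: "AE x in m. \<bar>slope (\<lambda>x. g x + c) x - slope g x\<bar> \<le> slope (\<lambda>x. c) x"
    using slope_diff_le[OF k assms(2)] by simp
  show ?thesis using 1 2 3 slope_const[of c] by eventually_elim auto
qed

lemma slope_cong_on:
  assumes "f \<in> V" "g \<in> V"
  shows "AE x in m. f x = g x \<longrightarrow> slope f x = slope g x"
  using slope_local[OF assms, of 0] by simp

lemma LinftyE: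
  assumes "f \<in> Linfty m"
  obtains C where "0 \<le> C" "AE x in m. \<bar>f x\<bar> \<le> C"
proof -
  obtain C where "AE x in m. \<bar>f x\<bar> \<le> C" using assms by (auto simp: Linfty_def)
  then show ?thesis by (intro that[of "max 0 C"]) (auto elim: eventually_mono)
qed

lemma Cb_subset_Linfty: "f \<in> Cb \<Longrightarrow> f \<in> Linfty m"
  unfolding Linfty_def using Cb_measurable Cb_bound by (metis (mono_tags, lifting) AE_I2 mem_Collect_eq)

lemma V_mult:
  assumes "f \<in> V \<inter> Linfty m" "g \<in> V \<inter> Linfty m"
  shows "(\<lambda>x. f x * g x) \<in> V \<inter> Linfty m"
    and "AE x in m. slope (\<lambda>x. f x * g x) x \<le> \<bar>g x\<bar> * slope f x + \<bar>f x\<bar> * slope g x"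
proof -
  obtain A where A: "0 \<le> A" "AE x in m. \<bar>f x\<bar> \<le> A" using assms by (blast elim: LinftyE)
  obtain B where B: "0 \<le> B" "AE x in m. \<bar>g x\<bar> \<le> B" using assms by (blast elim: LinftyE)
  have *: "relaxed_pair (\<lambda>x. f x * g x) (\<lambda>x. \<bar>g x\<bar> * slope f x + \<bar>f x\<bar> * slope g x)"
    by (rule relaxed_pair_mult[OF _ _ A(2) B(2) A(1) B(1)]) (use assms in \<open>auto intro: relaxed_pair_slope\<close>)
  then show "AE x in m. slope (\<lambda>x. f x * g x) x \<le> \<bar>g x\<bar> * slope f x + \<bar>f x\<bar> * slope g x" by (rule slope_le)
  have "AE x in m. \<bar>f x * g x\<bar> \<le> A * B"
    using A(2) B(2) by eventually_elim (auto simp: abs_mult intro: mult_mono A)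
  moreover have "(\<lambda>x. f x * g x) \<in> V" by (rule relaxed_pair_domain[OF *])
  ultimately show "(\<lambda>x. f x * g x) \<in> V \<inter> Linfty m" using V_measurable by (auto simp: Linfty_def)
qed

lemma Linfty_lincomb:
  assumes "f \<in> Linfty m" "g \<in> Linfty m"
  shows "(\<lambda>x. a * f x + b * g x) \<in> Linfty m"
proof -
  obtain A where A: "0 \<le> A" "AE x in m. \<bar>f x\<bar> \<le> A" using assms by (blast elim: LinftyE)
  obtain B where B: "0 \<le> B" "AE x in m. \<bar>g x\<bar> \<le> B" using assms by (blast elim: LinftyE)
  have "AE x in m. \<bar>a * f x + b * g x\<bar> \<le> \<bar>a\<bar> * A + \<bar>b\<bar> * B"
    using A(2) B(2)
  proof eventually_elim
    case (elim x)
    have "\<bar>a * f x + b * g x\<bar> \<le> \<bar>a\<bar> * \<bar>f x\<bar> + \<bar>b\<bar> * \<bar>g x\<bar>"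
      using abs_triangle_ineq[of "a * f x" "b * g x"] by (simp add: abs_mult)
    also have "\<dots> \<le> \<bar>a\<bar> * A + \<bar>b\<bar> * B" using elim by (intro add_mono mult_left_mono) auto
    finally show ?case .
  qed
  then show ?thesis using assms by (auto simp: Linfty_def)
qed

lemma V_abs: "f \<in> V \<Longrightarrow> (\<lambda>x. \<bar>f x\<bar>) \<in> V"
  by (rule V_contraction[of _ _ 1]) auto

lemma V_max:
  assumes "f \<in> V" "g \<in> V"
  shows "(\<lambda>x. max (f x) (g x)) \<in> V"
proof -
  have "(\<lambda>x. 1/2 * (f x + g x) + 1/2 * \<bar>f x - g x\<bar>) \<in> V"
    by (intro V_lincomb V_add V_abs V_diff assms)
  moreover have "(\<lambda>x. 1/2 * (f x + g x) + 1/2 * \<bar>f x - g x\<bar>) = (\<lambda>x. max (f x) (g x))"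
    by (auto simp: max_def field_simps)
  ultimately show ?thesis by simp
qed

lemma V_min:
  assumes "f \<in> V" "g \<in> V"
  shows "(\<lambda>x. min (f x) (g x)) \<in> V"
proof -
  have "(\<lambda>x. -1 * max (-1 * f x) (-1 * g x)) \<in> V" by (intro V_max V_scale assms)
  moreover have "(\<lambda>x. -1 * max (-1 * f x) (-1 * g x)) = (\<lambda>x. min (f x) (g x))"
    by (auto simp: max_def min_def)
  ultimately show ?thesis by simp
qed

lemma slope_max:
  assumes "f \<in> V" "g \<in> V"
  shows "AE x in m. slope (\<lambda>x. max (f x) (g x)) x = (if g x \<le> f x then slope f x else slope g x)"
  using slope_cong_on[OF V_max[OF assms] assms(1)] slope_cong_on[OF V_max[OF assms] assms(2)]
  by eventually_elim (auto simp: max_def split: if_splits)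

lemma slope_min:
  assumes "f \<in> V" "g \<in> V"
  shows "AE x in m. slope (\<lambda>x. min (f x) (g x)) x = (if f x \<le> g x then slope f x else slope g x)"
  using slope_cong_on[OF V_min[OF assms] assms(1)] slope_cong_on[OF V_min[OF assms] assms(2)]
  by eventually_elim (auto simp: min_def split: if_splits)

lemma slope_convex:
  assumes "f \<in> V" "g \<in> V" "0 \<le> a" "0 \<le> b" "a + b = 1"
  shows "AE x in m. (slope (\<lambda>x. a * f x + b * g x) x)\<^sup>2 \<le> a * (slope f x)\<^sup>2 + b * (slope g x)\<^sup>2"
  using slope_lincomb_le[OF assms(1,2), of a b] slope_nonneg[OF V_lincomb[OF assms(1,2)], of a b]
proof eventually_elim
  case (elim x)
  have "(slope (\<lambda>x. a * f x + b * g x) x)\<^sup>2 \<le> (a * slope f x + b * slope g x)\<^sup>2"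
    using elim assms by (intro power_mono) auto
  also have "\<dots> = a * (slope f x)\<^sup>2 + b * (slope g x)\<^sup>2 - a * b * (slope f x - slope g x)\<^sup>2"
  proof -
    have b: "b = 1 - a" using assms(5) by simp
    show ?thesis unfolding b by (simp add: power2_eq_square algebra_simps)
  qed
  also have "\<dots> \<le> a * (slope f x)\<^sup>2 + b * (slope g x)\<^sup>2" using assms by simp
  finally show ?case .
qed

text \<open>A Lipschitz function near \<open>F n\<close> with small energy is also near
  \<open>f\<close>, where \<open>Ch_lower_bound\<close> forbids small energy.\<close>

lemma Ch_lsc:
  assumes "L2_tendsto m F f" "\<And>n. Ch m d (F n) \<le> ennreal C"
  shows "Ch m d f \<le> ennreal C"
proof (rule ccontr)
  assume "\<not> Ch m d f \<le> ennreal C"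
  then obtain z where z: "ennreal C < z" "z < Ch m d f" using dense by (auto simp: not_le)
  then obtain b where b: "z = ennreal b" by (cases z) auto
  have f: "f \<in> L2 m" and F: "\<And>n. F n \<in> L2 m" using assms(1) by (auto simp: L2_tendsto_iff)
  obtain \<delta> where \<delta>: "\<delta> > 0" "\<And>u. u \<in> Lip_b d \<Longrightarrow> sqnorm m (\<lambda>x. u x - f x) < \<delta> \<Longrightarrow> b \<le> sqnorm m (star u)"
    using Ch_lower_bound[OF f, of b] z b by auto
  have "\<forall>\<^sub>F n in sequentially. sqnorm m (\<lambda>x. F n x - f x) < \<delta>/4"
    using assms(1) \<delta>(1) by (auto simp: L2_tendsto_iff intro!: order_tendstoD(2))
  then obtain n where n: "sqnorm m (\<lambda>x. F n x - f x) < \<delta>/4" by (auto simp: eventually_sequentially)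
  obtain u where u: "u \<in> Lip_b d" "sqnorm m (\<lambda>x. u x - F n x) < \<delta>/4" "sqnorm m (star u) < b"
    using Ch_approx[of "F n" b "\<delta>/4"] assms(2)[of n] z b \<delta>(1) by (auto intro: le_less_trans)
  have "sqnorm m (\<lambda>x. u x - f x) < \<delta>"
    using sqnorm_diff_triangle[OF Lip_b_L2[OF u(1)] F[of n] f] n u(2) \<delta>(1) by linarith
  then show False using \<delta>(2)[OF u(1)] u(3) by simp
qed

lemma Ch_slope: "f \<in> V \<Longrightarrow> Ch m d f = ennreal (sqnorm m (slope f))"
  by (simp add: sqnorm_slope)

text \<open>The limits of bounded Lipschitz functions form a closed subspace \<open>A\<close>. It
  contains the indicators by \<open>Lip_b_approx_indicator\<close>, hence by monotone approximation
  every nonnegative function in \<open>L2\<close>.\<close>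

lemma Lip_b_dense:
  assumes "f \<in> L2 m" "e > 0"
  shows "\<exists>u\<in>Lip_b d. sqnorm m (\<lambda>x. f x - u x) < e"
proof -
  define A where "A = {f \<in> L2 m. \<forall>e>0. \<exists>u\<in>Lip_b d. sqnorm m (\<lambda>x. f x - u x) < e}"
  have A_lim: "f \<in> A" if FA: "\<And>n. F n \<in> A" and "L2_tendsto m F f" for F f
    unfolding A_def
  proof (intro CollectI conjI allI impI)
    show f: "f \<in> L2 m" using that(2) by (simp add: L2_tendsto_iff)
    fix e :: real assume "e > 0"
    then have "\<forall>\<^sub>F n in sequentially. sqnorm m (\<lambda>x. F n x - f x) < e/4"
      using that(2) by (auto simp: L2_tendsto_iff intro!: order_tendstoD(2))
    then obtain n where n: "sqnorm m (\<lambda>x. f x - F n x) < e/4"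
      by (auto simp: eventually_sequentially sqnorm_minus_commute)
    obtain u where u: "u \<in> Lip_b d" "sqnorm m (\<lambda>x. F n x - u x) < e/4"
      using FA[of n] \<open>e > 0\<close> unfolding A_def by (auto dest!: spec[of _ "e/4"])
    have "F n \<in> L2 m" using FA[of n] by (simp add: A_def)
    from sqnorm_diff_triangle[OF f this Lip_b_L2[OF u(1)]]
    show "\<exists>u\<in>Lip_b d. sqnorm m (\<lambda>x. f x - u x) < e" using u n \<open>e > 0\<close> by (intro bexI[of _ u]) auto
  qed
  have A_Lip: "u \<in> A" if "u \<in> Lip_b d" for u
    using that Lip_b_L2[OF that] unfolding A_def by (auto intro!: bexI[of _ u])
  have A_seq: "\<exists>u. (\<forall>n. u n \<in> Lip_b d) \<and> L2_tendsto m u f" if "f \<in> A" for f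
  proof -
    have "\<forall>n. \<exists>u. u \<in> Lip_b d \<and> sqnorm m (\<lambda>x. f x - u x) < 1 / real (Suc n)"
    proof
      fix n
      have "0 < 1 / real (Suc n)" by simp
      with that show "\<exists>u. u \<in> Lip_b d \<and> sqnorm m (\<lambda>x. f x - u x) < 1 / real (Suc n)"
        unfolding A_def by blast
    qed
    then obtain u where u: "\<And>n. u n \<in> Lip_b d" "\<And>n. sqnorm m (\<lambda>x. f x - u n x) < 1 / real (Suc n)"
      by metis
    have lim: "(\<lambda>n. 1 / real (Suc n)) \<longlonglongrightarrow> 0" by (intro LIMSEQ_Suc lim_1_over_n)
    have "(\<lambda>n. sqnorm m (\<lambda>x. u n x - f x)) \<longlonglongrightarrow> 0"
      by (rule tendsto_0_if_le[OF _ lim]) (use u in \<open>simp_all add: less_imp_le sqnorm_minus_commute[of _ _ f]\<close>)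
    moreover have "f \<in> L2 m" using that by (simp add: A_def)
    ultimately show ?thesis using u by (intro exI[of _ u]) (auto simp: L2_tendsto_iff Lip_b_L2)
  qed
  have A_lincomb: "(\<lambda>x. a * f x + b * g x) \<in> A" if fg: "f \<in> A" "g \<in> A" for a b f g
  proof -
    obtain u where u: "\<And>n. u n \<in> Lip_b d" "L2_tendsto m u f" using A_seq[OF fg(1)] by blast
    obtain w where w: "\<And>n. w n \<in> Lip_b d" "L2_tendsto m w g" using A_seq[OF fg(2)] by blast
    show ?thesis
    proof (rule A_lim)
      show "(\<lambda>x. a * u n x + b * w n x) \<in> A" for n by (intro A_Lip Lip_b_lincomb u w)
      show "L2_tendsto m (\<lambda>n x. a * u n x + b * w n x) (\<lambda>x. a * f x + b * g x)"
        by (intro L2_tendsto_add L2_tendsto_scale u w)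
    qed
  qed
  \<comment> \<open>Square integrability stands as a premise inside the induction, because the rule
    ranges over all nonnegative measurable functions.\<close>
  have nonneg: "f \<in> L2 m \<longrightarrow> f \<in> A" if "f \<in> borel_measurable m" "\<And>x. 0 \<le> f x" for f
    using that
  proof (induction rule: borel_measurable_induct_real)
    case (set B)
    obtain g where g: "\<And>n. g n \<in> Lip_b d" "\<And>n x. 0 \<le> g n x" "\<And>n x. g n x \<le> 1"
      "AE x in m. (\<lambda>n. g n x) \<longlonglongrightarrow> indicator B x"
      by (rule Lip_b_approx_indicator[OF set]) (rule that)
    have "L2_tendsto m (\<lambda>n x. g n x * 1) (\<lambda>x. indicator B x * 1)"
      by (rule L2_tendsto_multiplier[OF L2_tendsto_const[OF L2_const] _ _ _ g(4), of 1])
        (use g set in \<open>auto intro: L2_measurable Lip_b_L2\<close>)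
    then show ?case using A_lim[OF A_Lip[OF g(1)]] by simp
  next
    case (mult u c)
    show ?case
    proof (cases "c = 0")
      case True
      then show ?thesis using A_Lip[OF Lip_b_const] by simp
    next
      case False
      show ?thesis
      proof
        assume "(\<lambda>x. c * u x) \<in> L2 m"
        from L2_scale[OF this, of "1/c"] False have "u \<in> L2 m" by simp
        then show "(\<lambda>x. c * u x) \<in> A" using mult A_lincomb[of u u c 0] by simp
      qed
    qed
  next
    case (add u v)
    show ?case
    proof
      assume uv: "(\<lambda>x. v x + u x) \<in> L2 m"
      have "u \<in> L2 m" by (rule L2_dominated[OF _ uv]) (use add in auto)
      moreover have "v \<in> L2 m" by (rule L2_dominated[OF _ uv]) (use add in auto)
      ultimately show "(\<lambda>x. v x + u x) \<in> A" using add A_lincomb[of v u 1 1] by simp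
    qed
  next
    case (seq U)
    show ?case
    proof
      assume fL: "f \<in> L2 m"
      have le: "U i x \<le> f x" for i x
        using incseq_le[of "\<lambda>i. U i x" "f x"] seq by (auto simp: incseq_def le_fun_def)
      have "\<bar>U i x\<bar> \<le> \<bar>f x\<bar>" for i x using le[of i x] seq(2)[of i x] by linarith
      then have UL: "U i \<in> L2 m" for i by (intro L2_dominated[OF _ fL]) (use seq in auto)
      have "(\<lambda>n. \<integral>x. (U n x - f x)\<^sup>2 \<partial>m) \<longlonglongrightarrow> (\<integral>x. 0 \<partial>m)"
      proof (rule integral_dominated_convergence[where w="\<lambda>x. (f x)\<^sup>2"])
        show "AE x in m. norm ((U n x - f x)\<^sup>2) \<le> (f x)\<^sup>2" for n
        proof (rule AE_I2)
          fix x
          have "0 \<le> U n x" using seq by auto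
          then have "\<bar>U n x - f x\<bar> \<le> \<bar>f x\<bar>" using le[of n x] by linarith
          then show "norm ((U n x - f x)\<^sup>2) \<le> (f x)\<^sup>2" by (simp add: abs_le_square_iff)
        qed
        show "AE x in m. (\<lambda>n. (U n x - f x)\<^sup>2) \<longlonglongrightarrow> 0"
        proof (rule AE_I2)
          fix x assume "x \<in> space m"
          then have "(\<lambda>n. (U n x - f x)\<^sup>2) \<longlonglongrightarrow> (f x - f x)\<^sup>2" using seq by (intro tendsto_intros) auto
          then show "(\<lambda>n. (U n x - f x)\<^sup>2) \<longlonglongrightarrow> 0" by simp
        qed
      qed (use UL fL L2_measurable L2_integrable_sq in auto)
      then have Uf: "L2_tendsto m U f" using UL fL by (simp add: L2_tendsto_def)
      have UA: "U n \<in> A" for n using seq.IH UL by blast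
      show "f \<in> A" by (rule A_lim[OF UA Uf])
    qed
  qed
  have fm: "f \<in> borel_measurable m" using assms(1) by (rule L2_measurable)
  have "(\<lambda>x. max 0 (f x)) \<in> A" "(\<lambda>x. max 0 (- f x)) \<in> A"
    by (rule nonneg[THEN mp]; use fm in \<open>auto intro!: L2_dominated[OF _ assms(1)]\<close>)+
  from A_lincomb[OF this, of 1 "-1"] have "(\<lambda>x. 1 * max 0 (f x) + -1 * max 0 (- f x)) \<in> A" .
  moreover have "(\<lambda>x. 1 * max 0 (f x) + -1 * max 0 (- f x)) = f" by (auto simp: max_def)
  ultimately have "f \<in> A" by simp
  then show ?thesis using assms(2) by (simp add: A_def)
qed

text \<open>Approximate indicators are nonnegative, so nonnegative test functions determine
  \<open>h\<close>. The restriction matters later, where \<open>\<phi>\<close> is the weight of a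
  quadratic form that has to be nonnegative.\<close>

lemma AE_zero_if_orthogonal:
  assumes h: "integrable m h" and 0: "\<And>\<phi>. \<phi> \<in> Lip_b d \<Longrightarrow> (\<And>x. 0 \<le> \<phi> x) \<Longrightarrow> (\<integral>x. h x * \<phi> x \<partial>m) = 0"
  shows "AE x in m. h x = 0"
proof -
  have ind: "(\<integral>x. h x * indicator B x \<partial>m) = 0" if B: "B \<in> sets m" for B
  proof -
    obtain g where g: "\<And>n. g n \<in> Lip_b d" "\<And>n x. 0 \<le> g n x" "\<And>n x. g n x \<le> 1"
      "AE x in m. (\<lambda>n. g n x) \<longlonglongrightarrow> indicator B x"
      by (rule Lip_b_approx_indicator[OF B]) (rule that)
    have gm: "g n \<in> borel_measurable m" for n by (rule L2_measurable[OF Lip_b_L2[OF g(1)]])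
    have "(\<lambda>n. \<integral>x. h x * g n x \<partial>m) \<longlonglongrightarrow> (\<integral>x. h x * indicator B x \<partial>m)"
    proof (rule integral_dominated_convergence[where w="\<lambda>x. \<bar>h x\<bar>"])
      show "AE x in m. (\<lambda>n. h x * g n x) \<longlonglongrightarrow> h x * indicator B x"
        using g(4) by eventually_elim (intro tendsto_intros)
      show "AE x in m. norm (h x * g n x) \<le> \<bar>h x\<bar>" for n
        using g by (simp add: abs_mult mult_left_le)
    qed (use h gm B in auto)
    then show ?thesis using 0[OF g(1,2)] by (simp add: LIMSEQ_const_iff)
  qed
  have hm: "h \<in> borel_measurable m" using h by simp
  have *: "AE x in m. h' x \<le> 0"
    if h': "integrable m h'" "\<And>B. B \<in> sets m \<Longrightarrow> (\<integral>x. h' x * indicator B x \<partial>m) = 0" for h' :: "'a \<Rightarrow> real"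
  proof -
    define B where "B = {x \<in> space m. 0 < h' x}"
    have [measurable]: "h' \<in> borel_measurable m" using h' by simp
    have "{x \<in> space m. 0 < h' x} \<in> sets m" by (rule borel_measurable_less[of "\<lambda>_. 0::real" m h']) auto
    then have B: "B \<in> sets m" by (simp add: B_def)
    have "AE x in m. h' x * indicator B x = 0"
      by (subst integral_nonneg_eq_0_iff_AE[symmetric])
        (use h'(2)[OF B] integrable_real_mult_indicator[OF B h'(1)] in \<open>auto simp: indicator_def B_def\<close>)
    then show ?thesis by eventually_elim (auto simp: B_def indicator_def split: if_splits)
  qed
  have "AE x in m. h x \<le> 0" by (rule *[OF h ind])
  moreover have "AE x in m. - h x \<le> 0" by (rule *) (use h ind in auto)
  ultimately show ?thesis by eventually_elim simp
qed

end

section \<open>Quadratic forms from the parallelogram law\<close>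

lemma additive_bounded_imp_linear:
  fixes \<phi> :: "real \<Rightarrow> real"
  assumes add: "\<And>s t. \<phi> (s + t) = \<phi> s + \<phi> t" and bd: "\<And>t. 0 \<le> t \<Longrightarrow> t \<le> 1 \<Longrightarrow> \<bar>\<phi> t\<bar> \<le> C"
  shows "\<phi> t = t * \<phi> 1"
proof -
  \<comment> \<open>Removing the linear part makes the additive function vanish on the integers,
    hence periodic and bounded everywhere; a bounded additive function is zero.\<close>
  define \<psi> where "\<psi> t = \<phi> t - t * \<phi> 1" for t
  have \<psi>_add: "\<psi> (s + t) = \<psi> s + \<psi> t" for s t by (simp add: \<psi>_def add algebra_simps)
  have \<psi>_mult: "\<psi> (real n * t) = real n * \<psi> t" for n t
  proof (induction n)
    case 0
    show ?case using \<psi>_add[of 0 0] by simp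
  qed (simp add: distrib_right \<psi>_add)
  have \<psi>0: "\<psi> 0 = 0" using \<psi>_add[of 0 0] by simp
  have \<psi>_neg: "\<psi> (- t) = - \<psi> t" for t using \<psi>_add[of t "- t"] \<psi>0 by simp
  have \<psi>_int: "\<psi> (of_int k) = 0" for k
  proof (cases "0 \<le> k")
    case True
    then show ?thesis using \<psi>_mult[of "nat k" 1] by (simp add: \<psi>_def)
  next
    case False
    then show ?thesis using \<psi>_mult[of "nat (- k)" 1] \<psi>_neg[of "of_int k"] by (simp add: \<psi>_def)
  qed
  have bd': "\<bar>\<psi> t\<bar> \<le> C + \<bar>\<phi> 1\<bar>" for t
  proof -
    have "\<psi> t = \<psi> (frac t)" using \<psi>_add[of "frac t" "of_int \<lfloor>t\<rfloor>"] \<psi>_int by (simp add: frac_def)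
    also have "\<bar>\<psi> (frac t)\<bar> \<le> \<bar>\<phi> (frac t)\<bar> + \<bar>frac t * \<phi> 1\<bar>"
      unfolding \<psi>_def by (rule abs_triangle_ineq4)
    also have "\<dots> \<le> C + 1 * \<bar>\<phi> 1\<bar>"
      using frac_ge_0[of t] frac_lt_1[of t] by (intro add_mono bd) (auto simp: abs_mult intro!: mult_left_le_one_le)
    finally show ?thesis by simp
  qed
  have "\<psi> t = 0"
  proof (rule ccontr)
    assume "\<psi> t \<noteq> 0"
    then obtain n where "C + \<bar>\<phi> 1\<bar> < real n * \<bar>\<psi> t\<bar>"
      using reals_Archimedean3[of "\<bar>\<psi> t\<bar>"] by auto
    then show False using bd'[of "real n * t"] by (simp add: \<psi>_mult abs_mult)
  qed
  then show ?thesis by (simp add: \<psi>_def)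
qed

text \<open>Additivity in the first argument comes from the parallelogram law, real homogeneity from
  additivity and the bound \<open>(q f + q h) / 2\<close> for factors in the unit interval. Applied
  to the energy on \<open>V\<close> and, later, to weighted integrals of squared slopes.\<close>

lemma Jordan_von_Neumann:
  fixes W :: "('a \<Rightarrow> real) set" and q :: "('a \<Rightarrow> real) \<Rightarrow> real"
  defines "B f g \<equiv> (q (\<lambda>x. f x + g x) - q (\<lambda>x. f x - g x)) / 4"
  assumes W: "\<And>f g a b. f \<in> W \<Longrightarrow> g \<in> W \<Longrightarrow> (\<lambda>x. a * f x + b * g x) \<in> W"
    and par: "\<And>f g. f \<in> W \<Longrightarrow> g \<in> W \<Longrightarrow> q (\<lambda>x. f x + g x) + q (\<lambda>x. f x - g x) = 2 * q f + 2 * q g"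
    and hom: "\<And>f a. f \<in> W \<Longrightarrow> q (\<lambda>x. a * f x) = a\<^sup>2 * q f"
    and nn: "\<And>f. f \<in> W \<Longrightarrow> 0 \<le> q f"
  shows "f \<in> W \<Longrightarrow> g \<in> W \<Longrightarrow> h \<in> W \<Longrightarrow> B (\<lambda>x. a * f x + b * g x) h = a * B f h + b * B g h"
    and "f \<in> W \<Longrightarrow> g \<in> W \<Longrightarrow> B f g = B g f"
    and "f \<in> W \<Longrightarrow> B f f = q f"
proof -
  have Wa: "(\<lambda>x. f x + g x) \<in> W" "(\<lambda>x. f x - g x) \<in> W" "(\<lambda>x. a * f x) \<in> W" if "f \<in> W" "g \<in> W" for f g a
    using W[OF that, of 1 1] W[OF that, of 1 "-1"] W[OF that, of a 0] by auto
  have neg: "q (\<lambda>x. g x - f x) = q (\<lambda>x. f x - g x)" if "f \<in> W" "g \<in> W" for f g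
    using hom[OF Wa(2)[OF that], of "-1"] by simp
  show "B f g = B g f" if "f \<in> W" "g \<in> W" for f g
    using neg[OF that] by (simp add: B_def add.commute)
  show "B f f = q f" if "f \<in> W" for f
  proof -
    have "(\<lambda>x. f x + f x) = (\<lambda>x. 2 * f x)" "(\<lambda>x. f x - f x) = (\<lambda>x. 0 * f x)" by auto
    then show ?thesis using hom[OF that, of 2] hom[OF that, of 0] unfolding B_def by simp
  qed
  have mid: "B (\<lambda>x. f x + g x) h + B (\<lambda>x. f x - g x) h = 2 * B f h" if "f \<in> W" "g \<in> W" "h \<in> W" for f g h
  proof -
    have "q (\<lambda>x. f x + h x + g x) + q (\<lambda>x. f x + h x - g x) = 2 * q (\<lambda>x. f x + h x) + 2 * q g"
      "q (\<lambda>x. f x - h x + g x) + q (\<lambda>x. f x - h x - g x) = 2 * q (\<lambda>x. f x - h x) + 2 * q g"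
      by (intro par Wa that)+
    moreover have "(\<lambda>x. f x + h x + g x) = (\<lambda>x. f x + g x + h x)" "(\<lambda>x. f x + h x - g x) = (\<lambda>x. f x - g x + h x)"
      "(\<lambda>x. f x - h x + g x) = (\<lambda>x. f x + g x - h x)" "(\<lambda>x. f x - h x - g x) = (\<lambda>x. f x - g x - h x)" by auto
    ultimately have "q (\<lambda>x. f x + g x + h x) + q (\<lambda>x. f x - g x + h x) = 2 * q (\<lambda>x. f x + h x) + 2 * q g"
      "q (\<lambda>x. f x + g x - h x) + q (\<lambda>x. f x - g x - h x) = 2 * q (\<lambda>x. f x - h x) + 2 * q g"
      by simp_all
    then show ?thesis by (simp only: B_def) argo
  qed
  have zero: "B (\<lambda>x. 0) h = 0" if "h \<in> W" for h
    using hom[OF that, of "-1"] by (simp add: B_def)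
  have dbl: "B (\<lambda>x. 2 * f x) h = 2 * B f h" if "f \<in> W" "h \<in> W" for f h
  proof -
    have "(\<lambda>x. f x + f x) = (\<lambda>x. 2 * f x)" "(\<lambda>x. f x - f x) = (\<lambda>x. 0)" by auto
    then show ?thesis using mid[OF that(1,1,2)] zero[OF that(2)] by simp
  qed
  have add: "B (\<lambda>x. f x + g x) h = B f h + B g h" if "f \<in> W" "g \<in> W" "h \<in> W" for f g h
  proof -
    have 1: "(\<lambda>x. 1/2 * f x + 1/2 * g x) \<in> W" "(\<lambda>x. 1/2 * f x + (-1/2) * g x) \<in> W" by (intro W that)+
    have "B (\<lambda>x. (1/2 * f x + 1/2 * g x) + (1/2 * f x + (-1/2) * g x)) h +
        B (\<lambda>x. (1/2 * f x + 1/2 * g x) - (1/2 * f x + (-1/2) * g x)) h = 2 * B (\<lambda>x. 1/2 * f x + 1/2 * g x) h"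
      by (rule mid[OF 1 that(3)])
    moreover have "B (\<lambda>x. 2 * (1/2 * f x + 1/2 * g x)) h = 2 * B (\<lambda>x. 1/2 * f x + 1/2 * g x) h"
      by (rule dbl[OF 1(1) that(3)])
    ultimately show ?thesis by (simp add: algebra_simps)
  qed
  have bound: "\<bar>B f h\<bar> \<le> (q f + q h) / 2" if "f \<in> W" "h \<in> W" for f h
    using par[OF that] nn[OF Wa(1)[OF that]] nn[OF Wa(2)[OF that]] by (simp add: B_def abs_le_iff)
  have scale: "B (\<lambda>x. a * f x) h = a * B f h" if "f \<in> W" "h \<in> W" for a f h
  proof -
    have "B (\<lambda>x. a * f x) h = a * B (\<lambda>x. 1 * f x) h"
    proof (rule additive_bounded_imp_linear[where \<phi>="\<lambda>a. B (\<lambda>x. a * f x) h" and C="(q f + q h) / 2"])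
      show "B (\<lambda>x. (s + t) * f x) h = B (\<lambda>x. s * f x) h + B (\<lambda>x. t * f x) h" for s t
        unfolding distrib_right by (intro add Wa(3)[OF that(1,1)] that(2))
      fix t :: real assume t: "0 \<le> t" "t \<le> 1"
      have "\<bar>B (\<lambda>x. t * f x) h\<bar> \<le> (q (\<lambda>x. t * f x) + q h) / 2" by (intro bound Wa(3)[OF that(1,1)] that(2))
      also have "q (\<lambda>x. t * f x) \<le> 1 * q f"
        unfolding hom[OF that(1)] using t nn[OF that(1)] by (intro mult_right_mono) (auto simp: power_le_one)
      finally show "\<bar>B (\<lambda>x. t * f x) h\<bar> \<le> (q f + q h) / 2" by simp
    qed
    then show ?thesis by simp
  qed
  show "B (\<lambda>x. a * f x + b * g x) h = a * B f h + b * B g h" if "f \<in> W" "g \<in> W" "h \<in> W" for f g h a b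
    using add[OF Wa(3)[OF that(1,1)] Wa(3)[OF that(2,2)] that(3), of a b] scale[OF that(1,3), of a] scale[OF that(2,3), of b]
    by simp
qed

section \<open>The Dirichlet form of an asymptotically Hilbertian space\<close>

lemma nonneg_if_nonneg_on_rats:
  fixes F :: "real \<Rightarrow> real"
  assumes "continuous_on UNIV F" "\<And>c::rat. 0 \<le> F (of_rat c)"
  shows "0 \<le> F t"
proof -
  have "closure (range (of_rat :: rat \<Rightarrow> real)) = UNIV"
    using Rats_closure_real by (simp add: Rats_def)
  then show ?thesis
    using continuous_ge_on_closure[of "range (of_rat :: rat \<Rightarrow> real)" F t 0] assms by auto
qed

locale hilbertian_space = ext_metric_measure +
  assumes hilbertian: "asymptotically_Hilbertian m d"
begin

abbreviation E :: "('a \<Rightarrow> real) \<Rightarrow> ('a \<Rightarrow> real) \<Rightarrow> real" where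
  "E \<equiv> Ch_form m d"

definition energy :: "('a \<Rightarrow> real) \<Rightarrow> real" where
  "energy f = sqnorm m (slope f)"

lemma energy_nonneg [simp]: "0 \<le> energy f"
  by (simp add: energy_def)

lemma Ch_energy: "f \<in> V \<Longrightarrow> Ch m d f = ennreal (energy f)"
  by (simp add: Ch_slope energy_def)

lemma energy_parallelogram:
  assumes "f \<in> V" "g \<in> V"
  shows "energy (\<lambda>x. f x + g x) + energy (\<lambda>x. f x - g x) = 2 * energy f + 2 * energy g"
proof -
  have "Ch m d (\<lambda>x. f x + g x) + Ch m d (\<lambda>x. f x - g x) = 2 * Ch m d f + 2 * Ch m d g"
    using hilbertian V_L2[OF assms(1)] V_L2[OF assms(2)] by (simp add: asymptotically_Hilbertian_def)
  moreover have "2 = ennreal 2" by simp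
  ultimately have "ennreal (energy (\<lambda>x. f x + g x) + energy (\<lambda>x. f x - g x)) = ennreal (2 * energy f + 2 * energy g)"
    using assms by (simp add: Ch_energy V_add V_diff ennreal_plus ennreal_mult del: ennreal_numeral)
  then show ?thesis by (subst (asm) ennreal_inj) auto
qed

lemma energy_scale:
  assumes "f \<in> V"
  shows "energy (\<lambda>x. a * f x) = a\<^sup>2 * energy f"
proof -
  have "energy (\<lambda>x. a * f x) = sqnorm m (\<lambda>x. \<bar>a\<bar> * slope f x)"
    unfolding energy_def
    by (rule sqnorm_cong_AE[OF slope_measurable[OF V_scale[OF assms]] _ slope_scale[OF assms]])
      (use slope_measurable[OF assms] in auto)
  then show ?thesis by (simp add: sqnorm_scale energy_def)
qed

lemma E_energy: "f \<in> V \<Longrightarrow> g \<in> V \<Longrightarrow> E f g = (energy (\<lambda>x. f x + g x) - energy (\<lambda>x. f x - g x)) / 4"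
  by (simp add: Ch_form_def Ch_energy V_add V_diff)

lemma E_linear:
  assumes "f \<in> V" "g \<in> V" "h \<in> V"
  shows "E (\<lambda>x. a * f x + b * g x) h = a * E f h + b * E g h"
  unfolding E_energy[OF V_lincomb[OF assms(1,2)] assms(3)] E_energy[OF assms(1,3)] E_energy[OF assms(2,3)]
  by (rule Jordan_von_Neumann(1)[of V energy, OF V_lincomb energy_parallelogram energy_scale energy_nonneg assms])

lemma E_sym:
  assumes "f \<in> V" "g \<in> V"
  shows "E f g = E g f"
  unfolding E_energy[OF assms] E_energy[OF assms(2,1)]
  by (rule Jordan_von_Neumann(2)[of V energy, OF V_lincomb energy_parallelogram energy_scale energy_nonneg assms])

lemma E_diag:
  assumes "f \<in> V"
  shows "E f f = energy f"
  unfolding E_energy[OF assms assms]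
  by (rule Jordan_von_Neumann(3)[of V energy, OF V_lincomb energy_parallelogram energy_scale energy_nonneg assms])

lemma E_linear2:
  assumes "f \<in> V" "g \<in> V" "h \<in> V"
  shows "E h (\<lambda>x. a * f x + b * g x) = a * E h f + b * E h g"
  unfolding E_sym[OF assms(3) V_lincomb[OF assms(1,2)]] E_sym[OF assms(3,1)] E_sym[OF assms(3,2)]
  by (rule E_linear[OF assms])

lemma energy_expand:
  assumes "f \<in> V" "g \<in> V"
  shows "energy (\<lambda>x. f x + t * g x) = energy f + 2 * t * E f g + t\<^sup>2 * energy g"
proof -
  have u: "(\<lambda>x. 1 * f x + t * g x) \<in> V" by (intro V_lincomb assms)
  have "energy (\<lambda>x. 1 * f x + t * g x) = E (\<lambda>x. 1 * f x + t * g x) (\<lambda>x. 1 * f x + t * g x)"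
    using E_diag[OF u] by simp
  also have "\<dots> = 1 * E f (\<lambda>x. 1 * f x + t * g x) + t * E g (\<lambda>x. 1 * f x + t * g x)"
    by (rule E_linear[OF assms u])
  also have "\<dots> = energy f + 2 * t * E f g + t\<^sup>2 * energy g"
    unfolding E_linear2[OF assms assms(1)] E_linear2[OF assms assms(2)]
    using E_sym[OF assms(2,1)] by (simp add: E_diag assms power2_eq_square algebra_simps)
  finally show ?thesis by simp
qed

lemma slope_sq_integrable: "f \<in> V \<Longrightarrow> integrable m (\<lambda>x. (slope f x)\<^sup>2)"
  by (rule L2_integrable_sq[OF slope_L2])

text \<open>
  Since \<open>E\<close> is a quadratic form, the left and right derivatives of the convex functions
  \<open>t \<mapsto> (slope (f + t g) x)\<^sup>2\<close> have the same integral, hence coincide almost everywhere. The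
  last property expresses uniqueness of the derivative.
\<close>

lemma directional_derivative:
  assumes f: "f \<in> V" and g: "g \<in> V"
  obtains k where "integrable m k" "(\<integral>x. k x \<partial>m) = E f g"
    "\<And>a b. AE x in m. a\<^sup>2 * (slope f x)\<^sup>2 + 2 * a * b * k x \<le> (slope (\<lambda>y. a * f y + b * g y) x)\<^sup>2"
    "AE x in m. \<forall>\<kappa> C. (\<forall>n. \<forall>\<sigma>\<in>{1,-1}. (slope f x)\<^sup>2 + 2 * (\<sigma> * (1/2)^n) * \<kappa> - C * (\<sigma> * (1/2)^n)\<^sup>2
        \<le> (slope (\<lambda>y. f y + (\<sigma> * (1/2)^n) * g y) x)\<^sup>2) \<longrightarrow> \<kappa> = k x"
proof -
  define p where "p t x = (slope (\<lambda>y. f y + t * g y) x)\<^sup>2" for t x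
  have ftg: "(\<lambda>y. f y + t * g y) \<in> V" for t using V_lincomb[OF f g, of 1 t] by simp
  have p0: "p 0 x = (slope f x)\<^sup>2" for x by (simp add: p_def)
  have pint: "integrable m (p t)" for t unfolding p_def by (rule slope_sq_integrable[OF ftg])
  have pI: "(\<integral>x. p t x \<partial>m) = energy f + 2 * t * E f g + t\<^sup>2 * energy g" for t
    unfolding p_def using energy_expand[OF f g, of t] by (simp add: energy_def sqnorm_def)
  \<comment> \<open>Right and left difference quotients of half the squared slope, so that their
    integrals tend to \<open>E f g\<close>.\<close>
  define qp where "qp t x = (p t x - p 0 x) / (2 * t)" for t x
  define qm where "qm t x = (p 0 x - p (- t) x) / (2 * t)" for t x
  have qint: "integrable m (qp t)" "integrable m (qm t)" for t
    unfolding qp_def qm_def by (intro integrable_divide Bochner_Integration.integrable_diff pint)+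
  have qpI: "(\<integral>x. qp t x \<partial>m) = E f g + t / 2 * energy g" if "t \<noteq> 0" for t
    unfolding qp_def using pint that by (simp add: pI field_simps power2_eq_square)
  have qmI: "(\<integral>x. qm t x \<partial>m) = E f g - t / 2 * energy g" if "t \<noteq> 0" for t
    unfolding qm_def using pint that by (simp add: pI field_simps power2_eq_square)
  \<comment> \<open>Convexity with 0 as a convex combination of \<open>- a\<close> and
    \<open>b\<close>: left quotients do not exceed right ones, whatever the step sizes.\<close>
  have qle: "AE x in m. qm a x \<le> qp b x" if ab: "a > 0" "b > 0" for a b
  proof -
    have "AE x in m. (slope (\<lambda>x. b / (a + b) * (f x + (- a) * g x) + a / (a + b) * (f x + b * g x)) x)\<^sup>2
        \<le> b / (a + b) * (slope (\<lambda>y. f y + (- a) * g y) x)\<^sup>2 + a / (a + b) * (slope (\<lambda>y. f y + b * g y) x)\<^sup>2"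
      by (rule slope_convex[OF ftg ftg]) (use ab in \<open>auto simp flip: add_divide_distrib\<close>)
    moreover have "(\<lambda>x. b / (a + b) * (f x + (- a) * g x) + a / (a + b) * (f x + b * g x)) = f"
    proof
      fix x
      have "b / (a + b) * (f x + (- a) * g x) + a / (a + b) * (f x + b * g x) = (b / (a + b) + a / (a + b)) * f x"
        by (simp add: algebra_simps)
      also have "b / (a + b) + a / (a + b) = 1" using ab by (simp flip: add_divide_distrib)
      finally show "b / (a + b) * (f x + (- a) * g x) + a / (a + b) * (f x + b * g x) = f x" by simp
    qed
    ultimately have "AE x in m. p 0 x \<le> b / (a + b) * p (- a) x + a / (a + b) * p b x"
      by (simp add: p0 p_def)
    then show ?thesis
    proof eventually_elim
      case (elim x)
      have "p 0 x \<le> (b * p (- a) x + a * p b x) / (a + b)" using elim by (simp add: add_divide_distrib)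
      then have "(a + b) * p 0 x \<le> b * p (- a) x + a * p b x" using ab by (simp add: pos_le_divide_eq mult.commute)
      then show ?case using ab by (simp add: qp_def qm_def field_simps)
    qed
  qed
  define e where "e n = (1/2::real)^n" for n
  have e: "e n > 0" for n by (simp add: e_def)
  have e0: "e \<longlonglongrightarrow> 0" unfolding e_def by (rule LIMSEQ_realpow_zero) auto
  \<comment> \<open>The infimum of the right quotients. The cut at \<open>qm (e 0) x\<close> bounds
    them below at every point and has no effect where the quotients are ordered.\<close>
  define k where "k x = (INF n. max (qp (e n) x) (qm (e 0) x))" for x
  have bdd: "bdd_below (range (\<lambda>n. max (qp (e n) x) (qm (e 0) x)))" for x
    by (rule bdd_belowI2[of _ "qm (e 0) x"]) auto
  have km: "k \<in> borel_measurable m"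
    unfolding k_def using qint by (intro borel_measurable_cINF bdd borel_measurable_max) auto
  have "AE x in m. \<forall>n j. qm (e n) x \<le> qp (e j) x"
    unfolding AE_all_countable using qle e by blast
  then have kle: "AE x in m. \<forall>n. qm (e n) x \<le> k x \<and> k x \<le> qp (e n) x"
  proof eventually_elim
    case (elim x)
    have "k x \<le> max (qp (e n) x) (qm (e 0) x)" for n unfolding k_def by (rule cINF_lower[OF bdd]) simp
    moreover have "qm (e n) x \<le> k x" for n
      unfolding k_def by (rule cINF_greatest) (use elim in \<open>auto intro: max.coboundedI1\<close>)
    ultimately show ?case using elim by (metis max.absorb1)
  qed
  have kint: "integrable m k"
  proof (rule Bochner_Integration.integrable_bound)
    show "integrable m (\<lambda>x. \<bar>qm (e 0) x\<bar> + \<bar>qp (e 0) x\<bar>)" using qint by auto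
    show "AE x in m. norm (k x) \<le> norm (\<bar>qm (e 0) x\<bar> + \<bar>qp (e 0) x\<bar>)"
      using kle
    proof eventually_elim
      case (elim x)
      have "qm (e 0) x \<le> k x" "k x \<le> qp (e 0) x" using elim by blast+
      then show ?case unfolding real_norm_def by linarith
    qed
  qed (rule km)
  \<comment> \<open>The integrated quotients differ from \<open>E f g\<close> by
    \<open>e n / 2 * energy g\<close> on either side and enclose the integral of
    \<open>k\<close>.\<close>
  have kI: "(\<integral>x. k x \<partial>m) = E f g"
  proof (rule LIMSEQ_unique)
    show "(\<lambda>n::nat. \<integral>x. k x \<partial>m) \<longlonglongrightarrow> (\<integral>x. k x \<partial>m)" by simp
    show "(\<lambda>n::nat. \<integral>x. k x \<partial>m) \<longlonglongrightarrow> E f g"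
    proof (rule tendsto_sandwich)
      show "\<forall>\<^sub>F n in sequentially. E f g - e n / 2 * energy g \<le> (\<integral>x. k x \<partial>m)"
      proof (intro always_eventually allI)
        fix n
        have "(\<integral>x. qm (e n) x \<partial>m) \<le> (\<integral>x. k x \<partial>m)"
          by (rule integral_mono_AE[OF qint(2) kint]) (use kle in \<open>auto elim: eventually_mono\<close>)
        then show "E f g - e n / 2 * energy g \<le> (\<integral>x. k x \<partial>m)" using e[of n] by (simp add: qmI)
      qed
      show "\<forall>\<^sub>F n in sequentially. (\<integral>x. k x \<partial>m) \<le> E f g + e n / 2 * energy g"
      proof (intro always_eventually allI)
        fix n
        have "(\<integral>x. k x \<partial>m) \<le> (\<integral>x. qp (e n) x \<partial>m)"
          by (rule integral_mono_AE[OF kint qint(1)]) (use kle in \<open>auto elim: eventually_mono\<close>)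
        then show "(\<integral>x. k x \<partial>m) \<le> E f g + e n / 2 * energy g" using e[of n] by (simp add: qpI)
      qed
      have "(\<lambda>n. E f g - e n / 2 * energy g) \<longlonglongrightarrow> E f g - 0 / 2 * energy g"
        by (intro tendsto_intros e0) simp
      then show "(\<lambda>n. E f g - e n / 2 * energy g) \<longlonglongrightarrow> E f g" by simp
      have "(\<lambda>n. E f g + e n / 2 * energy g) \<longlonglongrightarrow> E f g + 0 / 2 * energy g"
        by (intro tendsto_intros e0) simp
      then show "(\<lambda>n. E f g + e n / 2 * energy g) \<longlonglongrightarrow> E f g" by simp
    qed
  qed
  \<comment> \<open>Because the energy is exactly quadratic, the gap between right and left
    quotients has integral \<open>e n * energy g\<close>; so it tends to 0 almost everywhere along a
    subsequence.\<close>
  have "\<exists>r::nat\<Rightarrow>nat. strict_mono r \<and> (AE x in m. (\<lambda>n. qp (e (r n)) x - qm (e (r n)) x) \<longlonglongrightarrow> 0)"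
  proof (rule tendsto_L1_AE_subseq)
    show "integrable m (\<lambda>x. qp (e n) x - qm (e n) x)" for n by (intro Bochner_Integration.integrable_diff qint)
    have "(\<integral>x. norm (qp (e n) x - qm (e n) x) \<partial>m) = e n * energy g" for n
    proof -
      have "(\<integral>x. norm (qp (e n) x - qm (e n) x) \<partial>m) = (\<integral>x. qp (e n) x - qm (e n) x \<partial>m)"
        by (rule integral_cong_AE) (use qle[OF e e, of n n] qint in \<open>auto elim: eventually_mono\<close>)
      also have "\<dots> = e n * energy g"
        using e[of n] qint by (simp add: qpI qmI)
      finally show ?thesis .
    qed
    moreover have "(\<lambda>n. e n * energy g) \<longlonglongrightarrow> 0 * energy g" by (intro tendsto_intros e0)
    ultimately show "(\<lambda>n. \<integral>x. norm (qp (e n) x - qm (e n) x) \<partial>m) \<longlonglongrightarrow> 0" by simp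
  qed
  then obtain r :: "nat \<Rightarrow> nat" where r: "strict_mono r" and gap: "AE x in m. (\<lambda>n. qp (e (r n)) x - qm (e (r n)) x) \<longlonglongrightarrow> 0"
    by blast
  have lims: "AE x in m. (\<lambda>n. qp (e (r n)) x) \<longlonglongrightarrow> k x \<and> (\<lambda>n. qm (e (r n)) x) \<longlonglongrightarrow> k x"
    using gap kle
  proof eventually_elim
    case (elim x)
    have "(\<lambda>n. qp (e (r n)) x - k x) \<longlonglongrightarrow> 0"
      by (rule tendsto_0_if_le[OF _ elim(1)]) (use elim(2) in \<open>auto simp: algebra_simps\<close>)
    moreover have "(\<lambda>n. k x - qm (e (r n)) x) \<longlonglongrightarrow> 0"
      by (rule tendsto_0_if_le[OF _ elim(1)]) (use elim(2) in \<open>auto simp: algebra_simps\<close>)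
    then have "(\<lambda>n. k x - (k x - qm (e (r n)) x)) \<longlonglongrightarrow> k x - 0" by (intro tendsto_intros)
    ultimately show ?case by (simp add: LIM_zero_iff)
  qed
  have er0: "(\<lambda>n. e (r n)) \<longlonglongrightarrow> 0" using LIMSEQ_subseq_LIMSEQ[OF e0 r] by (simp add: o_def)
  \<comment> \<open>For a single real \<open>t\<close> the limits along dyadic steps still compare
    with the quotient at \<open>t\<close>, which makes \<open>2 * k x\<close> a subgradient at
    0.\<close>
  have sub1: "AE x in m. p 0 x + 2 * t * k x \<le> p t x" for t
  proof (cases t "0::real" rule: linorder_cases)
    case equal
    then show ?thesis by simp
  next
    case greater
    have "AE x in m. \<forall>n. qm (e n) x \<le> qp t x" unfolding AE_all_countable using qle[OF e greater] by blast
    with lims show ?thesis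
    proof eventually_elim
      case (elim x)
      have "k x \<le> qp t x" by (rule LIMSEQ_le_const2[of "\<lambda>n. qm (e (r n)) x"]) (use elim in auto)
      then show ?case using greater by (simp add: qp_def field_simps)
    qed
  next
    case less
    then have "0 < - t" by simp
    then have "AE x in m. \<forall>n. qm (- t) x \<le> qp (e n) x" unfolding AE_all_countable using qle[OF _ e] by blast
    with lims show ?thesis
    proof eventually_elim
      case (elim x)
      have "qm (- t) x \<le> k x" by (rule LIMSEQ_le_const[of "\<lambda>n. qp (e (r n)) x"]) (use elim in auto)
      then show ?case using less by (simp add: qm_def field_simps)
    qed
  qed
  have sub: "AE x in m. a\<^sup>2 * (slope f x)\<^sup>2 + 2 * a * b * k x \<le> (slope (\<lambda>y. a * f y + b * g y) x)\<^sup>2" for a b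
  proof (cases "a = 0")
    case False
    have "(\<lambda>y. a * (f y + b / a * g y)) = (\<lambda>y. a * f y + b * g y)" using False by (auto simp: field_simps)
    with slope_scale[OF ftg[of "b / a"], of a]
    have "AE x in m. slope (\<lambda>y. a * f y + b * g y) x = \<bar>a\<bar> * slope (\<lambda>y. f y + b / a * g y) x" by simp
    with sub1[of "b / a"] show ?thesis
    proof eventually_elim
      case (elim x)
      have "a\<^sup>2 * (slope f x)\<^sup>2 + 2 * a * b * k x = a\<^sup>2 * (p 0 x + 2 * (b / a) * k x)"
        using False by (simp add: p0 field_simps power2_eq_square)
      also have "\<dots> \<le> a\<^sup>2 * p (b / a) x" by (intro mult_left_mono elim) simp
      finally show ?case unfolding elim(2) by (simp add: p_def power_mult_distrib)
    qed
  qed simp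
  \<comment> \<open>A lower bound with linear coefficient \<open>2 * \<kappa>\<close> and quadratic
    error gives \<open>\<kappa> \<le> k x\<close> from positive and
    \<open>k x \<le> \<kappa>\<close> from negative steps. Restricting to dyadic steps leaves
    countably many premises, so that they can be verified off one null set.\<close>
  have uniq: "AE x in m. \<forall>\<kappa> C. (\<forall>n. \<forall>\<sigma>\<in>{1,-1}. (slope f x)\<^sup>2 + 2 * (\<sigma> * (1/2)^n) * \<kappa> - C * (\<sigma> * (1/2)^n)\<^sup>2
        \<le> (slope (\<lambda>y. f y + (\<sigma> * (1/2)^n) * g y) x)\<^sup>2) \<longrightarrow> \<kappa> = k x"
    using lims
  proof eventually_elim
    case (elim x)
    show ?case
    proof (intro allI impI)
      fix \<kappa> C
      assume "\<forall>n. \<forall>\<sigma>\<in>{1,-1}. (slope f x)\<^sup>2 + 2 * (\<sigma> * (1/2)^n) * \<kappa> - C * (\<sigma> * (1/2)^n)\<^sup>2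
        \<le> (slope (\<lambda>y. f y + (\<sigma> * (1/2)^n) * g y) x)\<^sup>2"
      then have *: "p 0 x + 2 * (\<sigma> * e n) * \<kappa> - C * (\<sigma> * e n)\<^sup>2 \<le> p (\<sigma> * e n) x" if "\<sigma> \<in> {1, -1}" for \<sigma> n
        using that unfolding p0 unfolding p_def e_def by blast
      have "\<kappa> - C * e n / 2 \<le> qp (e n) x" for n
        using *[of 1 n] e[of n] by (simp add: qp_def field_simps power2_eq_square)
      moreover have "(\<lambda>n. \<kappa> - C * e (r n) / 2) \<longlonglongrightarrow> \<kappa> - C * 0 / 2" by (intro tendsto_intros er0) simp
      ultimately have "\<kappa> - C * 0 / 2 \<le> k x" using elim by (intro LIMSEQ_le[of _ _ "\<lambda>n. qp (e (r n)) x"]) auto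
      moreover have "qm (e n) x \<le> \<kappa> + C * e n / 2" for n
        using *[of "-1" n] e[of n] by (simp add: qm_def field_simps power2_eq_square)
      moreover have "(\<lambda>n. \<kappa> + C * e (r n) / 2) \<longlonglongrightarrow> \<kappa> + C * 0 / 2" by (intro tendsto_intros er0) simp
      ultimately have "\<kappa> \<le> k x" "k x \<le> \<kappa> + C * 0 / 2"
        using elim by (simp, intro LIMSEQ_le[of "\<lambda>n. qm (e (r n)) x" _ "\<lambda>n. \<kappa> + C * e (r n) / 2"]) auto
      then show "\<kappa> = k x" by simp
    qed
  qed
  show ?thesis by (rule that[OF kint kI sub uniq])
qed

lemma Linfty_minus_const: "f \<in> Linfty m \<Longrightarrow> (\<lambda>x. f x - c) \<in> Linfty m"
  using Linfty_lincomb[of f "\<lambda>x. 1" 1 "- c"] by (auto simp: Linfty_def)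

lemma slope_minus_const:
  assumes "f \<in> V"
  shows "AE x in m. slope (\<lambda>x. f x - c) x = slope f x"
  using slope_local[OF V_diff[OF assms V_const, of c] assms, of "- c"] by simp

text \<open>Both energies are computed pointwise by expanding \<open>f\<close> and \<open>\<phi>\<close> around rational
  approximations of their values.\<close>

lemma slope_sq_representation:
  assumes f: "f \<in> V \<inter> Linfty m" and \<phi>: "\<phi> \<in> V \<inter> Linfty m"
  shows "(\<integral>x. (slope f x)\<^sup>2 * \<phi> x \<partial>m) = - (1/2) * E (\<lambda>x. (f x)\<^sup>2) \<phi> + E f (\<lambda>x. f x * \<phi> x)"
proof -
  have fV: "f \<in> V" and \<phi>V: "\<phi> \<in> V" using f \<phi> by auto
  define w where "w x = (f x)\<^sup>2" for x
  have w_eq: "w = (\<lambda>x. f x * f x)" by (auto simp: w_def power2_eq_square)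
  have w: "w \<in> V" using V_mult(1)[OF f f] by (simp add: w_eq)
  define z where "z x = f x * \<phi> x" for x
  have z: "z \<in> V" using V_mult(1)[OF f \<phi>] by (simp add: z_def[abs_def])
  \<comment> \<open>\<open>k1\<close>, \<open>k2\<close> and \<open>k3\<close> are the derivatives
    of \<open>f\<close> along \<open>\<phi>\<close>, of \<open>f\<close> along
    \<open>f \<phi>\<close> and of \<open>f^2\<close> along \<open>\<phi>\<close>. The last two are
    computed from \<open>k1\<close>.\<close>
  obtain k1 where k1: "integrable m k1"
    "\<And>a b. AE x in m. a\<^sup>2 * (slope f x)\<^sup>2 + 2 * a * b * k1 x \<le> (slope (\<lambda>y. a * f y + b * \<phi> y) x)\<^sup>2"
    by (rule directional_derivative[OF fV \<phi>V]) (rule that)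
  obtain k2 where k2: "integrable m k2" "(\<integral>x. k2 x \<partial>m) = E f z"
    "AE x in m. \<forall>\<kappa> C. (\<forall>n. \<forall>\<sigma>\<in>{1,-1}. (slope f x)\<^sup>2 + 2 * (\<sigma> * (1/2)^n) * \<kappa> - C * (\<sigma> * (1/2)^n)\<^sup>2
        \<le> (slope (\<lambda>y. f y + (\<sigma> * (1/2)^n) * z y) x)\<^sup>2) \<longrightarrow> \<kappa> = k2 x"
    by (rule directional_derivative[OF fV z]) (rule that)
  obtain k3 where k3: "integrable m k3" "(\<integral>x. k3 x \<partial>m) = E w \<phi>"
    "AE x in m. \<forall>\<kappa> C. (\<forall>n. \<forall>\<sigma>\<in>{1,-1}. (slope w x)\<^sup>2 + 2 * (\<sigma> * (1/2)^n) * \<kappa> - C * (\<sigma> * (1/2)^n)\<^sup>2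
        \<le> (slope (\<lambda>y. w y + (\<sigma> * (1/2)^n) * \<phi> y) x)\<^sup>2) \<longrightarrow> \<kappa> = k3 x"
    by (rule directional_derivative[OF w \<phi>V]) (rule that)
  have wt: "(\<lambda>y. w y + t * \<phi> y) \<in> V" for t using V_lincomb[OF w \<phi>V, of 1 t] by simp
  have zt: "(\<lambda>y. f y + t * z y) \<in> V" for t using V_lincomb[OF fV z, of 1 t] by simp
  have sw: "AE x in m. slope w x \<le> 2 * \<bar>f x\<bar> * slope f x"
    using V_mult(2)[OF f f] unfolding w_eq by eventually_elim simp
  have first: "AE x in m. (slope w x)\<^sup>2 + 2 * t * (2 * f x * k1 x) \<le> (slope (\<lambda>y. w y + t * \<phi> y) x)\<^sup>2" for t
  proof -
    \<comment> \<open>\<open>f^2 = 2 c f - c^2 + (f - c)^2\<close>, and the slope of the last term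
      is at most \<open>2 |f - c| slope f\<close>, a bound that vanishes where
      \<open>f x = c\<close>.\<close>
    have rat: "AE x in m. 4 * c\<^sup>2 * (slope f x)\<^sup>2 + 4 * c * t * k1 x \<le> (slope (\<lambda>y. w y + t * \<phi> y) x + 2 * \<bar>f x - c\<bar> * slope f x)\<^sup>2" for c
    proof -
      have fc: "(\<lambda>x. f x - c) \<in> V \<inter> Linfty m" using f V_diff[OF fV V_const] Linfty_minus_const by auto
      have ff: "(\<lambda>x. (f x - c) * (f x - c)) \<in> V" using V_mult(1)[OF fc fc] by auto
      have cf: "(\<lambda>y. 2 * c * f y + t * \<phi> y) \<in> V" by (intro V_lincomb fV \<phi>V)
      have 1: "AE x in m. \<bar>slope (\<lambda>y. 2 * c * f y + t * \<phi> y) x - slope (\<lambda>y. w y + t * \<phi> y) x\<bar>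
          \<le> slope (\<lambda>x. (2 * c * f x + t * \<phi> x) - (w x + t * \<phi> x)) x"
        by (rule slope_diff_le[OF cf wt[of t]])
      have 2: "AE x in m. slope (\<lambda>x. (2 * c * f x + t * \<phi> x) - (w x + t * \<phi> x)) x = slope (\<lambda>x. (-1) * ((f x - c) * (f x - c))) x"
        using slope_local[OF V_diff[OF cf wt[of t]] V_scale[OF ff, of "-1"], of "c\<^sup>2"]
        by (simp add: w_eq power2_eq_square algebra_simps)
      have 3: "AE x in m. slope (\<lambda>x. (-1) * ((f x - c) * (f x - c))) x = slope (\<lambda>x. (f x - c) * (f x - c)) x"
        using slope_scale[OF ff, of "-1"] by simp
      show ?thesis
        using 1 2 3 V_mult(2)[OF fc fc] slope_minus_const[OF fV, of c] k1(2)[of "2 * c" t]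
          slope_nonneg[OF cf] slope_nonneg[OF wt, of t] slope_nonneg[OF fV]
      proof eventually_elim
        case (elim x)
        have "4 * c\<^sup>2 * (slope f x)\<^sup>2 + 4 * c * t * k1 x \<le> (slope (\<lambda>y. 2 * c * f y + t * \<phi> y) x)\<^sup>2"
          using elim(6) by (simp add: power_mult_distrib)
        also have "\<dots> \<le> (slope (\<lambda>y. w y + t * \<phi> y) x + 2 * \<bar>f x - c\<bar> * slope f x)\<^sup>2"
        proof (rule power_mono[OF _ elim(7)])
          have "slope (\<lambda>x. (f x - c) * (f x - c)) x \<le> \<bar>f x - c\<bar> * slope f x + \<bar>f x - c\<bar> * slope f x"
            using elim(4,5) by simp
          then show "slope (\<lambda>y. 2 * c * f y + t * \<phi> y) x \<le> slope (\<lambda>y. w y + t * \<phi> y) x + 2 * \<bar>f x - c\<bar> * slope f x"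
            using elim(1-3) by linarith
        qed
        finally show ?case .
      qed
    qed
    \<comment> \<open>Rational \<open>c\<close> leave a single null set; continuity in
      \<open>c\<close> then permits \<open>c = f x\<close>.\<close>
    have "AE x in m. \<forall>c::rat. 4 * (of_rat c)\<^sup>2 * (slope f x)\<^sup>2 + 4 * of_rat c * t * k1 x
        \<le> (slope (\<lambda>y. w y + t * \<phi> y) x + 2 * \<bar>f x - of_rat c\<bar> * slope f x)\<^sup>2"
      unfolding AE_all_countable using rat by blast
    then show ?thesis
      using sw slope_nonneg[OF w]
    proof eventually_elim
      case (elim x)
      have "0 \<le> (slope (\<lambda>y. w y + t * \<phi> y) x + 2 * \<bar>f x - c\<bar> * slope f x)\<^sup>2 - (4 * c\<^sup>2 * (slope f x)\<^sup>2 + 4 * c * t * k1 x)" for c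
        by (rule nonneg_if_nonneg_on_rats) (use elim(1) in \<open>auto intro!: continuous_intros\<close>)
      from this[of "f x"] have "4 * (f x)\<^sup>2 * (slope f x)\<^sup>2 + 4 * f x * t * k1 x \<le> (slope (\<lambda>y. w y + t * \<phi> y) x)\<^sup>2"
        by simp
      moreover have "(slope w x)\<^sup>2 \<le> (2 * \<bar>f x\<bar> * slope f x)\<^sup>2" using elim by (intro power_mono)
      ultimately show ?case by (simp add: power_mult_distrib algebra_simps)
    qed
  qed
  have second: "AE x in m. (1 + t * \<phi> x)\<^sup>2 * (slope f x)\<^sup>2 + 2 * (1 + t * \<phi> x) * (t * f x) * k1 x
      \<le> (slope (\<lambda>y. f y + t * z y) x)\<^sup>2" for t
  proof -
    \<comment> \<open>\<open>f + t f \<phi> = (1 + t b) f + t c \<phi> + t (f - c) (\<phi> - b) - t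
      c b\<close>; the Leibniz bound for the product term vanishes where \<open>f x = c\<close> and
      \<open>\<phi> x = b\<close>.\<close>
    have rat: "AE x in m. (1 + t * b)\<^sup>2 * (slope f x)\<^sup>2 + 2 * (1 + t * b) * (t * c) * k1 x
        \<le> (slope (\<lambda>y. f y + t * z y) x + \<bar>t\<bar> * (\<bar>\<phi> x - b\<bar> * slope f x + \<bar>f x - c\<bar> * slope \<phi> x))\<^sup>2" for b c
    proof -
      have fc: "(\<lambda>x. f x - c) \<in> V \<inter> Linfty m" using f V_diff[OF fV V_const] Linfty_minus_const by auto
      have \<phi>b: "(\<lambda>x. \<phi> x - b) \<in> V \<inter> Linfty m" using \<phi> V_diff[OF \<phi>V V_const] Linfty_minus_const by auto
      have ff: "(\<lambda>x. (f x - c) * (\<phi> x - b)) \<in> V" using V_mult(1)[OF fc \<phi>b] by auto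
      have cf: "(\<lambda>y. (1 + t * b) * f y + (t * c) * \<phi> y) \<in> V" by (intro V_lincomb fV \<phi>V)
      have 1: "AE x in m. \<bar>slope (\<lambda>y. (1 + t * b) * f y + (t * c) * \<phi> y) x - slope (\<lambda>y. f y + t * z y) x\<bar>
          \<le> slope (\<lambda>x. ((1 + t * b) * f x + (t * c) * \<phi> x) - (f x + t * z x)) x"
        by (rule slope_diff_le[OF cf zt[of t]])
      have 2: "AE x in m. slope (\<lambda>x. ((1 + t * b) * f x + (t * c) * \<phi> x) - (f x + t * z x)) x =
          slope (\<lambda>x. (- t) * ((f x - c) * (\<phi> x - b))) x"
        using slope_local[OF V_diff[OF cf zt[of t]] V_scale[OF ff, of "- t"], of "t * c * b"]
        by (simp add: z_def algebra_simps)
      have 3: "AE x in m. slope (\<lambda>x. (- t) * ((f x - c) * (\<phi> x - b))) x = \<bar>t\<bar> * slope (\<lambda>x. (f x - c) * (\<phi> x - b)) x"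
        using slope_scale[OF ff, of "- t"] by simp
      show ?thesis
        using 1 2 3 V_mult(2)[OF fc \<phi>b] slope_minus_const[OF fV, of c] slope_minus_const[OF \<phi>V, of b]
          k1(2)[of "1 + t * b" "t * c"] slope_nonneg[OF cf] slope_nonneg[OF zt, of t]
      proof eventually_elim
        case (elim x)
        have "\<bar>t\<bar> * slope (\<lambda>x. (f x - c) * (\<phi> x - b)) x \<le> \<bar>t\<bar> * (\<bar>\<phi> x - b\<bar> * slope f x + \<bar>f x - c\<bar> * slope \<phi> x)"
          using elim by (intro mult_left_mono) auto
        then have le: "slope (\<lambda>y. (1 + t * b) * f y + (t * c) * \<phi> y) x \<le>
            slope (\<lambda>y. f y + t * z y) x + \<bar>t\<bar> * (\<bar>\<phi> x - b\<bar> * slope f x + \<bar>f x - c\<bar> * slope \<phi> x)"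
          using elim by linarith
        have "(1 + t * b)\<^sup>2 * (slope f x)\<^sup>2 + 2 * (1 + t * b) * (t * c) * k1 x \<le> (slope (\<lambda>y. (1 + t * b) * f y + (t * c) * \<phi> y) x)\<^sup>2"
          using elim(7) .
        also have "\<dots> \<le> (slope (\<lambda>y. f y + t * z y) x + \<bar>t\<bar> * (\<bar>\<phi> x - b\<bar> * slope f x + \<bar>f x - c\<bar> * slope \<phi> x))\<^sup>2"
          by (rule power_mono[OF le elim(8)])
        finally show ?case .
      qed
    qed
    have "AE x in m. \<forall>b c::rat. (1 + t * of_rat b)\<^sup>2 * (slope f x)\<^sup>2 + 2 * (1 + t * of_rat b) * (t * of_rat c) * k1 x
        \<le> (slope (\<lambda>y. f y + t * z y) x + \<bar>t\<bar> * (\<bar>\<phi> x - of_rat b\<bar> * slope f x + \<bar>f x - of_rat c\<bar> * slope \<phi> x))\<^sup>2"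
      unfolding AE_all_countable using rat by blast
    then show ?thesis
    proof eventually_elim
      case (elim x)
      define F where "F b c = (slope (\<lambda>y. f y + t * z y) x + \<bar>t\<bar> * (\<bar>\<phi> x - b\<bar> * slope f x + \<bar>f x - c\<bar> * slope \<phi> x))\<^sup>2 -
          ((1 + t * b)\<^sup>2 * (slope f x)\<^sup>2 + 2 * (1 + t * b) * (t * c) * k1 x)" for b c
      have "0 \<le> F (of_rat b) (of_rat c)" for b c using elim by (simp add: F_def)
      then have "0 \<le> F (of_rat b) c" for b c
        by (rule nonneg_if_nonneg_on_rats[rotated]) (auto simp: F_def intro!: continuous_intros)
      then have "0 \<le> F b c" for b c
        by (rule nonneg_if_nonneg_on_rats[rotated]) (auto simp: F_def intro!: continuous_intros)
      from this[of "\<phi> x" "f x"] show ?case by (simp add: F_def)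
    qed
  qed
  have "AE x in m. \<forall>n. \<forall>\<sigma>\<in>{1,-1}. (slope w x)\<^sup>2 + 2 * (\<sigma> * (1/2)^n) * (2 * f x * k1 x) \<le>
      (slope (\<lambda>y. w y + (\<sigma> * (1/2)^n) * \<phi> y) x)\<^sup>2"
    unfolding AE_all_countable using AE_conjI[OF first[of "1 * _"] first[of "-1 * _"]] by simp
  with k3(3) have k3_eq: "AE x in m. 2 * f x * k1 x = k3 x"
  proof eventually_elim
    case (elim x)
    show ?case
      by (rule elim(1)[rule_format, of _ 0]) (use elim(2) in auto)
  qed
  have "AE x in m. \<forall>n. \<forall>\<sigma>\<in>{1,-1}. (1 + \<sigma> * (1/2)^n * \<phi> x)\<^sup>2 * (slope f x)\<^sup>2 + 2 * (1 + \<sigma> * (1/2)^n * \<phi> x) * (\<sigma> * (1/2)^n * f x) * k1 x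
      \<le> (slope (\<lambda>y. f y + \<sigma> * (1/2)^n * z y) x)\<^sup>2"
    unfolding AE_all_countable using AE_conjI[OF second[of "1 * _"] second[of "-1 * _"]] by simp
  with k2(3) have k2_eq: "AE x in m. \<phi> x * (slope f x)\<^sup>2 + f x * k1 x = k2 x"
  proof eventually_elim
    case (elim x)
    \<comment> \<open>Minus the coefficient of \<open>t^2\<close> in the expansion that
      follows.\<close>
    define C where "C = - ((\<phi> x)\<^sup>2 * (slope f x)\<^sup>2 + 2 * \<phi> x * f x * k1 x)"
    have eq: "(1 + t * \<phi> x)\<^sup>2 * (slope f x)\<^sup>2 + 2 * (1 + t * \<phi> x) * (t * f x) * k1 x =
        (slope f x)\<^sup>2 + 2 * t * (\<phi> x * (slope f x)\<^sup>2 + f x * k1 x) - C * t\<^sup>2" for t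
      by (simp add: C_def power2_eq_square algebra_simps)
    show ?case
      by (rule elim(1)[rule_format, of _ C]) (use elim(2) in \<open>simp only: eq\<close>)
  qed
  have sm: "slope f \<in> borel_measurable m" and fm: "f \<in> borel_measurable m" and \<phi>m: "\<phi> \<in> borel_measurable m"
    using slope_measurable[OF fV] V_measurable[OF fV] V_measurable[OF \<phi>V] by auto
  have k1m: "k1 \<in> borel_measurable m" "k2 \<in> borel_measurable m" "k3 \<in> borel_measurable m" using k1 k2 k3 by auto
  \<comment> \<open>\<open>k2 = \<phi> |D f|^2 + f k1\<close> and \<open>k3 = 2 f k1\<close>, so
    \<open>f k1\<close> drops out of \<open>k2 - k3 / 2\<close>.\<close>
  have "(\<integral>x. (slope f x)\<^sup>2 * \<phi> x \<partial>m) = (\<integral>x. k2 x - (1/2) * k3 x \<partial>m)"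
    by (rule integral_cong_AE) (use k2_eq k3_eq sm fm \<phi>m k1m in \<open>auto elim!: eventually_elim2 simp: algebra_simps\<close>)
  also have "\<dots> = E f z - (1/2) * E w \<phi>" using k2 k3 by simp
  finally show ?thesis by (simp add: w_def[abs_def] z_def[abs_def])
qed

end

section \<open>The carre du champ as polarized squared slope\<close>

context hilbertian_space
begin

definition slope_form :: "('a \<Rightarrow> real) \<Rightarrow> ('a \<Rightarrow> real) \<Rightarrow> 'a \<Rightarrow> real" where
  "slope_form f g x = ((slope (\<lambda>y. f y + g y) x)\<^sup>2 - (slope (\<lambda>y. f y - g y) x)\<^sup>2) / 4"

lemma slope_form_integrable: "f \<in> V \<Longrightarrow> g \<in> V \<Longrightarrow> integrable m (slope_form f g)"
  unfolding slope_form_def[abs_def]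
  by (intro integrable_divide Bochner_Integration.integrable_diff slope_sq_integrable V_add V_diff)

lemma slope_form_sym:
  assumes "f \<in> V" "g \<in> V"
  shows "AE x in m. slope_form f g x = slope_form g f x"
  using slope_diff_commute[OF assms] by eventually_elim (simp add: slope_form_def add.commute)

lemma slope_form_diag:
  assumes "f \<in> V"
  shows "AE x in m. slope_form f f x = (slope f x)\<^sup>2"
proof -
  have "(\<lambda>y. f y + f y) = (\<lambda>y. 2 * f y)" by auto
  then show ?thesis
    using slope_scale[OF assms, of 2] slope_const[of 0] by (auto elim!: eventually_elim2 simp: slope_form_def power_mult_distrib)
qed

lemma V_Linfty_lincomb: "f \<in> V \<inter> Linfty m \<Longrightarrow> g \<in> V \<inter> Linfty m \<Longrightarrow> (\<lambda>x. a * f x + b * g x) \<in> V \<inter> Linfty m"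
  by (auto intro: V_lincomb Linfty_lincomb)

lemma weighted_integrable:
  assumes "integrable m h" "\<phi> \<in> Cb"
  shows "integrable m (\<lambda>x. h x * \<phi> x)"
proof -
  obtain C where C: "0 \<le> C" "\<And>x. \<bar>\<phi> x\<bar> \<le> C" using Cb_bound[OF assms(2)] by metis
  show ?thesis
  proof (rule Bochner_Integration.integrable_bound[where f="\<lambda>x. C * h x"])
    show "AE x in m. norm (h x * \<phi> x) \<le> norm (C * h x)"
      using C by (simp add: abs_mult mult.commute[of C] mult_left_mono)
  qed (use assms Cb_measurable in auto)
qed

text \<open>For fixed nonnegative \<open>\<phi>\<close>, \<open>slope_sq_representation\<close>
  expresses the integral of \<open>|D u|^2 \<phi>\<close> through the bilinear \<open>E\<close>; so
  it obeys the parallelogram law in \<open>u\<close> and \<open>Jordan_von_Neumann\<close> applies.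
  Varying \<open>\<phi>\<close> makes the identity pointwise.\<close>

lemma slope_form_bilinear_bounded:
  assumes f: "f \<in> V \<inter> Linfty m" and g: "g \<in> V \<inter> Linfty m" and h: "h \<in> V \<inter> Linfty m"
  shows "AE x in m. slope_form (\<lambda>x. a * f x + b * g x) h x = a * slope_form f h x + b * slope_form g h x"
proof -
  have fgh: "f \<in> V" "g \<in> V" "h \<in> V" "(\<lambda>x. a * f x + b * g x) \<in> V" using assms by (auto intro: V_lincomb)
  have "AE x in m. slope_form (\<lambda>x. a * f x + b * g x) h x - (a * slope_form f h x + b * slope_form g h x) = 0"
  proof (rule AE_zero_if_orthogonal)
    show "integrable m (\<lambda>x. slope_form (\<lambda>x. a * f x + b * g x) h x - (a * slope_form f h x + b * slope_form g h x))"
      by (intro Bochner_Integration.integrable_diff Bochner_Integration.integrable_add integrable_mult_right slope_form_integrable fgh)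
    fix \<phi> assume \<phi>L: "\<phi> \<in> Lip_b d" and \<phi>0: "\<And>x. 0 \<le> \<phi> x"
    have \<phi>: "\<phi> \<in> V \<inter> Linfty m" using \<phi>L Lip_b_subset_V Cb_subset_Linfty[OF Lip_b_Cb] by blast
    have \<phi>V: "\<phi> \<in> V" using \<phi> by simp
    define F where "F u = (\<integral>x. (slope u x)\<^sup>2 * \<phi> x \<partial>m)" for u
    have F: "F u = - (1/2) * E (\<lambda>x. u x * u x) \<phi> + E u (\<lambda>x. u x * \<phi> x)" if "u \<in> V \<inter> Linfty m" for u
      using slope_sq_representation[OF that \<phi>] by (simp add: F_def power2_eq_square)
    have int: "integrable m (\<lambda>x. (slope u x)\<^sup>2 * \<phi> x)" if "u \<in> V" for u
      by (rule weighted_integrable[OF slope_sq_integrable[OF that] Lip_b_Cb[OF \<phi>L]])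
    have par: "F (\<lambda>x. u x + v x) + F (\<lambda>x. u x - v x) = 2 * F u + 2 * F v"
      if u: "u \<in> V \<inter> Linfty m" and v: "v \<in> V \<inter> Linfty m" for u v
    proof -
      have uv: "u \<in> V" "v \<in> V" using u v by auto
      have W: "(\<lambda>x. u x + v x) \<in> V \<inter> Linfty m" "(\<lambda>x. u x - v x) \<in> V \<inter> Linfty m"
        using V_Linfty_lincomb[OF u v, of 1 1] V_Linfty_lincomb[OF u v, of 1 "-1"] by auto
      have p: "(\<lambda>x. u x * \<phi> x) \<in> V" "(\<lambda>x. v x * \<phi> x) \<in> V" "(\<lambda>x. u x * u x) \<in> V" "(\<lambda>x. v x * v x) \<in> V" "(\<lambda>x. u x * v x) \<in> V"
        using V_mult(1)[OF u \<phi>] V_mult(1)[OF v \<phi>] V_mult(1)[OF u u] V_mult(1)[OF v v] V_mult(1)[OF u v] by auto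
      \<comment> \<open>Expansion in a parameter \<open>s\<close>, so that terms odd in
        \<open>s\<close> cancel between \<open>s = 1\<close> and \<open>s = -1\<close>.\<close>
      have E1: "E (\<lambda>x. u x + s * v x) (\<lambda>x. (u x + s * v x) * \<phi> x) =
          E u (\<lambda>x. u x * \<phi> x) + s * E u (\<lambda>x. v x * \<phi> x) + s * E v (\<lambda>x. u x * \<phi> x) + s * s * E v (\<lambda>x. v x * \<phi> x)" for s
      proof -
        have e: "(\<lambda>x. (u x + s * v x) * \<phi> x) = (\<lambda>x. 1 * (u x * \<phi> x) + s * (v x * \<phi> x))" by (auto simp: algebra_simps)
        have k: "(\<lambda>x. 1 * (u x * \<phi> x) + s * (v x * \<phi> x)) \<in> V" by (intro V_lincomb p)
        show ?thesis
          using E_linear[OF uv k, of 1 s] E_linear2[OF p(1,2) uv(1), of 1 s] E_linear2[OF p(1,2) uv(2), of 1 s]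
          unfolding e by (simp add: algebra_simps)
      qed
      have E2: "E (\<lambda>x. (u x + s * v x) * (u x + s * v x)) \<phi> =
          E (\<lambda>x. u x * u x) \<phi> + 2 * s * E (\<lambda>x. u x * v x) \<phi> + s * s * E (\<lambda>x. v x * v x) \<phi>" for s
      proof -
        have e: "(\<lambda>x. (u x + s * v x) * (u x + s * v x)) =
            (\<lambda>x. 1 * (1 * (u x * u x) + (2 * s) * (u x * v x)) + (s * s) * (v x * v x))" by (auto simp: algebra_simps)
        have k: "(\<lambda>x. 1 * (u x * u x) + (2 * s) * (u x * v x)) \<in> V" by (intro V_lincomb p)
        show ?thesis
          unfolding e E_linear[OF k p(4) \<phi>V] E_linear[OF p(3,5) \<phi>V] by simp
      qed
      show ?thesis
        using F[OF W(1)] F[OF W(2)] F[OF u] F[OF v] E1[of 1] E1[of "-1"] E2[of 1] E2[of "-1"]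
        by (simp add: field_simps)
    qed
    have hom: "F (\<lambda>x. s * u x) = s\<^sup>2 * F u" if "u \<in> V \<inter> Linfty m" for u s
    proof -
      have u: "u \<in> V" using that by simp
      have "F (\<lambda>x. s * u x) = (\<integral>x. s\<^sup>2 * ((slope u x)\<^sup>2 * \<phi> x) \<partial>m)"
        unfolding F_def
        by (rule integral_cong_AE)
          (use slope_scale[OF u, of s] slope_measurable[OF u] slope_measurable[OF V_scale[OF u]] V_measurable[OF \<phi>V]
            in \<open>auto elim!: eventually_mono simp: power_mult_distrib\<close>)
      then show ?thesis by (simp add: F_def)
    qed
    have nn: "0 \<le> F u" for u unfolding F_def using \<phi>0 by simp
    have gF: "(\<integral>x. slope_form u v x * \<phi> x \<partial>m) = (F (\<lambda>x. u x + v x) - F (\<lambda>x. u x - v x)) / 4" if "u \<in> V" "v \<in> V" for u v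
    proof -
      have "(\<lambda>x. slope_form u v x * \<phi> x) = (\<lambda>x. ((slope (\<lambda>y. u y + v y) x)\<^sup>2 * \<phi> x - (slope (\<lambda>y. u y - v y) x)\<^sup>2 * \<phi> x) / 4)"
        by (auto simp: slope_form_def left_diff_distrib)
      then show ?thesis using int[OF V_add[OF that]] int[OF V_diff[OF that]] by (simp add: F_def)
    qed
    have "(\<integral>x. (slope_form (\<lambda>x. a * f x + b * g x) h x - (a * slope_form f h x + b * slope_form g h x)) * \<phi> x \<partial>m) =
       (\<integral>x. slope_form (\<lambda>x. a * f x + b * g x) h x * \<phi> x - (a * (slope_form f h x * \<phi> x) + b * (slope_form g h x * \<phi> x)) \<partial>m)"
      by (rule Bochner_Integration.integral_cong) (auto simp: algebra_simps)
    also have "\<dots> = (\<integral>x. slope_form (\<lambda>x. a * f x + b * g x) h x * \<phi> x \<partial>m)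
        - (a * (\<integral>x. slope_form f h x * \<phi> x \<partial>m) + b * (\<integral>x. slope_form g h x * \<phi> x \<partial>m))"
      using weighted_integrable[OF slope_form_integrable Lip_b_Cb[OF \<phi>L]] fgh by simp
    also have "\<dots> = 0"
      unfolding gF[OF fgh(4,3)] gF[OF fgh(1,3)] gF[OF fgh(2,3)]
      using Jordan_von_Neumann(1)[of "V \<inter> Linfty m" F, OF V_Linfty_lincomb par hom nn f g h, of a b] by simp
    finally show "(\<integral>x. (slope_form (\<lambda>x. a * f x + b * g x) h x - (a * slope_form f h x + b * slope_form g h x)) * \<phi> x \<partial>m) = 0" .
  qed
  then show ?thesis by eventually_elim simp
qed

text \<open>The representation involves products and thus bounded functions. By locality the slopes
  at almost every \<open>x\<close> are unchanged under truncation at a level above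
  \<open>|f x|\<close>, \<open>|g x|\<close> and \<open>|h x|\<close>, so bilinearity carries
  over.\<close>

lemma slope_form_bilinear:
  assumes f: "f \<in> V" and g: "g \<in> V" and h: "h \<in> V"
  shows "AE x in m. slope_form (\<lambda>x. a * f x + b * g x) h x = a * slope_form f h x + b * slope_form g h x"
proof -
  define T where "T N u = (\<lambda>x. max (- real N) (min (real N) (u x :: real)))" for N and u :: "'a \<Rightarrow> real"
  have TW: "T N u \<in> V \<inter> Linfty m" if "u \<in> V" for N u
  proof -
    have "T N u \<in> V" unfolding T_def by (rule V_contraction[OF that clamp_contraction]) simp
    moreover have "AE x in m. \<bar>T N u x\<bar> \<le> real N" by (auto simp: T_def)
    ultimately show ?thesis using V_measurable by (auto simp: Linfty_def)
  qed
  have TV: "T N u \<in> V" if "u \<in> V" for N u using TW[OF that] by simp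
  let ?u = "\<lambda>x. a * f x + b * g x" and ?v = "\<lambda>N x. a * T N f x + b * T N g x"
  have uV: "?u \<in> V" and vV: "\<And>N. ?v N \<in> V" by (intro V_lincomb TV f g)+
  have local: "AE x in m. u x = v x \<and> w x = z x \<longrightarrow> slope_form u w x = slope_form v z x"
    if "u \<in> V" "v \<in> V" "w \<in> V" "z \<in> V" for u v w z
    using slope_cong_on[OF V_add[OF that(1,3)] V_add[OF that(2,4)]] slope_cong_on[OF V_diff[OF that(1,3)] V_diff[OF that(2,4)]]
    by eventually_elim (simp add: slope_form_def)
  have "AE x in m. \<forall>N. slope_form (?v N) (T N h) x = a * slope_form (T N f) (T N h) x + b * slope_form (T N g) (T N h) x"
    unfolding AE_all_countable by (intro allI slope_form_bilinear_bounded TW f g h)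
  moreover have "AE x in m. \<forall>N. ?u x = ?v N x \<and> h x = T N h x \<longrightarrow> slope_form ?u h x = slope_form (?v N) (T N h) x"
    unfolding AE_all_countable by (intro allI local uV vV TV h)
  moreover have "AE x in m. \<forall>N. f x = T N f x \<and> h x = T N h x \<longrightarrow> slope_form f h x = slope_form (T N f) (T N h) x"
    unfolding AE_all_countable by (intro allI local TV f h)
  moreover have "AE x in m. \<forall>N. g x = T N g x \<and> h x = T N h x \<longrightarrow> slope_form g h x = slope_form (T N g) (T N h) x"
    unfolding AE_all_countable by (intro allI local TV g h)
  ultimately show ?thesis
  proof eventually_elim
    case (elim x)
    obtain N where N: "max \<bar>f x\<bar> (max \<bar>g x\<bar> \<bar>h x\<bar>) \<le> real N" using real_arch_simple by blast
    then have eqs: "T N f x = f x" "T N g x = g x" "T N h x = h x" by (auto simp: T_def)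
    have "slope_form ?u h x = slope_form (?v N) (T N h) x" by (rule elim(2)[rule_format]) (simp only: eqs)
    moreover have "slope_form f h x = slope_form (T N f) (T N h) x" by (rule elim(3)[rule_format]) (simp only: eqs)
    moreover have "slope_form g h x = slope_form (T N g) (T N h) x" by (rule elim(4)[rule_format]) (simp only: eqs)
    ultimately show ?case using elim(1)[rule_format, of N] by (simp only:)
  qed
qed

lemma L1_bilinear_slope_form: "L1_bilinear m V slope_form"
  unfolding L1_bilinear_def using slope_form_integrable slope_form_sym slope_form_bilinear by blast

lemma L1_bilinear_subset: "L1_bilinear m W B \<Longrightarrow> W' \<subseteq> W \<Longrightarrow> L1_bilinear m W' B"
  unfolding L1_bilinear_def by (meson subsetD)

lemma carre_du_champ_slope_form: "carre_du_champ m V E slope_form"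
  unfolding carre_du_champ_def
proof (intro conjI ballI)
  show "L1_bilinear m (V \<inter> Linfty m) slope_form" by (rule L1_bilinear_subset[OF L1_bilinear_slope_form]) simp
  fix f \<phi> assume f: "f \<in> V \<inter> Linfty m" and \<phi>: "\<phi> \<in> V \<inter> Linfty m"
  have fV: "f \<in> V" "\<phi> \<in> V" using f \<phi> by auto
  have "(\<integral>x. slope_form f f x * \<phi> x \<partial>m) = (\<integral>x. (slope f x)\<^sup>2 * \<phi> x \<partial>m)"
    by (rule integral_cong_AE)
      (use slope_form_diag[OF fV(1)] slope_form_integrable[OF fV(1,1)] slope_measurable[OF fV(1)] V_measurable[OF fV(2)]
        in \<open>auto elim!: eventually_mono\<close>)
  then show "(\<integral>x. slope_form f f x * \<phi> x \<partial>m) = - (1/2) * E (\<lambda>x. (f x)\<^sup>2) \<phi> + E f (\<lambda>x. f x * \<phi> x)"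
    using slope_sq_representation[OF f \<phi>] by simp
qed

text \<open>By bilinearity the difference quotient misses \<open>slope_form f g\<close> by exactly
  \<open>\<epsilon> / 2\<close> times the squared slope of \<open>g\<close>.\<close>

lemma slope_form_limit:
  assumes f: "f \<in> V" and g: "g \<in> V"
  shows "L1_tendsto m (\<lambda>\<epsilon> x. ((slope (\<lambda>y. f y + \<epsilon> * g y) x)\<^sup>2 - (slope f x)\<^sup>2) / (2 * \<epsilon>)) (slope_form f g) (at_right 0)"
  unfolding L1_tendsto_def
proof (intro conjI)
  let ?Q = "\<lambda>\<epsilon> x. ((slope (\<lambda>y. f y + \<epsilon> * g y) x)\<^sup>2 - (slope f x)\<^sup>2) / (2 * \<epsilon>)"
  have u: "(\<lambda>y. f y + \<epsilon> * g y) \<in> V" for \<epsilon> using V_lincomb[OF f g, of 1 \<epsilon>] by simp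
  show "integrable m (slope_form f g)" by (rule slope_form_integrable[OF f g])
  have Qint: "integrable m (?Q \<epsilon>)" for \<epsilon>
    by (intro integrable_divide Bochner_Integration.integrable_diff slope_sq_integrable u f)
  then show "\<forall>\<^sub>F \<epsilon> in at_right 0. integrable m (?Q \<epsilon>)" by simp
  have dist: "(\<integral>x. \<bar>?Q \<epsilon> x - slope_form f g x\<bar> \<partial>m) = \<epsilon> / 2 * energy g" if "\<epsilon> > 0" for \<epsilon>
  proof -
    have "AE x in m. \<bar>?Q \<epsilon> x - slope_form f g x\<bar> = \<epsilon> / 2 * (slope g x)\<^sup>2"
      using slope_form_diag[OF u[of \<epsilon>]] slope_form_bilinear[OF f g u[of \<epsilon>], of 1 \<epsilon>] slope_form_sym[OF f u[of \<epsilon>]] slope_form_sym[OF g u[of \<epsilon>]]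
        slope_form_bilinear[OF f g f, of 1 \<epsilon>] slope_form_bilinear[OF f g g, of 1 \<epsilon>] slope_form_diag[OF f] slope_form_diag[OF g] slope_form_sym[OF f g]
    proof eventually_elim
      case (elim x)
      then have "(slope (\<lambda>y. f y + \<epsilon> * g y) x)\<^sup>2 = (slope f x)\<^sup>2 + 2 * \<epsilon> * slope_form f g x + \<epsilon>\<^sup>2 * (slope g x)\<^sup>2"
        by (simp add: power2_eq_square algebra_simps)
      then have "?Q \<epsilon> x - slope_form f g x = \<epsilon> / 2 * (slope g x)\<^sup>2"
        using that by (simp add: field_simps power2_eq_square)
      moreover have "0 \<le> \<epsilon> / 2 * (slope g x)\<^sup>2" using that by simp
      ultimately show ?case by (simp only: abs_of_nonneg)
    qed
    then have "(\<integral>x. \<bar>?Q \<epsilon> x - slope_form f g x\<bar> \<partial>m) = (\<integral>x. \<epsilon> / 2 * (slope g x)\<^sup>2 \<partial>m)"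
      by (rule integral_cong_AE[rotated 2]) (use Qint[of \<epsilon>] slope_form_integrable[OF f g] slope_measurable[OF g] in auto)
    then show ?thesis by (simp add: energy_def sqnorm_def)
  qed
  have "((\<lambda>\<epsilon>. \<epsilon> / 2 * energy g) \<longlongrightarrow> 0 / 2 * energy g) (at_right 0)"
    by (intro tendsto_intros) simp
  then have "((\<lambda>\<epsilon>. \<epsilon> / 2 * energy g) \<longlongrightarrow> 0) (at_right 0)" by simp
  then show "((\<lambda>\<epsilon>. \<integral>x. \<bar>?Q \<epsilon> x - slope_form f g x\<bar> \<partial>m) \<longlongrightarrow> 0) (at_right 0)"
    by (rule Lim_transform_eventually)
      (use eventually_at_right_less[of "0::real"] dist in \<open>auto elim!: eventually_mono\<close>)
qed

text \<open>The defining identity fixes the integrals of \<open>\<Gamma> f f\<close> against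
  Lipschitz test functions; off the diagonal, bilinearity and symmetry reduce
  \<open>\<Gamma>\<close> to polarization.\<close>

lemma carre_du_champ_unique:
  assumes \<Gamma>: "carre_du_champ m V E \<Gamma>"
  shows "f \<in> V \<inter> Linfty m \<Longrightarrow> AE x in m. \<Gamma> f f x = (slope f x)\<^sup>2"
    and "f \<in> V \<inter> Linfty m \<Longrightarrow> g \<in> V \<inter> Linfty m \<Longrightarrow> AE x in m. slope_form f g x = \<Gamma> f g x"
proof -
  have bil: "L1_bilinear m (V \<inter> Linfty m) \<Gamma>"
    and rep: "\<And>f \<phi>. f \<in> V \<inter> Linfty m \<Longrightarrow> \<phi> \<in> V \<inter> Linfty m \<Longrightarrow>
        (\<integral>x. \<Gamma> f f x * \<phi> x \<partial>m) = - (1/2) * E (\<lambda>x. (f x)\<^sup>2) \<phi> + E f (\<lambda>x. f x * \<phi> x)"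
    using \<Gamma> unfolding carre_du_champ_def by blast+
  have \<Gamma>int: "\<And>f g. f \<in> V \<inter> Linfty m \<Longrightarrow> g \<in> V \<inter> Linfty m \<Longrightarrow> integrable m (\<Gamma> f g)"
    and \<Gamma>sym: "\<And>f g. f \<in> V \<inter> Linfty m \<Longrightarrow> g \<in> V \<inter> Linfty m \<Longrightarrow> AE x in m. \<Gamma> f g x = \<Gamma> g f x"
    and \<Gamma>lin: "\<And>f g h a b. f \<in> V \<inter> Linfty m \<Longrightarrow> g \<in> V \<inter> Linfty m \<Longrightarrow> h \<in> V \<inter> Linfty m \<Longrightarrow>
        AE x in m. \<Gamma> (\<lambda>x. a * f x + b * g x) h x = a * \<Gamma> f h x + b * \<Gamma> g h x"
    using bil unfolding L1_bilinear_def by blast+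
  show diag: "AE x in m. \<Gamma> f f x = (slope f x)\<^sup>2" if f: "f \<in> V \<inter> Linfty m" for f
  proof -
    have fV: "f \<in> V" using f by simp
    have "AE x in m. \<Gamma> f f x - (slope f x)\<^sup>2 = 0"
    proof (rule AE_zero_if_orthogonal)
      show "integrable m (\<lambda>x. \<Gamma> f f x - (slope f x)\<^sup>2)"
        by (intro Bochner_Integration.integrable_diff \<Gamma>int f slope_sq_integrable fV)
      fix \<phi> assume \<phi>L: "\<phi> \<in> Lip_b d"
      have \<phi>: "\<phi> \<in> V \<inter> Linfty m" using \<phi>L Lip_b_subset_V Cb_subset_Linfty[OF Lip_b_Cb] by blast
      note w = weighted_integrable[OF _ Lip_b_Cb[OF \<phi>L]]
      show "(\<integral>x. (\<Gamma> f f x - (slope f x)\<^sup>2) * \<phi> x \<partial>m) = 0"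
        using w[OF \<Gamma>int[OF f f]] w[OF slope_sq_integrable[OF fV]] rep[OF f \<phi>] slope_sq_representation[OF f \<phi>]
        by (simp add: left_diff_distrib)
    qed
    then show ?thesis by eventually_elim simp
  qed
  show "AE x in m. slope_form f g x = \<Gamma> f g x" if f: "f \<in> V \<inter> Linfty m" and g: "g \<in> V \<inter> Linfty m" for f g
  proof -
    have u: "(\<lambda>x. 1 * f x + s * g x) \<in> V \<inter> Linfty m" for s by (rule V_Linfty_lincomb[OF f g])
    have exp: "AE x in m. (slope (\<lambda>x. 1 * f x + s * g x) x)\<^sup>2 = \<Gamma> f f x + 2 * s * \<Gamma> f g x + s * s * \<Gamma> g g x" for s
      using diag[OF u[of s]] \<Gamma>lin[OF f g u[of s], of 1 s] \<Gamma>sym[OF f u[of s]] \<Gamma>sym[OF g u[of s]]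
        \<Gamma>lin[OF f g f, of 1 s] \<Gamma>lin[OF f g g, of 1 s] \<Gamma>sym[OF f g]
    proof eventually_elim
      case (elim x)
      then show ?case by (simp add: algebra_simps)
    qed
    show ?thesis using exp[of 1] exp[of "-1"]
      by eventually_elim (simp add: slope_form_def)
  qed
qed

section \<open>Closedness, Markov property and strong locality of the energy\<close>

lemma closed_form_Ch: "closed_form m V E"
  unfolding closed_form_def Let_def
proof (intro allI impI, elim conjE)
  fix F :: "nat \<Rightarrow> 'a \<Rightarrow> real"
  assume F: "\<forall>n. F n \<in> V"
  have N: "(\<integral>x. (f x - g x)\<^sup>2 \<partial>m) + E (\<lambda>x. f x - g x) (\<lambda>x. f x - g x) = sqnorm m (\<lambda>x. f x - g x) + energy (\<lambda>x. f x - g x)"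
    if "f \<in> V" "g \<in> V" for f g
    using E_diag[OF V_diff[OF that]] by (simp add: sqnorm_def)
  assume "\<forall>e>0. \<exists>k. \<forall>i\<ge>k. \<forall>j\<ge>k. (\<integral>x. (F i x - F j x)\<^sup>2 \<partial>m) + E (\<lambda>x. F i x - F j x) (\<lambda>x. F i x - F j x) < e"
  then have Cauchy: "\<exists>k. \<forall>i\<ge>k. \<forall>j\<ge>k. sqnorm m (\<lambda>x. F i x - F j x) + energy (\<lambda>x. F i x - F j x) < e" if "e > 0" for e
    using F that by (simp add: N)
  have "\<exists>k. \<forall>i\<ge>k. \<forall>j\<ge>k. sqnorm m (\<lambda>x. F i x - F j x) < e" if e: "e > 0" for e
  proof -
    obtain k where k: "\<And>i j. i \<ge> k \<Longrightarrow> j \<ge> k \<Longrightarrow> sqnorm m (\<lambda>x. F i x - F j x) + energy (\<lambda>x. F i x - F j x) < e"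
      using Cauchy[OF e] by blast
    have "sqnorm m (\<lambda>x. F i x - F j x) < e" if "i \<ge> k" "j \<ge> k" for i j
      using k[OF that] energy_nonneg[of "\<lambda>x. F i x - F j x"] by linarith
    then show ?thesis by blast
  qed
  then obtain f where f: "L2_tendsto m F f"
    by (rule L2_complete[of F m, rotated]) (use F V_L2 in blast)+
  have fL: "f \<in> L2 m" using f by (simp add: L2_tendsto_iff)
  \<comment> \<open>Lower semicontinuity of \<open>Ch\<close>, applied to \<open>F i - F j\<close>
    as \<open>j\<close> tends to infinity, carries the Cauchy estimate to the limit.\<close>
  have tail: "Ch m d (\<lambda>x. F i x - f x) \<le> ennreal e" if k: "\<And>j. j \<ge> k \<Longrightarrow> energy (\<lambda>x. F i x - F j x) < e" for i k e
  proof (rule Ch_lsc)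
    show "L2_tendsto m (\<lambda>n x. F i x - F (n + k) x) (\<lambda>x. F i x - f x)"
    proof -
      have "strict_mono (\<lambda>n. n + k)" by (auto intro: strict_monoI)
      from L2_tendsto_add[OF L2_tendsto_const[OF V_L2] L2_tendsto_scale[OF L2_tendsto_subseq[OF f this], of "-1"], of "F i"]
      show ?thesis using F by simp
    qed
    show "Ch m d (\<lambda>x. F i x - F (n + k) x) \<le> ennreal e" for n
      using Ch_energy[OF V_diff] F k[of "n + k"] by (auto intro!: ennreal_leI intro: less_imp_le)
  qed
  have en: "\<exists>k. \<forall>i\<ge>k. (\<lambda>x. F i x - f x) \<in> V \<and> energy (\<lambda>x. F i x - f x) \<le> e" if e: "e > 0" for e
  proof -
    obtain k where k: "\<And>i j. i \<ge> k \<Longrightarrow> j \<ge> k \<Longrightarrow> sqnorm m (\<lambda>x. F i x - F j x) + energy (\<lambda>x. F i x - F j x) < e"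
      using Cauchy[OF e] by blast
    have "(\<lambda>x. F i x - f x) \<in> V \<and> energy (\<lambda>x. F i x - f x) \<le> e" if i: "i \<ge> k" for i
    proof -
      have "energy (\<lambda>x. F i x - F j x) < e" if "j \<ge> k" for j
        using k[OF i that] sqnorm_nonneg[of m "\<lambda>x. F i x - F j x"] by linarith
      from tail[OF this] have le: "Ch m d (\<lambda>x. F i x - f x) \<le> ennreal e" by simp
      moreover have "(\<lambda>x. F i x - f x) \<in> L2 m" using F V_L2 fL by (auto intro: L2_diff)
      ultimately have "(\<lambda>x. F i x - f x) \<in> V" by (auto simp: Ch_domain_def intro: le_less_trans)
      then show ?thesis using le e by (simp add: Ch_energy)
    qed
    then show ?thesis by blast
  qed
  obtain k where k: "\<forall>i\<ge>k. (\<lambda>x. F i x - f x) \<in> V" using en[of 1] by auto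
  have "(\<lambda>x. F k x - (F k x - f x)) \<in> V" by (rule V_diff) (use k F in auto)
  then have fV: "f \<in> V" by simp
  show "\<exists>f\<in>V. (\<lambda>n. (\<integral>x. (F n x - f x)\<^sup>2 \<partial>m) + E (\<lambda>x. F n x - f x) (\<lambda>x. F n x - f x)) \<longlonglongrightarrow> 0"
  proof (rule bexI[OF _ fV])
    have "(\<lambda>n. energy (\<lambda>x. F n x - f x)) \<longlonglongrightarrow> 0"
    proof (rule LIMSEQ_I)
      fix e :: real assume "e > 0"
      then obtain k where "\<forall>i\<ge>k. energy (\<lambda>x. F i x - f x) \<le> e/2" using en[of "e/2"] by auto
      then show "\<exists>k. \<forall>n\<ge>k. norm (energy (\<lambda>x. F n x - f x) - 0) < e"
        using \<open>e > 0\<close> by (intro exI[of _ k]) force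
    qed
    moreover have "(\<lambda>n. sqnorm m (\<lambda>x. F n x - f x)) \<longlonglongrightarrow> 0" using f by (simp add: L2_tendsto_iff)
    ultimately have "(\<lambda>n. sqnorm m (\<lambda>x. F n x - f x) + energy (\<lambda>x. F n x - f x)) \<longlonglongrightarrow> 0 + 0"
      by (intro tendsto_add)
    then show "(\<lambda>n. (\<integral>x. (F n x - f x)\<^sup>2 \<partial>m) + E (\<lambda>x. F n x - f x) (\<lambda>x. F n x - f x)) \<longlonglongrightarrow> 0"
      using F fV by (simp add: N)
  qed
qed

lemma symmetric_form_Ch: "symmetric_form m V E"
  unfolding symmetric_form_def
proof (intro conjI ballI allI impI)
  show "V \<subseteq> L2 m" using V_L2 by blast
  show "(\<lambda>x. 0) \<in> V" by (rule V_const)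
  show "(\<lambda>x. a * f x + b * g x) \<in> V" if "f \<in> V" "g \<in> V" for f g a b using that by (rule V_lincomb)
  show "g \<in> V" if "f \<in> V" "g \<in> borel_measurable m" "AE x in m. f x = g x" for f g by (rule V_cong[OF that])
  show "E g h = E f h" if "f \<in> V" "g \<in> borel_measurable m" "AE x in m. f x = g x" "h \<in> V" for f g h
  proof -
    have g: "g \<in> V" by (rule V_cong[OF that(1-3)])
    have "energy (\<lambda>x. f x + h x) = energy (\<lambda>x. g x + h x)"
      unfolding energy_def
      by (rule sqnorm_cong_AE[OF _ _ slope_cong])
        (use that g in \<open>auto intro!: slope_measurable V_add V_measurable[OF V_add] elim: eventually_mono\<close>)
    moreover have "energy (\<lambda>x. f x - h x) = energy (\<lambda>x. g x - h x)"
      unfolding energy_def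
      by (rule sqnorm_cong_AE[OF _ _ slope_cong])
        (use that g in \<open>auto intro!: slope_measurable V_diff V_measurable[OF V_diff] elim: eventually_mono\<close>)
    ultimately show ?thesis using that g by (simp add: E_energy)
  qed
  show "E f g = E g f" if "f \<in> V" "g \<in> V" for f g using that by (rule E_sym)
  show "E (\<lambda>x. a * f x + b * g x) h = a * E f h + b * E g h" if "f \<in> V" "g \<in> V" "h \<in> V" for f g h a b
    using that by (rule E_linear)
  show "0 \<le> E f f" if "f \<in> V" for f using that by (simp add: E_diag)
qed

lemma Markovian_form_Ch: "Markovian_form V E"
  unfolding Markovian_form_def
proof (intro allI impI ballI)
  fix \<eta> :: "real \<Rightarrow> real" and f
  assume "\<eta> 0 = 0 \<and> (\<forall>s t. \<bar>\<eta> s - \<eta> t\<bar> \<le> \<bar>s - t\<bar>)" and f: "f \<in> V"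
  then have \<eta>: "\<bar>\<eta> s - \<eta> t\<bar> \<le> 1 * \<bar>s - t\<bar>" for s t by simp
  have V: "\<eta> \<circ> f \<in> V" using V_contraction[OF f \<eta>] by (simp add: o_def)
  have "AE x in m. \<bar>slope (\<lambda>x. \<eta> (f x)) x\<bar> \<le> \<bar>slope f x\<bar>"
    using slope_contraction[OF f \<eta>] slope_nonneg[OF V] by (auto elim!: eventually_elim2 simp: o_def)
  then have "energy (\<eta> \<circ> f) \<le> energy f"
    unfolding energy_def using slope_measurable[OF V]
    by (intro sqnorm_mono slope_L2 f) (auto simp: o_def)
  then show "\<eta> \<circ> f \<in> V \<and> E (\<eta> \<circ> f) (\<eta> \<circ> f) \<le> E f f" using V f by (simp add: E_diag)
qed

text \<open>Where \<open>g\<close> vanishes, \<open>f + g\<close> and \<open>f - g\<close> agree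
  with \<open>f\<close>; elsewhere \<open>f\<close> is the constant \<open>- a\<close> and they are
  translates of \<open>g\<close> and \<open>- g\<close>. So their slopes agree almost everywhere,
  and polarization gives 0.\<close>

lemma strongly_local_form_Ch: "strongly_local_form m V E"
  unfolding strongly_local_form_def
proof (intro ballI impI, elim exE)
  fix f g a assume f: "f \<in> V" and g: "g \<in> V" and 0: "AE x in m. (f x + a) * g x = 0"
  have fg: "(\<lambda>x. f x + g x) \<in> V" "(\<lambda>x. f x - g x) \<in> V" by (intro V_add V_diff f g)+
  have g': "(\<lambda>x. - 1 * g x) \<in> V" by (rule V_scale[OF g])
  have "AE x in m. slope (\<lambda>x. f x + g x) x = slope (\<lambda>x. f x - g x) x"
    using slope_cong_on[OF fg(1) f] slope_cong_on[OF fg(2) f] slope_local[OF fg(1) g, of "- a"]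
      slope_local[OF fg(2) g', of "- a"] slope_scale[OF g, of "-1"] 0
  proof eventually_elim
    case (elim x)
    show ?case
    proof (cases "g x = 0")
      case True
      then show ?thesis using elim(1,2) by simp
    next
      case False
      then have "f x = - a" using elim(6) by simp
      then show ?thesis using elim(3-5) by simp
    qed
  qed
  then have "energy (\<lambda>x. f x + g x) = energy (\<lambda>x. f x - g x)"
    unfolding energy_def by (intro sqnorm_cong_AE slope_measurable fg)
  then show "E f g = 0" using f g by (simp add: E_energy)
qed

lemma energy_measure_space_Ch: "energy_measure_space m V E"
proof -
  have "densely_defined m V"
    unfolding densely_defined_def using Lip_b_dense Lip_b_subset_V unfolding sqnorm_def by blast
  then show ?thesis
    unfolding energy_measure_space_def Dirichlet_form_def
    using symmetric_form_Ch closed_form_Ch Markovian_form_Ch strongly_local_form_Ch carre_du_champ_slope_form prob_space_axioms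
    by blast
qed

end

section \<open>The intrinsic distance\<close>

context ext_metric_measure
begin

definition unit_slope :: "('a \<Rightarrow> real) set" where
  "unit_slope = {f \<in> V \<inter> Cb. AE x in m. slope f x \<le> 1}"

text \<open>The energy distance expressed through slopes; \<open>energy_distance_eq_dE\<close>
  identifies it with the one defined by \<open>\<Gamma>\<close>.\<close>

definition dE :: "'a \<Rightarrow> 'a \<Rightarrow> ennreal" where
  "dE x y = (SUP f\<in>unit_slope. ennreal \<bar>f x - f y\<bar>)"

lemma unit_slope_const: "(\<lambda>x. c) \<in> unit_slope"
  using slope_const[of c] by (auto simp: unit_slope_def V_const Cb_def elim: eventually_mono)

lemma unit_slope_contraction:
  fixes \<eta> :: "real \<Rightarrow> real"
  assumes "f \<in> unit_slope" "\<And>s t. \<bar>\<eta> s - \<eta> t\<bar> \<le> \<bar>s - t\<bar>"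
  shows "(\<lambda>x. \<eta> (f x)) \<in> unit_slope"
proof -
  have \<eta>: "\<bar>\<eta> s - \<eta> t\<bar> \<le> 1 * \<bar>s - t\<bar>" for s t using assms(2) by simp
  have f: "f \<in> V" "f \<in> Cb" "AE x in m. slope f x \<le> 1" using assms(1) by (auto simp: unit_slope_def)
  have "AE x in m. slope (\<lambda>x. \<eta> (f x)) x \<le> 1"
    using slope_contraction[OF f(1) \<eta>] f(3) by (auto elim!: eventually_elim2)
  then show ?thesis
    using V_contraction[OF f(1) \<eta>] Cb_compose[OF f(2) lipschitz_continuous[OF \<eta>]] by (simp add: unit_slope_def)
qed

lemma unit_slope_max:
  assumes "f \<in> unit_slope" "g \<in> unit_slope"
  shows "(\<lambda>x. max (f x) (g x)) \<in> unit_slope"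
proof -
  have fg: "f \<in> V" "g \<in> V" "f \<in> Cb" "g \<in> Cb" "AE x in m. slope f x \<le> 1" "AE x in m. slope g x \<le> 1"
    using assms by (auto simp: unit_slope_def)
  have "AE x in m. slope (\<lambda>x. max (f x) (g x)) x \<le> 1"
    using slope_max[OF fg(1,2)] fg(5,6) by eventually_elim simp
  then show ?thesis using fg by (simp add: unit_slope_def V_max Cb_max)
qed

lemma unit_slope_Lip_b:
  assumes "u \<in> Lip_b d" "ext_lipschitz d u 1"
  shows "u \<in> unit_slope"
  using assms slope_le_star[OF assms(1)] Lip_a_star_le[OF assms]
  by (auto simp: unit_slope_def Lip_b_subset_V Lip_b_Cb elim!: eventually_elim2)

lemma dE_ge: "f \<in> unit_slope \<Longrightarrow> ennreal \<bar>f x - f y\<bar> \<le> dE x y"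
  unfolding dE_def by (rule SUP_upper)

lemma less_dE: "c < dE x y \<longleftrightarrow> (\<exists>f\<in>unit_slope. c < ennreal \<bar>f x - f y\<bar>)"
  unfolding dE_def by (rule less_SUP_iff)

text \<open>A generating semidistance of \<open>d\<close> with one argument fixed is 1-Lipschitz,
  hence has slope at most one and competes in the supremum for \<open>dE\<close>.\<close>

lemma dist_le_dE: "d x y \<le> dE x y"
proof (rule dense_le)
  fix c assume "c < d x y"
  then obtain u where u: "u \<in> Lip_b d" "ext_lipschitz d u 1" "\<And>z. 0 \<le> u z" "u x = 0" "c < ennreal (u y)"
    by (rule Lip_b_witness) (rule that)
  have "c \<le> ennreal \<bar>u x - u y\<bar>" using u by simp
  also have "\<dots> \<le> dE x y" by (rule dE_ge[OF unit_slope_Lip_b[OF u(1,2)]])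
  finally show "c \<le> dE x y" .
qed

lemma extended_distance_dE: "extended_distance dE"
  unfolding extended_distance_def
proof (intro conjI allI)
  show "dE x y = dE y x" for x y unfolding dE_def by (simp add: abs_minus_commute)
  show "dE x z \<le> dE x y + dE y z" for x y z
    unfolding dE_def[of x z]
  proof (rule SUP_least)
    fix f assume f: "f \<in> unit_slope"
    have "ennreal \<bar>f x - f z\<bar> \<le> ennreal (\<bar>f x - f y\<bar> + \<bar>f y - f z\<bar>)" by (rule ennreal_leI) linarith
    also have "\<dots> \<le> dE x y + dE y z" using dE_ge[OF f] by (auto simp: ennreal_plus intro: add_mono)
    finally show "ennreal \<bar>f x - f z\<bar> \<le> dE x y + dE y z" .
  qed
  show "dE x y = 0 \<longleftrightarrow> x = y" for x y
  proof
    assume "dE x y = 0"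
    then have "d x y = 0" using dist_le_dE[of x y] by simp
    then show "x = y" by (simp add: dist_eq_0)
  next
    assume "x = y"
    then show "dE x y = 0" using SUP_least[of unit_slope "\<lambda>f. ennreal \<bar>f x - f y\<bar>" 0] by (simp add: dE_def)
  qed
qed

lemma Lip_b_subset_Lip_b_dE: "u \<in> Lip_b d \<Longrightarrow> u \<in> Lip_b dE"
  using LIP_antimono(2)[OF extended_distance_dE dist_le_dE] by (auto simp: Lip_b_def)

lemma generate_topology_mono:
  assumes "generate_topology A U" "A \<subseteq> B"
  shows "generate_topology B U"
  using assms(1) by induction (use assms(2) in \<open>auto intro: generate_topology.intros\<close>)

text \<open>Each \<open>f\<close> in \<open>unit_slope\<close> contributes the continuous
  semidistance \<open>\<bar>f x - f y\<bar>\<close>. The generated topology stays the same, because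
  the class of Lipschitz functions grows but still consists of continuous functions.\<close>

lemma extended_metric_measure_space_dE: "extended_metric_measure_space dE m"
proof -
  have top: "open U \<longleftrightarrow> generate_topology {f -` S | f S. f \<in> Lip_b d \<and> open S} U" for U :: "'a set"
    using emms unfolding extended_metric_measure_space_def extended_metric_topological_space_def by blast
  have "open U \<longleftrightarrow> generate_topology {f -` S | f S. f \<in> Lip_b dE \<and> open S} U" for U :: "'a set"
  proof
    assume "open U"
    then show "generate_topology {f -` S | f S. f \<in> Lip_b dE \<and> open S} U"
      unfolding top by (rule generate_topology_mono) (use Lip_b_subset_Lip_b_dE in blast)
  next
    assume "generate_topology {f -` S | f S. f \<in> Lip_b dE \<and> open S} U"
    then show "open U"
    proof induction
      case (Basis U)
      then show ?case by (auto simp: Lip_b_def Cb_def intro!: open_vimage)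
    qed auto
  qed
  moreover have "\<exists>D :: ('a \<Rightarrow> 'a \<Rightarrow> real) set.
        (\<forall>\<delta>\<in>D. semidistance \<delta> \<and> (\<exists>C. \<forall>x y. \<delta> x y \<le> C) \<and> continuous_on UNIV (\<lambda>(x, y). \<delta> x y)) \<and>
        (\<forall>x y. dE x y = (SUP \<delta>\<in>D. ennreal (\<delta> x y)))"
  proof (intro exI[of _ "(\<lambda>f x y. \<bar>f x - f y\<bar>) ` unit_slope"] conjI ballI allI)
    fix \<delta> assume "\<delta> \<in> (\<lambda>f x y. \<bar>f x - f y\<bar>) ` unit_slope"
    then obtain f where f: "f \<in> Cb" and \<delta>: "\<delta> = (\<lambda>x y. \<bar>f x - f y\<bar>)" by (auto simp: unit_slope_def)
    show "semidistance \<delta>" unfolding semidistance_def \<delta> by auto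
    obtain C where C: "\<And>x. \<bar>f x\<bar> \<le> C" using Cb_bound[OF f] by metis
    have "\<delta> x y \<le> 2 * C" for x y using C[of x] C[of y] unfolding \<delta> by linarith
    then show "\<exists>C. \<forall>x y. \<delta> x y \<le> C" by blast
    show "continuous_on UNIV (\<lambda>(x, y). \<delta> x y)"
      unfolding \<delta> split_beta
      by (intro continuous_intros continuous_on_compose2[OF Cb_continuous[OF f]]) auto
  next
    show "dE x y = (SUP \<delta>\<in>(\<lambda>f x y. \<bar>f x - f y\<bar>) ` unit_slope. ennreal (\<delta> x y))" for x y
      by (simp add: dE_def image_comp)
  qed
  ultimately show ?thesis
    using emms extended_distance_dE
    unfolding extended_metric_measure_space_def extended_metric_topological_space_def by blast
qed

text \<open>
  Approximation of \<open>f\<close> by finite minima of functions \<open>f y + c (\<delta> x y)\<close>, where \<open>\<delta>\<close> approximates \<open>dE\<close> from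
  below and the cost \<open>c\<close> has slope \<open>L + \<epsilon>\<close> on \<open>[0, r/2]\<close> and is larger than the oscillation of \<open>f\<close> at
  distance \<open>r\<close>. The extra \<open>\<epsilon>\<close> makes a nearly optimal \<open>y\<close> stay within distance \<open>r/2\<close> of \<open>x\<close>, where
  only the slope \<open>L + \<epsilon>\<close> matters. As \<open>dE\<close> is merely lower semicontinuous, \<open>\<delta>\<close> is good on
  all of \<open>K\<close> only for \<open>x\<close> in compact subsets of some open set \<open>B\<close>.
\<close>

lemma local_slope_approximation:
  assumes f: "f \<in> Cb" and M: "0 < M" "\<And>x. \<bar>f x\<bar> \<le> M" and L: "0 \<le> L" and r: "0 < r" and \<epsilon>: "0 < \<epsilon>"
    and \<delta>0: "0 < \<delta>0" "4 * \<delta>0 \<le> \<epsilon> * r"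
    and A: "\<And>x y. x \<in> A \<Longrightarrow> dE x y < ennreal r \<Longrightarrow> f x - f y \<le> L * enn2real (dE x y)"
    and K: "compact K"
  obtains B where "open B" "A \<inter> K \<subseteq> B" "\<And>K'. compact K' \<Longrightarrow> K' \<subseteq> B \<inter> K \<Longrightarrow>
    \<exists>h\<in>V \<inter> Cb. (\<forall>x\<in>K'. \<bar>h x - f x\<bar> \<le> \<delta>0) \<and> (AE x in m. x \<in> K' \<longrightarrow> slope h x \<le> L + \<epsilon>) \<and>
      (AE x in m. slope h x \<le> L + 8 * M / r + \<epsilon>)"
proof -
  have fc: "continuous_on UNIV f" using f by (rule Cb_continuous)
  \<comment> \<open>The steep part of the cost starts at \<open>r/2\<close>; over a length
    \<open>r/4\<close> it climbs \<open>2 * M\<close>, a bound for the oscillation of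
    \<open>f\<close>.\<close>
  define S where "S = 8 * M / r"
  have S: "0 < S" "S * (r / 4) = 2 * M" using M r by (auto simp: S_def)
  define c1 where "c1 s = L * s + S * max 0 (s - r / 2)" for s
  define c2 where "c2 s = c1 s + \<epsilon> * s" for s
  have c1_mono: "c1 s \<le> c1 t" if "s \<le> t" for s t
    unfolding c1_def using that L S by (intro add_mono mult_left_mono) auto
  have c1_cont: "continuous_on UNIV c1" unfolding c1_def by (intro continuous_intros)
  have c2_cont: "continuous_on UNIV c2" unfolding c2_def c1_def by (intro continuous_intros)
  have c1_ge: "L * s \<le> c1 s" for s using S by (simp add: c1_def)
  have c1_nonneg: "0 \<le> c1 s" if "0 \<le> s" for s using L that c1_ge[of s] by (meson mult_nonneg_nonneg order_trans)
  have c1_far: "2 * M \<le> c1 s" if "3 / 4 * r \<le> s" for s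
  proof -
    have "r / 4 \<le> max 0 (s - r / 2)" using that by linarith
    then have "S * (r / 4) \<le> S * max 0 (s - r / 2)" using S by (intro mult_left_mono) auto
    moreover have "0 \<le> L * s" using L that r by (intro mult_nonneg_nonneg) auto
    ultimately show ?thesis unfolding c1_def S(2) by linarith
  qed
  have c2_lip: "\<bar>c2 s - c2 t\<bar> \<le> (L + S + \<epsilon>) * \<bar>s - t\<bar>" for s t
  proof -
    have "c2 s - c2 t = L * (s - t) + S * (max 0 (s - r / 2) - max 0 (t - r / 2)) + \<epsilon> * (s - t)"
      by (simp add: c2_def c1_def algebra_simps)
    also have "\<bar>\<dots>\<bar> \<le> L * \<bar>s - t\<bar> + S * \<bar>max 0 (s - r / 2) - max 0 (t - r / 2)\<bar> + \<epsilon> * \<bar>s - t\<bar>"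
      using abs_triangle_ineq[of "L * (s - t) + S * (max 0 (s - r / 2) - max 0 (t - r / 2))" "\<epsilon> * (s - t)"]
        abs_triangle_ineq[of "L * (s - t)" "S * (max 0 (s - r / 2) - max 0 (t - r / 2))"] L S(1) \<epsilon>
      by (simp add: abs_mult)
    also have "\<dots> \<le> L * \<bar>s - t\<bar> + S * \<bar>s - t\<bar> + \<epsilon> * \<bar>s - t\<bar>"
      using S(1) L \<epsilon> by (intro add_mono mult_left_mono) auto
    finally show ?thesis by (simp add: algebra_simps)
  qed
  \<comment> \<open>Admissible continuous approximations of \<open>dE\<close> from below. Only the
    first variable carries a slope bound, as \<open>y\<close> will be a fixed centre; the class is
    closed under maxima.\<close>
  define D where "D = {\<delta>. continuous_on UNIV (\<lambda>(x, y). \<delta> x y) \<and> (\<forall>x y. 0 \<le> \<delta> x y) \<and> (\<forall>y. \<delta> y y = 0) \<and>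
      (\<forall>y. (\<lambda>x. \<delta> x y) \<in> unit_slope)}"
  have D_0: "(\<lambda>x y. 0) \<in> D" using unit_slope_const[of 0] by (auto simp: D_def)
  have D_max: "(\<lambda>x y. max (\<delta> x y) (\<delta>' x y)) \<in> D" if "\<delta> \<in> D" "\<delta>' \<in> D" for \<delta> \<delta>'
    using that unit_slope_max unfolding D_def by (auto simp: split_beta le_max_iff_disj intro!: continuous_on_max)
  have D_fun: "(\<lambda>x y. \<bar>g x - g y\<bar>) \<in> D" if "g \<in> unit_slope" for g
  proof -
    have gc: "continuous_on UNIV g" using that by (simp add: unit_slope_def Cb_def)
    have "continuous_on UNIV (\<lambda>(x, y). \<bar>g x - g y\<bar>)"
      unfolding split_beta by (intro continuous_intros continuous_on_compose2[OF gc]) auto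
    moreover have "(\<lambda>x. \<bar>g x - g y\<bar>) \<in> unit_slope" for y
      by (rule unit_slope_contraction[OF that]) linarith
    ultimately show ?thesis by (simp add: D_def)
  qed
  \<comment> \<open>Centres \<open>y\<close> in \<open>W\<close> cannot pull the infimal convolution
    more than \<open>\<delta>0\<close> below \<open>f\<close> on \<open>U\<close>. Monotonicity of
    \<open>c1\<close> keeps this true when \<open>\<delta>\<close> grows, so finitely many choices
    merge into their maximum.\<close>
  define ok where "ok \<delta> U W \<longleftrightarrow> (\<forall>x\<in>U. \<forall>y\<in>W. f x - \<delta>0 < f y + c1 (\<delta> x y))" for \<delta> :: "'a \<Rightarrow> 'a \<Rightarrow> real" and U W
  have ok_max: "ok (\<lambda>x y. max (\<delta> x y) (\<delta>' x y)) U W" if "ok \<delta> U W \<or> ok \<delta>' U W" for \<delta> \<delta>' U W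
    using that c1_mono unfolding ok_def
    by (metis (no_types, lifting) add_left_mono less_le_trans max.cobounded1 max.cobounded2)
  define B where "B = \<Union>{U. open U \<and> (\<exists>\<delta>\<in>D. ok \<delta> U K)}"
  show ?thesis
  proof (rule that)
    show "open B" unfolding B_def by blast
    show "A \<inter> K \<subseteq> B"
    proof
      fix x assume x: "x \<in> A \<inter> K"
      \<comment> \<open>Here the centres range over the compact \<open>K\<close> while
        \<open>x\<close> keeps a neighbourhood; joint continuity of each \<open>\<delta>\<close>
        supplies the product neighbourhoods.\<close>
      define P where "P W \<longleftrightarrow> (\<exists>U. open U \<and> x \<in> U \<and> (\<exists>\<delta>\<in>D. ok \<delta> U W))" for W
      have "P K"
      proof (rule compact_local_induct[OF K])
        show "P {}" unfolding P_def ok_def using D_0 by (intro exI[of _ UNIV]) auto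
        show "P (W \<union> W')" if "P W" "P W'" for W W'
        proof -
          obtain U \<delta> where 1: "open U" "x \<in> U" "\<delta> \<in> D" "ok \<delta> U W" using \<open>P W\<close> unfolding P_def by blast
          obtain U' \<delta>' where 2: "open U'" "x \<in> U'" "\<delta>' \<in> D" "ok \<delta>' U' W'" using \<open>P W'\<close> unfolding P_def by blast
          have "ok \<delta> (U \<inter> U') W" "ok \<delta>' (U \<inter> U') W'" using 1 2 by (auto simp: ok_def)
          then have "ok (\<lambda>x y. max (\<delta> x y) (\<delta>' x y)) (U \<inter> U') W" "ok (\<lambda>x y. max (\<delta> x y) (\<delta>' x y)) (U \<inter> U') W'"
            using ok_max by blast+
          then have "ok (\<lambda>x y. max (\<delta> x y) (\<delta>' x y)) (U \<inter> U') (W \<union> W')" by (auto simp: ok_def)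
          then show ?thesis unfolding P_def using 1 2 D_max by blast
        qed
        show "P W" if "P W'" "W \<subseteq> W'" for W W' using that unfolding P_def ok_def by (meson subsetD)
        show "\<exists>W. open W \<and> y \<in> W \<and> P W" if "y \<in> K" for y
        proof -
          \<comment> \<open>Three cases: \<open>f y\<close> is not much below \<open>f x\<close>;
            \<open>y\<close> is close and the Lipschitz condition limits the gap; \<open>y\<close>
            is far and the steep part of \<open>c1\<close> exceeds the oscillation.\<close>
          have "\<exists>g\<in>unit_slope. f x - \<delta>0 < f y + c1 \<bar>g x - g y\<bar>"
          proof (cases "f x - f y < \<delta>0")
            case True
            then show ?thesis using unit_slope_const[of 0] by (intro bexI[of _ "\<lambda>x. 0"]) (auto simp: c1_def r less_imp_le)
          next
            case big: False
            show ?thesis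
            proof (cases "dE x y < ennreal r")
              case True
              then obtain D where D: "dE x y = ennreal D" "0 \<le> D" by (cases "dE x y") auto
              have le: "f x - f y \<le> L * D" using A[of x y] x True D by simp
              have "L \<noteq> 0" using le big \<delta>0(1) by auto
              then have L0: "0 < L" using L by simp
              have "(f x - f y - \<delta>0) / L < D" using le L0 \<delta>0(1) by (simp add: divide_less_eq mult.commute)
              moreover have "0 \<le> (f x - f y - \<delta>0) / L" using big L0 by simp
              ultimately have "ennreal ((f x - f y - \<delta>0) / L) < dE x y" by (simp add: D ennreal_less_iff)
              then obtain g where g: "g \<in> unit_slope" "ennreal ((f x - f y - \<delta>0) / L) < ennreal \<bar>g x - g y\<bar>"
                unfolding less_dE by blast
              have "(f x - f y - \<delta>0) / L < \<bar>g x - g y\<bar>" using g(2) \<open>0 \<le> (f x - f y - \<delta>0) / L\<close> by (simp add: ennreal_less_iff)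
              then have "f x - f y - \<delta>0 < L * \<bar>g x - g y\<bar>" using L0 by (simp add: pos_divide_less_eq mult.commute)
              then show ?thesis using g(1) c1_ge[of "\<bar>g x - g y\<bar>"] by (intro bexI[of _ g]) auto
            next
              case False
              have "ennreal (3 / 4 * r) < ennreal r" using r by (simp add: ennreal_less_iff)
              then have "ennreal (3 / 4 * r) < dE x y" using False by (simp add: not_less less_le_trans)
              then obtain g where g: "g \<in> unit_slope" "ennreal (3 / 4 * r) < ennreal \<bar>g x - g y\<bar>"
                unfolding less_dE by blast
              have "3 / 4 * r \<le> \<bar>g x - g y\<bar>" using g(2) r by (simp add: ennreal_less_iff)
              then have "2 * M \<le> c1 \<bar>g x - g y\<bar>" by (rule c1_far)
              then show ?thesis using g(1) M(2)[of x] M(2)[of y] \<delta>0(1) by (intro bexI[of _ g]) linarith+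
            qed
          qed
          then obtain g where g: "g \<in> unit_slope" "f x - \<delta>0 < f y + c1 \<bar>g x - g y\<bar>" by blast
          have gc: "continuous_on UNIV g" using g(1) by (simp add: unit_slope_def Cb_def)
          have "open {p. f (fst p) - \<delta>0 < f (snd p) + c1 \<bar>g (fst p) - g (snd p)\<bar>}"
            by (intro open_Collect_less continuous_intros continuous_on_compose2[OF fc] continuous_on_compose2[OF gc]
                continuous_on_compose2[OF c1_cont]) auto
          then obtain U W where UW: "open U" "open W" "x \<in> U" "y \<in> W"
            "U \<times> W \<subseteq> {p. f (fst p) - \<delta>0 < f (snd p) + c1 \<bar>g (fst p) - g (snd p)\<bar>}"
            using g(2) by (elim open_prod_elim[of _ "(x, y)"]) auto
          have "ok (\<lambda>x y. \<bar>g x - g y\<bar>) U W" using UW(5) by (auto simp: ok_def)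
          then have "P W" unfolding P_def using UW D_fun[OF g(1)] by blast
          then show ?thesis using UW by blast
        qed
      qed
      then show "x \<in> B" unfolding P_def B_def by blast
    qed
    fix K' assume K': "compact K'" "K' \<subseteq> B \<inter> K"
    have "\<exists>\<delta>\<in>D. ok \<delta> K' K"
    proof (rule compact_local_induct[OF K'(1), where P="\<lambda>W. \<exists>\<delta>\<in>D. ok \<delta> W K"])
      show "\<exists>\<delta>\<in>D. ok \<delta> {} K" using D_0 by (auto simp: ok_def)
      show "\<exists>\<delta>\<in>D. ok \<delta> (U \<union> U') K" if U: "\<exists>\<delta>\<in>D. ok \<delta> U K" "\<exists>\<delta>\<in>D. ok \<delta> U' K" for U U'
      proof -
        obtain \<delta> \<delta>' where \<delta>: "\<delta> \<in> D" "ok \<delta> U K" "\<delta>' \<in> D" "ok \<delta>' U' K" using U by blast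
        then have "ok (\<lambda>x y. max (\<delta> x y) (\<delta>' x y)) U K" "ok (\<lambda>x y. max (\<delta> x y) (\<delta>' x y)) U' K"
          using ok_max by blast+
        then have "ok (\<lambda>x y. max (\<delta> x y) (\<delta>' x y)) (U \<union> U') K" by (auto simp: ok_def)
        then show ?thesis using D_max \<delta> by blast
      qed
      show "\<exists>\<delta>\<in>D. ok \<delta> U K" if "\<exists>\<delta>\<in>D. ok \<delta> U' K" "U \<subseteq> U'" for U U' using that unfolding ok_def by (meson subsetD)
      show "\<exists>U. open U \<and> x \<in> U \<and> (\<exists>\<delta>\<in>D. ok \<delta> U K)" if "x \<in> K'" for x using K'(2) that unfolding B_def by blast
    qed
    then obtain \<delta> where \<delta>: "\<delta> \<in> D" "ok \<delta> K' K" by blast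
    \<comment> \<open>The sharp slope bound is imposed only where \<open>h\<close> is at most
      \<open>f + \<delta>0\<close>. In this form it survives minima, since the smaller function is
      the active one.\<close>
    define T where "T W \<longleftrightarrow> (\<exists>h\<in>V \<inter> Cb. (AE x in m. slope h x \<le> L + S + \<epsilon>) \<and>
        (AE x in m. x \<in> K' \<longrightarrow> h x \<le> f x + \<delta>0 \<longrightarrow> slope h x \<le> L + \<epsilon>) \<and>
        (\<forall>x\<in>W. h x \<le> f x + \<delta>0) \<and> (\<forall>x\<in>K'. f x - \<delta>0 \<le> h x))" for W
    have "T K'"
    proof (rule compact_local_induct[OF K'(1)])
      show "T {}"
        unfolding T_def
      proof (intro bexI[of _ "\<lambda>x. M"] conjI)
        show "AE x in m. slope (\<lambda>x. M) x \<le> L + S + \<epsilon>"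
          using slope_const[of M] by eventually_elim (use L S \<epsilon> in auto)
        show "AE x in m. x \<in> K' \<longrightarrow> M \<le> f x + \<delta>0 \<longrightarrow> slope (\<lambda>x. M) x \<le> L + \<epsilon>"
          using slope_const[of M] by eventually_elim (use L \<epsilon> in auto)
        show "\<forall>x\<in>K'. f x - \<delta>0 \<le> M"
        proof
          fix x
          show "f x - \<delta>0 \<le> M" using M(2)[of x] \<delta>0(1) by linarith
        qed
        show "(\<lambda>x. M) \<in> V \<inter> Cb" by (auto simp: V_const Cb_def)
      qed auto
      show "T (W \<union> W')" if T: "T W" "T W'" for W W'
      proof -
        obtain h where h: "h \<in> V" "h \<in> Cb" "AE x in m. slope h x \<le> L + S + \<epsilon>"
          "AE x in m. x \<in> K' \<longrightarrow> h x \<le> f x + \<delta>0 \<longrightarrow> slope h x \<le> L + \<epsilon>"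
          "\<forall>x\<in>W. h x \<le> f x + \<delta>0" "\<forall>x\<in>K'. f x - \<delta>0 \<le> h x"
          using T(1) unfolding T_def by blast
        obtain g where g: "g \<in> V" "g \<in> Cb" "AE x in m. slope g x \<le> L + S + \<epsilon>"
          "AE x in m. x \<in> K' \<longrightarrow> g x \<le> f x + \<delta>0 \<longrightarrow> slope g x \<le> L + \<epsilon>"
          "\<forall>x\<in>W'. g x \<le> f x + \<delta>0" "\<forall>x\<in>K'. f x - \<delta>0 \<le> g x"
          using T(2) unfolding T_def by blast
        show ?thesis
          unfolding T_def
        proof (intro bexI[of _ "\<lambda>x. min (h x) (g x)"] conjI)
          show "AE x in m. slope (\<lambda>x. min (h x) (g x)) x \<le> L + S + \<epsilon>"
            using slope_min[OF h(1) g(1)] h(3) g(3) by eventually_elim simp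
          show "AE x in m. x \<in> K' \<longrightarrow> min (h x) (g x) \<le> f x + \<delta>0 \<longrightarrow> slope (\<lambda>x. min (h x) (g x)) x \<le> L + \<epsilon>"
            using slope_min[OF h(1) g(1)] h(4) g(4) by eventually_elim (auto simp: min_def split: if_splits)
          show "(\<lambda>x. min (h x) (g x)) \<in> V \<inter> Cb" using h g V_min Cb_min by blast
        qed (use h g in \<open>auto simp: min_le_iff_disj\<close>)
      qed
      show "T W" if "T W'" "W \<subseteq> W'" for W W' using that unfolding T_def by (meson subsetD)
      show "\<exists>U. open U \<and> y \<in> U \<and> T U" if y: "y \<in> K'" for y
      proof -
        define q where "q x = f y + c2 (\<delta> x y)" for x
        have \<delta>y: "(\<lambda>x. \<delta> x y) \<in> V" "(\<lambda>x. \<delta> x y) \<in> Cb" "AE x in m. slope (\<lambda>x. \<delta> x y) x \<le> 1"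
          and \<delta>nn: "\<And>x. 0 \<le> \<delta> x y" "\<delta> y y = 0"
          using \<delta>(1) by (auto simp: D_def unit_slope_def)
        have qeta: "\<bar>(f y + c2 s) - (f y + c2 t)\<bar> \<le> (L + S + \<epsilon>) * \<bar>s - t\<bar>" for s t using c2_lip[of s t] by simp
        have S': "0 \<le> L + S + \<epsilon>" using L S \<epsilon> by simp
        have qV: "q \<in> V" unfolding q_def by (rule V_contraction[OF \<delta>y(1) qeta S'])
        have qC: "q \<in> Cb"
          unfolding q_def using c2_cont by (intro Cb_compose[OF \<delta>y(2), of "\<lambda>s. f y + c2 s"] continuous_intros)
        have 1: "AE x in m. slope q x \<le> L + S + \<epsilon>"
        proof -
          have "AE x in m. slope q x \<le> (L + S + \<epsilon>) * slope (\<lambda>x. \<delta> x y) x"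
            unfolding q_def by (rule slope_contraction[OF \<delta>y(1) qeta S'])
          then show ?thesis using \<delta>y(3)
          proof eventually_elim
            case (elim x)
            have "(L + S + \<epsilon>) * slope (\<lambda>x. \<delta> x y) x \<le> (L + S + \<epsilon>) * 1" by (intro mult_left_mono elim S')
            then show ?case using elim by simp
          qed
        qed
        have low: "f x - \<delta>0 < f y + c1 (\<delta> x y)" if "x \<in> K'" for x
          using \<delta>(2) that y K'(2) by (auto simp: ok_def)
        have 2: "AE x in m. x \<in> K' \<longrightarrow> q x \<le> f x + \<delta>0 \<longrightarrow> slope q x \<le> L + \<epsilon>"
          using slope_local[OF qV V_scale[OF \<delta>y(1), of "L + \<epsilon>"], of "f y"] slope_scale[OF \<delta>y(1), of "L + \<epsilon>"] \<delta>y(3)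
        proof eventually_elim
          case (elim x)
          show ?case
          proof (intro impI)
            assume x: "x \<in> K'" "q x \<le> f x + \<delta>0"
            \<comment> \<open>The upper bound contains \<open>c2\<close>, the lower bound
              \<open>c1\<close>; their comparison isolates the extra term of \<open>c2\<close>. Then
              \<open>4 * \<delta>0 \<le> \<epsilon> * r\<close> keeps \<open>\<delta> x y\<close>
              below \<open>r/2\<close>, where \<open>c2\<close> is linear.\<close>
            have "\<epsilon> * \<delta> x y < 2 * \<delta>0" using low[OF x(1)] x(2) by (simp add: q_def c2_def)
            then have "\<epsilon> * \<delta> x y < \<epsilon> * (r / 2)" using \<delta>0(2) by simp
            then have "\<delta> x y < r / 2" using \<epsilon> by simp
            then have "q x = (L + \<epsilon>) * \<delta> x y + f y" by (simp add: q_def c2_def c1_def algebra_simps)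
            then have "slope q x = \<bar>L + \<epsilon>\<bar> * slope (\<lambda>x. \<delta> x y) x" using elim by simp
            also have "\<dots> \<le> \<bar>L + \<epsilon>\<bar> * 1" by (intro mult_left_mono elim) simp
            finally show "slope q x \<le> L + \<epsilon>" using L \<epsilon> by simp
          qed
        qed
        have 3: "\<forall>x\<in>K'. f x - \<delta>0 \<le> q x"
        proof
          fix x assume "x \<in> K'"
          then show "f x - \<delta>0 \<le> q x" using low[of x] mult_nonneg_nonneg[OF less_imp_le[OF \<epsilon>] \<delta>nn(1)[of x]]
            by (simp add: q_def c2_def)
        qed
        have "open {x. q x < f x + \<delta>0}"
          by (intro open_Collect_less Cb_continuous[OF qC] continuous_intros fc)
        moreover have "q y < f y + \<delta>0" using \<delta>0 r by (simp add: q_def c2_def c1_def \<delta>nn(2))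
        moreover have "T {x. q x < f x + \<delta>0}"
          unfolding T_def using qV qC 1 2 3 by (intro bexI[of _ q]) auto
        ultimately show ?thesis by blast
      qed
    qed
    then obtain h where h: "h \<in> V \<inter> Cb" "AE x in m. slope h x \<le> L + S + \<epsilon>"
      "AE x in m. x \<in> K' \<longrightarrow> h x \<le> f x + \<delta>0 \<longrightarrow> slope h x \<le> L + \<epsilon>"
      "\<forall>x\<in>K'. h x \<le> f x + \<delta>0" "\<forall>x\<in>K'. f x - \<delta>0 \<le> h x"
      unfolding T_def by blast
    show "\<exists>h\<in>V \<inter> Cb. (\<forall>x\<in>K'. \<bar>h x - f x\<bar> \<le> \<delta>0) \<and> (AE x in m. x \<in> K' \<longrightarrow> slope h x \<le> L + \<epsilon>) \<and>
        (AE x in m. slope h x \<le> L + 8 * M / r + \<epsilon>)"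
    proof (intro bexI[OF _ h(1)] conjI ballI)
      show "\<bar>h x - f x\<bar> \<le> \<delta>0" if "x \<in> K'" for x using h(4,5) that by (auto simp: abs_le_iff)
      show "AE x in m. x \<in> K' \<longrightarrow> slope h x \<le> L + \<epsilon>" using h(3) by eventually_elim (use h(4) in auto)
      show "AE x in m. slope h x \<le> L + 8 * M / r + \<epsilon>" using h(2) by (simp add: S_def)
    qed
  qed
qed

section \<open>Slopes of functions that are Lipschitz for the energy distance\<close>

lemma compact_exhaustion:
  obtains K where "\<And>n. compact (K n)" "\<And>n. measure m (- K n) \<le> (1/2)^n"
proof -
  have "\<forall>n. \<exists>K. compact K \<and> measure m (- K) \<le> (1/2)^n"
  proof
    fix n :: nat
    obtain K where "compact K" "measure m (UNIV - K) \<le> (1/2)^n"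
      by (rule inner_compact[of UNIV "(1/2)^n"]) (auto simp: sets_m)
    then show "\<exists>K. compact K \<and> measure m (- K) \<le> (1/2)^n" by (auto simp: Compl_eq_Diff_UNIV)
  qed
  then show ?thesis using that by metis
qed

text \<open>The crude global slope bound of the approximations puts \<open>f\<close> into the
  domain; it is uniform in \<open>n\<close> because \<open>r\<close> and \<open>\<epsilon>\<close>
  are fixed at 1. A global Lipschitz constant lets \<open>A\<close> be the whole space.\<close>

lemma Lip_b_dE_subset_V:
  assumes "f \<in> Lip_b dE"
  obtains C where "0 \<le> C" "relaxed_pair f (\<lambda>x. C)"
proof -
  interpret D: ext_dist dE by unfold_locales (rule extended_distance_dE)
  have f: "f \<in> Cb" using assms by (rule Lip_b_Cb)
  obtain L where L: "ext_lipschitz dE f L" using assms by (auto simp: Lip_b_def)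
  then have L0: "0 \<le> L" by (simp add: ext_lipschitz_def)
  obtain M0 where M0: "0 \<le> M0" "\<And>x. \<bar>f x\<bar> \<le> M0" using Cb_bound[OF f] by metis
  \<comment> \<open>The summand 1 makes \<open>M\<close> positive even if \<open>f\<close>
    vanishes.\<close>
  define M where "M = M0 + 1"
  have M: "0 < M" "\<bar>f x\<bar> \<le> M" for x using M0(1) M0(2)[of x] by (auto simp: M_def)
  define C where "C = L + 8 * M / 1 + 1"
  have C: "0 \<le> C" using L0 M by (simp add: C_def)
  obtain K where K: "\<And>n. compact (K n)" "\<And>n. measure m (- K n) \<le> (1/2)^n" by (rule compact_exhaustion) (rule that)
  define e where "e n = (1/2)^n / (4::real)" for n :: nat
  have "\<forall>n. \<exists>h. h \<in> V \<inter> Cb \<and> (\<forall>x\<in>K n. \<bar>h x - f x\<bar> \<le> e n) \<and> (AE x in m. slope h x \<le> C)"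
  proof
    fix n
    have e: "0 < e n" "4 * e n \<le> 1 * 1" by (auto simp: e_def power_le_one)
    have lip: "f x - f y \<le> L * enn2real (dE x y)" if "x \<in> UNIV" "dE x y < ennreal 1" for x y
      using D.ext_lipschitz_enn2real[OF L, of x x 1 y] that D.dist_commute[of y x] by simp
    obtain B where "UNIV \<inter> K n \<subseteq> B" and B: "\<And>K'. compact K' \<Longrightarrow> K' \<subseteq> B \<inter> K n \<Longrightarrow>
      \<exists>h\<in>V \<inter> Cb. (\<forall>x\<in>K'. \<bar>h x - f x\<bar> \<le> e n) \<and> (AE x in m. x \<in> K' \<longrightarrow> slope h x \<le> L + 1) \<and>
        (AE x in m. slope h x \<le> L + 8 * M / 1 + 1)"
      by (rule local_slope_approximation[where A=UNIV, OF f M(1) M(2) L0 zero_less_one zero_less_one e lip K(1)[of n]])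
        (assumption | rule that)+
    then show "\<exists>h. h \<in> V \<inter> Cb \<and> (\<forall>x\<in>K n. \<bar>h x - f x\<bar> \<le> e n) \<and> (AE x in m. slope h x \<le> C)"
      using B[OF K(1)[of n]] unfolding C_def by blast
  qed
  then obtain h where h: "\<forall>n. h n \<in> V \<inter> Cb \<and> (\<forall>x\<in>K n. \<bar>h n x - f x\<bar> \<le> e n) \<and> (AE x in m. slope (h n) x \<le> C)"
    unfolding choice_iff by (elim exE) (rule that)
  define g where "g n x = max (- M) (min M (h n x))" for n x
  have gV: "g n \<in> V" for n unfolding g_def by (rule V_contraction[OF _ clamp_contraction]) (use h in auto)
  have pair: "relaxed_pair (g n) (\<lambda>x. C)" for n
  proof (rule relaxed_pair_mono[OF relaxed_pair_slope[OF gV] L2_const])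
    have "AE x in m. slope (g n) x \<le> 1 * slope (h n) x"
      unfolding g_def by (rule slope_contraction[OF _ clamp_contraction]) (use h in auto)
    moreover have "AE x in m. slope (h n) x \<le> C" using h by blast
    ultimately show "AE x in m. slope (g n) x \<le> C" by eventually_elim simp
  qed
  have e0: "e \<longlonglongrightarrow> 0"
    unfolding e_def using tendsto_divide[OF LIMSEQ_realpow_zero[of "1/2::real"] tendsto_const[of "4::real"]] by simp
  have "AE x in m. \<forall>\<^sub>F n in sequentially. x \<in> K n"
    by (rule AE_eventually_in) (use K compact_sets_m in auto)
  then have lim: "AE x in m. (\<lambda>n. g n x) \<longlonglongrightarrow> f x"
  proof eventually_elim
    case (elim x)
    then have "\<forall>\<^sub>F n in sequentially. norm (g n x - f x) \<le> e n"
    proof eventually_elim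
      case (elim n)
      then have "\<bar>h n x - f x\<bar> \<le> e n" using h by blast
      then show ?case using M(2)[of x] unfolding g_def real_norm_def by (auto simp: max_def min_def abs_le_iff)
    qed
    then show ?case by (rule LIM_zero_cancel[OF Lim_null_comparison[OF _ e0]])
  qed
  have "L2_tendsto m (\<lambda>n x. g n x * 1) (\<lambda>x. f x * 1)"
    by (rule L2_tendsto_multiplier[OF L2_tendsto_const[OF L2_const] _ _ _ lim, of M])
      (use V_measurable[OF gV] M(1) Cb_measurable[OF f] in \<open>auto simp: g_def[abs_def]\<close>)
  then have "L2_tendsto m g f" by simp
  then have "relaxed_pair f (\<lambda>x. C)" by (rule relaxed_pair_closed[OF pair _ L2_tendsto_const[OF L2_const]])
  with C show ?thesis by (rule that)
qed

text \<open>\<open>A\<close> is not known to be measurable, so the sharp bound is first obtained on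
  compact sets \<open>K' n\<close> nearly filling \<open>B n \<inter> K\<close>, where
  \<open>B n\<close> is open and contains \<open>A \<inter> K\<close>. Elsewhere the crude bound
  keeps the approximations under control.\<close>

lemma slope_le_on_local_lipschitz:
  assumes f: "f \<in> Lip_b dE" and L: "0 \<le> L" and r: "0 < r" and \<epsilon>: "0 < \<epsilon>" and K: "compact K"
    and A: "\<And>x y. x \<in> A \<Longrightarrow> dE x y < ennreal r \<Longrightarrow> f x - f y \<le> L * enn2real (dE x y)"
  shows "AE x in m. x \<in> A \<inter> K \<longrightarrow> slope f x \<le> L + \<epsilon>"
proof -
  have fC: "f \<in> Cb" using f by (rule Lip_b_Cb)
  obtain C0 where C0: "0 \<le> C0" "relaxed_pair f (\<lambda>x. C0)" by (rule Lip_b_dE_subset_V[OF f])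
  have fV: "f \<in> V" by (rule relaxed_pair_domain[OF C0(2)])
  obtain M0 where M0: "0 \<le> M0" "\<And>x. \<bar>f x\<bar> \<le> M0" using Cb_bound[OF fC] by metis
  define M where "M = M0 + 1"
  have M: "0 < M" "\<bar>f x\<bar> \<le> M" for x using M0(1) M0(2)[of x] by (auto simp: M_def)
  define C where "C = max C0 (L + 8 * M / r + \<epsilon>)"
  have "0 \<le> 8 * M / r" using M(1) r by simp
  then have LC: "L + \<epsilon> \<le> C" unfolding C_def by linarith
  \<comment> \<open>The first entry gives convergence to 0, the second the side condition of
    \<open>local_slope_approximation\<close>.\<close>
  define e where "e n = min ((1/2)^n) (\<epsilon> * r / 4)" for n :: nat
  have e: "0 < e n" "4 * e n \<le> \<epsilon> * r" for n using \<epsilon> r by (auto simp: e_def)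
  have e0: "e \<longlonglongrightarrow> 0"
  proof (rule tendsto_0_if_le)
    show "(\<lambda>n. (1/2::real)^n) \<longlonglongrightarrow> 0" by (rule LIMSEQ_realpow_zero) auto
  qed (use e in \<open>auto simp: e_def less_imp_le\<close>)
  have "\<forall>n. \<exists>B K' h. open B \<and> A \<inter> K \<subseteq> B \<and> compact K' \<and> K' \<subseteq> B \<inter> K \<and> measure m (B \<inter> K - K') \<le> (1/2)^n \<and>
      h \<in> V \<and> (\<forall>x\<in>K'. \<bar>h x - f x\<bar> \<le> e n) \<and> (AE x in m. x \<in> K' \<longrightarrow> slope h x \<le> L + \<epsilon>) \<and>
      (AE x in m. slope h x \<le> L + 8 * M / r + \<epsilon>)"
  proof
    fix n
    obtain B where B: "open B" "A \<inter> K \<subseteq> B" "\<And>K'. compact K' \<Longrightarrow> K' \<subseteq> B \<inter> K \<Longrightarrow>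
      \<exists>h\<in>V \<inter> Cb. (\<forall>x\<in>K'. \<bar>h x - f x\<bar> \<le> e n) \<and> (AE x in m. x \<in> K' \<longrightarrow> slope h x \<le> L + \<epsilon>) \<and>
        (AE x in m. slope h x \<le> L + 8 * M / r + \<epsilon>)"
      by (rule local_slope_approximation[where A=A, OF fC M(1) M(2) L r \<epsilon> e[of n] A K])
        (assumption | rule that)+
    have "B \<inter> K \<in> sets m" using open_sets_m[OF B(1)] compact_sets_m[OF K] by auto
    then obtain K' where K': "K' \<subseteq> B \<inter> K" "compact K'" "measure m (B \<inter> K - K') \<le> (1/2)^n"
      by (rule inner_compact[where e="(1/2)^n"]) auto
    then show "\<exists>B K' h. open B \<and> A \<inter> K \<subseteq> B \<and> compact K' \<and> K' \<subseteq> B \<inter> K \<and> measure m (B \<inter> K - K') \<le> (1/2)^n \<and>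
      h \<in> V \<and> (\<forall>x\<in>K'. \<bar>h x - f x\<bar> \<le> e n) \<and> (AE x in m. x \<in> K' \<longrightarrow> slope h x \<le> L + \<epsilon>) \<and>
      (AE x in m. slope h x \<le> L + 8 * M / r + \<epsilon>)"
      using B(1,2) B(3)[OF K'(2,1)] by blast
  qed
  then obtain B K' h where all: "\<forall>n. open (B n) \<and> A \<inter> K \<subseteq> B n \<and> compact (K' n) \<and> K' n \<subseteq> B n \<inter> K \<and>
      measure m (B n \<inter> K - K' n) \<le> (1/2)^n \<and>
      h n \<in> V \<and> (\<forall>x\<in>K' n. \<bar>h n x - f x\<bar> \<le> e n) \<and> (AE x in m. x \<in> K' n \<longrightarrow> slope (h n) x \<le> L + \<epsilon>) \<and>
      (AE x in m. slope (h n) x \<le> L + 8 * M / r + \<epsilon>)"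
    unfolding choice_iff by (elim exE) (rule that)
  have hV: "h n \<in> V" for n using all by blast
  \<comment> \<open>Clamping to within \<open>e n\<close> of \<open>f\<close> yields uniform
    convergence. The slope of the result is that of \<open>h n\<close> or of \<open>f\<close>, both
    bounded; this relies on \<open>f\<close> already lying in \<open>V\<close>.\<close>
  define g where "g n x = max (f x - e n) (min (h n x) (f x + e n))" for n x
  have fe: "(\<lambda>x. f x - e n) \<in> V" "(\<lambda>x. f x + e n) \<in> V" for n by (intro V_diff V_add V_const fV)+
  have mV: "(\<lambda>x. min (h n x) (f x + e n)) \<in> V" for n by (intro V_min hV fe)
  have gV: "g n \<in> V" for n unfolding g_def by (intro V_max mV fe)
  have sfe: "AE x in m. slope (\<lambda>x. f x - e n) x = slope f x" "AE x in m. slope (\<lambda>x. f x + e n) x = slope f x" for n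
    using slope_local[OF fe(1)[of n] fV, of "- e n"] slope_local[OF fe(2)[of n] fV, of "e n"] by simp_all
  have sf: "AE x in m. slope f x \<le> C0" by (rule slope_le[OF C0(2)])
  have g_global: "AE x in m. slope (g n) x \<le> C" for n
  proof -
    have "AE x in m. slope (h n) x \<le> L + 8 * M / r + \<epsilon>" using all by blast
    then show ?thesis
      using slope_max[OF fe(1)[of n] mV[of n]] slope_min[OF hV[of n] fe(2)[of n]] sfe[of n] sf
      unfolding g_def by eventually_elim (auto simp: C_def)
  qed
  have g_local: "AE x in m. x \<in> K' n \<longrightarrow> slope (g n) x \<le> L + \<epsilon>" for n
  proof -
    have "AE x in m. x \<in> K' n \<longrightarrow> slope (h n) x \<le> L + \<epsilon>" using all by blast
    with slope_cong_on[OF gV[of n] hV[of n]] show ?thesis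
    proof eventually_elim
      case (elim x)
      show ?case
      proof
        assume x: "x \<in> K' n"
        then have "\<bar>h n x - f x\<bar> \<le> e n" using all by blast
        then have "g n x = h n x" unfolding g_def by linarith
        then show "slope (g n) x \<le> L + \<epsilon>" using elim x by simp
      qed
    qed
  qed
  have gf: "L2_tendsto m g f"
  proof (rule L2_tendsto_dominated[of m "\<lambda>n x. e n * 1" "\<lambda>x. 0 * 1" _ _ 1])
    show "L2_tendsto m (\<lambda>n x. e n * 1) (\<lambda>x. 0 * 1)"
    proof (rule L2_tendsto_multiplier[OF L2_tendsto_const[OF L2_const], of _ _ 1])
      show "AE x in m. \<bar>e n\<bar> \<le> 1" for n
        using e(1)[of n] power_le_one[of "1/2::real" n] by (simp add: e_def min_le_iff_disj)
    qed (use e0 in auto)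
    show "AE x in m. \<bar>g n x - f x\<bar> \<le> 1 * \<bar>e n * 1 - 0 * 1\<bar>" for n
    proof (rule AE_I2)
      fix x
      show "\<bar>g n x - f x\<bar> \<le> 1 * \<bar>e n * 1 - 0 * 1\<bar>" using e(1)[of n] unfolding g_def by (auto simp: max_def min_def)
    qed
  qed (use gV fV V_L2 in auto)
  \<comment> \<open>On \<open>G N\<close> the sharp bound holds for every \<open>n \<ge> N\<close>,
    so one and the same function bounds the slopes of the whole tail and closedness applies.\<close>
  define G where "G N = (\<Inter>n\<in>{N..}. K' n)" for N
  have G: "G N \<in> sets m" for N
    unfolding G_def using all compact_sets_m by (intro sets.countable_INT'') (auto simp: sets_m)
  have "AE x in m. x \<in> G N \<longrightarrow> slope f x \<le> L + \<epsilon>" for N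
  proof -
    define b where "b x = (if x \<in> G N then L + \<epsilon> else C)" for x
    have bm: "b \<in> borel_measurable m" unfolding b_def using G by measurable
    have "\<bar>b x\<bar> \<le> C" for x using LC L \<epsilon> by (auto simp: b_def)
    then have bL: "b \<in> L2 m" by (intro L2_bounded[OF bm]) auto
    have "relaxed_pair f b"
    proof (rule relaxed_pair_closed)
      show "relaxed_pair (g (n + N)) b" for n
      proof (rule relaxed_pair_mono[OF relaxed_pair_slope[OF gV] bL])
        show "AE x in m. slope (g (n + N)) x \<le> b x"
          using g_global[of "n + N"] g_local[of "n + N"]
          by eventually_elim (auto simp: b_def G_def)
      qed
      have "strict_mono (\<lambda>n. n + N)" by (auto intro: strict_monoI)
      then show "L2_tendsto m (\<lambda>n. g (n + N)) f" by (rule L2_tendsto_subseq[OF gf])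
    qed (rule L2_tendsto_const[OF bL])
    from slope_le[OF this] show ?thesis by eventually_elim (auto simp: b_def)
  qed
  then have "AE x in m. \<forall>N. x \<in> G N \<longrightarrow> slope f x \<le> L + \<epsilon>" unfolding AE_all_countable by blast
  \<comment> \<open>Almost every point leaves the residual sets \<open>B n \<inter> K - K' n\<close>
    for good, so such a point of \<open>A \<inter> K\<close> eventually stays in
    \<open>K' n\<close>.\<close>
  moreover have "AE x in m. \<forall>\<^sub>F n in sequentially. x \<in> - (B n \<inter> K - K' n)"
  proof (rule AE_eventually_in)
    fix n
    have "open (B n)" "compact (K' n)" using all by auto
    then have "B n \<inter> K - K' n \<in> sets m" using open_sets_m compact_sets_m K by auto
    then show "- (B n \<inter> K - K' n) \<in> sets m" using sets.compl_sets[of "B n \<inter> K - K' n" m] by (simp add: Compl_eq_Diff_UNIV)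
    show "measure m (- (- (B n \<inter> K - K' n))) \<le> (1/2)^n" unfolding double_complement using all by blast
  qed
  ultimately show ?thesis
  proof eventually_elim
    case (elim x)
    show ?case
    proof
      assume x: "x \<in> A \<inter> K"
      obtain N where N: "\<And>n. n \<ge> N \<Longrightarrow> x \<in> - (B n \<inter> K - K' n)" using elim(2) by (auto simp: eventually_sequentially)
      have "x \<in> B n \<inter> K" for n using all x by blast
      then have "x \<in> G N" using N by (auto simp: G_def)
      then show "slope f x \<le> L + \<epsilon>" using elim(1) by blast
    qed
  qed
qed

text \<open>\<open>LIP dE f x < c\<close> implies the local condition at \<open>x\<close> with
  constant \<open>c\<close> and some radius. Rational \<open>c\<close>, radii
  \<open>1 / Suc j\<close> and an exhaustion by compact sets reduce the claim to countably many
  instances of \<open>slope_le_on_local_lipschitz\<close>.\<close>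

lemma slope_le_LIP_dE:
  assumes f: "f \<in> Lip_b dE"
  shows "AE x in m. slope f x \<le> LIP dE f x"
proof -
  interpret D: ext_dist dE by unfold_locales (rule extended_distance_dE)
  obtain L0 where L0: "ext_lipschitz dE f L0" using f by (auto simp: Lip_b_def)
  obtain K where K: "\<And>n. compact (K n)" "\<And>n. measure m (- K n) \<le> (1/2)^n" by (rule compact_exhaustion) (rule that)
  define A where "A c j = {x. \<forall>y. dE x y < ennreal (1 / Suc j) \<longrightarrow> f x - f y \<le> c * enn2real (dE x y)}" for c :: real and j :: nat
  have "AE x in m. \<forall>(c::rat) j n. 0 \<le> c \<longrightarrow> x \<in> A (of_rat c) j \<inter> K n \<longrightarrow> slope f x \<le> of_rat c + 1 / Suc j"
    unfolding AE_all_countable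
  proof (intro allI)
    fix c :: rat and j n :: nat
    show "AE x in m. 0 \<le> c \<longrightarrow> x \<in> A (of_rat c) j \<inter> K n \<longrightarrow> slope f x \<le> of_rat c + 1 / Suc j"
    proof (cases "0 \<le> c")
      case True
      have "AE x in m. x \<in> A (of_rat c) j \<inter> K n \<longrightarrow> slope f x \<le> of_rat c + 1 / Suc j"
        by (rule slope_le_on_local_lipschitz[OF f, where r="1 / Suc j"]) (use True K in \<open>auto simp: A_def\<close>)
      then show ?thesis by eventually_elim simp
    qed simp
  qed
  moreover have "AE x in m. \<forall>\<^sub>F n in sequentially. x \<in> K n"
    by (rule AE_eventually_in) (use K compact_sets_m in auto)
  ultimately show ?thesis
  proof eventually_elim
    case (elim x)
    obtain n where n: "x \<in> K n" using elim(2) by (auto simp: eventually_sequentially)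
    show ?case
    proof (rule field_le_epsilon)
      fix e :: real assume "e > 0"
      then obtain c where c: "LIP dE f x < of_rat c" "of_rat c < LIP dE f x + e/2"
        using of_rat_dense[of "LIP dE f x" "LIP dE f x + e/2"] by auto
      have "(0::real) < of_rat c" using c(1) D.LIP_nonneg[of f x] by linarith
      then have c0: "0 \<le> c" by simp
      obtain r where r: "r > 0" "\<And>y z. dE y x < ennreal r \<Longrightarrow> dE z x < ennreal r \<Longrightarrow> \<bar>f y - f z\<bar> \<le> of_rat c * enn2real (dE y z)"
        using D.local_lipschitz_LIP[OF L0 c(1)] by (auto simp: local_lipschitz_at_def)
      obtain j where j: "1 / Suc j < min r (e/2)" using nat_approx_posE[of "min r (e/2)"] r(1) \<open>e > 0\<close> by auto
      have "x \<in> A (of_rat c) j"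
        unfolding A_def
      proof (intro CollectI allI impI)
        fix y assume y: "dE x y < ennreal (1 / Suc j)"
        have "dE y x < ennreal r"
          using y j r(1) by (subst D.dist_commute) (auto intro: less_le_trans ennreal_leI)
        then show "f x - f y \<le> of_rat c * enn2real (dE x y)" using r(2)[of x y] r(1) by simp
      qed
      then have "slope f x \<le> of_rat c + 1 / Suc j" using elim(1) n c0 by blast
      then show "slope f x \<le> LIP dE f x + e" using c(2) j by linarith
    qed
  qed
qed

text \<open>The larger distance admits more competitors and assigns them smaller slopes, hence no
  more energy. Conversely \<open>slope_le_LIP_dE\<close> makes \<open>u\<close> together with its
  asymptotic constant for \<open>dE\<close> a relaxed pair for \<open>d\<close>, and lower
  semicontinuity of \<open>Ch\<close> concludes.\<close>

theorem Ch_dE: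
  assumes f: "f \<in> L2 m"
  shows "Ch m dE f = Ch m d f"
proof (rule antisym)
  interpret D: ext_metric_measure dE m by unfold_locales (rule extended_metric_measure_space_dE)
  show "Ch m dE f \<le> Ch m d f"
    unfolding Ch_def
  proof (rule INF_mono)
    fix F assume F: "F \<in> {F. (\<forall>n. F n \<in> Lip_b d) \<and> L2_tendsto m F f}"
    have "liminf (\<lambda>n. \<integral>\<^sup>+x. ennreal ((Lip_a_star m dE (F n) x)\<^sup>2) \<partial>m)
        \<le> liminf (\<lambda>n. \<integral>\<^sup>+x. ennreal ((Lip_a_star m d (F n) x)\<^sup>2) \<partial>m)"
    proof (rule Liminf_mono, rule always_eventually, rule allI, rule nn_integral_mono_AE)
      fix n
      have u: "F n \<in> Lip_b d" using F by blast
      obtain L where L: "ext_lipschitz d (F n) L" using u by (auto simp: Lip_b_def)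
      note u' = Lip_b_subset_Lip_b_dE[OF u]
      have "AE x in m. Lip_a_star m dE (F n) x \<le> star (F n) x"
      proof (rule D.Lip_a_star_least[OF u' Lip_a_star_measurable[OF u]])
        show "AE x in m. LIP dE (F n) x \<le> star (F n) x"
          using LIP_le_star[OF u] LIP_antimono(1)[OF extended_distance_dE dist_le_dE L]
          by (auto elim!: eventually_mono intro: order_trans)
      qed
      then show "AE x in m. ennreal ((Lip_a_star m dE (F n) x)\<^sup>2) \<le> ennreal ((star (F n) x)\<^sup>2)"
        using D.Lip_a_star_nonneg[OF u'] by eventually_elim (intro ennreal_leI power_mono)
    qed
    then show "\<exists>F'\<in>{F. (\<forall>n. F n \<in> Lip_b dE) \<and> L2_tendsto m F f}.
        liminf (\<lambda>n. \<integral>\<^sup>+x. ennreal ((Lip_a_star m dE (F' n) x)\<^sup>2) \<partial>m)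
        \<le> liminf (\<lambda>n. \<integral>\<^sup>+x. ennreal ((Lip_a_star m d (F n) x)\<^sup>2) \<partial>m)"
      using F Lip_b_subset_Lip_b_dE by (intro bexI[of _ F]) auto
  qed
  show "Ch m d f \<le> Ch m dE f"
  proof (rule ccontr)
    assume "\<not> Ch m d f \<le> Ch m dE f"
    then obtain z where z: "Ch m dE f < z" "z < Ch m d f" using dense by (auto simp: not_le)
    then obtain b where b: "z = ennreal b" by (cases z) auto
    have "\<forall>n. \<exists>u. u \<in> Lip_b dE \<and> sqnorm m (\<lambda>x. u x - f x) < 1 / real (Suc n) \<and> sqnorm m (Lip_a_star m dE u) < b"
    proof
      fix n
      show "\<exists>u. u \<in> Lip_b dE \<and> sqnorm m (\<lambda>x. u x - f x) < 1 / real (Suc n) \<and> sqnorm m (Lip_a_star m dE u) < b"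
        using D.Ch_approx[of f b "1 / real (Suc n)"] z b by auto
    qed
    then obtain u where u: "\<And>n. u n \<in> Lip_b dE" "\<And>n. sqnorm m (\<lambda>x. u n x - f x) < 1 / real (Suc n)"
      "\<And>n. sqnorm m (Lip_a_star m dE (u n)) < b" by metis
    have lim: "(\<lambda>n. 1 / real (Suc n)) \<longlonglongrightarrow> 0" by (intro LIMSEQ_Suc lim_1_over_n)
    have "(\<lambda>n. sqnorm m (\<lambda>x. u n x - f x)) \<longlonglongrightarrow> 0"
      by (rule tendsto_0_if_le[OF _ lim]) (use u in \<open>simp_all add: less_imp_le\<close>)
    then have uf: "L2_tendsto m u f" using u f by (auto simp: L2_tendsto_iff D.Lip_b_L2)
    have "Ch m d (u n) \<le> ennreal b" for n
    proof -
      obtain C where C: "relaxed_pair (u n) (\<lambda>x. C)" by (rule Lip_b_dE_subset_V[OF u(1)])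
      have V: "u n \<in> V" by (rule relaxed_pair_domain[OF C])
      have "relaxed_pair (u n) (Lip_a_star m dE (u n))"
      proof (rule relaxed_pair_mono[OF relaxed_pair_slope[OF V] D.Lip_a_star_L2[OF u(1)]])
        show "AE x in m. slope (u n) x \<le> Lip_a_star m dE (u n) x"
          using slope_le_LIP_dE[OF u(1)[of n]] D.LIP_le_star[OF u(1)[of n]] by eventually_elim simp
      qed
      from Ch_le_relaxed_pair[OF this] show ?thesis using u(3)[of n] by (meson ennreal_leI less_imp_le order_trans)
    qed
    then have "Ch m d f \<le> ennreal b" by (rule Ch_lsc[OF uf])
    then show False using z b by simp
  qed
qed

lemma dE_eq_iff:
  "dE = d \<longleftrightarrow> (\<forall>f\<in>V \<inter> Cb. (AE x in m. slope f x \<le> 1) \<longrightarrow> f \<in> Lip_b d \<and> Lip_const d f \<le> 1)"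
proof
  assume eq: "dE = d"
  show "\<forall>f\<in>V \<inter> Cb. (AE x in m. slope f x \<le> 1) \<longrightarrow> f \<in> Lip_b d \<and> Lip_const d f \<le> 1"
  proof (intro ballI impI)
    fix f assume f: "f \<in> V \<inter> Cb" "AE x in m. slope f x \<le> 1"
    then have "f \<in> unit_slope" by (simp add: unit_slope_def)
    then have lip: "ext_lipschitz d f 1" using dE_ge[of f] eq by (simp add: ext_lipschitz_def)
    then have "Lip_const d f \<le> ennreal 1" unfolding Lip_const_def by (intro INF_lower) simp
    then show "f \<in> Lip_b d \<and> Lip_const d f \<le> 1" using f lip by (auto simp: Lip_b_def)
  qed
next
  assume *: "\<forall>f\<in>V \<inter> Cb. (AE x in m. slope f x \<le> 1) \<longrightarrow> f \<in> Lip_b d \<and> Lip_const d f \<le> 1"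
  have "dE x y \<le> d x y" for x y
    unfolding dE_def
  proof (rule SUP_least)
    fix f assume "f \<in> unit_slope"
    then have lip: "Lip_const d f \<le> 1" using * by (simp add: unit_slope_def)
    show "ennreal \<bar>f x - f y\<bar> \<le> d x y"
    proof (cases "d x y")
      case (real D)
      have "\<bar>f x - f y\<bar> \<le> D"
      proof (rule field_le_epsilon)
        fix e :: real assume "e > 0"
        \<comment> \<open>\<open>Lip_const\<close> is an infimum, so a Lipschitz constant is only
          available below \<open>1 + t\<close>; this choice makes
          \<open>t * D \<le> e\<close>.\<close>
        define t where "t = e / (D + 1)"
        have t: "t > 0" "t * D \<le> e" using \<open>e > 0\<close> real by (auto simp: t_def field_simps)
        have "Lip_const d f < ennreal (1 + t)"
          using lip t(1) by (intro le_less_trans[OF lip]) (simp add: ennreal_less_iff flip: ennreal_1)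
        then obtain L where L: "ext_lipschitz d f L" "ennreal L < ennreal (1 + t)"
          unfolding Lip_const_def INF_less_iff by auto
        have L0: "0 \<le> L" using L(1) by (simp add: ext_lipschitz_def)
        have "ennreal \<bar>f x - f y\<bar> \<le> ennreal L * d x y" using L(1) by (simp add: ext_lipschitz_def)
        then have "ennreal \<bar>f x - f y\<bar> \<le> ennreal (L * D)" using real L0 by (simp add: ennreal_mult)
        then have "\<bar>f x - f y\<bar> \<le> L * D" using L0 real by (subst (asm) ennreal_le_iff) auto
        also have "\<dots> \<le> (1 + t) * D" using L(2) L0 real by (intro mult_right_mono) (auto simp: ennreal_less_iff)
        also have "\<dots> \<le> D + e" using t by (simp add: distrib_right)
        finally show "\<bar>f x - f y\<bar> \<le> D + e" .
      qed
      then show ?thesis using real by (simp add: ennreal_leI)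
    qed simp
  qed
  then show "dE = d" using dist_le_dE by (intro ext antisym) auto
qed

end

lemma (in hilbertian_space) energy_distance_eq_dE:
  assumes "carre_du_champ m V E \<Gamma>"
  shows "energy_distance m V \<Gamma> = dE"
proof -
  have "(AE z in m. \<Gamma> f f z \<le> 1) \<longleftrightarrow> (AE z in m. slope f z \<le> 1)" if "f \<in> V \<inter> Cb" for f
  proof -
    have f: "f \<in> V \<inter> Linfty m" using that Cb_subset_Linfty by blast
    have fV: "f \<in> V" using that by simp
    have "AE z in m. (\<Gamma> f f z \<le> 1) = (slope f z \<le> 1)"
      using carre_du_champ_unique(1)[OF assms f] slope_nonneg[OF fV]
      by eventually_elim (simp add: power_le_one_iff abs_square_le_1)
    then show ?thesis by (rule eventually_subst)
  qed
  then have "{f \<in> V \<inter> Cb. AE z in m. \<Gamma> f f z \<le> 1} = unit_slope" unfolding unit_slope_def by blast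
  then show ?thesis by (intro ext) (simp add: energy_distance_def dE_def)
qed

theorem theorem12p8:
  fixes d :: "'a::t2_space \<Rightarrow> 'a \<Rightarrow> ennreal" and m :: "'a measure"
  assumes "extended_metric_measure_space d m"
    and "ext_complete d"
    and "asymptotically_Hilbertian m d"
  shows "energy_measure_space m (Ch_domain m d) (Ch_form m d) \<and>
    (\<forall>f\<in>Ch_domain m d. ennreal (Ch_form m d f f) = Ch m d f) \<and>
    (\<forall>\<Gamma>. carre_du_champ m (Ch_domain m d) (Ch_form m d) \<Gamma> \<longrightarrow>
      (let V = Ch_domain m d;
           slope = minimal_relaxed_slope m d;
           dE = energy_distance m V \<Gamma>
       in
         \<comment> \<open>(a)\<close>
         (\<forall>f\<in>V \<inter> Linfty m. AE x in m. \<Gamma> f f x = (slope f x)\<^sup>2) \<and>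
         (\<exists>\<Gamma>'. L1_bilinear m V \<Gamma>' \<and>
            (\<forall>f\<in>V. \<forall>g\<in>V.
               L1_tendsto m
                 (\<lambda>\<epsilon> x. ((slope (\<lambda>y. f y + \<epsilon> * g y) x)\<^sup>2 - (slope f x)\<^sup>2) / (2 * \<epsilon>))
                 (\<Gamma>' f g) (at_right 0)) \<and>
            (\<forall>f\<in>V \<inter> Linfty m. \<forall>g\<in>V \<inter> Linfty m. AE x in m. \<Gamma>' f g x = \<Gamma> f g x)) \<and>
         \<comment> \<open>(b)\<close>
         extended_metric_measure_space dE m \<and>
         (\<forall>x y. d x y \<le> dE x y) \<and>
         (\<forall>f\<in>L2 m. Ch m dE f = Ch m d f) \<and>
         \<comment> \<open>(c)\<close>
         (dE = d \<longleftrightarrow>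
           (\<forall>f\<in>V \<inter> Cb. (AE x in m. slope f x \<le> 1) \<longrightarrow>
              f \<in> Lip_b d \<and> Lip_const d f \<le> 1))))"
proof -
  interpret H: hilbertian_space d m by unfold_locales fact+
  have "ennreal (Ch_form m d f f) = Ch m d f" if "f \<in> Ch_domain m d" for f
    using that by (simp add: H.E_diag H.Ch_energy)
  then show ?thesis
    unfolding Let_def
  proof (intro conjI ballI allI impI)
    show "energy_measure_space m (Ch_domain m d) (Ch_form m d)" by (rule H.energy_measure_space_Ch)
  next
    fix \<Gamma> assume \<Gamma>: "carre_du_champ m (Ch_domain m d) (Ch_form m d) \<Gamma>"
    note dE = H.energy_distance_eq_dE[OF \<Gamma>]
    show "AE x in m. \<Gamma> f f x = (minimal_relaxed_slope m d f x)\<^sup>2" if "f \<in> Ch_domain m d \<inter> Linfty m" for f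
      by (rule H.carre_du_champ_unique(1)[OF \<Gamma> that])
    \<comment> \<open>\<open>slope_form\<close> is bilinear on all of \<open>V\<close> and serves as
      the extension.\<close>
    show "\<exists>\<Gamma>'. L1_bilinear m (Ch_domain m d) \<Gamma>' \<and>
        (\<forall>f\<in>Ch_domain m d. \<forall>g\<in>Ch_domain m d.
           L1_tendsto m
             (\<lambda>\<epsilon> x. ((minimal_relaxed_slope m d (\<lambda>y. f y + \<epsilon> * g y) x)\<^sup>2 - (minimal_relaxed_slope m d f x)\<^sup>2) / (2 * \<epsilon>))
             (\<Gamma>' f g) (at_right 0)) \<and>
        (\<forall>f\<in>Ch_domain m d \<inter> Linfty m. \<forall>g\<in>Ch_domain m d \<inter> Linfty m. AE x in m. \<Gamma>' f g x = \<Gamma> f g x)"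
      using H.L1_bilinear_slope_form H.slope_form_limit H.carre_du_champ_unique(2)[OF \<Gamma>] by (intro exI[of _ H.slope_form]) blast
    show "extended_metric_measure_space (energy_distance m (Ch_domain m d) \<Gamma>) m"
      unfolding dE by (rule H.extended_metric_measure_space_dE)
    show "d x y \<le> energy_distance m (Ch_domain m d) \<Gamma> x y" for x y
      unfolding dE by (rule H.dist_le_dE)
    show "Ch m (energy_distance m (Ch_domain m d) \<Gamma>) f = Ch m d f" if "f \<in> L2 m" for f
      unfolding dE by (rule H.Ch_dE[OF that])
    show "energy_distance m (Ch_domain m d) \<Gamma> = d \<longleftrightarrow>
        (\<forall>f\<in>Ch_domain m d \<inter> Cb. (AE x in m. minimal_relaxed_slope m d f x \<le> 1) \<longrightarrow> f \<in> Lip_b d \<and> Lip_const d f \<le> 1)"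
      unfolding dE by (rule H.dE_eq_iff)
  qed
qed

end
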